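(* Let $V:\mathbb R^n\to\mathbb R$ be twice continuously differentiable with $V(q)\to+\infty$ as $|q|\to+\infty$, let $\gamma_1,\gamma_n>0$, and let $\zeta=(\zeta_1,\zeta_n)$ be a random process whose trajectories almost surely belong to $L^2_{\rm loc}(\mathbb R,\mathbb R^2)$. Consider the system in $\mathbb R^{2n}$ $$\dot q=p,\qquad\dot p=-\nabla V(q)+(-\gamma_1p_1+\zeta_1(t))e_1+(-\gamma_np_n+\zeta_n(t))e_n,$$ where $\{e_j\}$ is the standard basis of $\mathbb R^n$. Let Hypotheses (BAS), (SE), (CP), (DR) and (LC) stated in the context be fulfilled. Then there are a measure $\mu\in\mathcal P(\mathbb R^{2n})$ with compact support and a number $\gamma>0$ such that, for any $r>0$ and a sufficiently large $C_r>0$, $$\sup_{(p^0,q^0)\in\overline B(r)}\|\mu_t(p^0,q^0)-\mu\|_L^*\le C_re^{-\gamma t},\qquad t\in\mathbb Z_+,$$ where $\mu_t(p^0,q^0)$ is the law at time $t$ of the trajectory of the system issued from $(p^0,q^0)\in\mathbb R^{2n}$.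
   Context: Notation. $\mathcal P(Y)$: Borel probability measures; $\|\mu-\nu\|_{\mathrm{var}}=\sup_\Gamma|\mu(\Gamma)-\nu(\Gamma)|$; $\|\mu-\nu\|_L^*=\sup|\langle f,\mu\rangle-\langle f,\nu\rangle|$ over Lipschitz $f$ with $|f|\le1$, $\operatorname{Lip}(f)\le1$. $\mathbb Z_+$ and $\mathbb Z_-$ are the non-negative and non-positive integers. $J=[0,1)$, $E=L^2(J,\mathbb R^2)$. $\overline B(r)$ is the closed ball of radius $r$ in $\mathbb R^{2n}$ centred at zero. $\varPhi^t(p^0,q^0;\zeta)$ is the value at time $t\ge0$ of the solution of the system with initial condition $(p^0,q^0)$ and (deterministic) forcing $\zeta$ (solutions are global since $V$ is coercive). (BAS) For any $M>0$ there is $\rho>0$ such that for every $r>0$ there is $T_r>0$ with the property: if a measurable $\zeta=(\zeta_1,\zeta_n):\mathbb R_+\to\mathbb R^2$ satisfies $$\sup_{t\ge0}\int_t^{t+1}(|\zeta_1(s)|^2+|\zeta_n(s)|^2)\,ds\le M,\qquad( * )$$ then $\varPhi^t(p^0,q^0;\zeta)\in\overline B(\rho)$ for each $(p^0,q^0)\in\overline B(r)$ and $t\ge T_r$. (CP) The law of $\zeta$ is invariant under the time-1 shift, and the support of the projection of this law to $J$ is a compact set $\mathcal K\subset E$. The set $X$. Let $M>0$ be such that almost every trajectory of $\zeta$ satisfies $( * )$, and let $\rho$ correspond to $M$ in (BAS). Let $T\ge1$ be the minimal time such that $\varPhi^t(p^0,q^0;\zeta)\in\overline B(\rho)$ for all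 $t\ge T$, $(p^0,q^0)\in\overline B(\rho)$ and all $\zeta$ satisfying $( * )$. Let $E_M$ be the set of $\zeta\in L^2(0,T;\mathbb R^2)$ for which $( * )$ holds with the supremum over $t\in[0,T-1]$. Then $X:=\bigcup_{t\in[0,T]}\bigcup_{\zeta\in E_M}\varPhi^t(\overline B(\rho);\zeta)$, a compact set. (SE) There is $c\in\mathbb R^n$ such that $\sup_{(p^0,q^0)\in X}|\varPhi^t(p^0,q^0;0)-(0,c)|\to0$ as $t\to\infty$. (LC) There is an open set $O\subset\mathbb R^{2n}\times E$ containing $X\times\mathcal K$ such that, for any $((p^0,q^0),\zeta)\in O$, with $(p(t),q(t))$ the solution of the system on $[0,1]$ with initial condition $(p^0,q^0)$ and forcing $\zeta$, the linear system $$\dot x=y,\quad\dot y=-(D^2V)(q(t))x+(-\gamma_1y_1+\xi_1(t))e_1+(-\gamma_ny_n+\xi_n(t))e_n,\quad x(0)=y(0)=0,$$ is controllable at time $t=1$ with control $\xi=(\xi_1,\xi_n)\in E$ (every vector of $\mathbb R^{2n}$ equals $(x(1),y(1))$ for some $\xi\in E$). (DR) Let $\eta_k(t)=\zeta(t+k-1)$, $t\in J$, which is a stationary process $\{\eta_k\}_{k\in\mathbb Z}$ in $E$. Let $\mathcal E\subset\boldsymbol{\mathcal K}:=\mathcal K^{\mathbb Z_-}$ be the support of the law of $\{\eta_l,l\in\mathbb Z_-\}$, where $\boldsymbol{\mathcal K}$ has the distance $\mathrm d(\boldsymbol\xi,\boldsymbol\xi')=\sum_{k\le0}\iota^k\|\xi_k-\xi_k'\|_E$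 with a fixed $\iota>1$, and let $Q(\boldsymbol\xi;\cdot)$ be the conditional law of $\eta_1$ given $\{\eta_l\}_{l\in\mathbb Z_-}=\boldsymbol\xi$. Then (SF), (DLP$'$), (SRZ) hold: (SF) $Q(\boldsymbol\xi;\cdot)$ can be chosen to be continuous from $\mathcal E$ to $\mathcal P(\mathcal K)$ (weak topology), and there is $C>0$ with $\|Q(\boldsymbol\xi;\cdot)-Q(\boldsymbol\xi';\cdot)\|_{\mathrm{var}}\le C\,\mathrm d(\boldsymbol\xi,\boldsymbol\xi')$ on $\mathcal E$. (DLP$'$) There is an increasing sequence of finite-dimensional subspaces $F_n\subset E$ with complementary subspaces $F_n^\dagger$ and projections $\mathsf P_n:E\to F_n$ (along $F_n^\dagger$) such that $\cup_nF_n$ is dense in $E$, the norms of $\mathsf P_n$ are uniformly bounded, and for each $n\ge1$, $\boldsymbol\xi\in\mathcal E$, $Q(\boldsymbol\xi;dy)=Q_n^\dagger(\boldsymbol\xi;dy_n^\dagger)\,\rho_n(\boldsymbol\xi,y_n^\dagger,y_n)\,\ell_n(dy_n)$, where $y=(y_n,y_n^\dagger)$ corresponds to $E=F_n\dotplus F_n^\dagger$, $Q_n^\dagger(\boldsymbol\xi;\cdot)$ is the image of $Q(\boldsymbol\xi;\cdot)$ under $I-\mathsf P_n$, $\ell_n$ is Lebesgue measure on $F_n$, and $\rho_n:\mathcal E\times E\to\mathbb R_+$ is Lipschitz continuous. (SRZ) For any $n\in\mathbb N$ and $\delta>0$ there is an integer $s\ge0$ such that $\inf_{\boldsymbol\xi\in\mathcal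 E}Q_s^n(\boldsymbol\xi;\mathcal O_\delta(\mathbf 0_n))>0$, where $Q_s^n(\boldsymbol\xi;\cdot)$ is the conditional law of $(\eta_{s+1},\dots,\eta_{s+n})$ given the past $\boldsymbol\xi$ (the projection to the last $n$ components of $Q(\boldsymbol\xi;dy_1)Q((\boldsymbol\xi,y_1);dy_2)\cdots Q((\boldsymbol\xi,y_1,\dots,y_{s+n-1});dy_{s+n})$), and $\mathcal O_\delta(\mathbf 0_n)$ is the product of $n$ open $\delta$-balls centred at $0\in E$. *)

theory Defs
  imports "HOL-Probability.Probability"
begin

definition square_integrable_on :: "(real \<Rightarrow> real \<times> real) \<Rightarrow> real set \<Rightarrow> bool" where
  "square_integrable_on z S \<longleftrightarrow>
     z \<in> borel_measurable (lebesgue_on S) \<and> integrable (lebesgue_on S) (\<lambda>s. (norm (z s))\<^sup>2)"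

lemma square_integrable_on_zero: "square_integrable_on (\<lambda>_. 0) S"
  by (simp add: square_integrable_on_def)

lemma square_integrable_on_scaleR:
  "square_integrable_on f S \<Longrightarrow> square_integrable_on (\<lambda>s. c *\<^sub>R f s) S"
  by (auto simp: square_integrable_on_def power_mult_distrib)

lemma square_integrable_on_add:
  assumes "square_integrable_on f S" "square_integrable_on g S"
  shows "square_integrable_on (\<lambda>s. f s + g s) S"
proof -
  have [measurable]: "f \<in> borel_measurable (lebesgue_on S)" "g \<in> borel_measurable (lebesgue_on S)"
    using assms by (auto simp: square_integrable_on_def)
  have "integrable (lebesgue_on S) (\<lambda>s. 2 * (norm (f s))\<^sup>2 + 2 * (norm (g s))\<^sup>2)"
    using assms by (auto simp: square_integrable_on_def)
  then have "integrable (lebesgue_on S) (\<lambda>s. (norm (f s + g s))\<^sup>2)"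
  proof (rule Bochner_Integration.integrable_bound)
    have "(norm (x + y))\<^sup>2 \<le> 2 * (norm x)\<^sup>2 + 2 * (norm y)\<^sup>2" for x y :: "real \<times> real"
    proof -
      have "(norm (x + y))\<^sup>2 \<le> (norm x + norm y)\<^sup>2"
        by (intro power_mono norm_triangle_ineq norm_ge_zero)
      also have "\<dots> \<le> 2 * (norm x)\<^sup>2 + 2 * (norm y)\<^sup>2"
        using sum_squares_bound[of "norm x" "norm y"] by (simp add: power2_sum)
      finally show ?thesis .
    qed
    then show "AE s in lebesgue_on S.
        norm ((norm (f s + g s))\<^sup>2) \<le> norm (2 * (norm (f s))\<^sup>2 + 2 * (norm (g s))\<^sup>2)"
      by (auto intro: order_trans[OF _ abs_ge_self])
  qed measurable
  then show ?thesis
    by (simp add: square_integrable_on_def)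
qed

lemma square_integrable_on_inner:
  assumes "square_integrable_on f S" "square_integrable_on g S"
  shows "integrable (lebesgue_on S) (\<lambda>s. f s \<bullet> g s)"
proof -
  have [measurable]: "f \<in> borel_measurable (lebesgue_on S)" "g \<in> borel_measurable (lebesgue_on S)"
    using assms by (auto simp: square_integrable_on_def)
  have "integrable (lebesgue_on S) (\<lambda>s. (norm (f s))\<^sup>2 + (norm (g s))\<^sup>2)"
    using assms by (auto simp: square_integrable_on_def)
  then show ?thesis
  proof (rule Bochner_Integration.integrable_bound)
    have "\<bar>x \<bullet> y\<bar> \<le> (norm x)\<^sup>2 + (norm y)\<^sup>2" for x y :: "real \<times> real"
    proof -
      have "\<bar>x \<bullet> y\<bar> \<le> norm x * norm y"
        by (rule Cauchy_Schwarz_ineq2)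
      also have "\<dots> \<le> (norm x)\<^sup>2 + (norm y)\<^sup>2"
        using sum_squares_bound[of "norm x" "norm y"] mult_nonneg_nonneg[OF norm_ge_zero[of x] norm_ge_zero[of y]]
        unfolding mult.assoc by linarith
      finally show ?thesis .
    qed
    then show "AE s in lebesgue_on S. norm (f s \<bullet> g s) \<le> norm ((norm (f s))\<^sup>2 + (norm (g s))\<^sup>2)"
      by (auto intro: order_trans[OF _ abs_ge_self])
  qed measurable
qed

(* The Hilbert space L^2([0,1), R^2): square-integrable functions modulo equality a.e. on [0,1). *)
quotient_type L2J = "real \<Rightarrow> real \<times> real" / partial:
  "\<lambda>f g. square_integrable_on f {0..<1} \<and> square_integrable_on g {0..<1} \<and>
     (AE s in lebesgue_on {0..<1}. f s = g s)"
proof (rule part_equivpI)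
  show "\<exists>f. square_integrable_on f {0..<1} \<and> square_integrable_on f {0..<1} \<and>
     (AE s in lebesgue_on {0..<1}. f s = f s)"
    using square_integrable_on_zero by auto
qed (auto intro!: sympI transpI elim: AE_mp)

instantiation L2J :: real_inner
begin

lift_definition zero_L2J :: L2J is "\<lambda>_. 0"
  by (simp add: square_integrable_on_zero)

lift_definition plus_L2J :: "L2J \<Rightarrow> L2J \<Rightarrow> L2J" is "\<lambda>f g s. f s + g s"
  by (auto intro: square_integrable_on_add)

lift_definition scaleR_L2J :: "real \<Rightarrow> L2J \<Rightarrow> L2J" is "\<lambda>c f s. c *\<^sub>R f s"
  by (auto intro: square_integrable_on_scaleR)

lift_definition inner_L2J :: "L2J \<Rightarrow> L2J \<Rightarrow> real" is
  "\<lambda>f g. \<integral>s. f s \<bullet> g s \<partial>lebesgue_on {0..<1}"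
  by (intro integral_cong_AE)
     (auto simp: square_integrable_on_def intro!: borel_measurable_inner)

definition uminus_L2J :: "L2J \<Rightarrow> L2J" where "uminus_L2J f = (-1) *\<^sub>R f"
definition minus_L2J :: "L2J \<Rightarrow> L2J \<Rightarrow> L2J" where "minus_L2J f g = f + (- g)"
definition norm_L2J :: "L2J \<Rightarrow> real" where "norm_L2J f = sqrt (f \<bullet> f)"
definition sgn_L2J :: "L2J \<Rightarrow> L2J" where "sgn_L2J f = inverse (norm f) *\<^sub>R f"
definition dist_L2J :: "L2J \<Rightarrow> L2J \<Rightarrow> real" where "dist_L2J f g = norm (f - g)"
definition uniformity_L2J :: "(L2J \<times> L2J) filter" where
  "uniformity_L2J = (INF e\<in>{0<..}. principal {(x, y). dist x y < e})"
definition open_L2J :: "L2J set \<Rightarrow> bool" where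
  "open_L2J U \<longleftrightarrow> (\<forall>x\<in>U. eventually (\<lambda>(x', y). x' = x \<longrightarrow> y \<in> U) uniformity)"

instance
proof
  fix f g h :: L2J and a b c :: real
  show "f + g + h = f + (g + h)"
    by transfer (auto intro!: square_integrable_on_add simp: add.assoc)
  show "f + g = g + f"
    by transfer (auto intro!: square_integrable_on_add simp: add.commute)
  show "0 + f = f"
    by transfer auto
  show "- f + f = 0"
    unfolding uminus_L2J_def
    by transfer (auto intro!: square_integrable_on_add square_integrable_on_zero
        square_integrable_on_scaleR[of _ _ "-1", simplified])
  show "f - g = f + - g"
    by (fact minus_L2J_def)
  show "a *\<^sub>R (f + g) = a *\<^sub>R f + a *\<^sub>R g"
    by transfer (auto intro!: square_integrable_on_add square_integrable_on_scaleR
        simp: scaleR_add_right)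
  show "(a + b) *\<^sub>R f = a *\<^sub>R f + b *\<^sub>R f"
    by transfer (auto intro!: square_integrable_on_add square_integrable_on_scaleR
        simp: scaleR_add_left)
  show "a *\<^sub>R b *\<^sub>R f = (a * b) *\<^sub>R f"
    by transfer (auto intro!: square_integrable_on_scaleR)
  show "1 *\<^sub>R f = f"
    by transfer auto
  show "f \<bullet> g = g \<bullet> f"
    by transfer (simp add: inner_commute)
  show "(f + g) \<bullet> h = f \<bullet> h + g \<bullet> h"
    by transfer (simp add: inner_add_left square_integrable_on_inner)
  show "(a *\<^sub>R f) \<bullet> g = a * (f \<bullet> g)"
    by transfer simp
  show "0 \<le> f \<bullet> f"
    by transfer (simp add: integral_nonneg_AE)
  show "f \<bullet> f = 0 \<longleftrightarrow> f = 0"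
    by transfer
       (subst integral_nonneg_eq_0_iff_AE,
        auto simp: square_integrable_on_zero intro: square_integrable_on_inner)
  show "norm f = sqrt (f \<bullet> f)"
    by (fact norm_L2J_def)
  show "sgn f = inverse (norm f) *\<^sub>R f"
    by (fact sgn_L2J_def)
  show "dist f g = norm (f - g)"
    by (fact dist_L2J_def)
  show "(uniformity :: (L2J \<times> L2J) filter) = (INF e\<in>{0<..}. principal {(x, y). dist x y < e})"
    by (fact uniformity_L2J_def)
  show "open U \<longleftrightarrow> (\<forall>x\<in>U. eventually (\<lambda>(x', y). x' = x \<longrightarrow> y \<in> U) uniformity)" for U :: "L2J set"
    by (fact open_L2J_def)
qed

end

(* Any measurable square-integrable representative; its values outside J carry no information. *)
definition L2J_fun :: "L2J \<Rightarrow> real \<Rightarrow> real \<times> real" where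
  "L2J_fun = rep_L2J"

(* The index set {1, ..., n} is an arbitrary finite linearly ordered type; only its least and
   greatest elements 1 and n (which coincide if n = 1) play a special role. *)
definition first_ix :: "'n::{finite,linorder}" where "first_ix = Min UNIV"
definition last_ix :: "'n::{finite,linorder}" where "last_ix = Max UNIV"

definition grad :: "(real^'n \<Rightarrow> real) \<Rightarrow> real^'n \<Rightarrow> real^'n" where
  "grad V q = (THE D. GDERIV V q :> D)"

definition hessian :: "(real^'n \<Rightarrow> real) \<Rightarrow> real^'n \<Rightarrow> real^'n^'n" where
  "hessian V q = matrix (frechet_derivative (grad V) (at q))"

definition twice_continuously_differentiable :: "(real^'n \<Rightarrow> real) \<Rightarrow> bool" where
  "twice_continuously_differentiable V \<longleftrightarrow>
     (\<forall>q. V differentiable (at q)) \<and> (\<forall>q. grad V differentiable (at q)) \<and>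
     continuous_on UNIV (hessian V)"

type_synonym 'n config = "(real, 'n) vec"
type_synonym 'n state = "'n config \<times> 'n config"

(* The boundary part (-gamma_1 p_1 + z_1) e_1 + (-gamma_n p_n + z_n) e_n of the force. *)
definition boundary_force ::
  "real \<Rightarrow> real \<Rightarrow> ('n::{finite,linorder}) config \<Rightarrow> real \<times> real \<Rightarrow> 'n config" where
  "boundary_force \<gamma>1 \<gamma>n p z =
     (- \<gamma>1 * p $ first_ix + fst z) *\<^sub>R axis first_ix 1 + (- \<gamma>n * p $ last_ix + snd z) *\<^sub>R axis last_ix 1"

(* Points of R^{2n} are written (p, q), momentum first.  For a forcing that is merely L^2 in time,
   a solution is an (absolutely) continuous curve satisfying the integrated equation. *)
definition solves ::
  "(('n::{finite,linorder}) config \<Rightarrow> real) \<Rightarrow> real \<Rightarrow> real \<Rightarrow> (real \<Rightarrow> real \<times> real) \<Rightarrow>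
   real \<Rightarrow> 'n state \<Rightarrow> (real \<Rightarrow> 'n state) \<Rightarrow> bool" where
  "solves V \<gamma>1 \<gamma>n z t x0 u \<longleftrightarrow> continuous_on {0..t} u \<and>
     (\<forall>s\<in>{0..t}. ((\<lambda>\<tau>. (- grad V (snd (u \<tau>)) + boundary_force \<gamma>1 \<gamma>n (fst (u \<tau>)) (z \<tau>), fst (u \<tau>)))
        has_integral (u s - x0)) {0..s})"

definition flow ::
  "(('n::{finite,linorder}) config \<Rightarrow> real) \<Rightarrow> real \<Rightarrow> real \<Rightarrow> real \<Rightarrow>
   'n state \<Rightarrow> (real \<Rightarrow> real \<times> real) \<Rightarrow> 'n state" where
  "flow V \<gamma>1 \<gamma>n t x0 z = (THE x. \<exists>u. solves V \<gamma>1 \<gamma>n z t x0 u \<and> u t = x)"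

(* The linearisation along q, started at 0; w = (x, y) with x the variation of q. *)
definition solves_linearised ::
  "(('n::{finite,linorder}) config \<Rightarrow> real) \<Rightarrow> real \<Rightarrow> real \<Rightarrow> (real \<Rightarrow> 'n config) \<Rightarrow>
   (real \<Rightarrow> real \<times> real) \<Rightarrow> (real \<Rightarrow> 'n state) \<Rightarrow> bool" where
  "solves_linearised V \<gamma>1 \<gamma>n q \<xi> w \<longleftrightarrow> continuous_on {0..1} w \<and>
     (\<forall>s\<in>{0..1}. ((\<lambda>\<tau>. (snd (w \<tau>),
          - (hessian V (q \<tau>) *v fst (w \<tau>)) + boundary_force \<gamma>1 \<gamma>n (snd (w \<tau>)) (\<xi> \<tau>)))
        has_integral w s) {0..s})"

definition energy :: "(real \<Rightarrow> real \<times> real) \<Rightarrow> real \<Rightarrow> ennreal" where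
  "energy z t = (\<integral>\<^sup>+s\<in>{t..t+1}. ennreal (\<bar>fst (z s)\<bar>\<^sup>2 + \<bar>snd (z s)\<bar>\<^sup>2) \<partial>lebesgue)"

definition bounded_forcing :: "real \<Rightarrow> (real \<Rightarrow> real \<times> real) \<Rightarrow> bool" where
  "bounded_forcing M z \<longleftrightarrow>
     z \<in> borel_measurable (lebesgue_on {0..}) \<and> (SUP t\<in>{0..}. energy z t) \<le> ennreal M"

definition absorbing_radius ::
  "(('n::{finite,linorder}) config \<Rightarrow> real) \<Rightarrow> real \<Rightarrow> real \<Rightarrow> real \<Rightarrow> real \<Rightarrow> bool" where
  "absorbing_radius V \<gamma>1 \<gamma>n M \<rho> \<longleftrightarrow> \<rho> > 0 \<and>
     (\<forall>r>0. \<exists>T>0. \<forall>z. bounded_forcing M z \<longrightarrow>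
        (\<forall>x0\<in>cball 0 r. \<forall>t\<ge>T. flow V \<gamma>1 \<gamma>n t x0 z \<in> cball 0 \<rho>))"

definition BAS :: "(('n::{finite,linorder}) config \<Rightarrow> real) \<Rightarrow> real \<Rightarrow> real \<Rightarrow> bool" where
  "BAS V \<gamma>1 \<gamma>n \<longleftrightarrow> (\<forall>M>0. \<exists>\<rho>. absorbing_radius V \<gamma>1 \<gamma>n M \<rho>)"

definition absorbing_time ::
  "(('n::{finite,linorder}) config \<Rightarrow> real) \<Rightarrow> real \<Rightarrow> real \<Rightarrow> real \<Rightarrow> real \<Rightarrow> real" where
  "absorbing_time V \<gamma>1 \<gamma>n M \<rho> = (LEAST T. T \<ge> 1 \<and>
     (\<forall>t\<ge>T. \<forall>x0\<in>cball 0 \<rho>. \<forall>z. bounded_forcing M z \<longrightarrow> flow V \<gamma>1 \<gamma>n t x0 z \<in> cball 0 \<rho>))"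

definition forcing_set :: "real \<Rightarrow> real \<Rightarrow> (real \<Rightarrow> real \<times> real) set" where
  "forcing_set M T =
     {z. square_integrable_on z {0..T} \<and> (SUP t\<in>{0..T - 1}. energy z t) \<le> ennreal M}"

definition phase_set ::
  "(('n::{finite,linorder}) config \<Rightarrow> real) \<Rightarrow> real \<Rightarrow> real \<Rightarrow> real \<Rightarrow> real \<Rightarrow> ('n state) set" where
  "phase_set V \<gamma>1 \<gamma>n M \<rho> =
     (let T = absorbing_time V \<gamma>1 \<gamma>n M \<rho> in
      \<Union>t\<in>{0..T}. \<Union>z\<in>forcing_set M T. (\<lambda>x0. flow V \<gamma>1 \<gamma>n t x0 z) ` cball 0 \<rho>)"

definition SE ::
  "(('n::{finite,linorder}) config \<Rightarrow> real) \<Rightarrow> real \<Rightarrow> real \<Rightarrow> ('n state) set \<Rightarrow> bool" where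
  "SE V \<gamma>1 \<gamma>n X \<longleftrightarrow>
     (\<exists>c. ((\<lambda>t. SUP x0\<in>X. norm (flow V \<gamma>1 \<gamma>n t x0 (\<lambda>_. 0) - (0, c))) \<longlongrightarrow> 0) at_top)"

definition LC ::
  "(('n::{finite,linorder}) config \<Rightarrow> real) \<Rightarrow> real \<Rightarrow> real \<Rightarrow> ('n state) set \<Rightarrow> L2J set \<Rightarrow> bool" where
  "LC V \<gamma>1 \<gamma>n X K \<longleftrightarrow> (\<exists>U. open U \<and> X \<times> K \<subseteq> U \<and>
     (\<forall>(x0, \<zeta>)\<in>U. \<forall>v. \<exists>\<xi> w.
        solves_linearised V \<gamma>1 \<gamma>n (\<lambda>t. snd (flow V \<gamma>1 \<gamma>n t x0 (L2J_fun \<zeta>))) (L2J_fun \<xi>) w \<and> w 1 = v))"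

definition support :: "'a topology \<Rightarrow> 'a measure \<Rightarrow> 'a set" where
  "support \<T> \<mu> = {x \<in> topspace \<T>. \<forall>U. openin \<T> U \<longrightarrow> x \<in> U \<longrightarrow> emeasure \<mu> U > 0}"

definition var_dist :: "'a measure \<Rightarrow> 'a measure \<Rightarrow> real" where
  "var_dist \<mu> \<nu> = (SUP \<Gamma>\<in>sets \<mu>. \<bar>measure \<mu> \<Gamma> - measure \<nu> \<Gamma>\<bar>)"

definition dual_lipschitz_dist :: "'a::metric_space measure \<Rightarrow> 'a measure \<Rightarrow> real" where
  "dual_lipschitz_dist \<mu> \<nu> =
     (SUP f\<in>{f. (\<forall>x. \<bar>f x\<bar> \<le> 1) \<and> 1-lipschitz_on UNIV f}. \<bar>(\<integral>x. f x \<partial>\<mu>) - (\<integral>x. f x \<partial>\<nu>)\<bar>)"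

definition L2_loc :: "(real \<Rightarrow> real \<times> real) \<Rightarrow> bool" where
  "L2_loc z \<longleftrightarrow> (\<forall>a b. square_integrable_on z {a..b})"

(* The class in L^2(J) of t |-> z (t + k - 1); set to 0 for the trajectories that are not
   square integrable there, which form a null set. *)
definition segment :: "int \<Rightarrow> (real \<Rightarrow> real \<times> real) \<Rightarrow> L2J" where
  "segment k z = (let f = (\<lambda>t. z (t + real_of_int k - 1)) in
     if square_integrable_on f {0..<1} then abs_L2J f else 0)"

(* The sigma-algebra generated by the unit-interval segments, that is, the Borel sigma-algebra of
   the separable Frechet space L^2_loc(R, R^2), which is the product of copies of L^2(J). *)
definition trajectories :: "(real \<Rightarrow> real \<times> real) measure" where
  "trajectories = vimage_algebra UNIV (\<lambda>z k. segment k z) (Pi\<^sub>M UNIV (\<lambda>_::int. borel))"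

(* The completion makes laws insensitive to what happens on null sets of the sample space,
   where trajectories need not be locally square integrable. *)
definition law :: "'w measure \<Rightarrow> 'a measure \<Rightarrow> ('w \<Rightarrow> 'a) \<Rightarrow> 'a measure" where
  "law P N Y = distr (completion P) N Y"

definition CP :: "(real \<Rightarrow> real \<times> real) measure \<Rightarrow> L2J set \<Rightarrow> bool" where
  "CP \<Lambda> K \<longleftrightarrow> distr \<Lambda> trajectories (\<lambda>z t. z (t + 1)) = \<Lambda> \<and>
     K = support euclidean (distr \<Lambda> borel (segment 1)) \<and> compact K"

(* A past (xi_l), l = 0, -1, -2, ..., is stored as a function on nat: xi_l is at index -l. *)
type_synonym past = "nat \<Rightarrow> L2J"

abbreviation past_algebra :: "past measure" where
  "past_algebra \<equiv> Pi\<^sub>M UNIV (\<lambda>_. borel)"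

definition past_of :: "(real \<Rightarrow> real \<times> real) \<Rightarrow> past" where
  "past_of z = (\<lambda>j. segment (- int j) z)"

(* The past (xi, y) in which y has become the most recent element. *)
definition append_past :: "past \<Rightarrow> L2J \<Rightarrow> past" where
  "append_past \<xi> y = case_nat y \<xi>"

definition past_law :: "(real \<Rightarrow> real \<times> real) measure \<Rightarrow> past measure" where
  "past_law \<Lambda> = distr \<Lambda> past_algebra past_of"

definition past_dist :: "real \<Rightarrow> past \<Rightarrow> past \<Rightarrow> real" where
  "past_dist \<iota> \<xi> \<xi>' = (\<Sum>\<^sub>\<infinity>j. \<iota> powi (- int j) * norm (\<xi> j - \<xi>' j))"

(* On pasts with values in a bounded set the series converges and gives a metric. *)
lemma Metric_space_past_dist:
  assumes "\<iota> > 1" "bounded K"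
  shows "Metric_space (UNIV \<rightarrow> K) (past_dist \<iota>)"
proof -
  obtain B where B: "\<And>y. y \<in> K \<Longrightarrow> norm y \<le> B"
    using assms(2) by (auto simp: bounded_iff)
  have summ: "(\<lambda>j. \<iota> powi (- int j) * norm (\<xi> j - \<xi>' j)) summable_on UNIV"
    if "\<xi> \<in> UNIV \<rightarrow> K" "\<xi>' \<in> UNIV \<rightarrow> K" for \<xi> \<xi>' :: past
  proof -
    have "summable (\<lambda>j. \<iota> powi (- int j) * norm (\<xi> j - \<xi>' j))"
    proof (rule summable_comparison_test')
      show "summable (\<lambda>j. (inverse \<iota>) ^ j * (2 * B))"
        using assms(1) by (intro summable_mult2 summable_geometric) (simp add: field_simps)
      show "norm (\<iota> powi (- int j) * norm (\<xi> j - \<xi>' j)) \<le> (inverse \<iota>) ^ j * (2 * B)" for j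
      proof -
        have "norm (\<xi> j - \<xi>' j) \<le> norm (\<xi> j) + norm (\<xi>' j)"
          by (rule norm_triangle_ineq4)
        also have "\<dots> \<le> 2 * B"
          using B[OF funcset_mem[OF that(1) UNIV_I, of j]] B[OF funcset_mem[OF that(2) UNIV_I, of j]]
          by simp
        finally show ?thesis
          using assms(1)
          by (auto simp: power_int_minus power_inverse abs_mult intro!: mult_left_mono)
      qed
    qed
    then show ?thesis
      using assms(1) by (intro norm_summable_imp_summable_on) (simp add: abs_mult power_int_minus)
  qed
  show ?thesis
  proof
    fix x y z :: past
    show "0 \<le> past_dist \<iota> x y"
      unfolding past_dist_def using assms(1) by (intro infsum_nonneg) auto
    show "past_dist \<iota> x y = past_dist \<iota> y x"
      by (simp add: past_dist_def norm_minus_commute)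
    assume x: "x \<in> UNIV \<rightarrow> K" and y: "y \<in> UNIV \<rightarrow> K"
    show "past_dist \<iota> x y = 0 \<longleftrightarrow> x = y"
    proof
      assume "past_dist \<iota> x y = 0"
      then have "\<iota> powi (- int j) * norm (x j - y j) = 0" for j
        unfolding past_dist_def using summ[OF x y] assms(1)
        by (intro nonneg_infsum_le_0D[where A=UNIV and f="\<lambda>j. \<iota> powi (- int j) * norm (x j - y j)"]) auto
      then show "x = y"
        using assms(1) by (auto simp: fun_eq_iff)
    qed (simp add: past_dist_def)
    assume z: "z \<in> UNIV \<rightarrow> K"
    have "past_dist \<iota> x z \<le> (\<Sum>\<^sub>\<infinity>j. \<iota> powi (- int j) * norm (x j - y j) + \<iota> powi (- int j) * norm (y j - z j))"
      unfolding past_dist_def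
    proof (intro infsum_mono summ summable_on_add x y z)
      fix j
      have "norm (x j - z j) \<le> norm (x j - y j) + norm (y j - z j)"
        using norm_triangle_ineq[of "x j - y j" "y j - z j"] by simp
      then show "\<iota> powi (- int j) * norm (x j - z j)
          \<le> \<iota> powi (- int j) * norm (x j - y j) + \<iota> powi (- int j) * norm (y j - z j)"
        using assms(1) by (auto simp flip: distrib_left intro!: mult_left_mono)
    qed
    also have "\<dots> = past_dist \<iota> x y + past_dist \<iota> y z"
      unfolding past_dist_def by (intro infsum_add summ x y z)
    finally show "past_dist \<iota> x z \<le> past_dist \<iota> x y + past_dist \<iota> y z" .
  qed
qed

definition past_topology :: "real \<Rightarrow> L2J set \<Rightarrow> past topology" where
  "past_topology \<iota> K = Metric_space.mtopology (UNIV \<rightarrow> K) (past_dist \<iota>)"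

definition past_support :: "real \<Rightarrow> L2J set \<Rightarrow> (real \<Rightarrow> real \<times> real) measure \<Rightarrow> past set" where
  "past_support \<iota> K \<Lambda> = support (past_topology \<iota> K) (past_law \<Lambda>)"

(* Q is a regular conditional law of eta_1 = segment 1 given the past; only its values on the
   support S of the law of the past matter. *)
definition conditional_law ::
  "(real \<Rightarrow> real \<times> real) measure \<Rightarrow> past set \<Rightarrow> (past \<Rightarrow> L2J measure) \<Rightarrow> bool" where
  "conditional_law \<Lambda> S Q \<longleftrightarrow> Q \<in> restrict_space past_algebra S \<rightarrow>\<^sub>M prob_algebra borel \<and>
     (\<forall>A\<in>sets past_algebra. \<forall>B\<in>sets borel.
        emeasure \<Lambda> {z \<in> space \<Lambda>. past_of z \<in> A \<and> segment 1 z \<in> B} =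
          (\<integral>\<^sup>+\<xi>\<in>A \<inter> S. emeasure (Q \<xi>) B \<partial>past_law \<Lambda>))"

definition SF :: "real \<Rightarrow> L2J set \<Rightarrow> past set \<Rightarrow> (past \<Rightarrow> L2J measure) \<Rightarrow> bool" where
  "SF \<iota> K S Q \<longleftrightarrow>
     (\<forall>\<xi>\<in>S. emeasure (Q \<xi>) K = 1) \<and>
     (\<forall>f. continuous_on UNIV f \<and> bounded (range f) \<longrightarrow>
        continuous_map (subtopology (past_topology \<iota> K) S) euclideanreal (\<lambda>\<xi>. \<integral>y. f y \<partial>Q \<xi>)) \<and>
     (\<exists>C>0. \<forall>\<xi>\<in>S. \<forall>\<xi>'\<in>S. var_dist (Q \<xi>) (Q \<xi>') \<le> C * past_dist \<iota> \<xi> \<xi>')"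

(* Lebesgue measure of a finite-dimensional subspace, as a measure on L^2(J) carried by it:
   the image of Lebesgue measure on coordinates in an orthonormal basis (any choice of basis
   gives the same measure). *)
definition subspace_lebesgue :: "L2J set \<Rightarrow> L2J measure" where
  "subspace_lebesgue F =
     (let B = (SOME B. finite B \<and> pairwise orthogonal B \<and> (\<forall>b\<in>B. norm b = 1) \<and> span B = F) in
      distr (Pi\<^sub>M B (\<lambda>_. lborel)) borel (\<lambda>a. \<Sum>b\<in>B. a b *\<^sub>R b))"

(* rho_n(xi, y_n^dagger, y_n) is written rho n xi (y_n + y_n^dagger); F' n is the complement of F n;
   the sequence of subspaces is indexed from 0. *)
definition DLP ::
  "real \<Rightarrow> past set \<Rightarrow> (past \<Rightarrow> L2J measure) \<Rightarrow> bool" where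
  "DLP \<iota> S Q \<longleftrightarrow> (\<exists>(F :: nat \<Rightarrow> L2J set) (F' :: nat \<Rightarrow> L2J set) (P :: nat \<Rightarrow> L2J \<Rightarrow> L2J) (\<rho> :: nat \<Rightarrow> past \<Rightarrow> L2J \<Rightarrow> real).
     incseq F \<and> closure (\<Union>n. F n) = UNIV \<and>
     (\<forall>n. (\<exists>B. finite B \<and> F n = span B) \<and> subspace (F' n) \<and> F n \<inter> F' n = {0} \<and>
          bounded_linear (P n) \<and> (\<forall>y. P n y \<in> F n \<and> y - P n y \<in> F' n)) \<and>
     (\<exists>C. \<forall>n. onorm (P n) \<le> C) \<and>
     (\<forall>n. (\<forall>\<xi>\<in>S. \<forall>y. \<rho> n \<xi> y \<ge> 0) \<and>
          (\<exists>L. \<forall>\<xi>\<in>S. \<forall>\<xi>'\<in>S. \<forall>y y'.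
             \<bar>\<rho> n \<xi> y - \<rho> n \<xi>' y'\<bar> \<le> L * (past_dist \<iota> \<xi> \<xi>' + norm (y - y'))) \<and>
          (\<forall>\<xi>\<in>S. \<forall>A\<in>sets borel. emeasure (Q \<xi>) A =
             (\<integral>\<^sup>+v. (\<integral>\<^sup>+u. ennreal (\<rho> n \<xi> (u + v)) * indicator A (u + v) \<partial>subspace_lebesgue (F n))
                \<partial>distr (Q \<xi>) borel (\<lambda>y. y - P n y)))))"

(* Integral of g(y_1, ..., y_m) against Q(xi; dy_1) Q((xi, y_1); dy_2) ... *)
primrec iterated_integral ::
  "(past \<Rightarrow> L2J measure) \<Rightarrow> nat \<Rightarrow> (L2J list \<Rightarrow> ennreal) \<Rightarrow> past \<Rightarrow> ennreal" where
  "iterated_integral Q 0 g \<xi> = g []"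
| "iterated_integral Q (Suc m) g \<xi> =
     (\<integral>\<^sup>+y. iterated_integral Q m (\<lambda>ys. g (y # ys)) (append_past \<xi> y) \<partial>Q \<xi>)"

(* The probability Q_s^n(xi; G) that (eta_{s+1}, ..., eta_{s+n}) lies in the set G of n-tuples. *)
definition delayed_prob ::
  "(past \<Rightarrow> L2J measure) \<Rightarrow> nat \<Rightarrow> nat \<Rightarrow> past \<Rightarrow> L2J list set \<Rightarrow> ennreal" where
  "delayed_prob Q s n \<xi> G = iterated_integral Q (s + n) (\<lambda>ys. indicator G (drop s ys)) \<xi>"

definition SRZ :: "past set \<Rightarrow> (past \<Rightarrow> L2J measure) \<Rightarrow> bool" where
  "SRZ S Q \<longleftrightarrow> (\<forall>n\<ge>1. \<forall>\<delta>>0. \<exists>s.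
     (INF \<xi>\<in>S. delayed_prob Q s n \<xi> {ys. length ys = n \<and> set ys \<subseteq> ball 0 \<delta>}) > 0)"

definition DR :: "(real \<Rightarrow> real \<times> real) measure \<Rightarrow> L2J set \<Rightarrow> real \<Rightarrow> bool" where
  "DR \<Lambda> K \<iota> \<longleftrightarrow> (let S = past_support \<iota> K \<Lambda> in
     \<exists>Q. conditional_law \<Lambda> S Q \<and> SF \<iota> K S Q \<and> DLP \<iota> S Q \<and> SRZ S Q)"

end

theory Submission
  imports Defs
begin

text \<open>The noise segments make the system a Markov chain on pairs \<open>(x, \<xi>)\<close> of a state and a past of
  the noise, which moves from \<open>(x, \<xi>)\<close> to \<open>(step x y, (\<xi>, y))\<close> with \<open>y\<close> distributed according to
  \<open>Q \<xi>\<close>. Its transfer operator contracts oscillations measured by a cost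
  \<open>min 1 (\<theta> * gap x x' \<xi> + B * D \<xi> \<xi>')\<close>. Here the gap is the largest difference of
  \<open>\<integral> h (step x y) y Q(\<xi>; dy)\<close> and \<open>\<integral> h (step x' y) y Q(\<xi>; dy)\<close> over functions \<open>h\<close> with values in
  \<open>[0, 1]\<close> that are merely measurable in the state and \<open>B\<close>-Lipschitz in the noise; with this choice
  the contraction at costs below 1 follows from (SF) alone, and no coupling has to be constructed.
  At cost 1 one uses that (BAS), (SRZ) and (SE) bring the chain close to the equilibrium and
  the zero past with a probability bounded below, and that the gap is less than 1 there:
  by (LC) a change of the initial state is compensated by a shift of the noise in one of the
  finite-dimensional spaces of (DLP'), under which the law of the noise is quasi-invariant.
  As observables only need to be bounded and measurable, the marginals converge in total variation.\<close>

subsection \<open>Integral equations\<close>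

text \<open>State and past cannot be treated alike: appending a segment brings two pasts closer by
  the factor \<open>1 / \<iota>\<close>, whereas \<open>step\<close> need not contract anything.
  States are therefore compared not by a metric but by how well the next pair (state, segment) can
  be told apart; one transfer is then bounded by the gap itself, and every weight \<theta> > 1 gives
  contraction. The weight \<open>B\<close> is so large that the total variation error
  \<open>2 * C\<close> from (SF) uses up only half of what the factor \<open>1 / \<iota>\<close>
  gains. The price is that at cost 1 the improvement must come from the noise alone, uniformly over
  all measurable observables; hence the near-identity maps and the covering estimate for Lebesgue
  measure. The chain lives on the forward orbit of a ball under segments from \<open>K\<close>, not
  on \<open>phase_set\<close>: the orbit is invariant by construction, while arbitrary
  concatenations of elements of \<open>K\<close> need not obey the bound \<open>M\<close>. The set
  \<open>phase_set\<close> serves only to apply (SE) and (LC).\<close>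

lemma gronwall:
  fixes g :: "real \<Rightarrow> real"
  assumes cont: "continuous_on {0..t} g"
    and le: "\<And>s. s \<in> {0..t} \<Longrightarrow> g s \<le> a + L * integral {0..s} g"
    and L: "L \<ge> 0" and s: "s \<in> {0..t}"
  shows "g s \<le> a * exp (L * s)"
proof -
  \<comment> \<open>With the integrating factor \<open>exp (- L * s)\<close> the right-hand side of
    the hypothesis becomes nonincreasing.\<close>
  define G where "G = (\<lambda>s. exp (- L * s) * (a + L * integral {0..s} g))"
  have der: "(G has_vector_derivative exp (- L * x) * (L * g x - L * (a + L * integral {0..x} g)))
      (at x within {0..t})" if "x \<in> {0..t}" for x
    unfolding G_def has_real_derivative_iff_has_vector_derivative[symmetric]
    by (rule derivative_eq_intros integral_has_real_derivative[OF cont that] refl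
        | simp add: algebra_simps)+
  have "((\<lambda>x. - (exp (- L * x) * (L * g x - L * (a + L * integral {0..x} g)))) has_integral - G s - - G 0) {0..s}"
    using s
    by (intro fundamental_theorem_of_calculus has_vector_derivative_minus
          has_vector_derivative_within_subset[OF der]) auto
  then have "0 \<le> - G s - - G 0"
  proof (rule has_integral_nonneg)
    fix x assume "x \<in> {0..s}"
    then have "L * g x \<le> L * (a + L * integral {0..x} g)"
      using s L by (intro mult_left_mono le) auto
    then show "0 \<le> - (exp (- L * x) * (L * g x - L * (a + L * integral {0..x} g)))"
      by (simp add: mult_nonneg_nonpos)
  qed
  then have "G s \<le> a" by (simp add: G_def)
  then have "exp (L * s) * G s \<le> exp (L * s) * a" by simp
  moreover have "exp (L * s) * G s = a + L * integral {0..s} g"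
    by (simp add: G_def exp_minus field_simps)
  ultimately show ?thesis using le[OF s] by (metis mult.commute order_trans)
qed

text \<open>The forcing enters only through a primitive contained in the continuous function
  \<open>W\<close>, so a forcing that is merely square integrable leads to a fixed-point equation
  for continuous curves.\<close>

definition mild :: "('s::euclidean_space \<Rightarrow> 's) \<Rightarrow> (real \<Rightarrow> 's) \<Rightarrow> real \<Rightarrow> (real \<Rightarrow> 's) \<Rightarrow> bool" where
  "mild F W t u \<longleftrightarrow> continuous_on {0..t} u \<and> (\<forall>s\<in>{0..t}. u s = W s + integral {0..s} (\<lambda>\<tau>. F (u \<tau>)))"

lemma norm_integral_le_integral:
  fixes f :: "real \<Rightarrow> 's::euclidean_space"
  assumes "continuous_on {0..s} f" "continuous_on {0..s} g" "\<And>\<tau>. \<tau> \<in> {0..s} \<Longrightarrow> norm (f \<tau>) \<le> g \<tau>"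
  shows "norm (integral {0..s} f) \<le> integral {0..s} g"
  using assms by (intro integral_norm_bound_integral integrable_continuous_interval) auto

text \<open>Gronwall's inequality for the difference of two curves. It asks for a Lipschitz constant
  only on a set \<open>B\<close> containing both curves, which suits the locally Lipschitz
  drift.\<close>

lemma mild_stable:
  fixes F :: "'s::euclidean_space \<Rightarrow> 's"
  assumes u: "mild F W t u" and v: "mild F W' t v"
    and F: "L-lipschitz_on B F" "u ` {0..t} \<subseteq> B" "v ` {0..t} \<subseteq> B"
    and W: "\<And>s. s \<in> {0..t} \<Longrightarrow> norm (W s - W' s) \<le> e"
    and s: "s \<in> {0..t}"
  shows "norm (u s - v s) \<le> e * exp (L * s)"
proof (rule gronwall[where g = "\<lambda>s. norm (u s - v s)" and t = t, OF _ _ _ s])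
  have cu: "continuous_on {0..t} u" and cv: "continuous_on {0..t} v"
    using u v by (auto simp: mild_def)
  show "continuous_on {0..t} (\<lambda>s. norm (u s - v s))"
    by (intro continuous_intros cu cv)
  show "L \<ge> 0" using F(1) by (rule lipschitz_on_nonneg)
  fix r assume r: "r \<in> {0..t}"
  have sub: "{0..r} \<subseteq> {0..t}" using r by auto
  have cF: "continuous_on {0..r} (\<lambda>\<tau>. F (u \<tau>))" "continuous_on {0..r} (\<lambda>\<tau>. F (v \<tau>))"
    using F sub
    by (auto intro!: continuous_on_compose2[OF lipschitz_on_continuous_on[OF F(1)]]
        intro: continuous_on_subset[OF cu] continuous_on_subset[OF cv])
  have "u r - v r = (W r - W' r) + integral {0..r} (\<lambda>\<tau>. F (u \<tau>) - F (v \<tau>))"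
    using u v r cF by (simp add: mild_def integral_diff integrable_continuous_interval)
  moreover have "norm (integral {0..r} (\<lambda>\<tau>. F (u \<tau>) - F (v \<tau>))) \<le> integral {0..r} (\<lambda>\<tau>. L * norm (u \<tau> - v \<tau>))"
  proof (rule norm_integral_le_integral)
    show "continuous_on {0..r} (\<lambda>\<tau>. F (u \<tau>) - F (v \<tau>))"
      by (intro continuous_intros cF)
    show "continuous_on {0..r} (\<lambda>\<tau>. L * norm (u \<tau> - v \<tau>))"
      using sub by (intro continuous_intros continuous_on_subset[OF cu] continuous_on_subset[OF cv])
    fix \<tau> assume "\<tau> \<in> {0..r}"
    then have "u \<tau> \<in> B" "v \<tau> \<in> B" using F sub by auto
    then show "norm (F (u \<tau>) - F (v \<tau>)) \<le> L * norm (u \<tau> - v \<tau>)"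
      using lipschitz_onD[OF F(1)] by (simp add: dist_norm)
  qed
  ultimately show "norm (u r - v r) \<le> e + L * integral {0..r} (\<lambda>s. norm (u s - v s))"
    using add_mono[OF W[OF r]] by (auto intro: order_trans[OF norm_triangle_ineq])
qed

lemma mild_unique:
  fixes F :: "'s::euclidean_space \<Rightarrow> 's"
  assumes F: "\<And>R. \<exists>L. L-lipschitz_on (cball 0 R) F"
    and u: "mild F W t u" and v: "mild F W t v" and s: "s \<in> {0..t}"
  shows "u s = v s"
proof -
  have "compact (u ` {0..t} \<union> v ` {0..t})"
    using u v by (intro compact_Un compact_continuous_image) (auto simp: mild_def)
  then obtain R where "\<forall>x\<in>u ` {0..t} \<union> v ` {0..t}. norm x \<le> R"
    using compact_imp_bounded bounded_iff by blast
  then have R: "u ` {0..t} \<union> v ` {0..t} \<subseteq> cball 0 R" by auto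
  obtain L where L: "L-lipschitz_on (cball 0 R) F" using F by blast
  have "norm (u s - v s) \<le> 0 * exp (L * s)"
    using R by (intro mild_stable[OF u v L _ _ _ s]) auto
  then show ?thesis by simp
qed

lemma mild_exists_lipschitz:
  fixes F :: "'s::euclidean_space \<Rightarrow> 's"
  assumes F: "L-lipschitz_on UNIV F" and W: "continuous_on {0..t} W" and t: "t \<ge> 0"
  shows "\<exists>u. mild F W t u"
proof -
  have L: "L \<ge> 0" using F by (rule lipschitz_on_nonneg)
  \<comment> \<open>The fixed point is sought in the norm weighted by \<open>exp (- la * s)\<close>:
    the contraction factor \<open>L / la\<close> is below 1 on an interval of any length, so no
    pieces have to be glued.\<close>
  define la where "la = L + 1"
  have lam: "la > 0" using L by (simp add: la_def)
  \<comment> \<open>Clamping times to \<open>{0..t}\<close> turns a curve on the interval into a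
    bounded continuous function on the line, an element of a complete metric space.\<close>
  define c where "c = (\<lambda>s::real. max 0 (min t s))"
  have c: "c s \<in> {0..t}" for s using t by (auto simp: c_def)
  have cc: "continuous_on A c" for A unfolding c_def by (intro continuous_intros)
  have cF: "continuous_on A (\<lambda>\<tau>. F (v \<tau>))" if "continuous_on A v" for A v
    using that by (intro continuous_on_compose2[OF lipschitz_on_continuous_on[OF F]]) auto
  define T0 where "T0 = (\<lambda>(v :: real \<Rightarrow> 's) s. exp (- la * c s) *\<^sub>R
      (W (c s) + integral {0..c s} (\<lambda>\<tau>. F (exp (la * \<tau>) *\<^sub>R v \<tau>))))"
  have contF: "continuous_on A (\<lambda>\<tau>. F (exp (la * \<tau>) *\<^sub>R apply_bcontfun v \<tau>))" for A v
    by (intro cF continuous_intros continuous_on_apply_bcontfun)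
  have contT: "continuous_on {0..t} (\<lambda>s. exp (- la * s) *\<^sub>R
      (W s + integral {0..s} (\<lambda>\<tau>. F (exp (la * \<tau>) *\<^sub>R apply_bcontfun v \<tau>))))" for v
    by (intro continuous_intros W indefinite_integral_continuous_1 integrable_continuous_interval contF)
  have T0: "T0 (apply_bcontfun v) \<in> bcontfun" for v
  proof -
    have "continuous_on UNIV (T0 v)"
      unfolding T0_def using c by (intro continuous_on_compose2[OF contT cc]) auto
    moreover have "bounded (range (T0 v))"
    proof (rule bounded_subset[OF compact_imp_bounded[OF compact_continuous_image[OF contT compact_Icc]]])
      show "range (T0 v) \<subseteq> (\<lambda>s. exp (- la * s) *\<^sub>R (W s + integral {0..s} (\<lambda>\<tau>. F (exp (la * \<tau>) *\<^sub>R apply_bcontfun v \<tau>)))) ` {0..t}"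
        unfolding T0_def using c by auto
    qed
    ultimately show ?thesis by (simp add: bcontfun_def)
  qed
  define T where "T = (\<lambda>v. Bcontfun (T0 (apply_bcontfun v)))"
  have T: "apply_bcontfun (T v) = T0 (apply_bcontfun v)" for v
    by (simp add: T_def Bcontfun_inverse T0)
  have contr: "dist (T v) (T w) \<le> (L / la) * dist v w" for v w
  proof (rule dist_bound)
    fix s
    let ?I = "\<lambda>v. integral {0..c s} (\<lambda>\<tau>. F (exp (la * \<tau>) *\<^sub>R apply_bcontfun v \<tau>))"
    have "?I v - ?I w = integral {0..c s} (\<lambda>\<tau>. F (exp (la * \<tau>) *\<^sub>R apply_bcontfun v \<tau>) - F (exp (la * \<tau>) *\<^sub>R apply_bcontfun w \<tau>))"
      by (intro integral_diff[symmetric] integrable_continuous_interval contF)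
    also have "norm \<dots> \<le> integral {0..c s} (\<lambda>\<tau>. (L * dist v w) * exp (la * \<tau>))"
    proof (rule norm_integral_le_integral)
      fix \<tau>
      have "norm (F (exp (la * \<tau>) *\<^sub>R apply_bcontfun v \<tau>) - F (exp (la * \<tau>) *\<^sub>R apply_bcontfun w \<tau>))
          \<le> L * norm (exp (la * \<tau>) *\<^sub>R apply_bcontfun v \<tau> - exp (la * \<tau>) *\<^sub>R apply_bcontfun w \<tau>)"
        using lipschitz_onD[OF F] by (simp add: dist_norm)
      also have "\<dots> = L * (exp (la * \<tau>) * dist (apply_bcontfun v \<tau>) (apply_bcontfun w \<tau>))"
        by (simp flip: scaleR_diff_right add: dist_norm)
      also have "\<dots> \<le> L * (exp (la * \<tau>) * dist v w)"
        using L by (intro mult_left_mono dist_bounded) auto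
      finally show "norm (F (exp (la * \<tau>) *\<^sub>R apply_bcontfun v \<tau>) - F (exp (la * \<tau>) *\<^sub>R apply_bcontfun w \<tau>))
          \<le> (L * dist v w) * exp (la * \<tau>)" by (simp add: mult_ac)
    qed (auto intro!: continuous_intros contF)
    also have "\<dots> = (L * dist v w) * ((exp (la * c s) - 1) / la)"
    proof -
      have "((\<lambda>\<tau>. exp (la * \<tau>)) has_integral exp (la * c s) / la - exp (la * 0) / la) {0..c s}"
        using c[of s] lam by (intro fundamental_theorem_of_calculus)
          (auto intro!: derivative_eq_intros simp flip: has_real_derivative_iff_has_vector_derivative)
      from integral_unique[OF this] show ?thesis by (simp add: diff_divide_distrib)
    qed
    finally have I: "norm (?I v - ?I w) \<le> (L * dist v w) * ((exp (la * c s) - 1) / la)" .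
    have "dist (T v s) (T w s) = exp (- la * c s) * norm (?I v - ?I w)"
      unfolding T T0_def dist_norm by (simp flip: scaleR_diff_right)
    also have "\<dots> \<le> exp (- la * c s) * ((L * dist v w) * ((exp (la * c s) - 1) / la))"
      using I by (intro mult_left_mono) auto
    also have "\<dots> = (L / la * dist v w) * (1 - exp (- la * c s))"
      by (simp add: exp_minus field_simps)
    also have "\<dots> \<le> (L / la * dist v w) * 1"
      using L lam by (intro mult_left_mono) auto
    finally show "dist (T v s) (T w s) \<le> L / la * dist v w" by simp
  qed
  have "\<exists>!v. T v = v"
    using L contr by (intro banach_fix_type[where c = "L / la"]) (auto simp: la_def field_simps)
  then obtain v where v: "T v = v" by blast
  define u where "u = (\<lambda>s. exp (la * s) *\<^sub>R apply_bcontfun v s)"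
  have "u s = W s + integral {0..s} (\<lambda>\<tau>. F (u \<tau>))" if "s \<in> {0..t}" for s
  proof -
    have [simp]: "c s = s" using that by (auto simp: c_def)
    have "u s = exp (la * s) *\<^sub>R T0 (apply_bcontfun v) s" by (metis u_def T v)
    then show ?thesis by (simp add: T0_def u_def flip: exp_add)
  qed
  moreover have "continuous_on {0..t} u"
    unfolding u_def by (intro continuous_intros continuous_on_apply_bcontfun)
  ultimately show ?thesis unfolding mild_def by blast
qed

text \<open>Outside \<^term>\<open>cball 0 R\<close> the field is cut off by the nearest-point projection; an a priori
  bound below \<^term>\<open>R\<close> makes the cut-off invisible.\<close>

lemma mild_exists:
  fixes F :: "'s::euclidean_space \<Rightarrow> 's"
  assumes F: "L-lipschitz_on (cball 0 R) F" and W: "continuous_on {0..t} W" and t: "t \<ge> 0"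
    and apriori: "\<And>s u. s \<in> {0..t} \<Longrightarrow> mild F W s u \<Longrightarrow> norm (u s) < R"
  shows "\<exists>u. mild F W t u"
proof -
  define \<pi> where "\<pi> = closest_point (cball (0::'s) R)"
  have "mild F W 0 (\<lambda>_. W 0)" by (simp add: mild_def)
  with apriori[of 0] t have R: "R > 0" by (smt (verit) atLeastAtMost_iff norm_ge_zero)
  have "1-lipschitz_on UNIV \<pi>"
    unfolding \<pi>_def using R by (intro lipschitz_onI) (auto intro: closest_point_lipschitz)
  moreover have "range \<pi> \<subseteq> cball 0 R"
    unfolding \<pi>_def using R by (intro image_subsetI closest_point_in_set) auto
  ultimately have "(L * 1)-lipschitz_on UNIV (F \<circ> \<pi>)"
    using F by (intro lipschitz_on_compose) (auto intro: lipschitz_on_subset)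
  from mild_exists_lipschitz[OF this W t] obtain u where u: "mild (F \<circ> \<pi>) W t u" by blast
  have cu: "continuous_on {0..t} u" using u by (simp add: mild_def)
  have eq: "mild F W s u" if "s \<in> {0..t}" "\<And>r. r \<in> {0..s} \<Longrightarrow> norm (u r) \<le> R" for s
    unfolding mild_def
  proof (intro conjI ballI)
    show "continuous_on {0..s} u" using that by (auto intro: continuous_on_subset[OF cu])
    fix r assume r: "r \<in> {0..s}"
    then have "u r = W r + integral {0..r} (\<lambda>\<tau>. (F \<circ> \<pi>) (u \<tau>))"
      using u that by (auto simp: mild_def)
    also have "integral {0..r} (\<lambda>\<tau>. (F \<circ> \<pi>) (u \<tau>)) = integral {0..r} (\<lambda>\<tau>. F (u \<tau>))"
      using that r by (intro integral_cong) (auto simp: \<pi>_def closest_point_self)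
    finally show "u r = W r + integral {0..r} (\<lambda>\<tau>. F (u \<tau>))" .
  qed
  have "norm (u r) < R" if r: "r \<in> {0..t}" for r
  proof (rule ccontr)
    assume "\<not> norm (u r) < R"
    \<comment> \<open>Its least element \<open>s\<close> is the first time at which the norm reaches
      \<open>R\<close>. Up to and including \<open>s\<close> the curve stays in the closed ball,
      where the cut-off is invisible, so the strict a priori bound at \<open>s\<close> gives the
      contradiction.\<close>
    define C where "C = {s \<in> {0..t}. norm (u s) \<ge> R}"
    have "closed C"
      unfolding C_def by (intro continuous_closed_preimage_constant[where a=True, simplified]
        continuous_on_closed_Collect_le continuous_intros cu closed_atLeastAtMost)
    moreover have "C \<subseteq> {0..t}" by (auto simp: C_def)
    ultimately have "compact C" by (simp add: compact_eq_bounded_closed bounded_subset[OF bounded_closed_interval])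
    moreover have "C \<noteq> {}" using r \<open>\<not> _\<close> by (auto simp: C_def)
    ultimately obtain s where s: "s \<in> C" "\<And>x. x \<in> C \<Longrightarrow> s \<le> x"
      using compact_attains_inf[of C] by metis
    have st: "s \<in> {0..t}" using s by (auto simp: C_def)
    have less: "norm (u x) < R" if "x \<in> {0..<s}" for x
    proof (rule ccontr)
      assume "\<not> norm (u x) < R"
      then have "x \<in> C" using that st by (auto simp: C_def)
      then show False using s(2) that by force
    qed
    have "norm (u s) \<le> R"
    proof (cases "s = 0")
      case True
      then have "u s = W 0" using u t by (simp add: mild_def)
      moreover have "norm (W 0) < R"
        using apriori[of 0 "\<lambda>_. W 0"] t by (auto simp: mild_def)
      ultimately show ?thesis by simp
    next
      case False
      then have s0: "s > 0" using st by auto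
      have "continuous_on {0..s} (\<lambda>x. norm (u x))"
        using st by (intro continuous_intros continuous_on_subset[OF cu]) auto
      then show ?thesis
        using s0 less continuous_le_on_closure[of "{0..<s}" "\<lambda>x. norm (u x)" s R]
        by (force intro: less_imp_le)
    qed
    then have "mild F W s u" using less st by (intro eq) (auto simp: less_le)
    from apriori[OF st this] s(1) show False by (auto simp: C_def)
  qed
  then show ?thesis using eq[of t] t by (auto intro: less_imp_le)
qed

text \<open>The local bound is summed over a uniform partition finer than \<delta>; the increments
  of \<open>N\<close> telescope, so the bound does not deteriorate with the number of
  pieces.\<close>

lemma abs_diff_le_telescope:
  fixes g N :: "real \<Rightarrow> real"
  assumes loc: "\<And>a b. 0 \<le> a \<Longrightarrow> a \<le> b \<Longrightarrow> b \<le> t \<Longrightarrow> b - a < \<delta> \<Longrightarrow> \<bar>g b - g a\<bar> \<le> e * (N b - N a)"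
    and "\<delta> > 0" "t \<ge> 0"
  shows "\<bar>g t - g 0\<bar> \<le> e * (N t - N 0)"
proof -
  obtain n :: nat where n: "n > 0" "t / n < \<delta>"
  proof -
    obtain n :: nat where "t / \<delta> < n" using reals_Archimedean2 by blast
    then show ?thesis using that[of "Suc n"] \<open>\<delta> > 0\<close> by (simp add: field_simps)
  qed
  define s where "s = (\<lambda>i::nat. t * i / n)"
  have s: "s 0 = 0" "s n = t" using n by (auto simp: s_def)
  have step: "\<bar>g (s (Suc i)) - g (s i)\<bar> \<le> e * (N (s (Suc i)) - N (s i))" if "i < n" for i
  proof (rule loc)
    show "0 \<le> s i" "s i \<le> s (Suc i)" using assms n by (auto simp: s_def field_simps)
    have "t * (1 + real i) \<le> t * real n" using that assms by (intro mult_left_mono) auto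
    then show "s (Suc i) \<le> t" using n by (simp add: s_def field_simps)
    have "s (Suc i) - s i = t / n" by (simp add: s_def distrib_left add_divide_distrib)
    then show "s (Suc i) - s i < \<delta>" using n by simp
  qed
  have "\<bar>g (s n) - g (s 0)\<bar> = \<bar>\<Sum>i<n. g (s (Suc i)) - g (s i)\<bar>"
    by (simp only: sum_lessThan_telescope[where f = "\<lambda>i. g (s i)"])
  also have "\<dots> \<le> (\<Sum>i<n. \<bar>g (s (Suc i)) - g (s i)\<bar>)" by (rule sum_abs)
  also have "\<dots> \<le> (\<Sum>i<n. e * (N (s (Suc i)) - N (s i)))" by (intro sum_mono step) auto
  also have "\<dots> = e * (N (s n) - N (s 0))" by (simp only: sum_lessThan_telescope[where f = "\<lambda>i. N (s i)"] flip: sum_distrib_left)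
  finally show ?thesis using s by simp
qed

text \<open>The mean value inequality for \<open>H\<close> minus the linear function given by
  \<open>c\<close>.\<close>

lemma gderiv_linearisation:
  fixes H :: "'s::euclidean_space \<Rightarrow> real"
  assumes H: "\<And>x. GDERIV H x :> h x" and S: "convex S" "x \<in> S" "y \<in> S"
    and close: "\<And>z. z \<in> S \<Longrightarrow> norm (h z - c) \<le> e"
  shows "\<bar>H x - H y - (x - y) \<bullet> c\<bar> \<le> e * norm (x - y)"
proof -
  have "norm ((\<lambda>z. H z - z \<bullet> c) x - (\<lambda>z. H z - z \<bullet> c) y) \<le> e * norm (x - y)"
  proof (rule differentiable_bound[OF S(1) _ _ S(2,3), where f' = "\<lambda>z v. v \<bullet> h z - v \<bullet> c"])
    fix z assume z: "z \<in> S"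
    show "((\<lambda>z. H z - z \<bullet> c) has_derivative (\<lambda>v. v \<bullet> h z - v \<bullet> c)) (at z within S)"
      using H[of z] unfolding gderiv_def
      by (auto intro!: derivative_eq_intros intro: has_derivative_at_withinI)
    show "onorm (\<lambda>v. v \<bullet> h z - v \<bullet> c) \<le> e"
    proof (rule onorm_le)
      fix v
      have "norm (v \<bullet> h z - v \<bullet> c) \<le> norm v * norm (h z - c)"
        by (simp flip: inner_diff_right add: Cauchy_Schwarz_ineq2)
      also have "\<dots> \<le> e * norm v" using mult_left_mono[OF close[OF z], of "norm v"] by (simp add: mult.commute)
      finally show "norm (v \<bullet> h z - v \<bullet> c) \<le> e * norm v" .
    qed
  qed
  then show ?thesis by (simp add: inner_diff_left algebra_simps)
qed

text \<open>The curve \<open>u\<close> is only the indefinite integral of an integrable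
  \<open>f\<close> and may lack a derivative at individual points. On a short interval both
  \<open>H (u b) - H (u a)\<close> and the integral of the claimed derivative are close to
  \<open>(u b - u a) \<bullet> h (u a)\<close>, with an error of \<open>e\<close> times the
  variation \<open>N b - N a\<close>; these errors telescope, and \<open>e\<close> is
  arbitrary.\<close>

lemma has_integral_chain_rule:
  fixes u f :: "real \<Rightarrow> 's::euclidean_space" and H :: "'s \<Rightarrow> real"
  assumes f: "f absolutely_integrable_on {0..t}"
    and u: "\<And>s. s \<in> {0..t} \<Longrightarrow> (f has_integral (u s - x0)) {0..s}"
    and H: "\<And>x. GDERIV H x :> h x" and h: "continuous_on UNIV h" and t: "t \<ge> 0"
  shows "((\<lambda>\<tau>. f \<tau> \<bullet> h (u \<tau>)) has_integral (H (u t) - H x0)) {0..t}"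
proof -
  have fi: "f integrable_on {0..t}" "(\<lambda>\<tau>. norm (f \<tau>)) integrable_on {0..t}"
    using f by (auto simp: absolutely_integrable_on_def)
  have ueq: "u s = x0 + integral {0..s} f" if "s \<in> {0..t}" for s
    using u[OF that] by (simp add: integral_unique)
  have cu: "continuous_on {0..t} u"
    using ueq by (subst continuous_on_cong[OF refl ueq])
      (auto intro!: continuous_intros indefinite_integral_continuous_1 fi)
  have chu: "continuous_on {0..t} (\<lambda>\<tau>. h (u \<tau>))"
    by (intro continuous_on_compose2[OF h cu]) auto
  have prod: "(\<lambda>\<tau>. h (u \<tau>) \<bullet> f \<tau>) absolutely_integrable_on {0..t}"
  proof (rule absolutely_integrable_bounded_measurable_product[where h = "(\<bullet>)" and f = "\<lambda>\<tau>. h (u \<tau>)", OF _ _ _ _ f])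
    show "bilinear ((\<bullet>) :: 's \<Rightarrow> 's \<Rightarrow> real)" using bounded_bilinear_inner by (simp add: bilinear_conv_bounded_bilinear)
    show "(\<lambda>\<tau>. h (u \<tau>)) \<in> borel_measurable (lebesgue_on {0..t})"
      by (intro continuous_imp_measurable_on_sets_lebesgue chu) auto
    show "bounded ((\<lambda>\<tau>. h (u \<tau>)) ` {0..t})"
      by (intro compact_imp_bounded compact_continuous_image chu) auto
  qed auto
  then have pi: "(\<lambda>\<tau>. f \<tau> \<bullet> h (u \<tau>)) integrable_on {0..t}"
    by (simp add: absolutely_integrable_on_def inner_commute)
  \<comment> \<open>The defect of the chain rule, to be shown to have no increment over
    \<open>{0..t}\<close>.\<close>
  define g where "g = (\<lambda>s. H (u s) - integral {0..s} (\<lambda>\<tau>. f \<tau> \<bullet> h (u \<tau>)))"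
  define N where "N = (\<lambda>s. integral {0..s} (\<lambda>\<tau>. norm (f \<tau>)))"
  have N0: "N 0 = 0" by (simp add: N_def)
  have Nt: "N t \<ge> 0" unfolding N_def by (intro integral_nonneg fi) auto
  have "compact (u ` {0..t})" by (intro compact_continuous_image cu) auto
  then obtain R where R: "\<forall>x\<in>u ` {0..t}. norm x \<le> R"
    using compact_imp_bounded bounded_iff by blast
  have hunif: "uniformly_continuous_on (cball 0 R) h"
    using h by (intro compact_uniformly_continuous) (auto intro: continuous_on_subset)
  have uunif: "uniformly_continuous_on {0..t} u"
    by (intro compact_uniformly_continuous cu) auto
  have bound: "\<bar>g t - g 0\<bar> \<le> 2 * e * N t" if e: "e > 0" for e
  proof -
    obtain \<eta> where \<eta>: "\<eta> > 0" "\<And>x y. x \<in> cball 0 R \<Longrightarrow> y \<in> cball 0 R \<Longrightarrow> dist y x < \<eta> \<Longrightarrow> dist (h y) (h x) < e"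
      using hunif e unfolding uniformly_continuous_on_def by meson
    obtain \<delta> where \<delta>: "\<delta> > 0" "\<And>x y. x \<in> {0..t} \<Longrightarrow> y \<in> {0..t} \<Longrightarrow> dist y x < \<delta> \<Longrightarrow> dist (u y) (u x) < \<eta>"
      using uunif \<eta>(1) unfolding uniformly_continuous_on_def by meson
    have "\<bar>g t - g 0\<bar> \<le> (2 * e) * (N t - N 0)"
    proof (rule abs_diff_le_telescope[OF _ \<delta>(1) t])
      fix a b assume ab: "0 \<le> a" "a \<le> b" "b \<le> t" "b - a < \<delta>"
      have split: "integral {0..b} k - integral {0..a} k = integral {a..b} k"
        if "k integrable_on {0..t}" for k :: "real \<Rightarrow> 'z::euclidean_space"
        using Henstock_Kurzweil_Integration.integral_combine[of 0 a b k] ab that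
        by (auto simp: algebra_simps dest: integrable_on_subinterval[where a=0 and b=b])
      have sub: "k integrable_on {a..b}" if "k integrable_on {0..t}" for k :: "real \<Rightarrow> 'z::euclidean_space"
        using integrable_on_subinterval[OF that, of a b] ab by auto
      have Nab: "N b - N a = integral {a..b} (\<lambda>\<tau>. norm (f \<tau>))"
        unfolding N_def by (rule split[OF fi(2)])
      have uab: "u b - u a = integral {a..b} f"
        using split[OF fi(1)] ab by (simp add: ueq)
      have nuab: "norm (u b - u a) \<le> N b - N a"
        unfolding uab Nab by (intro integral_norm_bound_integral sub fi) auto
      have close: "norm (h (u \<tau>) - h (u a)) \<le> e" if "\<tau> \<in> {a..b}" for \<tau>
        using \<eta>(2)[of "u a" "u \<tau>"] \<delta>(2)[of a \<tau>] that ab R by (force simp: dist_norm)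
      have "\<bar>H (u b) - H (u a) - (u b - u a) \<bullet> h (u a)\<bar> \<le> e * norm (u b - u a)"
      proof (rule gderiv_linearisation[OF H, of "ball (u a) \<eta> \<inter> cball 0 R"])
        show "convex (ball (u a) \<eta> \<inter> cball 0 R)" by (intro convex_Int) auto
        show "u a \<in> ball (u a) \<eta> \<inter> cball 0 R" "u b \<in> ball (u a) \<eta> \<inter> cball 0 R"
          using R ab \<eta>(1) \<delta>(2)[of b a] by (auto simp: dist_real_def)
        show "norm (h z - h (u a)) \<le> e" if "z \<in> ball (u a) \<eta> \<inter> cball 0 R" for z
          using \<eta>(2)[of "u a" z] that R ab by (force simp: dist_norm norm_minus_commute)
      qed
      also have "\<dots> \<le> e * (N b - N a)" using nuab e by simp
      finally have A: "\<bar>H (u b) - H (u a) - (u b - u a) \<bullet> h (u a)\<bar> \<le> e * (N b - N a)" .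
      have "(u b - u a) \<bullet> h (u a) - integral {a..b} (\<lambda>\<tau>. f \<tau> \<bullet> h (u \<tau>))
          = integral {a..b} (\<lambda>\<tau>. f \<tau> \<bullet> h (u a) - f \<tau> \<bullet> h (u \<tau>))"
        unfolding uab using sub[OF fi(1)] sub[OF pi]
        by (subst integral_diff) (auto simp: integral_component_eq_cart intro!: integrable_component
            integral_linear[OF _ bounded_linear_inner_left, unfolded o_def, symmetric]
            integrable_linear[OF _ bounded_linear_inner_left, unfolded o_def])
      also have "norm \<dots> \<le> integral {a..b} (\<lambda>\<tau>. e * norm (f \<tau>))"
      proof (rule integral_norm_bound_integral)
        show "(\<lambda>\<tau>. f \<tau> \<bullet> h (u a) - f \<tau> \<bullet> h (u \<tau>)) integrable_on {a..b}"
          using sub[OF fi(1)] sub[OF pi]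
          by (intro integrable_diff integrable_linear[OF _ bounded_linear_inner_left, unfolded o_def])
        show "(\<lambda>\<tau>. e * norm (f \<tau>)) integrable_on {a..b}"
          by (intro integrable_on_mult_right sub fi)
        fix \<tau> assume "\<tau> \<in> {a..b}"
        have "norm (f \<tau> \<bullet> h (u a) - f \<tau> \<bullet> h (u \<tau>)) \<le> norm (f \<tau>) * norm (h (u \<tau>) - h (u a))"
          using Cauchy_Schwarz_ineq2[of "f \<tau>" "h (u a) - h (u \<tau>)"]
          by (simp flip: inner_diff_right add: norm_minus_commute)
        also have "\<dots> \<le> norm (f \<tau>) * e" by (intro mult_left_mono close norm_ge_zero) fact
        finally show "norm (f \<tau> \<bullet> h (u a) - f \<tau> \<bullet> h (u \<tau>)) \<le> e * norm (f \<tau>)" by (simp add: mult.commute)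
      qed
      also have "\<dots> = e * (N b - N a)" by (simp add: Nab)
      finally have B: "\<bar>(u b - u a) \<bullet> h (u a) - integral {a..b} (\<lambda>\<tau>. f \<tau> \<bullet> h (u \<tau>))\<bar> \<le> e * (N b - N a)"
        by simp
      have "g b - g a = H (u b) - H (u a) - integral {a..b} (\<lambda>\<tau>. f \<tau> \<bullet> h (u \<tau>))"
        unfolding g_def using split[OF pi] by (simp add: algebra_simps)
      then show "\<bar>g b - g a\<bar> \<le> (2 * e) * (N b - N a)" using A B by (simp add: abs_le_iff)
    qed
    then show ?thesis by (simp add: N0)
  qed
  have "\<bar>g t - g 0\<bar> \<le> 0"
  proof (rule field_le_epsilon)
    fix e :: real assume "e > 0"
    then have "\<bar>g t - g 0\<bar> \<le> 2 * (e / (2 * (N t + 1))) * N t" using Nt by (intro bound) simp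
    also have "\<dots> \<le> e" using Nt \<open>e > 0\<close> by (simp add: field_simps)
    finally show "\<bar>g t - g 0\<bar> \<le> 0 + e" by simp
  qed
  then have "integral {0..t} (\<lambda>\<tau>. f \<tau> \<bullet> h (u \<tau>)) = H (u t) - H x0"
    using ueq[of 0] t by (simp add: g_def)
  then show ?thesis using pi by (metis integrable_integral)
qed

subsection \<open>The system of forced oscillators\<close>

lemma gderiv_unique:
  fixes V :: "'a::real_inner \<Rightarrow> real"
  assumes "GDERIV V q :> D" "GDERIV V q :> D'"
  shows "D = D'"
proof -
  have "(\<lambda>h. h \<bullet> D) = (\<lambda>h. h \<bullet> D')"
    using assms unfolding gderiv_def by (rule has_derivative_unique)
  then have "(D - D') \<bullet> D = (D - D') \<bullet> D'" by metis
  then have "(D - D') \<bullet> (D - D') = 0" by (simp add: inner_diff_right)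
  then show ?thesis by simp
qed

lemma gderiv_exists:
  fixes V :: "'a::euclidean_space \<Rightarrow> real"
  assumes "V differentiable (at q)"
  shows "\<exists>D. GDERIV V q :> D"
proof -
  obtain V' where V': "(V has_derivative V') (at q)"
    using assms by (auto simp: differentiable_def)
  have lin: "linear V'" using V' by (rule has_derivative_linear)
  have "V' h = h \<bullet> (\<Sum>b\<in>Basis. V' b *\<^sub>R b)" for h
  proof -
    have "V' h = V' (\<Sum>b\<in>Basis. (h \<bullet> b) *\<^sub>R b)" by (simp add: euclidean_representation)
    also have "\<dots> = (\<Sum>b\<in>Basis. (h \<bullet> b) * V' b)"
      by (simp add: linear_sum[OF lin] linear_scale[OF lin])
    finally show ?thesis by (simp add: inner_sum_right mult.commute)
  qed
  then show ?thesis using V' by (auto simp: gderiv_def intro!: exI[of _ "\<Sum>b\<in>Basis. V' b *\<^sub>R b"]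
        elim!: has_derivative_eq_rhs)
qed

lemma gderiv_grad:
  assumes "V differentiable (at q)"
  shows "GDERIV V q :> grad V q"
  unfolding grad_def using gderiv_exists[OF assms] gderiv_unique by (metis theI)

definition drift :: "(('n::{finite,linorder}) config \<Rightarrow> real) \<Rightarrow> real \<Rightarrow> real \<Rightarrow> 'n state \<Rightarrow> 'n state" where
  "drift V \<gamma>1 \<gamma>n u = (- grad V (snd u) + boundary_force \<gamma>1 \<gamma>n (fst u) 0, fst u)"

definition forcing_input :: "real \<times> real \<Rightarrow> ('n::{finite,linorder}) state" where
  "forcing_input z = (fst z *\<^sub>R axis first_ix 1 + snd z *\<^sub>R axis last_ix 1, 0)"

definition primitive :: "(real \<Rightarrow> real \<times> real) \<Rightarrow> real \<Rightarrow> ('n::{finite,linorder}) state" where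
  "primitive z s = integral {0..s} (\<lambda>\<tau>. forcing_input (z \<tau>))"

lemma boundary_force_split:
  "boundary_force \<gamma>1 \<gamma>n p z = boundary_force \<gamma>1 \<gamma>n p 0 + fst (forcing_input z)"
  by (simp add: boundary_force_def forcing_input_def algebra_simps)

lemma linear_boundary_force: "linear (\<lambda>p. boundary_force \<gamma>1 \<gamma>n p 0)"
  by (rule linearI) (simp_all add: boundary_force_def algebra_simps)

lemma linear_forcing_input: "linear forcing_input"
  by (rule linearI) (simp_all add: forcing_input_def algebra_simps)

lemma norm_forcing_input: "norm (forcing_input z :: ('n::{finite,linorder}) state) \<le> 2 * norm z"
proof -
  have "norm (forcing_input z :: 'n state) \<le> \<bar>fst z\<bar> + \<bar>snd z\<bar>"
    by (simp add: forcing_input_def norm_Pair order_trans[OF norm_triangle_ineq])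
  also have "\<dots> \<le> 2 * norm z"
    using norm_fst_le[of "fst z" "snd z"] norm_snd_le[of "snd z" "fst z"] by simp
  finally show ?thesis .
qed

lemma square_integrable_on_iff:
  assumes "S \<in> sets lebesgue"
  shows "square_integrable_on z S \<longleftrightarrow> (\<lambda>s. indicator S s *\<^sub>R z s) \<in> borel_measurable lebesgue
    \<and> integrable lebesgue (\<lambda>s. indicator S s *\<^sub>R (norm (z s))\<^sup>2)"
  using assms by (simp add: square_integrable_on_def borel_measurable_restrict_space_iff integrable_restrict_space)

lemma square_integrable_on_subset:
  assumes "square_integrable_on z S" "T \<subseteq> S" "T \<in> sets lebesgue" "S \<in> sets lebesgue"
  shows "square_integrable_on z T"
proof -
  have "(\<lambda>s. indicator S s *\<^sub>R z s) \<in> borel_measurable lebesgue"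
    using conjunct1[OF iffD1[OF square_integrable_on_iff[OF assms(4)] assms(1)]] .
  then have "(\<lambda>s. indicator T s *\<^sub>R (indicator S s *\<^sub>R z s)) \<in> borel_measurable lebesgue"
    by (rule borel_measurable_scaleR[OF borel_measurable_indicator[OF assms(3)]])
  moreover have "integrable lebesgue (\<lambda>s. indicator T s *\<^sub>R (indicator S s *\<^sub>R (norm (z s))\<^sup>2))"
    using conjunct2[OF iffD1[OF square_integrable_on_iff[OF assms(4)] assms(1)]]
    by (rule integrable_mult_indicator[OF assms(3)])
  moreover have eq: "indicator T s *\<^sub>R (indicator S s *\<^sub>R x) = indicator T s *\<^sub>R x"
    for s and x :: "'z::real_vector"
    using assms(2) by (auto simp: indicator_def)
  ultimately show ?thesis unfolding square_integrable_on_iff[OF assms(3)] eq by blast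
qed

text \<open>Segments are classes on \<open>{0..<1}\<close>, whereas the integral equations use
  \<open>{0..1}\<close>; the endpoint is a null set.\<close>

lemma square_integrable_on_closed_unit_iff:
  "square_integrable_on z {0..1} \<longleftrightarrow> square_integrable_on z {0..<1}"
proof
  assume "square_integrable_on z {0..1}"
  then show "square_integrable_on z {0..<1}" by (rule square_integrable_on_subset) auto
next
  assume z: "square_integrable_on z {0..<1}"
  have ae: "AE s in lebesgue. s \<noteq> (1::real)"
    using AE_lborel_singleton by (rule AE_completion)
  have eq: "indicator {0..1} s *\<^sub>R x = indicator {0..<1} s *\<^sub>R x + indicator {1} s *\<^sub>R x"
    for s :: real and x :: "'z::real_vector"
    by (auto simp: indicator_def)
  have "(\<lambda>s. indicator {1} s *\<^sub>R z s) = (\<lambda>s. indicator {1} s *\<^sub>R z 1)"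
    by (auto simp: indicator_def)
  moreover have "(\<lambda>s. indicator {1} s *\<^sub>R z 1) \<in> borel_measurable lebesgue"
    by (rule borel_measurable_scaleR[OF borel_measurable_indicator]) auto
  ultimately have "(\<lambda>s. indicator {1} s *\<^sub>R z s) \<in> borel_measurable lebesgue" by simp
  moreover have "(\<lambda>s. indicator {0..<1} s *\<^sub>R z s) \<in> borel_measurable lebesgue"
    using z square_integrable_on_iff[of "{0..<1}" z] by auto
  ultimately have 1: "(\<lambda>s. indicator {0..1} s *\<^sub>R z s) \<in> borel_measurable lebesgue"
    unfolding eq by (intro borel_measurable_add)
  have "(\<lambda>s. indicator {1} s *\<^sub>R (norm (z s))\<^sup>2) = (\<lambda>s. indicator {1} s *\<^sub>R (norm (z 1))\<^sup>2)"
    by (auto simp: indicator_def)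
  then have "integrable lebesgue (\<lambda>s. indicator {1} s *\<^sub>R (norm (z s))\<^sup>2)"
    by simp
  then have "integrable lebesgue (\<lambda>s. indicator {0..1} s *\<^sub>R (norm (z s))\<^sup>2)"
    unfolding eq using z by (intro Bochner_Integration.integrable_add) (auto simp: square_integrable_on_iff)
  with 1 show "square_integrable_on z {0..1}" by (simp add: square_integrable_on_iff)
qed

lemma square_integrable_imp:
  assumes "square_integrable_on z {a..b}"
  shows "z absolutely_integrable_on {a..b}" "(\<lambda>s. (norm (z s))\<^sup>2) absolutely_integrable_on {a..b}"
proof -
  show 2: "(\<lambda>s. (norm (z s))\<^sup>2) absolutely_integrable_on {a..b}"
    using assms by (simp add: square_integrable_on_def absolutely_integrable_measurable
      integrable_restrict_space set_integrable_def)
  show "z absolutely_integrable_on {a..b}"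
  proof (rule measurable_bounded_by_integrable_imp_absolutely_integrable)
    show "z \<in> borel_measurable (lebesgue_on {a..b})" using assms by (simp add: square_integrable_on_def)
    show "(\<lambda>s. 1 + (norm (z s))\<^sup>2) integrable_on {a..b}"
      using 2 by (intro integrable_add integrable_const_ivl) (auto simp: absolutely_integrable_on_def)
    fix s
    have "0 \<le> (norm (z s) - 1)\<^sup>2 + norm (z s)" by simp
    then show "norm (z s) \<le> 1 + (norm (z s))\<^sup>2" by (simp add: power2_eq_square algebra_simps)
  qed auto
qed

lemma forcing_input_integrable:
  assumes "square_integrable_on z {0..t}"
  shows "(\<lambda>s. forcing_input (z s) :: ('n::{finite,linorder}) state) absolutely_integrable_on {0..t}"
  using absolutely_integrable_linear[OF square_integrable_imp(1)[OF assms], of forcing_input]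
    linear_forcing_input by (simp add: o_def linear_conv_bounded_linear)

lemma continuous_on_primitive:
  assumes "square_integrable_on z {0..t}"
  shows "continuous_on {0..t} (primitive z :: real \<Rightarrow> ('n::{finite,linorder}) state)"
  unfolding primitive_def
  using forcing_input_integrable[OF assms]
  by (intro indefinite_integral_continuous_1) (auto simp: absolutely_integrable_on_def)

lemma primitive_0 [simp]: "primitive z 0 = 0"
  by (simp add: primitive_def)

lemma norm_primitive_diff_le:
  assumes z: "square_integrable_on z {0..1}" and z': "square_integrable_on z' {0..1}" and s: "s \<in> {0..1}"
  shows "norm (primitive z s - primitive z' s :: ('n::{finite,linorder}) state)
    \<le> 2 * sqrt (integral {0..1} (\<lambda>s. (norm (z s - z' s))\<^sup>2))"
proof -
  define d where "d = (\<lambda>s. z s - z' s)"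
  have d: "square_integrable_on d {0..1}"
    using square_integrable_on_add[OF z square_integrable_on_scaleR[OF z', of "-1"]] by (simp add: d_def)
  have lin: "forcing_input (z s) - forcing_input (z' s) = (forcing_input (d s) :: 'n state)" for s
    by (simp add: d_def linear_diff[OF linear_forcing_input])
  have int: "(\<lambda>s. norm (d s)) integrable_on {0..1}" "(\<lambda>s. (norm (d s))\<^sup>2) integrable_on {0..1}"
    using square_integrable_imp[OF d] by (auto simp: absolutely_integrable_on_def)
  define I where "I = integral {0..1} (\<lambda>s. (norm (d s))\<^sup>2)"
  have I: "I \<ge> 0" unfolding I_def by (intro integral_nonneg int) auto
  have "primitive z s - primitive z' s = integral {0..s} (\<lambda>\<tau>. forcing_input (d \<tau>) :: 'n state)"
  proof -
    have "square_integrable_on z {0..s}" "square_integrable_on z' {0..s}"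
      using z z' s by (auto intro: square_integrable_on_subset)
    then show ?thesis
      unfolding primitive_def
      using forcing_input_integrable[where 'n='n] lin
      by (subst integral_diff[symmetric]) (auto simp: absolutely_integrable_on_def)
  qed
  also have "norm \<dots> \<le> integral {0..s} (\<lambda>\<tau>. 2 * norm (d \<tau>))"
  proof (rule integral_norm_bound_integral)
    have "square_integrable_on d {0..s}" using d s by (auto intro: square_integrable_on_subset)
    then show "(\<lambda>\<tau>. forcing_input (d \<tau>) :: 'n state) integrable_on {0..s}"
      by (metis forcing_input_integrable absolutely_integrable_on_def)
    show "(\<lambda>\<tau>. 2 * norm (d \<tau>)) integrable_on {0..s}"
      using s by (intro integrable_on_mult_right integrable_on_subinterval[OF int(1)]) auto
  qed (rule norm_forcing_input)
  also have "\<dots> \<le> 2 * integral {0..1} (\<lambda>\<tau>. norm (d \<tau>))"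
    using s by (auto intro!: integral_subset_le int integrable_on_subinterval[OF int(1)])
  also have "\<dots> \<le> 2 * sqrt I"
  proof (rule mult_left_mono)
    show "integral {0..1} (\<lambda>\<tau>. norm (d \<tau>)) \<le> sqrt I"
    proof (rule field_le_epsilon)
      fix e :: real assume e: "e > 0"
      \<comment> \<open>Cauchy-Schwarz by way of \<open>x \<le> m / 2 + x\<^sup>2 / (2 * m)\<close>;
        the summand \<open>e\<close> keeps \<open>m\<close> positive when
        \<open>I = 0\<close>.\<close>
      define m where "m = sqrt I + e"
      have m: "m > 0" "I \<le> m\<^sup>2"
        using e I by (auto simp: m_def power2_sum add_nonneg_pos)
      have "integral {0..1} (\<lambda>\<tau>. norm (d \<tau>)) \<le> integral {0..1} (\<lambda>\<tau>. m / 2 + (norm (d \<tau>))\<^sup>2 * (1 / (2 * m)))"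
      proof (rule integral_le[OF int(1)])
        show "(\<lambda>\<tau>. m / 2 + (norm (d \<tau>))\<^sup>2 * (1 / (2 * m))) integrable_on {0..1}"
          by (intro integrable_add integrable_const_ivl integrable_on_mult_left int)
        fix \<tau>
        have "0 \<le> (norm (d \<tau>) - m)\<^sup>2 / (2 * m)" using m by simp
        also have "\<dots> = m / 2 + (norm (d \<tau>))\<^sup>2 * (1 / (2 * m)) - norm (d \<tau>)"
          using m by (simp add: power2_eq_square field_simps)
        finally show "norm (d \<tau>) \<le> m / 2 + (norm (d \<tau>))\<^sup>2 * (1 / (2 * m))" by simp
      qed
      also have "\<dots> = m / 2 + I * (1 / (2 * m))"
        unfolding I_def by (subst integral_add) (auto intro!: integrable_on_divide int)
      also have "\<dots> \<le> m / 2 + m\<^sup>2 * (1 / (2 * m))"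
        using m by (intro add_left_mono mult_right_mono) auto
      also have "\<dots> = m" using m by (simp add: power2_eq_square)
      finally show "integral {0..1} (\<lambda>\<tau>. norm (d \<tau>)) \<le> sqrt I + e" by (simp add: m_def)
    qed
  qed simp
  finally show ?thesis by (simp add: I_def d_def)
qed

locale oscillators =
  fixes V :: "('n::{finite,linorder}) config \<Rightarrow> real" and \<gamma>1 \<gamma>n :: real
  assumes V_C2: "twice_continuously_differentiable V"
    and V_coercive: "filterlim V at_top at_infinity"
    and gamma_pos: "\<gamma>1 > 0" "\<gamma>n > 0"
begin

lemma gderiv_V: "GDERIV V q :> grad V q"
  using V_C2 by (intro gderiv_grad) (simp add: twice_continuously_differentiable_def)

lemma has_derivative_grad: "(grad V has_derivative (*v) (hessian V q)) (at q)"
proof -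
  have "(grad V has_derivative frechet_derivative (grad V) (at q)) (at q)"
    using V_C2 by (simp add: twice_continuously_differentiable_def flip: frechet_derivative_works)
  moreover have "(*v) (hessian V q) = frechet_derivative (grad V) (at q)"
    unfolding hessian_def using has_derivative_linear[OF calculation] by (auto simp: matrix_works)
  ultimately show ?thesis by simp
qed

lemma continuous_on_V: "continuous_on A V"
  by (intro continuous_at_imp_continuous_on ballI has_derivative_continuous[OF gderiv_V[unfolded gderiv_def]])

lemma continuous_on_grad: "continuous_on A (grad V)"
  by (intro continuous_at_imp_continuous_on ballI has_derivative_continuous[OF has_derivative_grad])

lemma continuous_on_hessian: "continuous_on A (hessian V)"
  using V_C2 by (auto simp: twice_continuously_differentiable_def intro: continuous_on_subset)

lemma grad_linearisation:
  assumes "convex A" "x \<in> A" "y \<in> A"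
    and "\<And>z. z \<in> A \<Longrightarrow> (\<Sum>i\<in>UNIV. \<Sum>j\<in>UNIV. \<bar>(hessian V z - H) $ i $ j\<bar>) \<le> e"
  shows "norm (grad V x - grad V y - H *v (x - y)) \<le> e * norm (x - y)"
proof -
  have "norm ((\<lambda>z. grad V z - H *v z) x - (\<lambda>z. grad V z - H *v z) y) \<le> e * norm (x - y)"
  proof (rule differentiable_bound[OF assms(1) _ _ assms(2,3), where f' = "\<lambda>z v. (hessian V z - H) *v v"])
    fix z assume z: "z \<in> A"
    show "((\<lambda>z. grad V z - H *v z) has_derivative (\<lambda>v. (hessian V z - H) *v v)) (at z within A)"
      unfolding matrix_vector_mult_diff_rdistrib
      by (rule has_derivative_at_withinI)
         (intro has_derivative_diff has_derivative_grad
          bounded_linear_imp_has_derivative matrix_vector_mul_bounded_linear)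
    show "onorm (\<lambda>v. (hessian V z - H) *v v) \<le> e"
      using onorm_le_matrix_component_sum assms(4)[OF z] by (rule order_trans)
  qed
  then show ?thesis by (simp add: matrix_vector_mult_diff_distrib algebra_simps)
qed

lemma lipschitz_drift: "\<exists>L. L-lipschitz_on (cball 0 R) (drift V \<gamma>1 \<gamma>n)"
proof -
  have "compact ((\<lambda>z. \<Sum>i\<in>UNIV. \<Sum>j\<in>UNIV. \<bar>(hessian V z - 0) $ i $ j\<bar>) ` cball 0 R)"
    by (intro compact_continuous_image continuous_intros continuous_on_hessian) auto
  from compact_imp_bounded[OF this]
  obtain B where B: "\<And>z. z \<in> cball 0 R \<Longrightarrow> (\<Sum>i\<in>UNIV. \<Sum>j\<in>UNIV. \<bar>(hessian V z - 0) $ i $ j\<bar>) \<le> B"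
    unfolding bounded_iff real_norm_def by (blast intro: order_trans[OF abs_ge_self])
  define B' where "B' = max 0 B"
  obtain C where C: "\<And>p. norm (boundary_force \<gamma>1 \<gamma>n p 0 :: 'n config) \<le> C * norm p" "C > 0"
    using linear_bounded_pos[OF linear_boundary_force] by blast
  have "(B' + C + 1)-lipschitz_on (cball 0 R) (drift V \<gamma>1 \<gamma>n)"
  proof (rule lipschitz_onI)
    show "0 \<le> B' + C + 1" using C(2) by (simp add: B'_def)
    fix u v :: "'n state" assume uv: "u \<in> cball 0 R" "v \<in> cball 0 R"
    obtain p q p' q' where [simp]: "u = (p, q)" "v = (p', q')" by (metis prod.exhaust)
    have "norm q \<le> R" "norm q' \<le> R"
      using uv norm_snd_le[of q p] norm_snd_le[of q' p'] by auto
    then have "norm (grad V q - grad V q' - 0 *v (q - q')) \<le> B' * norm (q - q')"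
      by (intro grad_linearisation[where A = "cball 0 R"]) (auto simp: B'_def intro!: max.coboundedI2 B[simplified])
    then have g: "norm (grad V q' - grad V q) \<le> B' * norm (q - q')"
      by (simp add: norm_minus_commute)
    have b: "norm (boundary_force \<gamma>1 \<gamma>n p 0 - boundary_force \<gamma>1 \<gamma>n p' 0 :: 'n config) \<le> C * norm (p - p')"
      using C(1)[of "p - p'"] by (simp add: linear_diff[OF linear_boundary_force])
    have n: "norm (q - q') \<le> norm (u - v)" "norm (p - p') \<le> norm (u - v)"
      using norm_snd_le[of "q - q'" "p - p'"] norm_fst_le[of "p - p'" "q - q'"] by auto
    have "dist (drift V \<gamma>1 \<gamma>n u) (drift V \<gamma>1 \<gamma>n v)
        = norm ((grad V q' - grad V q) + (boundary_force \<gamma>1 \<gamma>n p 0 - boundary_force \<gamma>1 \<gamma>n p' 0), p - p')"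
      by (simp add: dist_norm drift_def algebra_simps)
    also have "\<dots> \<le> norm ((grad V q' - grad V q) + (boundary_force \<gamma>1 \<gamma>n p 0 - boundary_force \<gamma>1 \<gamma>n p' 0)) + norm (p - p')"
      by (rule norm_Pair_le)
    also have "\<dots> \<le> B' * norm (q - q') + C * norm (p - p') + norm (p - p')"
      using g b by (intro add_mono order_trans[OF norm_triangle_ineq]) auto
    also have "\<dots> \<le> B' * norm (u - v) + C * norm (u - v) + norm (u - v)"
      using n C(2) by (intro add_mono mult_left_mono) (auto simp: B'_def)
    finally show "dist (drift V \<gamma>1 \<gamma>n u) (drift V \<gamma>1 \<gamma>n v) \<le> (B' + C + 1) * dist u v"
      by (simp add: dist_norm algebra_simps)
  qed
  then show ?thesis by blast
qed

lemma continuous_on_drift: "continuous_on A (drift V \<gamma>1 \<gamma>n)"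
proof -
  have "continuous_on UNIV (\<lambda>p. boundary_force \<gamma>1 \<gamma>n p 0 :: 'n config)"
    by (intro linear_continuous_on) (simp flip: linear_conv_bounded_linear add: linear_boundary_force)
  then have "continuous_on A (\<lambda>u. boundary_force \<gamma>1 \<gamma>n (fst u) 0 :: 'n config)"
    by (rule continuous_on_compose2) (auto intro: continuous_intros)
  moreover have "continuous_on A (\<lambda>u :: 'n state. grad V (snd u))"
    by (rule continuous_on_compose2[OF continuous_on_grad[of UNIV]]) (auto intro: continuous_intros)
  ultimately show ?thesis
    unfolding drift_def by (intro continuous_intros)
qed

lemma solves_iff_mild:
  assumes z: "square_integrable_on z {0..t}"
  shows "solves V \<gamma>1 \<gamma>n z t x0 u \<longleftrightarrow> mild (drift V \<gamma>1 \<gamma>n) (\<lambda>s. x0 + primitive z s) t u"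
proof -
  have eq: "(- grad V (snd w) + boundary_force \<gamma>1 \<gamma>n (fst w) y, fst w) = drift V \<gamma>1 \<gamma>n w + forcing_input y"
    for w and y
    by (simp add: drift_def boundary_force_split[of _ _ _ y] forcing_input_def)
  have "((\<lambda>\<tau>. drift V \<gamma>1 \<gamma>n (u \<tau>) + forcing_input (z \<tau>)) has_integral (u s - x0)) {0..s} \<longleftrightarrow>
      u s = x0 + primitive z s + integral {0..s} (\<lambda>\<tau>. drift V \<gamma>1 \<gamma>n (u \<tau>))"
    if u: "continuous_on {0..t} u" and s: "s \<in> {0..t}" for s
  proof -
    have 1: "(\<lambda>\<tau>. drift V \<gamma>1 \<gamma>n (u \<tau>)) integrable_on {0..s}"
      using s u by (intro integrable_continuous_interval continuous_on_compose2[OF continuous_on_drift])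
        (auto intro: continuous_on_subset)
    have "square_integrable_on z {0..s}" using z s by (auto intro: square_integrable_on_subset)
    then have 2: "(\<lambda>\<tau>. forcing_input (z \<tau>) :: 'n state) integrable_on {0..s}"
      by (metis forcing_input_integrable absolutely_integrable_on_def)
    have "integral {0..s} (\<lambda>\<tau>. drift V \<gamma>1 \<gamma>n (u \<tau>) + forcing_input (z \<tau>))
        = integral {0..s} (\<lambda>\<tau>. drift V \<gamma>1 \<gamma>n (u \<tau>)) + primitive z s"
      unfolding primitive_def by (rule integral_add[OF 1 2])
    then show ?thesis
      using integrable_add[OF 1 2] by (auto simp: has_integral_iff algebra_simps)
  qed
  then show ?thesis
    unfolding solves_def mild_def eq by blast
qed

end

text \<open>Reduces square integrability on compact intervals to two gauge integrals, for which the
  rules for shifting and joining intervals apply.\<close>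

lemma square_integrable_on_Icc_iff:
  "square_integrable_on z {a..b} \<longleftrightarrow> z integrable_on {a..b} \<and> (\<lambda>s. (norm (z s))\<^sup>2) integrable_on {a..b}"
proof
  assume "square_integrable_on z {a..b}"
  then show "z integrable_on {a..b} \<and> (\<lambda>s. (norm (z s))\<^sup>2) integrable_on {a..b}"
    using square_integrable_imp by (auto simp: absolutely_integrable_on_def)
next
  assume z: "z integrable_on {a..b} \<and> (\<lambda>s. (norm (z s))\<^sup>2) integrable_on {a..b}"
  then have "(\<lambda>s. (norm (z s))\<^sup>2) absolutely_integrable_on {a..b}"
    by (intro nonnegative_absolutely_integrable_1) auto
  then show "square_integrable_on z {a..b}"
    using z integrable_imp_measurable[of z "{a..b}"]
    by (simp add: square_integrable_on_def set_integrable_def integrable_restrict_space)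
qed

lemma square_integrable_on_shift:
  assumes "square_integrable_on z {a + c..b + c}"
  shows "square_integrable_on (\<lambda>s. z (s + c)) {a..b}"
  using assms has_integral_shift_Icc_real[of z c _ a b] has_integral_shift_Icc_real[of "\<lambda>s. (norm (z s))\<^sup>2" c _ a b]
  by (auto simp: square_integrable_on_Icc_iff integrable_on_def o_def add.commute)

lemma primitive_cong:
  assumes "negligible N" "\<And>\<tau>. \<tau> \<in> {0..t} - N \<Longrightarrow> z \<tau> = z' \<tau>" "s \<le> t"
  shows "primitive z s = primitive z' s"
  unfolding primitive_def using assms by (intro integral_spike[of N]) auto

section \<open>Energy balance, a priori bounds and the global flow\<close>

context oscillators begin

definition energy_function :: "'n state \<Rightarrow> real" where
  "energy_function u = (norm (fst u))\<^sup>2 / 2 + V (snd u)"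

lemma gderiv_energy_function: "GDERIV energy_function u :> (fst u, grad V (snd u))"
proof -
  have "energy_function = (\<lambda>u. (fst u \<bullet> fst u) / 2 + V (snd u))"
    by (simp add: energy_function_def fun_eq_iff power2_norm_eq_inner)
  moreover have "((\<lambda>u. V (snd u)) has_derivative (\<lambda>v. snd v \<bullet> grad V (snd u))) (at u)"
    using has_derivative_compose[OF has_derivative_snd[OF has_derivative_ident] gderiv_V[unfolded gderiv_def], of u] .
  ultimately show ?thesis
    unfolding gderiv_def
    by (auto intro!: derivative_eq_intros simp: inner_prod_def inner_commute)
qed

text \<open>The gradient terms of the two components cancel. Completing the square, friction bounds
  the work of the forcing at each end:
  \<open>(- g * a + y) * a \<le> y\<^sup>2 / (4 * g)\<close>.\<close>

lemma power_dissipation: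
  "(- grad V q + boundary_force \<gamma>1 \<gamma>n p z, p) \<bullet> (p, grad V q) \<le> (1 / (4 * \<gamma>1) + 1 / (4 * \<gamma>n)) * (norm z)\<^sup>2"
proof -
  have sq: "(- g * a + y) * a \<le> y\<^sup>2 * (1 / (4 * g))" if "g > 0" for g a y :: real
  proof -
    have "0 \<le> (2 * g * a - y)\<^sup>2 * (1 / (4 * g))" using that by simp
    also have "\<dots> = y\<^sup>2 * (1 / (4 * g)) - (- g * a + y) * a"
      using that by (simp add: power2_eq_square field_simps)
    finally show ?thesis by simp
  qed
  have le: "(fst z)\<^sup>2 \<le> (norm z)\<^sup>2" "(snd z)\<^sup>2 \<le> (norm z)\<^sup>2"
    by (simp_all add: norm_prod_def)
  have "(- grad V q + boundary_force \<gamma>1 \<gamma>n p z, p) \<bullet> (p, grad V q) = boundary_force \<gamma>1 \<gamma>n p z \<bullet> p"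
    by (simp add: inner_prod_def inner_add_left inner_diff_left inner_diff_right inner_commute)
  also have "\<dots> = (- \<gamma>1 * p $ first_ix + fst z) * p $ first_ix + (- \<gamma>n * p $ last_ix + snd z) * p $ last_ix"
    by (simp add: boundary_force_def inner_add_left inner_axis')
  also have "\<dots> \<le> (fst z)\<^sup>2 * (1 / (4 * \<gamma>1)) + (snd z)\<^sup>2 * (1 / (4 * \<gamma>n))"
    by (intro add_mono sq gamma_pos)
  also have "\<dots> \<le> (norm z)\<^sup>2 * (1 / (4 * \<gamma>1)) + (norm z)\<^sup>2 * (1 / (4 * \<gamma>n))"
    using gamma_pos by (intro add_mono mult_right_mono le) auto
  finally show ?thesis by (simp add: algebra_simps)
qed

lemma energy_estimate:
  assumes z: "square_integrable_on z {0..t}" and t: "t \<ge> 0" and u: "solves V \<gamma>1 \<gamma>n z t x0 u"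
  shows "energy_function (u t) \<le> energy_function x0
    + (1 / (4 * \<gamma>1) + 1 / (4 * \<gamma>n)) * integral {0..t} (\<lambda>s. (norm (z s))\<^sup>2)"
proof -
  define f where "f = (\<lambda>\<tau>. (- grad V (snd (u \<tau>)) + boundary_force \<gamma>1 \<gamma>n (fst (u \<tau>)) (z \<tau>), fst (u \<tau>)))"
  have f_eq: "f = (\<lambda>\<tau>. drift V \<gamma>1 \<gamma>n (u \<tau>) + forcing_input (z \<tau>))"
    unfolding f_def by (simp add: fun_eq_iff drift_def boundary_force_split[of \<gamma>1 \<gamma>n _ "z _"] forcing_input_def)
  have "continuous_on {0..t} (\<lambda>\<tau>. drift V \<gamma>1 \<gamma>n (u \<tau>))"
    using u by (intro continuous_on_compose2[OF continuous_on_drift]) (auto simp: solves_def)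
  then have fa: "f absolutely_integrable_on {0..t}"
    unfolding f_eq using forcing_input_integrable[OF z]
    by (intro set_integral_add(1)) (auto intro: absolutely_integrable_continuous_real)
  have hu: "((\<lambda>\<tau>. f \<tau> \<bullet> (fst (u \<tau>), grad V (snd (u \<tau>)))) has_integral
      (energy_function (u t) - energy_function x0)) {0..t}"
  proof (rule has_integral_chain_rule[OF fa _ gderiv_energy_function _ t])
    show "(f has_integral u s - x0) {0..s}" if "s \<in> {0..t}" for s
      using u that by (simp add: solves_def f_def)
    have "continuous_on UNIV (\<lambda>u :: 'n state. grad V (snd u))"
      by (rule continuous_on_compose2[OF continuous_on_grad[of UNIV]]) (auto intro: continuous_intros)
    then show "continuous_on UNIV (\<lambda>u :: 'n state. (fst u, grad V (snd u)))" by (intro continuous_intros)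
  qed
  have "((\<lambda>s. (norm (z s))\<^sup>2) has_integral integral {0..t} (\<lambda>s. (norm (z s))\<^sup>2)) {0..t}"
    using z by (auto simp: square_integrable_on_Icc_iff intro: integrable_integral)
  from has_integral_mult_right[OF this]
  have "((\<lambda>s. (1 / (4 * \<gamma>1) + 1 / (4 * \<gamma>n)) * (norm (z s))\<^sup>2) has_integral
      (1 / (4 * \<gamma>1) + 1 / (4 * \<gamma>n)) * integral {0..t} (\<lambda>s. (norm (z s))\<^sup>2)) {0..t}" .
  from has_integral_le[OF hu this] power_dissipation show ?thesis
    by (simp add: f_def)
qed

lemma coercive_bounded: "\<exists>R. \<forall>q. V q \<le> h \<longrightarrow> norm q \<le> R"
proof -
  have "eventually (\<lambda>q. V q > h) at_infinity"
    using V_coercive by (simp add: filterlim_at_top_dense)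
  then obtain R where "\<And>q. norm q \<ge> R \<Longrightarrow> V q > h" by (auto simp: eventually_at_infinity)
  then show ?thesis by (meson linorder_not_le nle_le)
qed

lemma V_bounded_below: "\<exists>m. \<forall>q. m \<le> V q"
proof -
  obtain R where R: "\<And>q. V q \<le> 0 \<Longrightarrow> norm q \<le> R" using coercive_bounded by blast
  have "bounded (V ` cball 0 R)"
    by (intro compact_imp_bounded compact_continuous_image continuous_on_V) auto
  then obtain B where B: "\<forall>x\<in>V ` cball 0 R. \<bar>x\<bar> \<le> B" by (auto simp: bounded_iff)
  have "- \<bar>B\<bar> \<le> V q" for q
  proof (cases "V q \<le> 0")
    case True
    then have "q \<in> cball 0 R" using R by simp
    then have "\<bar>V q\<bar> \<le> B" using B by blast
    then show ?thesis by linarith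
  qed simp
  then show ?thesis by blast
qed

text \<open>The energy can grow only through the forcing, so time enters the bound only through
  \<open>E\<close>. With \<open>E = 0\<close> it is uniform over all times, as the unforced flow
  requires later.\<close>

lemma apriori_bound:
  "\<exists>R. \<forall>t z x0 u. t \<ge> 0 \<longrightarrow> square_integrable_on z {0..t} \<longrightarrow> solves V \<gamma>1 \<gamma>n z t x0 u \<longrightarrow>
    norm x0 \<le> r \<longrightarrow> integral {0..t} (\<lambda>s. (norm (z s))\<^sup>2) \<le> E \<longrightarrow> norm (u t) < R"
proof -
  have "continuous_on (cball 0 r) energy_function"
    by (intro continuous_at_imp_continuous_on ballI
        has_derivative_continuous[OF gderiv_energy_function[unfolded gderiv_def]])
  then have "bounded (energy_function ` cball 0 r)"
    by (intro compact_imp_bounded compact_continuous_image) auto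
  then obtain B where B: "\<forall>x\<in>energy_function ` cball 0 r. \<bar>x\<bar> \<le> B" by (auto simp: bounded_iff)
  define c where "c = 1 / (4 * \<gamma>1) + 1 / (4 * \<gamma>n)"
  have c: "c \<ge> 0" using gamma_pos by (simp add: c_def)
  obtain m where m: "\<And>q. m \<le> V q" using V_bounded_below by blast
  define h where "h = B + c * E"
  obtain R where R: "\<And>q. V q \<le> h \<Longrightarrow> norm q \<le> R" using coercive_bounded by blast
  have "norm (u t) < sqrt (2 * (h - m)) + R + 1"
    if t: "t \<ge> 0" and z: "square_integrable_on z {0..t}" and u: "solves V \<gamma>1 \<gamma>n z t x0 u"
      and x0: "norm x0 \<le> r" and E: "integral {0..t} (\<lambda>s. (norm (z s))\<^sup>2) \<le> E" for t z x0 u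
  proof -
    have "energy_function (u t) \<le> energy_function x0 + c * integral {0..t} (\<lambda>s. (norm (z s))\<^sup>2)"
      using energy_estimate[OF z t u] by (simp add: c_def)
    also have "\<dots> \<le> B + c * E"
      using B x0 by (intro add_mono mult_left_mono E c) force
    finally have le: "(norm (fst (u t)))\<^sup>2 / 2 + V (snd (u t)) \<le> h"
      by (simp add: energy_function_def h_def)
    then have "norm (snd (u t)) \<le> R" by (intro R) (smt (verit) zero_le_power2 divide_nonneg_pos)
    moreover have "norm (fst (u t)) \<le> sqrt (2 * (h - m))"
      using le m[of "snd (u t)"] by (intro real_le_rsqrt) simp
    moreover have "norm (u t) \<le> norm (fst (u t)) + norm (snd (u t))"
      using norm_Pair_le[of "fst (u t)" "snd (u t)"] by simp
    ultimately show ?thesis by simp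
  qed
  then show ?thesis by blast
qed

lemma solves_subset: "solves V \<gamma>1 \<gamma>n z t x0 u \<Longrightarrow> s \<le> t \<Longrightarrow> solves V \<gamma>1 \<gamma>n z s x0 u"
  unfolding solves_def by (auto elim: continuous_on_subset)

lemma solves_unique:
  assumes z: "square_integrable_on z {0..t}"
    and "solves V \<gamma>1 \<gamma>n z t x0 u" "solves V \<gamma>1 \<gamma>n z t x0 v" "s \<in> {0..t}"
  shows "u s = v s"
  using assms(2-4) lipschitz_drift unfolding solves_iff_mild[OF z] by (intro mild_unique)

lemma solves_exists:
  assumes z: "square_integrable_on z {0..t}" and t: "t \<ge> 0"
  shows "\<exists>u. solves V \<gamma>1 \<gamma>n z t x0 u"
proof -
  define E where "E = integral {0..t} (\<lambda>s. (norm (z s))\<^sup>2)"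
  obtain R where R: "\<And>s u. s \<ge> 0 \<Longrightarrow> square_integrable_on z {0..s} \<Longrightarrow> solves V \<gamma>1 \<gamma>n z s x0 u \<Longrightarrow>
    integral {0..s} (\<lambda>s. (norm (z s))\<^sup>2) \<le> E \<Longrightarrow> norm (u s) < R"
    using apriori_bound[of "norm x0" E] by blast
  obtain L where L: "L-lipschitz_on (cball 0 R) (drift V \<gamma>1 \<gamma>n)" using lipschitz_drift by blast
  have "\<exists>u. mild (drift V \<gamma>1 \<gamma>n) (\<lambda>s. x0 + primitive z s) t u"
  proof (rule mild_exists[OF L _ t])
    show "continuous_on {0..t} (\<lambda>s. x0 + primitive z s)"
      by (intro continuous_intros continuous_on_primitive z)
    fix s u assume s: "s \<in> {0..t}" and u: "mild (drift V \<gamma>1 \<gamma>n) (\<lambda>s. x0 + primitive z s) s u"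
    have zs: "square_integrable_on z {0..s}" using z s by (auto intro: square_integrable_on_subset)
    have "integral {0..s} (\<lambda>s. (norm (z s))\<^sup>2) \<le> E"
      unfolding E_def using s z zs by (intro integral_subset_le) (auto simp: square_integrable_on_Icc_iff)
    then show "norm (u s) < R" using u s zs by (intro R) (auto simp: solves_iff_mild)
  qed
  then show ?thesis using solves_iff_mild[OF z] by blast
qed

lemma flow_eqI:
  assumes z: "square_integrable_on z {0..t}" and u: "solves V \<gamma>1 \<gamma>n z t x0 u" and s: "s \<in> {0..t}"
  shows "flow V \<gamma>1 \<gamma>n s x0 z = u s"
  unfolding flow_def
proof (rule the_equality)
  show "\<exists>v. solves V \<gamma>1 \<gamma>n z s x0 v \<and> v s = u s" using solves_subset[OF u] s by auto
  fix x assume "\<exists>v. solves V \<gamma>1 \<gamma>n z s x0 v \<and> v s = x"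
  then obtain v where v: "solves V \<gamma>1 \<gamma>n z s x0 v" "v s = x" by blast
  have "square_integrable_on z {0..s}" using z s by (auto intro: square_integrable_on_subset)
  from solves_unique[OF this v(1) solves_subset[OF u], of s] s v(2) show "x = u s" by simp
qed

lemma solves_flow:
  assumes z: "square_integrable_on z {0..t}" and t: "t \<ge> 0"
  shows "solves V \<gamma>1 \<gamma>n z t x0 (\<lambda>s. flow V \<gamma>1 \<gamma>n s x0 z)"
proof -
  obtain u where u: "solves V \<gamma>1 \<gamma>n z t x0 u" using solves_exists[OF z t] by blast
  have eq: "flow V \<gamma>1 \<gamma>n s x0 z = u s" if "s \<in> {0..t}" for s
    by (rule flow_eqI[OF z u that])
  have "mild (drift V \<gamma>1 \<gamma>n) (\<lambda>s. x0 + primitive z s) t (\<lambda>s. flow V \<gamma>1 \<gamma>n s x0 z)"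
    using u unfolding solves_iff_mild[OF z] mild_def
  proof (elim conjE, intro conjI ballI)
    assume "continuous_on {0..t} u"
    then show "continuous_on {0..t} (\<lambda>s. flow V \<gamma>1 \<gamma>n s x0 z)"
      using continuous_on_eq eq by metis
    fix s assume s: "s \<in> {0..t}" and
      u: "\<forall>s\<in>{0..t}. u s = x0 + primitive z s + integral {0..s} (\<lambda>\<tau>. drift V \<gamma>1 \<gamma>n (u \<tau>))"
    have "integral {0..s} (\<lambda>\<tau>. drift V \<gamma>1 \<gamma>n (u \<tau>)) = integral {0..s} (\<lambda>\<tau>. drift V \<gamma>1 \<gamma>n (flow V \<gamma>1 \<gamma>n \<tau> x0 z))"
      using s by (intro integral_cong) (auto simp: eq)
    then show "flow V \<gamma>1 \<gamma>n s x0 z = x0 + primitive z s + integral {0..s} (\<lambda>\<tau>. drift V \<gamma>1 \<gamma>n (flow V \<gamma>1 \<gamma>n \<tau> x0 z))"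
      using s u eq by simp
  qed
  then show ?thesis unfolding solves_iff_mild[OF z] .
qed

lemma continuous_on_flow:
  assumes "square_integrable_on z {0..t}" "t \<ge> 0"
  shows "continuous_on {0..t} (\<lambda>s. flow V \<gamma>1 \<gamma>n s x0 z)"
  using solves_flow[OF assms] by (simp add: solves_def)

lemma flow_0 [simp]: "flow V \<gamma>1 \<gamma>n 0 x0 z = x0"
proof -
  have "solves V \<gamma>1 \<gamma>n z 0 x0 (\<lambda>_. x0)" by (simp add: solves_def has_integral_refl)
  moreover have "square_integrable_on z {0..0}"
    unfolding square_integrable_on_Icc_iff
    using integrable_on_refl[of z "0::real"] integrable_on_refl[of "\<lambda>s. (norm (z s))\<^sup>2" "0::real"] by simp
  ultimately show ?thesis by (intro flow_eqI) auto
qed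

lemma flow_bounded:
  "\<exists>R. \<forall>t z x0. t \<ge> 0 \<longrightarrow> square_integrable_on z {0..t} \<longrightarrow> norm x0 \<le> r \<longrightarrow>
    integral {0..t} (\<lambda>s. (norm (z s))\<^sup>2) \<le> E \<longrightarrow> norm (flow V \<gamma>1 \<gamma>n t x0 z) < R"
  using apriori_bound[of r E] solves_flow by fast

lemma flow_cong:
  assumes z: "square_integrable_on z {0..t}" and z': "square_integrable_on z' {0..t}" and t: "t \<ge> 0"
    and N: "negligible N" "\<And>\<tau>. \<tau> \<in> {0..t} - N \<Longrightarrow> z \<tau> = z' \<tau>"
  shows "flow V \<gamma>1 \<gamma>n t x0 z = flow V \<gamma>1 \<gamma>n t x0 z'"
proof (rule flow_eqI[OF z])
  have "mild (drift V \<gamma>1 \<gamma>n) (\<lambda>s. x0 + primitive z' s) t (\<lambda>s. flow V \<gamma>1 \<gamma>n s x0 z')"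
    using solves_flow[OF z' t] by (simp add: solves_iff_mild[OF z'])
  then show "solves V \<gamma>1 \<gamma>n z t x0 (\<lambda>s. flow V \<gamma>1 \<gamma>n s x0 z')"
    unfolding solves_iff_mild[OF z] mild_def using primitive_cong[of N t z z', OF N]
    by (metis (no_types, lifting) atLeastAtMost_iff)
qed (use t in auto)

text \<open>The cocycle property: the shifted curve solves the equation with the shifted forcing,
  and solutions are unique.\<close>

lemma flow_add:
  assumes z: "square_integrable_on z {0..s + r}" and s: "s \<ge> 0" and r: "r \<ge> 0"
  shows "flow V \<gamma>1 \<gamma>n (s + r) x0 z = flow V \<gamma>1 \<gamma>n r (flow V \<gamma>1 \<gamma>n s x0 z) (\<lambda>\<tau>. z (\<tau> + s))"
proof -
  define u where "u = (\<lambda>s. flow V \<gamma>1 \<gamma>n s x0 z)"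
  define f where "f = (\<lambda>\<tau>. (- grad V (snd (u \<tau>)) + boundary_force \<gamma>1 \<gamma>n (fst (u \<tau>)) (z \<tau>), fst (u \<tau>)))"
  have u: "continuous_on {0..s + r} u" "\<And>\<tau>. \<tau> \<in> {0..s + r} \<Longrightarrow> (f has_integral (u \<tau> - x0)) {0..\<tau>}"
    using solves_flow[OF z, of x0] s r by (auto simp: solves_def u_def f_def)
  have "solves V \<gamma>1 \<gamma>n (\<lambda>\<tau>. z (\<tau> + s)) r (u s) (\<lambda>\<tau>. u (\<tau> + s))"
    unfolding solves_def
  proof (intro conjI ballI)
    show "continuous_on {0..r} (\<lambda>\<tau>. u (\<tau> + s))"
      using s by (intro continuous_on_compose2[OF u(1)] continuous_intros) auto
    fix \<tau> assume \<tau>: "\<tau> \<in> {0..r}"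
    have fs: "(f has_integral (u (\<tau> + s) - x0)) {0..\<tau> + s}" "(f has_integral (u s - x0)) {0..s}"
      using \<tau> s by (auto intro!: u(2))
    have "f integrable_on {s..\<tau> + s}"
      using fs(1) s \<tau> by (auto intro: integrable_on_subinterval simp: has_integral_iff)
    moreover have "integral {0..s} f + integral {s..\<tau> + s} f = integral {0..\<tau> + s} f"
      using fs(1) s \<tau> by (intro Henstock_Kurzweil_Integration.integral_combine) (auto simp: has_integral_iff)
    then have "integral {s..\<tau> + s} f = (u (\<tau> + s) - x0) - (u s - x0)"
      unfolding integral_unique[OF fs(1)] integral_unique[OF fs(2)] by (metis add_diff_cancel_left')
    ultimately have "(f has_integral (u (\<tau> + s) - u s)) {s..\<tau> + s}"
      by (simp add: has_integral_iff)
    then have "((\<lambda>x. f (x + s)) has_integral (u (\<tau> + s) - u s)) {0..\<tau>}"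
      using has_integral_shift_Icc_real[of f s "u (\<tau> + s) - u s" 0 \<tau>] by (simp add: o_def add.commute)
    then show "((\<lambda>\<tau>. (- grad V (snd (u (\<tau> + s))) + boundary_force \<gamma>1 \<gamma>n (fst (u (\<tau> + s))) (z (\<tau> + s)), fst (u (\<tau> + s))))
        has_integral u (\<tau> + s) - u s) {0..\<tau>}"
      by (simp add: f_def)
  qed
  moreover have "square_integrable_on (\<lambda>\<tau>. z (\<tau> + s)) {0..r}"
    using z s by (intro square_integrable_on_shift) (auto intro: square_integrable_on_subset simp: add.commute)
  ultimately have "flow V \<gamma>1 \<gamma>n r (u s) (\<lambda>\<tau>. z (\<tau> + s)) = u (r + s)"
    using r by (intro flow_eqI[of _ r]) auto
  then show ?thesis by (simp add: u_def add.commute)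
qed

end

subsection \<open>The time-one map\<close>

lemma L2J_fun_rel:
  "square_integrable_on (L2J_fun y) {0..<1} \<and> square_integrable_on (L2J_fun y) {0..<1} \<and>
     (AE s in lebesgue_on {0..<1}. L2J_fun y s = L2J_fun y s)"
  unfolding L2J_fun_def using Quotient3_rep_reflp[OF Quotient3_L2J] .

lemma square_integrable_L2J_fun: "square_integrable_on (L2J_fun y) {0..1}"
  using L2J_fun_rel by (simp add: square_integrable_on_closed_unit_iff)

lemma abs_L2J_fun [simp]: "abs_L2J (L2J_fun y) = y"
  unfolding L2J_fun_def by (rule Quotient3_abs_rep[OF Quotient3_L2J])

lemma L2J_fun_abs:
  assumes "square_integrable_on f {0..<1}"
  shows "AE s in lebesgue_on {0..<1}. L2J_fun (abs_L2J f) s = f s"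
  unfolding L2J_fun_def using Quotient3_rep_abs[OF Quotient3_L2J, of f] assms by simp

lemma AE_unit_interval_negligible:
  assumes "AE s in lebesgue_on {0..<1::real}. P s"
  obtains N where "negligible N" "\<And>s. s \<in> {0..1} - N \<Longrightarrow> P s"
proof -
  have "AE s in lebesgue. s \<in> {0..<1} \<longrightarrow> P s"
    using assms by (simp add: AE_restrict_space_iff)
  then obtain N where N: "N \<in> null_sets lebesgue" "\<And>s. s \<in> space lebesgue - N \<Longrightarrow> s \<in> {0..<1} \<longrightarrow> P s"
    by (rule AE_E3) blast
  show ?thesis
  proof (rule that[of "insert 1 N"])
    show "negligible (insert 1 N)" using N(1) by (simp add: negligible_iff_null_sets)
    show "P s" if "s \<in> {0..1} - insert 1 N" for s using that N(2)[of s] by force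
  qed
qed

lemma L2J_fun_add: "AE s in lebesgue_on {0..<1}. L2J_fun (y + y') s = L2J_fun y s + L2J_fun y' s"
proof -
  have "y + y' = abs_L2J (\<lambda>s. L2J_fun y s + L2J_fun y' s)"
    using plus_L2J.abs_eq[OF L2J_fun_rel L2J_fun_rel, of y y'] by simp
  then show ?thesis
    using L2J_fun_abs[OF square_integrable_on_add] L2J_fun_rel by metis
qed

lemma L2J_fun_scaleR: "AE s in lebesgue_on {0..<1}. L2J_fun (c *\<^sub>R y) s = c *\<^sub>R L2J_fun y s"
proof -
  have "c *\<^sub>R y = abs_L2J (\<lambda>s. c *\<^sub>R L2J_fun y s)"
    using scaleR_L2J.abs_eq[OF L2J_fun_rel, of c y] by simp
  then show ?thesis
    using L2J_fun_abs[OF square_integrable_on_scaleR] L2J_fun_rel by metis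
qed

lemma L2J_fun_diff: "AE s in lebesgue_on {0..<1}. L2J_fun (y - y') s = L2J_fun y s - L2J_fun y' s"
proof -
  have eq: "y - y' = y + (-1) *\<^sub>R y'" by (simp add: scaleR_minus1_left)
  show ?thesis
    using L2J_fun_add[of y "(-1) *\<^sub>R y'"] L2J_fun_scaleR[of "-1" y'] unfolding eq
    by eventually_elim simp
qed

lemma power2_norm_L2J: "(norm y)\<^sup>2 = integral {0..1} (\<lambda>s. (norm (L2J_fun y s))\<^sup>2)"
proof -
  have "(norm y)\<^sup>2 = y \<bullet> y" by (simp add: power2_norm_eq_inner)
  also have "\<dots> = (\<integral>s. L2J_fun y s \<bullet> L2J_fun y s \<partial>lebesgue_on {0..<1})"
    using inner_L2J.abs_eq[OF L2J_fun_rel L2J_fun_rel, of y y] by simp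
  also have "\<dots> = integral {0..<1} (\<lambda>s. (norm (L2J_fun y s))\<^sup>2)"
    using L2J_fun_rel[of y] by (subst lebesgue_integral_eq_integral)
      (auto simp: square_integrable_on_def power2_norm_eq_inner)
  also have "\<dots> = integral {0..1} (\<lambda>s. (norm (L2J_fun y s))\<^sup>2)"
    by (rule integral_spike_set; rule negligible_subset[of "{1}"]) auto
  finally show ?thesis .
qed

lemma primitive_L2J_diff:
  "s \<le> 1 \<Longrightarrow> primitive (L2J_fun (y - y')) s = (primitive (L2J_fun y) s - primitive (L2J_fun y') s :: ('n::{finite,linorder}) state)"
proof -
  assume s: "s \<le> 1"
  obtain N where N: "negligible N" "\<And>s. s \<in> {0..1} - N \<Longrightarrow> L2J_fun (y - y') s = L2J_fun y s - L2J_fun y' s"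
    by (rule AE_unit_interval_negligible[OF L2J_fun_diff[of y y']]) blast
  have int: "(\<lambda>\<tau>. forcing_input (L2J_fun y \<tau>) :: 'n state) integrable_on {0..s}" for y
  proof -
    have "square_integrable_on (L2J_fun y) {0..s}"
      using s by (auto intro: square_integrable_on_subset[OF square_integrable_L2J_fun])
    then show ?thesis by (metis forcing_input_integrable absolutely_integrable_on_def)
  qed
  have "primitive (L2J_fun (y - y')) s = (primitive (\<lambda>s. L2J_fun y s - L2J_fun y' s) s :: 'n state)"
    using N s by (rule primitive_cong[where t = 1])
  also have "\<dots> = primitive (L2J_fun y) s - primitive (L2J_fun y') s"
    unfolding primitive_def linear_diff[OF linear_forcing_input] by (rule integral_diff[OF int int])
  finally show ?thesis .
qed

lemma norm_primitive_L2J: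
  assumes "s \<in> {0..1}"
  shows "norm (primitive (L2J_fun y) s :: ('n::{finite,linorder}) state) \<le> 2 * norm y"
proof -
  have "primitive (\<lambda>_. 0) s = (0 :: 'n state)"
    by (simp add: primitive_def linear_0[OF linear_forcing_input])
  then show ?thesis
    using norm_primitive_diff_le[where 'n='n, OF square_integrable_L2J_fun[of y] square_integrable_on_zero assms]
    by (simp flip: power2_norm_L2J)
qed

lemma norm_primitive_L2J_diff:
  assumes "s \<in> {0..1}"
  shows "norm (primitive (L2J_fun y) s - primitive (L2J_fun y') s :: ('n::{finite,linorder}) state) \<le> 2 * norm (y - y')"
  using norm_primitive_L2J[where 'n='n, OF assms, of "y - y'"] primitive_L2J_diff[where 'n='n, of s y y'] assms by simp

lemma norm_snd_diff_le: "norm (snd a - snd b) \<le> norm (a - b)"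
  by (metis norm_snd_le prod.collapse snd_diff)

lemma sum_abs_matrix_le_norm:
  fixes A :: "real^'n^'n"
  shows "(\<Sum>i\<in>UNIV. \<Sum>j\<in>UNIV. \<bar>A $ i $ j\<bar>) \<le> (real CARD('n))\<^sup>2 * norm A"
proof -
  have "\<bar>A $ i $ j\<bar> \<le> norm A" for i j
  proof -
    have "norm (A $ i) \<le> norm A" by (rule Finite_Cartesian_Product.norm_nth_le)
    then show ?thesis using component_le_norm_cart[of "A $ i" j] by linarith
  qed
  then have "(\<Sum>i\<in>(UNIV::'n set). \<Sum>j\<in>(UNIV::'n set). \<bar>A $ i $ j\<bar>) \<le> (\<Sum>i\<in>(UNIV::'n set). \<Sum>j\<in>(UNIV::'n set). norm A)"
    by (intro sum_mono)
  then show ?thesis by (simp add: power2_eq_square)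
qed

context oscillators begin

definition step :: "'n state \<Rightarrow> L2J \<Rightarrow> 'n state" where
  "step x y = flow V \<gamma>1 \<gamma>n 1 x (L2J_fun y)"

abbreviation path :: "'n state \<Rightarrow> L2J \<Rightarrow> real \<Rightarrow> 'n state" where
  "path x y s \<equiv> flow V \<gamma>1 \<gamma>n s x (L2J_fun y)"

lemma mild_path: "mild (drift V \<gamma>1 \<gamma>n) (\<lambda>s. x + primitive (L2J_fun y) s) 1 (path x y)"
  using solves_flow[OF square_integrable_L2J_fun[of y], of x] by (simp add: solves_iff_mild[OF square_integrable_L2J_fun])

lemma path_bounded: "\<exists>R. \<forall>x y. norm x \<le> r \<longrightarrow> norm y \<le> r \<longrightarrow> path x y ` {0..1} \<subseteq> cball 0 R"
proof -
  obtain R where R: "\<And>t z x0. t \<ge> 0 \<Longrightarrow> square_integrable_on z {0..t} \<Longrightarrow> norm x0 \<le> r \<Longrightarrow>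
    integral {0..t} (\<lambda>s. (norm (z s))\<^sup>2) \<le> r\<^sup>2 \<Longrightarrow> norm (flow V \<gamma>1 \<gamma>n t x0 z) < R"
    using flow_bounded[of r "r\<^sup>2"] by blast
  have "norm (path x y s) \<le> R" if "norm x \<le> r" "norm y \<le> r" "s \<in> {0..1}" for x y s
  proof -
    have sq: "square_integrable_on (L2J_fun y) {0..s}"
      using that by (auto intro: square_integrable_on_subset[OF square_integrable_L2J_fun])
    have "integral {0..s} (\<lambda>s. (norm (L2J_fun y s))\<^sup>2) \<le> (norm y)\<^sup>2"
      unfolding power2_norm_L2J using sq square_integrable_L2J_fun[of y] that
      by (intro integral_subset_le) (auto simp: square_integrable_on_Icc_iff)
    also have "\<dots> \<le> r\<^sup>2" using that by (intro power_mono) auto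
    finally show ?thesis using that sq by (intro less_imp_le[OF R]) auto
  qed
  then show ?thesis by (intro exI[of _ R]) auto
qed

lemma path_lipschitz:
  "\<exists>L>0. \<forall>x x' y y' s. norm x \<le> r \<longrightarrow> norm x' \<le> r \<longrightarrow> norm y \<le> r \<longrightarrow> norm y' \<le> r \<longrightarrow> s \<in> {0..1} \<longrightarrow>
    norm (path x y s - path x' y' s) \<le> L * (norm (x - x') + norm (y - y'))"
proof -
  obtain R where R: "\<And>x y. norm x \<le> r \<Longrightarrow> norm y \<le> r \<Longrightarrow> path x y ` {0..1} \<subseteq> cball 0 R"
    using path_bounded[of r] by blast
  obtain L where L: "L-lipschitz_on (cball 0 R) (drift V \<gamma>1 \<gamma>n)" using lipschitz_drift by blast
  have L0: "L \<ge> 0" using L by (rule lipschitz_on_nonneg)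
  have "norm (path x y s - path x' y' s) \<le> (2 * exp L) * (norm (x - x') + norm (y - y'))"
    if r: "norm x \<le> r" "norm x' \<le> r" "norm y \<le> r" "norm y' \<le> r" and s: "s \<in> {0..1}" for x x' y y' s
  proof -
    have "norm (path x y s - path x' y' s) \<le> (norm (x - x') + 2 * norm (y - y')) * exp (L * s)"
    proof (rule mild_stable[OF mild_path mild_path L R R])
      fix s :: real assume s: "s \<in> {0..1}"
      have "norm ((x - x') + (primitive (L2J_fun y) s - primitive (L2J_fun y') s)) \<le> norm (x - x') + 2 * norm (y - y')"
        using norm_primitive_L2J_diff[where 'n='n, OF s] by (intro order_trans[OF norm_triangle_ineq] add_left_mono)
      then show "norm (x + primitive (L2J_fun y) s - (x' + primitive (L2J_fun y') s)) \<le> norm (x - x') + 2 * norm (y - y')"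
        by (simp add: algebra_simps)
    qed (use r s in auto)
    also have "\<dots> \<le> (2 * (norm (x - x') + norm (y - y'))) * exp L"
      using s L0 by (intro mult_mono) (auto simp: mult_left_le)
    finally show ?thesis by (simp add: mult_ac)
  qed
  then show ?thesis by (intro exI[of _ "2 * exp L"]) auto
qed

lemma step_lipschitz:
  "\<exists>L>0. \<forall>x x' y y'. norm x \<le> r \<longrightarrow> norm x' \<le> r \<longrightarrow> norm y \<le> r \<longrightarrow> norm y' \<le> r \<longrightarrow>
    norm (step x y - step x' y') \<le> L * (norm (x - x') + norm (y - y'))"
proof -
  obtain L where "L > 0" "\<And>x x' y y' s. norm x \<le> r \<Longrightarrow> norm x' \<le> r \<Longrightarrow> norm y \<le> r \<Longrightarrow> norm y' \<le> r \<Longrightarrow> s \<in> {0..1} \<Longrightarrow>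
      norm (path x y s - path x' y' s) \<le> L * (norm (x - x') + norm (y - y'))"
    using path_lipschitz[of r] by blast
  then show ?thesis unfolding step_def by (intro exI[of _ L]) auto
qed

lemma continuous_step: "continuous_on UNIV (\<lambda>(x, y). step x y)"
proof (rule continuous_at_imp_continuous_on, intro ballI)
  fix w :: "'n state \<times> L2J"
  obtain x y where [simp]: "w = (x, y)" by (cases w)
  define r where "r = max (norm x) (norm y) + 1"
  obtain L where L: "L > 0" "\<And>x x' y y'. norm x \<le> r \<Longrightarrow> norm x' \<le> r \<Longrightarrow> norm y \<le> r \<Longrightarrow> norm y' \<le> r \<Longrightarrow>
      norm (step x y - step x' y') \<le> L * (norm (x - x') + norm (y - y'))"
    using step_lipschitz[of r] by blast
  show "isCont (\<lambda>(x, y). step x y) w"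
    unfolding continuous_at_eps_delta
  proof (intro allI impI)
    fix e :: real assume e: "e > 0"
    show "\<exists>d>0. \<forall>x'. dist x' w < d \<longrightarrow> dist (case x' of (x, y) \<Rightarrow> step x y) (case w of (x, y) \<Rightarrow> step x y) < e"
    proof (intro exI[of _ "min 1 (e / (3 * L))"] conjI allI impI)
      show "min 1 (e / (3 * L)) > 0" using e L by simp
      fix w' :: "'n state \<times> L2J" assume d: "dist w' w < min 1 (e / (3 * L))"
      obtain x' y' where [simp]: "w' = (x', y')" by (cases w')
      have le: "norm (x' - x) \<le> dist w' w" "norm (y' - y) \<le> dist w' w"
        using norm_fst_le[of "x' - x" "y' - y"] norm_snd_le[of "y' - y" "x' - x"] by (auto simp: dist_norm)
      then have "norm x' \<le> r" "norm y' \<le> r"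
        using d norm_triangle_ineq2[of x' x] norm_triangle_ineq2[of y' y] by (auto simp: r_def)
      then have "norm (step x' y' - step x y) \<le> L * (norm (x' - x) + norm (y' - y))"
        by (intro L(2)) (auto simp: r_def)
      also have "\<dots> \<le> L * (2 * dist w' w)" using le L(1) by (intro mult_left_mono) auto
      also have "\<dots> \<le> L * (2 * (e / (3 * L)))" using d L(1) by (intro mult_left_mono) auto
      also have "\<dots> < e" using L(1) e by simp
      finally show "dist (case w' of (x, y) \<Rightarrow> step x y) (case w of (x, y) \<Rightarrow> step x y) < e"
        by (simp add: dist_norm)
    qed
  qed
qed

text \<open>The link between continuous time and the chain: on each unit interval the noise acts
  only through its class in \<open>L2J\<close>, since a change of the forcing on a null set does not
  change the flow.\<close>

lemma flow_Suc_segment: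
  assumes z: "square_integrable_on z {0..real (Suc k)}"
  shows "flow V \<gamma>1 \<gamma>n (real (Suc k)) x0 z = step (flow V \<gamma>1 \<gamma>n (real k) x0 z) (segment (int (Suc k)) z)"
proof -
  define f where "f = (\<lambda>t. z (t + real k))"
  have f: "square_integrable_on f {0..1}"
    unfolding f_def using z by (intro square_integrable_on_shift) (auto intro: square_integrable_on_subset simp: add.commute)
  then have f': "square_integrable_on f {0..<1}" by (simp add: square_integrable_on_closed_unit_iff)
  have seg: "segment (int (Suc k)) z = abs_L2J f"
    using f' by (simp add: segment_def f_def add.commute)
  obtain N where N: "negligible N" "\<And>s. s \<in> {0..1} - N \<Longrightarrow> L2J_fun (abs_L2J f) s = f s"
    by (rule AE_unit_interval_negligible[OF L2J_fun_abs[OF f']]) blast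
  have "flow V \<gamma>1 \<gamma>n (real k + 1) x0 z = flow V \<gamma>1 \<gamma>n 1 (flow V \<gamma>1 \<gamma>n (real k) x0 z) f"
    unfolding f_def using z by (intro flow_add) (auto simp: add.commute)
  also have "\<dots> = step (flow V \<gamma>1 \<gamma>n (real k) x0 z) (segment (int (Suc k)) z)"
    unfolding step_def seg
    by (rule flow_cong[OF f square_integrable_L2J_fun _ N(1)]) (use N(2) in auto)
  finally show ?thesis by (simp add: add.commute)
qed

text \<open>Strict differentiability of the endpoint in the noise, uniform in the initial state near
  \<open>x0\<close>: two noises near \<open>y0\<close> are compared with the linearisation along the
  single path of \<open>(x0, y0)\<close>. The control \<xi> may differ from \<open>y - y'\<close> at
  the cost of the last term, which later allows controls to be replaced by approximations;
  \<open>C\<close> is therefore fixed before \<open>e\<close>. The components of \<open>w\<close>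
  are swapped because it lists positions first, while states list momenta first.\<close>

lemma step_strict_derivative:
  "\<exists>C\<ge>0. \<forall>e>0. \<exists>\<delta>>0. \<forall>x y y' \<xi> w. norm (x - x0) < \<delta> \<longrightarrow> norm (y - y0) < \<delta> \<longrightarrow> norm (y' - y0) < \<delta> \<longrightarrow>
     solves_linearised V \<gamma>1 \<gamma>n (\<lambda>t. snd (path x0 y0 t)) (L2J_fun \<xi>) w \<longrightarrow>
     norm (step x y - step x y' - (snd (w 1), fst (w 1))) \<le> e * norm (y - y') + C * norm (y - y' - \<xi>)"
proof -
  define r where "r = max (norm x0) (norm y0) + 1"
  obtain R where R: "\<And>x y. norm x \<le> r \<Longrightarrow> norm y \<le> r \<Longrightarrow> path x y ` {0..1} \<subseteq> cball 0 R"
    using path_bounded[of r] by blast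
  obtain L where L: "L > 0" "\<And>x x' y y' s. norm x \<le> r \<Longrightarrow> norm x' \<le> r \<Longrightarrow> norm y \<le> r \<Longrightarrow> norm y' \<le> r \<Longrightarrow> s \<in> {0..1} \<Longrightarrow>
      norm (path x y s - path x' y' s) \<le> L * (norm (x - x') + norm (y - y'))"
    using path_lipschitz[of r] by blast
  have "compact ((\<lambda>z. \<Sum>i\<in>UNIV. \<Sum>j\<in>UNIV. \<bar>hessian V z $ i $ j\<bar>) ` cball 0 R)"
    by (intro compact_continuous_image continuous_intros continuous_on_hessian) auto
  from compact_imp_bounded[OF this]
  obtain B where B: "\<And>z. z \<in> cball 0 R \<Longrightarrow> (\<Sum>i\<in>UNIV. \<Sum>j\<in>UNIV. \<bar>hessian V z $ i $ j\<bar>) \<le> B"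
    unfolding bounded_iff real_norm_def by (blast intro: order_trans[OF abs_ge_self])
  obtain C where C: "\<And>p. norm (boundary_force \<gamma>1 \<gamma>n p 0 :: 'n config) \<le> C * norm p" "C > 0"
    using linear_bounded_pos[OF linear_boundary_force] by blast
  define K where "K = max 0 B + C + 1"
  have K: "K > 0" using C(2) by (simp add: K_def)
  define u0 where "u0 = path x0 y0"
  define A where "A = (\<lambda>\<tau> (v :: 'n state). (- (hessian V (snd (u0 \<tau>)) *v snd v) + boundary_force \<gamma>1 \<gamma>n (fst v) 0, fst v))"
  have r0: "norm x0 \<le> r" "norm y0 \<le> r" by (auto simp: r_def)
  have u0R: "norm (snd (u0 \<tau>)) \<le> R" if "\<tau> \<in> {0..1}" for \<tau>
    using R[OF r0] that norm_snd_le[of "snd (u0 \<tau>)" "fst (u0 \<tau>)"] by (fastforce simp: u0_def)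
  have A: "norm (A \<tau> v) \<le> K * norm v" if "\<tau> \<in> {0..1}" for \<tau> v
  proof -
    have n: "norm (snd v) \<le> norm v" "norm (fst v) \<le> norm v"
      using norm_snd_le[of "snd v" "fst v"] norm_fst_le[of "fst v" "snd v"] by auto
    have "norm (hessian V (snd (u0 \<tau>)) *v snd v) \<le> onorm ((*v) (hessian V (snd (u0 \<tau>)))) * norm (snd v)"
      by (rule onorm[OF matrix_vector_mul_bounded_linear])
    also have "\<dots> \<le> max 0 B * norm (snd v)"
      using order_trans[OF onorm_le_matrix_component_sum B[of "snd (u0 \<tau>)"]] u0R[OF that]
      by (intro mult_right_mono max.coboundedI2) auto
    also have "\<dots> \<le> max 0 B * norm v" using n by (intro mult_left_mono) auto
    finally have h: "norm (hessian V (snd (u0 \<tau>)) *v snd v) \<le> max 0 B * norm v" .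
    have b: "norm (boundary_force \<gamma>1 \<gamma>n (fst v) 0 :: 'n config) \<le> C * norm v"
      using C n by (intro order_trans[OF C(1)] mult_left_mono) auto
    have "norm (A \<tau> v) \<le> norm (- (hessian V (snd (u0 \<tau>)) *v snd v) + boundary_force \<gamma>1 \<gamma>n (fst v) 0) + norm (fst v)"
      unfolding A_def by (rule norm_Pair_le)
    also have "\<dots> \<le> max 0 B * norm v + C * norm v + norm v"
      using h b n by (intro add_mono order_trans[OF norm_triangle_ineq]) auto
    finally show ?thesis by (simp add: K_def algebra_simps)
  qed
  have linA: "A \<tau> (v - v') = A \<tau> v - A \<tau> v'" for \<tau> v v'
    by (simp add: A_def matrix_vector_mult_diff_distrib linear_diff[OF linear_boundary_force])
  have contA: "continuous_on {0..1} (\<lambda>\<tau>. A \<tau> (v \<tau>))" if "continuous_on {0..1} v" for v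
  proof -
    have "continuous_on {0..1} u0" unfolding u0_def using mild_path[of x0 y0] by (simp add: mild_def)
    then have "continuous_on {0..1} (\<lambda>\<tau>. hessian V (snd (u0 \<tau>)))"
      by (intro continuous_on_compose2[OF continuous_on_hessian[of UNIV]] continuous_intros) auto
    then have 1: "continuous_on {0..1} (\<lambda>\<tau>. hessian V (snd (u0 \<tau>)) *v snd (v \<tau>))"
      unfolding matrix_vector_mult_def using that by (intro continuous_intros)
    have "continuous_on UNIV (\<lambda>p. boundary_force \<gamma>1 \<gamma>n p 0 :: 'n config)"
      by (intro linear_continuous_on) (simp flip: linear_conv_bounded_linear add: linear_boundary_force)
    then have 2: "continuous_on {0..1} (\<lambda>\<tau>. boundary_force \<gamma>1 \<gamma>n (fst (v \<tau>)) 0 :: 'n config)"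
      using that by (rule continuous_on_compose2[OF _ continuous_on_fst]) auto
    from 1 2 that show ?thesis unfolding A_def by (intro continuous_intros)
  qed
  have hunif: "uniformly_continuous_on (cball 0 (R + 1)) (hessian V)"
    by (intro compact_uniformly_continuous continuous_on_hessian) auto
  have "\<exists>\<delta>>0. \<forall>x y y' \<xi> w. norm (x - x0) < \<delta> \<longrightarrow> norm (y - y0) < \<delta> \<longrightarrow> norm (y' - y0) < \<delta> \<longrightarrow>
     solves_linearised V \<gamma>1 \<gamma>n (\<lambda>t. snd (path x0 y0 t)) (L2J_fun \<xi>) w \<longrightarrow>
     norm (step x y - step x y' - (snd (w 1), fst (w 1))) \<le> e * norm (y - y') + (2 * exp K) * norm (y - y' - \<xi>)"
    if e: "e > 0" for e
  proof -
    \<comment> \<open>Compensates the Lipschitz constant \<open>L\<close> of the path and the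
      Gronwall factor \<open>exp K\<close> in the final estimate.\<close>
    define e' where "e' = e / (L * exp K)"
    have e': "e' > 0" using e L by (simp add: e'_def)
    define N where "N = (real CARD('n))\<^sup>2"
    have N: "N > 0" by (simp add: N_def)
    obtain \<eta>0 where \<eta>0: "\<eta>0 > 0" "\<And>z z'. z \<in> cball 0 (R + 1) \<Longrightarrow> z' \<in> cball 0 (R + 1) \<Longrightarrow> dist z' z < \<eta>0 \<Longrightarrow>
        dist (hessian V z') (hessian V z) < e' / N"
      by (rule uniformly_continuous_onE[OF hunif divide_pos_pos[OF e' N]]) blast
    define \<eta> where "\<eta> = min \<eta>0 1"
    have \<eta>: "\<eta> > 0" using \<eta>0 by (simp add: \<eta>_def)
    \<comment> \<open>State and noise deviate by less than \<delta>, so paths stay within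
      \<open>2 * L * \<delta> \<le> \<eta>\<close> of \<open>u0\<close>, where the entries of the
      Hessian vary by at most \<open>e'\<close> in total.\<close>
    define \<delta> where "\<delta> = min 1 (\<eta> / (2 * L))"
    have "norm (step x y - step x y' - (snd (w 1), fst (w 1))) \<le> e * norm (y - y') + (2 * exp K) * norm (y - y' - \<xi>)"
      if x: "norm (x - x0) < \<delta>" and y: "norm (y - y0) < \<delta>" and y': "norm (y' - y0) < \<delta>"
        and w: "solves_linearised V \<gamma>1 \<gamma>n (\<lambda>t. snd (path x0 y0 t)) (L2J_fun \<xi>) w" for x y y' \<xi> w
    proof -
      define u where "u = path x y"
      define u' where "u' = path x y'"
      define \<omega> where "\<omega> = (\<lambda>s. (snd (w s), fst (w s)))"
      define h where "h = (\<lambda>s. u s - u' s - \<omega> s)"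
      have r: "norm x \<le> r" "norm y \<le> r" "norm y' \<le> r"
        using x y y' norm_triangle_ineq2[of x x0] norm_triangle_ineq2[of y y0] norm_triangle_ineq2[of y' y0]
        by (auto simp: r_def \<delta>_def)
      have u: "continuous_on {0..1} u" "\<And>s. s \<in> {0..1} \<Longrightarrow> u s = x + primitive (L2J_fun y) s + integral {0..s} (\<lambda>\<tau>. drift V \<gamma>1 \<gamma>n (u \<tau>))"
        using mild_path[of x y] by (auto simp: mild_def u_def)
      have u': "continuous_on {0..1} u'" "\<And>s. s \<in> {0..1} \<Longrightarrow> u' s = x + primitive (L2J_fun y') s + integral {0..s} (\<lambda>\<tau>. drift V \<gamma>1 \<gamma>n (u' \<tau>))"
        using mild_path[of x y'] by (auto simp: mild_def u'_def)
      have "continuous_on {0..1} w" using w by (simp add: solves_linearised_def)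
      then have c\<omega>: "continuous_on {0..1} \<omega>" unfolding \<omega>_def by (intro continuous_intros)
      have \<omega>: "\<omega> s = primitive (L2J_fun \<xi>) s + integral {0..s} (\<lambda>\<tau>. A \<tau> (\<omega> \<tau>))" if s: "s \<in> {0..1}" for s
      proof -
        have H: "((\<lambda>\<tau>. (snd (w \<tau>), - (hessian V (snd (u0 \<tau>)) *v fst (w \<tau>)) + boundary_force \<gamma>1 \<gamma>n (snd (w \<tau>)) (L2J_fun \<xi> \<tau>)))
            has_integral w s) {0..s}"
          using w s by (simp add: solves_linearised_def u0_def)
        have "bounded_linear (\<lambda>v :: 'n state. (snd v, fst v))"
          by (intro bounded_linear_Pair bounded_linear_snd bounded_linear_fst)
        from has_integral_linear[OF H this] have "((\<lambda>\<tau>. (- (hessian V (snd (u0 \<tau>)) *v fst (w \<tau>)) + boundary_force \<gamma>1 \<gamma>n (snd (w \<tau>)) (L2J_fun \<xi> \<tau>), snd (w \<tau>)))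
            has_integral \<omega> s) {0..s}"
          by (simp add: o_def \<omega>_def)
        moreover have "(\<lambda>\<tau>. (- (hessian V (snd (u0 \<tau>)) *v fst (w \<tau>)) + boundary_force \<gamma>1 \<gamma>n (snd (w \<tau>)) (L2J_fun \<xi> \<tau>), snd (w \<tau>)))
            = (\<lambda>\<tau>. forcing_input (L2J_fun \<xi> \<tau>) + A \<tau> (\<omega> \<tau>))"
          by (simp add: fun_eq_iff A_def \<omega>_def boundary_force_split[of \<gamma>1 \<gamma>n _ "L2J_fun \<xi> _"] forcing_input_def)
        ultimately have "\<omega> s = integral {0..s} (\<lambda>\<tau>. forcing_input (L2J_fun \<xi> \<tau>) + A \<tau> (\<omega> \<tau>))"
          by (simp add: integral_unique)
        also have "\<dots> = primitive (L2J_fun \<xi>) s + integral {0..s} (\<lambda>\<tau>. A \<tau> (\<omega> \<tau>))"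
          unfolding primitive_def
        proof (rule integral_add)
          have "square_integrable_on (L2J_fun \<xi>) {0..s}"
            using s by (auto intro: square_integrable_on_subset[OF square_integrable_L2J_fun])
          then show "(\<lambda>\<tau>. forcing_input (L2J_fun \<xi> \<tau>) :: 'n state) integrable_on {0..s}"
            by (metis forcing_input_integrable absolutely_integrable_on_def)
          show "(\<lambda>\<tau>. A \<tau> (\<omega> \<tau>)) integrable_on {0..s}"
            using s by (intro integrable_continuous_interval continuous_on_subset[OF contA[OF c\<omega>]]) auto
        qed
        finally show ?thesis .
      qed
      have ch: "continuous_on {0..1} h" unfolding h_def by (intro continuous_intros u u' c\<omega>)
      have cd: "continuous_on {0..1} (\<lambda>\<tau>. drift V \<gamma>1 \<gamma>n (u \<tau>))" "continuous_on {0..1} (\<lambda>\<tau>. drift V \<gamma>1 \<gamma>n (u' \<tau>))"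
        using u(1) u'(1) by (auto intro!: continuous_on_compose2[OF continuous_on_drift[of UNIV]])
      have uu': "norm (u \<tau> - u' \<tau>) \<le> L * norm (y - y')" if "\<tau> \<in> {0..1}" for \<tau>
        using L(2)[OF r(1) r(1) r(2) r(3) that] by (simp add: u_def u'_def)
      have near: "norm (path x v \<tau> - u0 \<tau>) < \<eta>" if "\<tau> \<in> {0..1}" "norm v \<le> r" "norm (v - y0) < \<delta>" for v \<tau>
      proof -
        have "norm (path x v \<tau> - u0 \<tau>) \<le> L * (norm (x - x0) + norm (v - y0))"
          unfolding u0_def by (rule L(2)[OF r(1) r0(1) that(2) r0(2) that(1)])
        also have "\<dots> < L * (\<delta> + \<delta>)" using L(1) x that by (intro mult_strict_left_mono add_strict_mono)
        also have "\<dots> \<le> \<eta>"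
        proof -
          have "\<delta> \<le> \<eta> / (2 * L)" by (simp add: \<delta>_def)
          then show ?thesis using L(1) by (simp add: field_simps)
        qed
        finally show ?thesis .
      qed
      have lin: "norm (drift V \<gamma>1 \<gamma>n (u \<tau>) - drift V \<gamma>1 \<gamma>n (u' \<tau>) - A \<tau> (u \<tau> - u' \<tau>)) \<le> e' * (L * norm (y - y'))"
        if \<tau>: "\<tau> \<in> {0..1}" for \<tau>
      proof -
        let ?q = "snd (u \<tau>)" and ?q' = "snd (u' \<tau>)" and ?b = "snd (u0 \<tau>)"
        have "norm (?q - ?b) < \<eta>" "norm (?q' - ?b) < \<eta>"
          using near[OF \<tau> r(2) y] near[OF \<tau> r(3) y'] norm_snd_diff_le[of "u \<tau>" "u0 \<tau>"]
            norm_snd_diff_le[of "u' \<tau>" "u0 \<tau>"] unfolding u_def u'_def by linarith+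
        then have "norm (grad V ?q - grad V ?q' - hessian V ?b *v (?q - ?q')) \<le> e' * norm (?q - ?q')"
        proof (intro grad_linearisation[where A = "ball ?b \<eta>"])
          fix z assume z: "z \<in> ball ?b \<eta>"
          then have "norm z \<le> R + 1" "norm ?b \<le> R + 1"
            using u0R[OF \<tau>] norm_triangle_ineq2[of z ?b] by (auto simp: \<eta>_def dist_norm norm_minus_commute)
          then have "dist (hessian V z) (hessian V ?b) < e' / N"
            using z by (intro \<eta>0(2)) (auto simp: \<eta>_def dist_commute)
          then have "N * norm (hessian V z - hessian V ?b) \<le> e'"
            using N by (simp add: dist_norm field_simps)
          then show "(\<Sum>i\<in>UNIV. \<Sum>j\<in>UNIV. \<bar>(hessian V z - hessian V ?b) $ i $ j\<bar>) \<le> e'"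
            using sum_abs_matrix_le_norm[of "hessian V z - hessian V ?b"] by (simp add: N_def)
        qed (auto simp: dist_norm norm_minus_commute)
        also have "\<dots> \<le> e' * norm (u \<tau> - u' \<tau>)"
          using e' norm_snd_diff_le[of "u \<tau>" "u' \<tau>"] by (intro mult_left_mono) auto
        also have "\<dots> \<le> e' * (L * norm (y - y'))" using e' uu'[OF \<tau>] by (intro mult_left_mono) auto
        finally have "norm (grad V ?q - grad V ?q' - hessian V ?b *v (?q - ?q')) \<le> e' * (L * norm (y - y'))" .
        moreover have "drift V \<gamma>1 \<gamma>n (u \<tau>) - drift V \<gamma>1 \<gamma>n (u' \<tau>) - A \<tau> (u \<tau> - u' \<tau>)
            = (- (grad V ?q - grad V ?q' - hessian V ?b *v (?q - ?q')), 0)"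
          by (simp add: drift_def A_def linear_diff[OF linear_boundary_force])
        ultimately show ?thesis by (simp add: norm_minus_commute)
      qed
      \<comment> \<open>The error \<open>h\<close> solves the linearised equation, driven by
        \<open>y - y' - \<xi>\<close> and by the remainder of the linearised drift.\<close>
      have heq: "h s = primitive (L2J_fun (y - y' - \<xi>)) s + integral {0..s} (\<lambda>\<tau>. A \<tau> (h \<tau>) +
          (drift V \<gamma>1 \<gamma>n (u \<tau>) - drift V \<gamma>1 \<gamma>n (u' \<tau>) - A \<tau> (u \<tau> - u' \<tau>)))" if s: "s \<in> {0..1}" for s
      proof -
        have sub: "k integrable_on {0..s}" if "continuous_on {0..1} k" for k :: "real \<Rightarrow> 'n state"
          using s by (intro integrable_continuous_interval continuous_on_subset[OF that]) auto
        have "(\<lambda>\<tau>. A \<tau> (h \<tau>) + (drift V \<gamma>1 \<gamma>n (u \<tau>) - drift V \<gamma>1 \<gamma>n (u' \<tau>) - A \<tau> (u \<tau> - u' \<tau>)))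
            = (\<lambda>\<tau>. drift V \<gamma>1 \<gamma>n (u \<tau>) - drift V \<gamma>1 \<gamma>n (u' \<tau>) - A \<tau> (\<omega> \<tau>))"
          by (rule ext) (simp add: h_def linA[of _ "u _ - u' _" "\<omega> _"])
        then have "integral {0..s} (\<lambda>\<tau>. A \<tau> (h \<tau>) + (drift V \<gamma>1 \<gamma>n (u \<tau>) - drift V \<gamma>1 \<gamma>n (u' \<tau>) - A \<tau> (u \<tau> - u' \<tau>)))
            = integral {0..s} (\<lambda>\<tau>. drift V \<gamma>1 \<gamma>n (u \<tau>) - drift V \<gamma>1 \<gamma>n (u' \<tau>) - A \<tau> (\<omega> \<tau>))"
          by (rule arg_cong)
        also have "\<dots> = integral {0..s} (\<lambda>\<tau>. drift V \<gamma>1 \<gamma>n (u \<tau>)) - integral {0..s} (\<lambda>\<tau>. drift V \<gamma>1 \<gamma>n (u' \<tau>)) - integral {0..s} (\<lambda>\<tau>. A \<tau> (\<omega> \<tau>))"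
          by (simp add: integral_diff sub cd contA c\<omega> integrable_diff)
        finally show ?thesis
          using s by (simp add: h_def u(2)[OF s] u'(2)[OF s] \<omega>[OF s] primitive_L2J_diff)
      qed
      have "norm (h 1) \<le> (2 * norm (y - y' - \<xi>) + e' * (L * norm (y - y'))) * exp (K * 1)"
      proof (rule gronwall[where g = "\<lambda>s. norm (h s)" and t = 1])
        show "continuous_on {0..1} (\<lambda>s. norm (h s))" by (intro continuous_intros ch)
        show "K \<ge> 0" using K by simp
        fix s :: real assume s: "s \<in> {0..1}"
        let ?D = "\<lambda>\<tau>. drift V \<gamma>1 \<gamma>n (u \<tau>) - drift V \<gamma>1 \<gamma>n (u' \<tau>) - A \<tau> (u \<tau> - u' \<tau>)"
        have sub: "continuous_on {0..s} k" if "continuous_on {0..1} k" for k :: "real \<Rightarrow> 'n state"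
          using s by (intro continuous_on_subset[OF that]) auto
        have "norm (integral {0..s} (\<lambda>\<tau>. A \<tau> (h \<tau>) + ?D \<tau>)) \<le> integral {0..s} (\<lambda>\<tau>. K * norm (h \<tau>) + e' * (L * norm (y - y')))"
        proof (rule norm_integral_le_integral)
          show "continuous_on {0..s} (\<lambda>\<tau>. A \<tau> (h \<tau>) + ?D \<tau>)"
            by (intro sub continuous_intros contA ch cd u u')
          show "continuous_on {0..s} (\<lambda>\<tau>. K * norm (h \<tau>) + e' * (L * norm (y - y')))"
            by (intro continuous_intros sub ch)
          fix \<tau> assume "\<tau> \<in> {0..s}"
          then have "\<tau> \<in> {0..1}" using s by auto
          then show "norm (A \<tau> (h \<tau>) + ?D \<tau>) \<le> K * norm (h \<tau>) + e' * (L * norm (y - y'))"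
            by (intro order_trans[OF norm_triangle_ineq] add_mono A lin)
        qed
        also have "\<dots> = K * integral {0..s} (\<lambda>\<tau>. norm (h \<tau>)) + s * (e' * (L * norm (y - y')))"
          using s by (subst integral_add) (auto intro!: integrable_continuous_interval continuous_intros sub ch)
        also have "\<dots> \<le> K * integral {0..s} (\<lambda>\<tau>. norm (h \<tau>)) + e' * (L * norm (y - y'))"
          using s e' L(1) by (intro add_left_mono mult_left_le_one_le) auto
        finally show "norm (h s) \<le> (2 * norm (y - y' - \<xi>) + e' * (L * norm (y - y'))) + K * integral {0..s} (\<lambda>\<tau>. norm (h \<tau>))"
          using norm_primitive_L2J[where 'n='n, OF s, of "y - y' - \<xi>"]
            norm_triangle_ineq[of "primitive (L2J_fun (y - y' - \<xi>)) s" "integral {0..s} (\<lambda>\<tau>. A \<tau> (h \<tau>) + ?D \<tau>)"]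
          unfolding heq[OF s] by linarith
      qed auto
      also have "\<dots> = e * norm (y - y') + (2 * exp K) * norm (y - y' - \<xi>)"
        using L(1) by (simp add: e'_def field_simps)
      finally show ?thesis by (simp add: h_def \<omega>_def u_def u'_def step_def)
    qed
    moreover have "\<delta> > 0" using \<eta> L(1) by (simp add: \<delta>_def)
    ultimately show ?thesis by blast
  qed
  then show ?thesis by (intro exI[of _ "2 * exp K"]) auto
qed

end

subsection \<open>Measure-theoretic tools\<close>

text \<open>The second factor will be \<^typ>\<open>L2J\<close>, which is not an instance of second countability.\<close>

lemma open_in_sets_pair_borel:
  fixes U :: "('a::second_countable_topology \<times> 'b::topological_space) set"
  assumes U: "open U"
  shows "U \<in> sets (borel \<Otimes>\<^sub>M borel)"
proof -
  obtain \<B> :: "'a set set" where \<B>: "countable \<B>" "topological_basis \<B>"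
    using ex_countable_basis by blast
  \<comment> \<open>A countable base of the first factor suffices: for each basic set
    \<open>B\<close>, the union of all open sets that may stand next to it is again open.\<close>
  define R where "R = (\<lambda>B. \<Union>{V :: 'b set. open V \<and> B \<times> V \<subseteq> U})"
  have R: "open (R B)" for B by (auto simp: R_def)
  have "U = (\<Union>B\<in>\<B>. B \<times> R B)"
  proof (intro equalityI subsetI)
    fix w assume w: "w \<in> U"
    obtain x y where [simp]: "w = (x, y)" by (cases w)
    obtain A V where A: "open A" "open V" "x \<in> A" "y \<in> V" "A \<times> V \<subseteq> U"
      using w U by (auto elim!: open_prod_elim)
    obtain B where B: "B \<in> \<B>" "x \<in> B" "B \<subseteq> A"
      using topological_basisE[OF \<B>(2) A(1,3)] by blast
    then have "y \<in> R B" using A by (auto simp: R_def)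
    then show "w \<in> (\<Union>B\<in>\<B>. B \<times> R B)" using B by auto
  qed (auto simp: R_def)
  also have "\<dots> \<in> sets (borel \<Otimes>\<^sub>M borel)"
    by (intro sets.countable_UN'' pair_measureI borel_open R \<B>(1)) (rule topological_basis_open[OF \<B>(2)])
  finally show ?thesis .
qed

lemma borel_measurable_pair_continuous:
  fixes f :: "'a::second_countable_topology \<times> 'b::topological_space \<Rightarrow> 'c::topological_space"
  assumes "continuous_on UNIV f"
  shows "f \<in> borel_measurable (borel \<Otimes>\<^sub>M borel)"
  using assms
  by (intro borel_measurableI) (auto simp: space_pair_measure intro!: open_in_sets_pair_borel open_vimage)

lemma borel_measurable_pair_continuous':
  fixes f :: "'b::topological_space \<times> 'a::second_countable_topology \<Rightarrow> 'c::topological_space"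
  assumes "continuous_on UNIV f"
  shows "f \<in> borel_measurable (borel \<Otimes>\<^sub>M borel)"
proof -
  have "(\<lambda>w. f (snd w, fst w)) \<in> borel_measurable (borel \<Otimes>\<^sub>M borel)"
    by (intro borel_measurable_pair_continuous continuous_on_compose2[OF assms] continuous_intros) auto
  from measurable_compose[OF measurable_pair_swap' this] show ?thesis
    by (simp add: case_prod_unfold)
qed

text \<open>Up to \<open>1 / N\<close>, a function with values in [0, 1] is the average of the
  indicators of its \<open>N\<close> superlevel sets \<open>A N k\<close>; averaging keeps the
  setwise bound \<open>e\<close> without a factor \<open>N\<close>.\<close>

lemma integral_diff_le_setwise:
  fixes f :: "'a \<Rightarrow> real"
  assumes "prob_space \<mu>" "prob_space \<nu>" and s: "sets \<mu> = sets \<nu>" and f: "f \<in> borel_measurable \<mu>"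
    and f01: "\<And>x. x \<in> space \<mu> \<Longrightarrow> 0 \<le> f x \<and> f x \<le> 1"
    and le: "\<And>\<Gamma>. \<Gamma> \<in> sets \<mu> \<Longrightarrow> \<bar>measure \<mu> \<Gamma> - measure \<nu> \<Gamma>\<bar> \<le> e"
  shows "\<bar>(\<integral>x. f x \<partial>\<mu>) - (\<integral>x. f x \<partial>\<nu>)\<bar> \<le> e"
proof -
  interpret m: prob_space \<mu> by fact
  interpret n: prob_space \<nu> by fact
  have sp: "space \<mu> = space \<nu>" using s by (rule sets_eq_imp_space_eq)
  have fn: "f \<in> borel_measurable \<nu>" using f measurable_cong_sets[OF s refl] by blast
  have im: "integrable \<mu> f"
    using f f01 by (intro m.integrable_const_bound[where B = 1]) auto
  have "in": "integrable \<nu> f"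
    using fn f01 sp by (intro n.integrable_const_bound[where B = 1]) auto
  define A where "A = (\<lambda>(N::nat) k. {x \<in> space \<mu>. real (Suc k) / real N \<le> f x})"
  have A: "A N k \<in> sets \<mu>" for N k unfolding A_def using f by measurable
  define g where "g = (\<lambda>N x. (\<Sum>k<N. indicator (A N k) x) / real N :: real)"
  have g: "g N x \<le> f x \<and> f x \<le> g N x + 1 / real N" if "x \<in> space \<mu>" "N > 0" for N x
  proof -
    define m where "m = nat \<lfloor>real N * f x\<rfloor>"
    have m0: "0 \<le> real N * f x" "real N * f x \<le> real N" using f01[OF that(1)] that by (auto simp: mult_left_le)
    have m: "real m \<le> real N * f x" "real N * f x < real m + 1"
      using m0 by (auto simp: m_def)
    have "m \<le> N" using m(1) m0 by linarith
    have "real (Suc k) / real N \<le> f x \<longleftrightarrow> k < m" for k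
    proof -
      have "real (Suc k) / real N \<le> f x \<longleftrightarrow> real (Suc k) \<le> real N * f x" using that by (simp add: field_simps)
      also have "\<dots> \<longleftrightarrow> Suc k \<le> m" using m by (smt (verit) of_nat_less_iff of_nat_Suc not_less_eq_eq of_nat_le_iff)
      finally show ?thesis by auto
    qed
    then have "(\<Sum>k<N. indicator (A N k) x) = (\<Sum>k<N. if k < m then 1 else 0 :: real)"
      using that by (intro sum.cong) (auto simp: A_def indicator_def)
    also have "\<dots> = real m"
      using \<open>m \<le> N\<close> by (subst sum.If_cases) (auto simp: Int_absorb1 lessThan_def[symmetric] Collect_conj_eq Int_commute)
    finally have gN: "g N x = real m / real N" by (simp add: g_def)
    have "real m / real N \<le> f x" using m that by (simp add: pos_divide_le_eq mult.commute)
    moreover have "f x \<le> (real m + 1) / real N"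
      using m that by (simp add: pos_le_divide_eq mult.commute)
    ultimately show ?thesis unfolding gN by (simp add: add_divide_distrib)
  qed
  have gm: "integrable M (g N)" "(\<integral>x. g N x \<partial>M) = (\<Sum>k<N. measure M (A N k)) / real N"
    if "sets M = sets \<mu>" "finite_measure M" for M N
  proof -
    interpret finite_measure M by fact
    have A': "A N k \<in> sets M" for k using A that by simp
    have Ai: "integrable M (indicator (A N k) :: _ \<Rightarrow> real)" for k
      using A' by (intro integrable_real_indicator) (auto simp: less_top[symmetric])
    then show "integrable M (g N)"
      unfolding g_def by (intro integrable_divide Bochner_Integration.integrable_sum)
    have "(\<integral>x. g N x \<partial>M) = (\<Sum>k<N. (\<integral>x. indicator (A N k) x \<partial>M)) / real N"
      unfolding g_def using Ai by (subst integral_divide_zero, subst Bochner_Integration.integral_sum) auto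
    also have "\<dots> = (\<Sum>k<N. measure M (A N k)) / real N"
      using A' sets.sets_into_space by (simp add: Int_absorb2)
    finally show "(\<integral>x. g N x \<partial>M) = (\<Sum>k<N. measure M (A N k)) / real N" .
  qed
  have bound: "\<bar>(\<integral>x. f x \<partial>\<mu>) - (\<integral>x. f x \<partial>\<nu>)\<bar> \<le> e + 1 / real N" if N: "N > 0" for N
  proof -
    have sandwich: "(\<integral>x. g N x \<partial>M) \<le> (\<integral>x. f x \<partial>M) \<and> (\<integral>x. f x \<partial>M) \<le> (\<integral>x. g N x \<partial>M) + 1 / real N"
      if M: "sets M = sets \<mu>" "prob_space M" and f: "integrable M f" for M
    proof -
      interpret prob_space M by fact
      have sp: "space M = space \<mu>" using M(1) by (rule sets_eq_imp_space_eq)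
      have gi: "integrable M (g N)" using M by (intro gm) auto
      have 1: "(\<integral>x. g N x \<partial>M) \<le> (\<integral>x. f x \<partial>M)"
        using g N sp by (intro integral_mono gi f) auto
      have "(\<integral>x. f x \<partial>M) \<le> (\<integral>x. g N x + 1 / real N \<partial>M)"
        using g N sp gi by (intro integral_mono f) auto
      also have "\<dots> = (\<integral>x. g N x \<partial>M) + 1 / real N"
        using gi by (subst Bochner_Integration.integral_add) (auto simp: prob_space)
      finally show ?thesis using 1 by simp
    qed
    have "\<bar>(\<integral>x. g N x \<partial>\<mu>) - (\<integral>x. g N x \<partial>\<nu>)\<bar> \<le> e"
    proof -
      have "(\<integral>x. g N x \<partial>\<mu>) - (\<integral>x. g N x \<partial>\<nu>) = (\<Sum>k<N. measure \<mu> (A N k) - measure \<nu> (A N k)) / real N"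
        using gm(2)[OF refl m.finite_measure_axioms] gm(2)[OF s[symmetric] n.finite_measure_axioms]
        by (simp add: sum_subtractf diff_divide_distrib)
      also have "\<bar>\<dots>\<bar> \<le> (\<Sum>k<N. \<bar>measure \<mu> (A N k) - measure \<nu> (A N k)\<bar>) / real N"
        by (simp add: divide_right_mono sum_abs)
      also have "\<dots> \<le> (\<Sum>k<N. e) / real N" by (intro divide_right_mono sum_mono le A) auto
      also have "\<dots> = e" using N by simp
      finally show ?thesis .
    qed
    then show ?thesis
      using sandwich[OF refl m.prob_space_axioms im] sandwich[OF s[symmetric] n.prob_space_axioms "in"]
      by (auto simp: abs_le_iff)
  qed
  show ?thesis
  proof (rule field_le_epsilon)
    fix d :: real assume "d > 0"
    then obtain n :: nat where n: "inverse (real (Suc n)) < d" using reals_Archimedean by blast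
    show "\<bar>(\<integral>x. f x \<partial>\<mu>) - (\<integral>x. f x \<partial>\<nu>)\<bar> \<le> e + d"
      using bound[of "Suc n"] n by (simp add: inverse_eq_divide)
  qed
qed

lemma emeasure_lborel_cball_scale:
  fixes a b :: "'s::euclidean_space"
  assumes "c \<ge> 0" "r \<ge> 0"
  shows "emeasure lborel (cball a (c * r)) = ennreal (c ^ DIM('s)) * emeasure lborel (cball b r)"
  using assms by (simp add: emeasure_cball power_mult_distrib ennreal_mult[symmetric] mult_ac)

lemma emeasure_countable_UN_le:
  assumes I: "countable I" and A: "\<And>i. i \<in> I \<Longrightarrow> A i \<in> sets M"
  shows "emeasure M (\<Union>i\<in>I. A i) \<le> (\<integral>\<^sup>+i. emeasure M (A i) \<partial>count_space I)"
proof -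
  have "emeasure M (\<Union>i\<in>I. A i) = (\<integral>\<^sup>+x. indicator (\<Union>i\<in>I. A i) x \<partial>M)"
    using I A by (intro nn_integral_indicator[symmetric] sets.countable_UN'')
  also have "\<dots> \<le> (\<integral>\<^sup>+x. (\<integral>\<^sup>+i. indicator (A i) x \<partial>count_space I) \<partial>M)"
  proof (intro nn_integral_mono)
    fix x
    show "indicator (\<Union>i\<in>I. A i) x \<le> (\<integral>\<^sup>+i. indicator (A i) x \<partial>count_space I)"
    proof (cases "x \<in> (\<Union>i\<in>I. A i)")
      case True
      then obtain j where j: "j \<in> I" "x \<in> A j" by blast
      have "(1 :: ennreal) = (\<integral>\<^sup>+i. indicator {j} i \<partial>count_space I)"
        using j by (subst nn_integral_indicator) auto
      also have "\<dots> \<le> (\<integral>\<^sup>+i. indicator (A i) x \<partial>count_space I)"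
        using j by (intro nn_integral_mono) (auto simp: indicator_def)
      finally show ?thesis using True by simp
    qed simp
  qed
  also have "\<dots> = (\<integral>\<^sup>+i. (\<integral>\<^sup>+x. indicator (A i) x \<partial>M) \<partial>count_space I)"
    using I A by (intro nn_integral_count_space_nn_integral) auto
  also have "\<dots> = (\<integral>\<^sup>+i. emeasure M (A i) \<partial>count_space I)"
    using A by (intro nn_integral_cong) auto
  finally show ?thesis .
qed

text \<open>By a Vitali covering, an \<open>L\<close>-Lipschitz map enlarges Lebesgue measure at most by the factor
  \<open>(10 L) ^ DIM('s)\<close>; the statement is phrased for a section \<open>\<tau>\<close> of the map.\<close>

lemma emeasure_lborel_section_le:
  fixes \<sigma> \<tau> :: "'s::euclidean_space \<Rightarrow> 's"
  assumes L: "L-lipschitz_on C \<sigma>" and \<tau>: "\<And>s. s \<in> W \<Longrightarrow> \<tau> s \<in> C \<and> \<sigma> (\<tau> s) = s"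
    and W: "W \<in> sets borel" and \<tau>m: "\<tau> \<in> borel_measurable borel" and A: "A \<in> sets borel"
  shows "emeasure lborel (W \<inter> \<tau> -` A) \<le> ennreal ((10 * L) ^ DIM('s)) * emeasure lborel A"
proof (rule ennreal_le_epsilon)
  have L0: "L \<ge> 0" using L by (rule lipschitz_on_nonneg)
  have m: "W \<inter> \<tau> -` B \<in> sets lborel" if "B \<in> sets borel" for B
    using W measurable_sets[OF \<tau>m that] by simp
  fix e :: real assume e: "e > 0"
  define e' where "e' = e / ((10 * L) ^ DIM('s) + 1)"
  have e': "e' > 0" using e L0 by (simp add: e'_def add_nonneg_pos)
  \<comment> \<open>Outer regularity: the balls of the covering stay in \<open>U\<close>, so their
    total measure exceeds that of \<open>A\<close> by at most \<open>e'\<close>.\<close>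
  obtain U where U: "open U" "A \<subseteq> U" "U - A \<in> lmeasurable" "emeasure lebesgue (U - A) < ennreal e'"
    using sets_lebesgue_outer_open[of A e'] A e' by auto
  have "\<exists>r. 0 < r \<and> r \<le> 1 \<and> cball x r \<subseteq> U" if "x \<in> A" for x
  proof -
    have "x \<in> U" using U(2) that by auto
    then obtain d where "d > 0" "cball x d \<subseteq> U"
      using open_contains_cball_eq[OF U(1)] by blast
    then show ?thesis by (intro exI[of _ "min d 1"]) auto
  qed
  then obtain r where r: "\<And>x. x \<in> A \<Longrightarrow> 0 < r x \<and> r x \<le> 1 \<and> cball x (r x) \<subseteq> U" by metis
  have cov: "A \<subseteq> (\<Union>x\<in>A. cball x (r x))"
  proof
    fix x assume "x \<in> A"
    then show "x \<in> (\<Union>x\<in>A. cball x (r x))" using r[of x] by (intro UN_I[of x]) auto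
  qed
  obtain I where I: "countable I" "I \<subseteq> A" "pairwise (\<lambda>i j. disjnt (cball i (r i)) (cball j (r j))) I"
      "A \<subseteq> (\<Union>i\<in>I. cball i (5 * r i))"
    by (rule Vitali_covering_lemma_cballs[where a = "\<lambda>x. x" and r = r and K = A and S = A and B = 1])
      (use r cov in auto)
  \<comment> \<open>Two points of the five times dilated ball are at most \<open>10 * r i\<close>
    apart, so their images under \<sigma> are at most \<open>10 * L * r i\<close> apart. This
    compares the preimage with the undilated ball, and the undilated balls are disjoint.\<close>
  have piece: "emeasure lborel (W \<inter> \<tau> -` cball i (5 * r i)) \<le> ennreal ((10 * L) ^ DIM('s)) * emeasure lborel (cball i (r i))"
    if "i \<in> I" for i
  proof (cases "W \<inter> \<tau> -` cball i (5 * r i) = {}")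
    case False
    then obtain s0 where s0: "s0 \<in> W" "\<tau> s0 \<in> cball i (5 * r i)" by auto
    have "W \<inter> \<tau> -` cball i (5 * r i) \<subseteq> cball s0 ((10 * L) * r i)"
    proof
      fix s assume s: "s \<in> W \<inter> \<tau> -` cball i (5 * r i)"
      have d: "dist (\<tau> s0) (\<tau> s) \<le> 10 * r i"
        using s s0 dist_triangle3[of "\<tau> s0" "\<tau> s" i] by auto
      have "dist s0 s = dist (\<sigma> (\<tau> s0)) (\<sigma> (\<tau> s))" using s s0 \<tau> by simp
      also have "\<dots> \<le> L * dist (\<tau> s0) (\<tau> s)" using s s0 \<tau> by (intro lipschitz_onD[OF L]) auto
      also have "\<dots> \<le> L * (10 * r i)" using L0 d by (rule mult_left_mono[rotated])
      finally show "s \<in> cball s0 ((10 * L) * r i)" by (simp add: mult_ac)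
    qed
    then have "emeasure lborel (W \<inter> \<tau> -` cball i (5 * r i)) \<le> emeasure lborel (cball s0 ((10 * L) * r i))"
      by (intro emeasure_mono) auto
    also have "\<dots> = ennreal ((10 * L) ^ DIM('s)) * emeasure lborel (cball i (r i))"
      using r I(2) that L0 by (intro emeasure_lborel_cball_scale) (auto simp: less_imp_le)
    finally show ?thesis .
  qed simp
  have "W \<inter> \<tau> -` A \<subseteq> (\<Union>i\<in>I. W \<inter> \<tau> -` cball i (5 * r i))" using I(4) by blast
  then have "emeasure lborel (W \<inter> \<tau> -` A) \<le> emeasure lborel (\<Union>i\<in>I. W \<inter> \<tau> -` cball i (5 * r i))"
    using m I(1) by (intro emeasure_mono sets.countable_UN'') auto
  also have "\<dots> \<le> (\<integral>\<^sup>+i. emeasure lborel (W \<inter> \<tau> -` cball i (5 * r i)) \<partial>count_space I)"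
    using m I(1) by (intro emeasure_countable_UN_le) auto
  also have "\<dots> \<le> (\<integral>\<^sup>+i. ennreal ((10 * L) ^ DIM('s)) * emeasure lborel (cball i (r i)) \<partial>count_space I)"
    using piece by (intro nn_integral_mono) auto
  also have "\<dots> = ennreal ((10 * L) ^ DIM('s)) * (\<integral>\<^sup>+i. emeasure lborel (cball i (r i)) \<partial>count_space I)"
    by (intro nn_integral_cmult) auto
  also have "(\<integral>\<^sup>+i. emeasure lborel (cball i (r i)) \<partial>count_space I) = emeasure lborel (\<Union>i\<in>I. cball i (r i))"
    using I by (intro emeasure_UN_countable[symmetric]) (auto simp: disjoint_family_on_def pairwise_def disjnt_def)
  also have "\<dots> \<le> emeasure lborel U"
    using r I(2) U(1) by (intro emeasure_mono) auto
  also have "emeasure lborel U = emeasure lebesgue U" using U(1) by simp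
  also have "\<dots> \<le> emeasure lebesgue (A \<union> (U - A))"
    using A U(1,2) by (intro emeasure_mono) auto
  also have "\<dots> \<le> emeasure lebesgue A + emeasure lebesgue (U - A)"
    using A U(3) by (intro emeasure_subadditive) (auto simp: fmeasurable_def)
  also have "\<dots> \<le> emeasure lborel A + ennreal e'"
    using A U(4) by (intro add_mono) auto
  finally have "emeasure lborel (W \<inter> \<tau> -` A) \<le> ennreal ((10 * L) ^ DIM('s)) * (emeasure lborel A + ennreal e')"
    by (simp add: mult_left_mono)
  also have "\<dots> = ennreal ((10 * L) ^ DIM('s)) * emeasure lborel A + ennreal ((10 * L) ^ DIM('s) * e')"
    using L0 e' by (simp add: distrib_left ennreal_mult)
  also have "\<dots> \<le> ennreal ((10 * L) ^ DIM('s)) * emeasure lborel A + ennreal e"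
  proof (intro add_left_mono ennreal_leI)
    have "0 \<le> (10 * L) ^ DIM('s)" using L0 by simp
    then have "e = ((10 * L) ^ DIM('s) + 1) * e'" unfolding e'_def by simp
    then show "(10 * L) ^ DIM('s) * e' \<le> e" using e' by (simp add: distrib_right)
  qed
  finally show "emeasure lborel (W \<inter> \<tau> -` A) \<le> ennreal ((10 * L) ^ DIM('s)) * emeasure lborel A + ennreal e" .
qed

text \<open>The setwise bound says that the image of Lebesgue measure on \<open>W\<close> under
  \<tau> is dominated by a multiple of Lebesgue measure, so it passes to integrals.\<close>

lemma nn_integral_section_le:
  fixes \<sigma> \<tau> :: "'s::euclidean_space \<Rightarrow> 's"
  assumes L: "L-lipschitz_on C \<sigma>" and \<tau>: "\<And>s. s \<in> W \<Longrightarrow> \<tau> s \<in> C \<and> \<sigma> (\<tau> s) = s"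
    and W: "W \<in> sets borel" and \<tau>m: "\<tau> \<in> borel_measurable borel"
    and C: "C \<in> sets borel" and G: "G \<in> borel_measurable borel"
  shows "(\<integral>\<^sup>+s\<in>W. G (\<tau> s) \<partial>lborel) \<le> ennreal ((10 * L) ^ DIM('s)) * (\<integral>\<^sup>+a\<in>C. G a \<partial>lborel)"
proof -
  define \<nu> where "\<nu> = distr (density lborel (indicator W)) borel \<tau>"
  define c where "c = ennreal ((10 * L) ^ DIM('s))"
  have \<tau>m': "\<tau> \<in> density lborel (indicator W) \<rightarrow>\<^sub>M borel" using \<tau>m by simp
  have em: "emeasure \<nu> A = emeasure lborel (W \<inter> \<tau> -` A)" if "A \<in> sets borel" for A
    unfolding \<nu>_def using W measurable_sets[OF \<tau>m that] that
    by (simp add: emeasure_distr[OF \<tau>m'] emeasure_restricted)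
  have "\<nu> \<le> scale_measure c lborel"
  proof -
    have "emeasure \<nu> A \<le> emeasure (scale_measure c lborel) A" for A
    proof (cases "A \<in> sets borel")
      case True
      then show ?thesis using emeasure_lborel_section_le[OF L \<tau> W \<tau>m True] by (simp add: em c_def)
    next
      case False
      then have "A \<notin> sets \<nu>" by (simp add: \<nu>_def)
      then show ?thesis by (simp add: emeasure_notin_sets)
    qed
    then show ?thesis by (simp add: le_measure_iff le_fun_def \<nu>_def space_scale_measure)
  qed
  have "(\<integral>\<^sup>+s\<in>W. G (\<tau> s) \<partial>lborel) = (\<integral>\<^sup>+s. G (\<tau> s) * indicator C (\<tau> s) * indicator W s \<partial>lborel)"
    using \<tau> by (intro nn_integral_cong) (auto simp: indicator_def)
  also have "\<dots> = (\<integral>\<^sup>+a\<in>C. G a \<partial>\<nu>)"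
    unfolding \<nu>_def using G C W \<tau>m
    by (subst nn_integral_distr[OF \<tau>m']) (auto simp: nn_integral_density mult_ac)
  also have "\<dots> \<le> (\<integral>\<^sup>+a\<in>C. G a \<partial>scale_measure c lborel)"
    using \<open>\<nu> \<le> _\<close> by (intro nn_integral_mono_measure) (auto simp: \<nu>_def)
  also have "\<dots> = c * (\<integral>\<^sup>+a\<in>C. G a \<partial>lborel)"
    using G C by (intro nn_integral_scale_measure) auto
  finally show ?thesis by (simp add: c_def)
qed

text \<open>Here \<open>k\<close> is a test function of the endpoint \<open>s\<close> and the noise
  parameter \<open>a\<close>. Both maps cover the ball \<open>W\<close> around \<open>c\<close>, and
  two parameters with the same endpoint differ by at most \<open>2 * \<eta>\<close>, so
  \<open>k\<close> varies by at most \<open>1 / 2\<close> between them: \<open>1 - k\<close> at the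
  first plus \<open>k\<close> at the second is at least \<open>1 / 2\<close> on \<open>W\<close>.
  The factor 15 per dimension is \<open>10 * (3 / 2)\<close> with \<open>3 / 2\<close> the Lipschitz
  constant of the maps, and the factor 2 undoes the \<open>1 / 2\<close>.\<close>

lemma near_identity_overlap:
  fixes \<sigma> \<sigma>' :: "'s::euclidean_space \<Rightarrow> 's" and k :: "'s \<Rightarrow> 's \<Rightarrow> real"
  assumes r: "r > 0"
    and cont: "continuous_on UNIV \<sigma>" "continuous_on UNIV \<sigma>'"
    and near: "\<And>a b. a \<in> cball 0 r \<Longrightarrow> b \<in> cball 0 r \<Longrightarrow> norm (\<sigma> a - \<sigma> b - (a - b)) \<le> norm (a - b) / 2"
      "\<And>a b. a \<in> cball 0 r \<Longrightarrow> b \<in> cball 0 r \<Longrightarrow> norm (\<sigma>' a - \<sigma>' b - (a - b)) \<le> norm (a - b) / 2"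
    and centre: "norm (\<sigma> 0 - c) \<le> r / 4" "norm (\<sigma>' 0 - c) \<le> r / 4"
    and close: "\<And>a. a \<in> cball 0 r \<Longrightarrow> norm (\<sigma> a - \<sigma>' a) \<le> \<eta>"
    and k: "(\<lambda>(s, a). k s a) \<in> borel_measurable borel" "\<And>s a. 0 \<le> k s a \<and> k s a \<le> 1"
      "\<And>s a b. \<bar>k s a - k s b\<bar> \<le> B * norm (a - b)"
    and \<eta>: "B * (2 * \<eta>) \<le> 1 / 2" "B \<ge> 0"
  shows "emeasure lborel (cball (0::'s) (r / 4)) \<le> ennreal (2 * 15 ^ DIM('s)) *
    ((\<integral>\<^sup>+a\<in>cball 0 r. ennreal (1 - k (\<sigma> a) a) \<partial>lborel) + (\<integral>\<^sup>+a\<in>cball 0 r. ennreal (k (\<sigma>' a) a) \<partial>lborel))"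
proof -
  define W where "W = cball c (r / 4)"
  have lips: "(3/2)-lipschitz_on (cball 0 r) f" and sec: "\<exists>\<tau>. \<tau> \<in> borel_measurable borel \<and> (\<forall>s\<in>W. \<tau> s \<in> cball 0 r \<and> f (\<tau> s) = s)"
    and inv: "\<And>a b. a \<in> cball 0 r \<Longrightarrow> b \<in> cball 0 r \<Longrightarrow> norm (a - b) \<le> 2 * norm (f a - f b)"
    if f: "continuous_on UNIV f" "\<And>a b. a \<in> cball 0 r \<Longrightarrow> b \<in> cball 0 r \<Longrightarrow> norm (f a - f b - (a - b)) \<le> norm (a - b) / 2"
      "norm (f 0 - c) \<le> r / 4" for f :: "'s \<Rightarrow> 's"
  proof -
    show "(3/2)-lipschitz_on (cball 0 r) f"
    proof (rule lipschitz_onI)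
      fix a b assume "a \<in> cball (0::'s) r" "b \<in> cball (0::'s) r"
      then show "dist (f a) (f b) \<le> 3 / 2 * dist a b"
        using f(2)[of a b] norm_triangle_sub[of "f a - f b" "a - b"] by (simp add: dist_norm)
    qed simp
    show inv: "norm (a - b) \<le> 2 * norm (f a - f b)" if "a \<in> cball 0 r" "b \<in> cball 0 r" for a b
      using f(2)[OF that] norm_triangle_sub[of "a - b" "f a - f b"] by (simp add: norm_minus_commute)
    \<comment> \<open>Brouwer's theorem: sending \<open>a\<close> to \<open>x + (a - f a)\<close>
      maps the ball into itself, as \<open>x\<close> and \<open>f 0\<close> are within
      \<open>r / 4\<close> of \<open>c\<close> and \<open>f\<close> deviates from a translation by
      at most \<open>r / 2\<close>.\<close>
    have "\<exists>a\<in>cball 0 r. f a = s" if s: "s \<in> W" for s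
    proof (rule brouwer_surjective_cball[OF _ r s])
      show "continuous_on (cball 0 r) f" using f(1) by (rule continuous_on_subset) simp
      fix x a assume x: "x \<in> W" and a: "a \<in> cball (0::'s) r"
      have "x + (a - f a) = (x - c) - (f 0 - c) - (f a - f 0 - (a - 0))" by simp
      also have "norm \<dots> \<le> norm (x - c) + norm (f 0 - c) + norm (f a - f 0 - (a - 0))"
        using norm_triangle_ineq4[of "(x - c) - (f 0 - c)" "f a - f 0 - (a - 0)"]
          norm_triangle_ineq4[of "x - c" "f 0 - c"] by linarith
      also have "\<dots> \<le> r / 4 + r / 4 + r / 2"
        using x a f(2)[of a 0] f(3) r by (intro add_mono) (auto simp: W_def dist_norm norm_minus_commute)
      finally show "x + (a - f a) \<in> cball 0 r" by simp
    qed
    then obtain \<tau> where \<tau>: "\<And>s. s \<in> W \<Longrightarrow> \<tau> s \<in> cball 0 r \<and> f (\<tau> s) = s" by metis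
    have "2-lipschitz_on W \<tau>"
    proof (rule lipschitz_onI)
      fix s s' assume "s \<in> W" "s' \<in> W"
      then show "dist (\<tau> s) (\<tau> s') \<le> 2 * dist s s'"
        using inv[of "\<tau> s" "\<tau> s'"] \<tau>[of s] \<tau>[of s'] by (simp add: dist_norm)
    qed simp
    from lipschitz_on_continuous_on[OF this]
    have "(\<lambda>s. if s \<in> W then \<tau> s else 0) \<in> borel_measurable borel"
      by (rule borel_measurable_continuous_on_if[rotated]) (auto simp: W_def)
    then show "\<exists>\<tau>. \<tau> \<in> borel_measurable borel \<and> (\<forall>s\<in>W. \<tau> s \<in> cball 0 r \<and> f (\<tau> s) = s)"
      using \<tau> by (intro exI[of _ "\<lambda>s. if s \<in> W then \<tau> s else 0"]) auto
  qed
  obtain \<tau> where \<tau>: "\<tau> \<in> borel_measurable borel" "\<And>s. s \<in> W \<Longrightarrow> \<tau> s \<in> cball 0 r \<and> \<sigma> (\<tau> s) = s"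
    using sec[OF cont(1) near(1) centre(1)] by blast
  obtain \<tau>' where \<tau>': "\<tau>' \<in> borel_measurable borel" "\<And>s. s \<in> W \<Longrightarrow> \<tau>' s \<in> cball 0 r \<and> \<sigma>' (\<tau>' s) = s"
    using sec[OF cont(2) near(2) centre(2)] by blast
  have km: "(\<lambda>a. k (f a) (g a)) \<in> borel_measurable borel"
    if "f \<in> borel_measurable borel" "g \<in> borel_measurable borel" for f g :: "'s \<Rightarrow> 's"
    using measurable_compose[OF _ k(1), of "\<lambda>a. (f a, g a)" borel] that by simp
  have \<sigma>m: "\<sigma> \<in> borel_measurable borel" "\<sigma>' \<in> borel_measurable borel"
    using cont by (auto intro: borel_measurable_continuous_onI)
  have Wm: "W \<in> sets borel" by (simp add: W_def)
  have pw: "1 / 2 \<le> (1 - k s (\<tau> s)) + k s (\<tau>' s)" if s: "s \<in> W" for s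
  proof -
    have "norm (\<tau> s - \<tau>' s) \<le> 2 * norm (\<sigma> (\<tau> s) - \<sigma> (\<tau>' s))"
      using \<tau>(2)[OF s] \<tau>'(2)[OF s] by (intro inv[OF cont(1) near(1) centre(1)]) auto
    also have "\<sigma> (\<tau> s) = \<sigma>' (\<tau>' s)" using \<tau>(2)[OF s] \<tau>'(2)[OF s] by simp
    also have "2 * norm (\<sigma>' (\<tau>' s) - \<sigma> (\<tau>' s)) \<le> 2 * \<eta>"
      using close[of "\<tau>' s"] \<tau>'(2)[OF s] by (simp add: norm_minus_commute)
    finally have "B * norm (\<tau> s - \<tau>' s) \<le> B * (2 * \<eta>)" using \<eta>(2) by (intro mult_left_mono)
    then have "\<bar>k s (\<tau> s) - k s (\<tau>' s)\<bar> \<le> 1 / 2" using k(3)[of s "\<tau> s" "\<tau>' s"] \<eta>(1) by linarith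
    then show ?thesis by linarith
  qed
  have "ennreal (1 / 2) * emeasure lborel W = (\<integral>\<^sup>+s\<in>W. ennreal (1 / 2) \<partial>lborel)"
    using Wm by (subst nn_integral_cmult_indicator) auto
  also have "\<dots> \<le> (\<integral>\<^sup>+s. ennreal (1 - k s (\<tau> s)) * indicator W s + ennreal (k s (\<tau>' s)) * indicator W s \<partial>lborel)"
  proof (intro nn_integral_mono)
    fix s
    show "ennreal (1 / 2) * indicator W s \<le> ennreal (1 - k s (\<tau> s)) * indicator W s + ennreal (k s (\<tau>' s)) * indicator W s"
    proof (cases "s \<in> W")
      case True
      have "ennreal (1 / 2) \<le> ennreal ((1 - k s (\<tau> s)) + k s (\<tau>' s))"
        by (intro ennreal_leI pw True)
      also have "\<dots> = ennreal (1 - k s (\<tau> s)) + ennreal (k s (\<tau>' s))"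
        using k(2) by (intro ennreal_plus) auto
      finally show ?thesis using True by simp
    qed simp
  qed
  also have "\<dots> = (\<integral>\<^sup>+s\<in>W. ennreal (1 - k s (\<tau> s)) \<partial>lborel) + (\<integral>\<^sup>+s\<in>W. ennreal (k s (\<tau>' s)) \<partial>lborel)"
    using Wm km[OF _ \<tau>(1), of "\<lambda>s. s"] km[OF _ \<tau>'(1), of "\<lambda>s. s"] by (intro nn_integral_add) auto
  also have "(\<integral>\<^sup>+s\<in>W. ennreal (1 - k s (\<tau> s)) \<partial>lborel) = (\<integral>\<^sup>+s\<in>W. ennreal (1 - k (\<sigma> (\<tau> s)) (\<tau> s)) \<partial>lborel)"
    using \<tau>(2) by (intro nn_integral_cong) (auto simp: indicator_def)
  also have "\<dots> \<le> ennreal ((10 * (3/2)) ^ DIM('s)) * (\<integral>\<^sup>+a\<in>cball 0 r. ennreal (1 - k (\<sigma> a) a) \<partial>lborel)"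
    using km[OF \<sigma>m(1), of "\<lambda>a. a"]
    by (intro nn_integral_section_le[OF lips[OF cont(1) near(1) centre(1)] \<tau>(2) Wm \<tau>(1)]) auto
  also have "(\<integral>\<^sup>+s\<in>W. ennreal (k s (\<tau>' s)) \<partial>lborel) = (\<integral>\<^sup>+s\<in>W. ennreal (k (\<sigma>' (\<tau>' s)) (\<tau>' s)) \<partial>lborel)"
    using \<tau>'(2) by (intro nn_integral_cong) (auto simp: indicator_def)
  also have "\<dots> \<le> ennreal ((10 * (3/2)) ^ DIM('s)) * (\<integral>\<^sup>+a\<in>cball 0 r. ennreal (k (\<sigma>' a) a) \<partial>lborel)"
    using km[OF \<sigma>m(2), of "\<lambda>a. a"]
    by (intro nn_integral_section_le[OF lips[OF cont(2) near(2) centre(2)] \<tau>'(2) Wm \<tau>'(1)]) auto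
  finally have main: "ennreal (1 / 2) * emeasure lborel W \<le> ennreal (15 ^ DIM('s)) *
      ((\<integral>\<^sup>+a\<in>cball 0 r. ennreal (1 - k (\<sigma> a) a) \<partial>lborel) + (\<integral>\<^sup>+a\<in>cball 0 r. ennreal (k (\<sigma>' a) a) \<partial>lborel))"
    by (simp add: distrib_left add_mono)
  have "emeasure lborel (cball (0::'s) (r / 4)) = emeasure lborel W"
    using r by (simp add: W_def emeasure_cball)
  also have "\<dots> = ennreal 2 * (ennreal (1 / 2) * emeasure lborel W)"
  proof -
    have "ennreal 2 * ennreal (1 / 2) = 1" by (subst ennreal_mult[symmetric]) auto
    then show ?thesis by (simp only: mult.assoc[symmetric] mult_1)
  qed
  also have "\<dots> \<le> ennreal 2 * (ennreal (15 ^ DIM('s)) *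
      ((\<integral>\<^sup>+a\<in>cball 0 r. ennreal (1 - k (\<sigma> a) a) \<partial>lborel) + (\<integral>\<^sup>+a\<in>cball 0 r. ennreal (k (\<sigma>' a) a) \<partial>lborel)))"
    by (intro mult_left_mono main) auto
  finally show ?thesis by (simp add: ennreal_mult mult.assoc)
qed

subsection \<open>Quasi-invariance of decomposable laws\<close>

text \<open>Without second countability the product of two Borel algebras may be smaller than the
  Borel algebra of the product, so sums of measurable functions need care; a real coefficient makes
  one factor second countable.\<close>

lemma borel_measurable_add_scaleR:
  fixes g :: "'w \<Rightarrow> 'b::real_normed_vector"
  assumes "g \<in> borel_measurable N" "t \<in> borel_measurable N"
  shows "(\<lambda>w. g w + t w *\<^sub>R b) \<in> borel_measurable N"
proof -
  have "(\<lambda>w :: 'b \<times> real. fst w + snd w *\<^sub>R b) \<in> borel_measurable (borel \<Otimes>\<^sub>M borel)"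
    by (intro borel_measurable_pair_continuous' continuous_intros)
  from measurable_compose[OF measurable_Pair[OF assms] this] show ?thesis by simp
qed

lemma borel_measurable_add_sum_scaleR:
  fixes g :: "'w \<Rightarrow> 'b::real_normed_vector"
  assumes "finite B" "g \<in> borel_measurable N" "\<And>b. b \<in> B \<Longrightarrow> t b \<in> borel_measurable N"
  shows "(\<lambda>w. g w + (\<Sum>b\<in>B. t b w *\<^sub>R f b)) \<in> borel_measurable N"
  using assms
proof (induction B)
  case (insert b B)
  have "(\<lambda>w. (g w + (\<Sum>b\<in>B. t b w *\<^sub>R f b)) + t b w *\<^sub>R f b) \<in> borel_measurable N"
    using insert by (intro borel_measurable_add_scaleR) auto
  then show ?case using insert.hyps by (simp add: algebra_simps)
qed simp

lemma orthonormal_basis_exists: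
  fixes B :: "'a::real_inner set"
  assumes "finite B"
  shows "\<exists>C. finite C \<and> pairwise orthogonal C \<and> (\<forall>b\<in>C. norm b = 1) \<and> span C = span B"
proof -
  obtain C where C: "finite C" "span C = span B" "pairwise orthogonal C"
    using basis_orthogonal[OF assms] by blast
  define D where "D = (\<lambda>b. b /\<^sub>R norm b) ` (C - {0})"
  have "finite D" using C by (simp add: D_def)
  moreover have "pairwise orthogonal D"
    using C(3) unfolding D_def pairwise_def by (auto simp: orthogonal_def)
  moreover have "\<forall>b\<in>D. norm b = 1" by (auto simp: D_def)
  moreover have "span D = span C"
  proof (rule subset_antisym; rule span_minimal[OF _ subspace_span])
    show "D \<subseteq> span C" by (auto simp: D_def intro: span_scale span_base)
    have "c \<in> span D" if "c \<in> C" for c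
    proof (cases "c = 0")
      case False
      then have "c = norm c *\<^sub>R (c /\<^sub>R norm c)" by simp
      moreover have "c /\<^sub>R norm c \<in> span D" using that False by (auto simp: D_def intro: span_base)
      ultimately show ?thesis by (metis span_scale)
    qed (simp add: span_zero)
    then show "C \<subseteq> span D" by blast
  qed
  ultimately show ?thesis using C(2) by metis
qed

lemma subspace_lebesgue_basis:
  assumes "\<exists>B. finite B \<and> F = span B"
  obtains B where "finite B" "span B = F"
    "subspace_lebesgue F = distr (Pi\<^sub>M B (\<lambda>_. lborel)) borel (\<lambda>a. \<Sum>b\<in>B. a b *\<^sub>R b)"
proof -
  have ex: "\<exists>B. finite B \<and> pairwise orthogonal B \<and> (\<forall>b\<in>B. norm b = 1) \<and> span B = F"
    using assms orthonormal_basis_exists by metis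
  from someI_ex[OF this] show ?thesis
    by (intro that[of "SOME B. finite B \<and> pairwise orthogonal B \<and> (\<forall>b\<in>B. norm b = 1) \<and> span B = F"])
       (auto simp: subspace_lebesgue_def Let_def)
qed

lemma PiM_lborel_translation:
  assumes B: "finite B"
  shows "distr (Pi\<^sub>M B (\<lambda>_. lborel)) (Pi\<^sub>M B (\<lambda>_. lborel)) (\<lambda>a. \<lambda>b\<in>B. a b + (c b :: real)) = Pi\<^sub>M B (\<lambda>_. lborel)"
proof -
  interpret product_sigma_finite "\<lambda>_. lborel :: real measure" ..
  have m: "(\<lambda>a. \<lambda>b\<in>B. a b + c b) \<in> Pi\<^sub>M B (\<lambda>_. lborel) \<rightarrow>\<^sub>M Pi\<^sub>M B (\<lambda>_. lborel)"
    by (intro measurable_restrict) measurable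
  show ?thesis
  proof (rule PiM_eqI[OF B])
    fix A :: "'a \<Rightarrow> real set" assume A: "\<And>i. i \<in> B \<Longrightarrow> A i \<in> sets lborel"
    have A': "(\<lambda>x. x + c i) -` A i \<in> sets borel" if "i \<in> B" for i
      using measurable_sets[of "\<lambda>x. x + c i" borel borel "A i"] A[OF that] by simp
    have "emeasure (distr (Pi\<^sub>M B (\<lambda>_. lborel)) (Pi\<^sub>M B (\<lambda>_. lborel)) (\<lambda>a. \<lambda>b\<in>B. a b + c b)) (Pi\<^sub>E B A)
        = emeasure (Pi\<^sub>M B (\<lambda>_. lborel)) ((\<lambda>a. \<lambda>b\<in>B. a b + c b) -` Pi\<^sub>E B A \<inter> space (Pi\<^sub>M B (\<lambda>_. lborel)))"
      using A B by (intro emeasure_distr m sets_PiM_I_finite) auto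
    also have "(\<lambda>a. \<lambda>b\<in>B. a b + c b) -` Pi\<^sub>E B A \<inter> space (Pi\<^sub>M B (\<lambda>_. lborel)) = Pi\<^sub>E B (\<lambda>i. (\<lambda>x. x + c i) -` A i)"
      by (auto simp: space_PiM PiE_iff)
    also have "emeasure (Pi\<^sub>M B (\<lambda>_. lborel)) \<dots> = (\<Prod>i\<in>B. emeasure lborel ((\<lambda>x. x + c i) -` A i))"
      using A' B by (intro emeasure_PiM) auto
    also have "\<dots> = (\<Prod>i\<in>B. emeasure lborel (A i))"
    proof (intro prod.cong refl)
      fix i assume i: "i \<in> B"
      have "emeasure lborel (A i) = emeasure (distr lborel borel ((+) (c i))) (A i)"
        by (simp add: lborel_distr_plus)
      also have "\<dots> = emeasure lborel ((\<lambda>x. x + c i) -` A i)"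
      proof -
        have "(+) (c i) = (\<lambda>x. x + c i)" by auto
        then show ?thesis using A[OF i] by (simp add: emeasure_distr)
      qed
      finally show "emeasure lborel ((\<lambda>x. x + c i) -` A i) = emeasure lborel (A i)" ..
    qed
    finally show "emeasure (distr (Pi\<^sub>M B (\<lambda>_. lborel)) (Pi\<^sub>M B (\<lambda>_. lborel)) (\<lambda>a. \<lambda>b\<in>B. a b + c b)) (Pi\<^sub>E B A)
        = (\<Prod>i\<in>B. emeasure lborel (A i))" .
  qed simp
qed

lemma span_finite_combination:
  assumes "finite B" "w \<in> span B"
  obtains c where "w = (\<Sum>b\<in>B. c b *\<^sub>R b)"
  using assms by (auto simp: span_finite)

text \<open>\<open>Q0\<close> is the image under \<open>add\<close> of a measure with density \<rho>
  with respect to the product \<open>T\<close> of \<open>N\<close> and Lebesgue measure on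
  coordinates of \<open>F\<close>. The image of \<open>T\<close> itself is invariant under shifts
  along \<open>F\<close>, so a shift by \<open>l a\<close> only exchanges densities: the upper bound
  \<open>c1\<close> is used at the unshifted point, the lower bound \<open>c0\<close> at the shifted
  one. Averaging over the ball of parameters gives the volume factor.\<close>

lemma quasi_invariance:
  fixes Q0 :: "L2J measure" and l :: "'s::euclidean_space \<Rightarrow> L2J"
  assumes Q0: "prob_space Q0" "sets Q0 = sets borel"
    and F: "\<exists>B. finite B \<and> F = span B" and p: "continuous_on UNIV p"
    and \<rho>: "continuous_on UNIV \<rho>" "\<And>y. \<rho> y \<ge> 0"
    and dis: "\<And>A. A \<in> sets borel \<Longrightarrow> emeasure Q0 A =
      (\<integral>\<^sup>+v. (\<integral>\<^sup>+u. ennreal (\<rho> (u + v)) * indicator A (u + v) \<partial>subspace_lebesgue F) \<partial>distr Q0 borel p)"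
    and l: "linear l" "range l \<subseteq> F"
    and R: "\<And>a. a \<in> cball 0 r \<Longrightarrow> norm (l a) \<le> R" "R' \<le> R"
    and c: "\<And>y. y \<in> ball y1 (2 * R) \<Longrightarrow> c0 \<le> \<rho> y \<and> \<rho> y \<le> c1" "c0 \<ge> 0"
    and G: "G \<in> borel_measurable borel"
  shows "ennreal c0 * (\<integral>\<^sup>+y\<in>ball y1 R'. (\<integral>\<^sup>+a\<in>cball 0 r. G (y + l a) \<partial>lborel) \<partial>Q0)
    \<le> ennreal c1 * emeasure lborel (cball (0::'s) r) * (\<integral>\<^sup>+y. G y \<partial>Q0)"
proof -
  interpret Q0: prob_space Q0 by fact
  obtain B where B: "finite B" "span B = F"
    "subspace_lebesgue F = distr (Pi\<^sub>M B (\<lambda>_. lborel)) borel (\<lambda>a. \<Sum>b\<in>B. a b *\<^sub>R b)"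
    using subspace_lebesgue_basis[OF F] by blast
  define PB where "PB = Pi\<^sub>M B (\<lambda>_. lborel :: real measure)"
  define N where "N = distr Q0 borel p"
  define T where "T = N \<Otimes>\<^sub>M PB"
  define add where "add = (\<lambda>w :: L2J \<times> (L2J \<Rightarrow> real). fst w + (\<Sum>b\<in>B. snd w b *\<^sub>R b))"
  interpret ps: product_sigma_finite "\<lambda>_. lborel :: real measure" ..
  interpret PB: sigma_finite_measure PB unfolding PB_def by (rule ps.sigma_finite[OF B(1)])
  have pm: "p \<in> Q0 \<rightarrow>\<^sub>M borel"
    using borel_measurable_continuous_onI[OF p] measurable_cong_sets[OF Q0(2) refl] by blast
  interpret N: prob_space N unfolding N_def by (rule Q0.prob_space_distr[OF pm])
  interpret NP: pair_sigma_finite N PB ..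
  interpret T: sigma_finite_measure T
    unfolding T_def by (rule sigma_finite_pair_measure[OF N.sigma_finite_measure_axioms PB.sigma_finite_measure_axioms])
  interpret TL: pair_sigma_finite T "lborel :: 's measure" ..
  have setsN: "sets N = sets borel" by (simp add: N_def)
  have addm: "add \<in> borel_measurable T"
    unfolding add_def T_def
  proof (rule borel_measurable_add_sum_scaleR[OF B(1)])
    show "fst \<in> borel_measurable (N \<Otimes>\<^sub>M PB)"
      using measurable_fst[of N PB] measurable_cong_sets[OF refl setsN] by blast
    show "(\<lambda>w. snd w b) \<in> borel_measurable (N \<Otimes>\<^sub>M PB)" if "b \<in> B" for b
    proof -
      have "(\<lambda>a. a b) \<in> PB \<rightarrow>\<^sub>M borel"
        using measurable_component_singleton[OF that, of "\<lambda>_. lborel :: real measure"] by (simp add: PB_def)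
      from measurable_compose[OF measurable_snd this] show ?thesis .
    qed
  qed
  have \<rho>m: "\<rho> \<in> borel_measurable borel" using \<rho>(1) by (rule borel_measurable_continuous_onI)
  have \<rho>am: "(\<lambda>w. ennreal (\<rho> (add w))) \<in> borel_measurable T"
    using measurable_compose[OF addm \<rho>m] by measurable
  have Hm: "(\<lambda>w. H (add w)) \<in> borel_measurable T" if "H \<in> borel_measurable borel" for H :: "L2J \<Rightarrow> ennreal"
    by (rule measurable_compose[OF addm that])
  have Q0_eq: "Q0 = distr (density T (\<lambda>w. ennreal (\<rho> (add w)))) borel add"
  proof (rule measure_eqI)
    fix A assume "A \<in> sets Q0"
    then have A: "A \<in> sets borel" by (simp add: Q0)
    have sm: "(\<lambda>a. \<Sum>b\<in>B. a b *\<^sub>R b) \<in> PB \<rightarrow>\<^sub>M (borel :: L2J measure)"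
      using borel_measurable_add_sum_scaleR[OF B(1), of "\<lambda>_. 0" PB "\<lambda>b a. a b" "\<lambda>b. b"]
        measurable_component_singleton[of _ B "\<lambda>_. lborel :: real measure"] by (simp add: PB_def)
    have meas: "(\<lambda>w. ennreal (\<rho> (add w)) * indicator A (add w)) \<in> borel_measurable T"
      using \<rho>am Hm[of "indicator A"] A by measurable
    have "emeasure (distr (density T (\<lambda>w. ennreal (\<rho> (add w)))) borel add) A
        = (\<integral>\<^sup>+w. ennreal (\<rho> (add w)) * indicator A (add w) \<partial>T)"
      using addm A \<rho>am measurable_sets[OF addm A]
      by (subst emeasure_distr) (auto simp: emeasure_density indicator_vimage[symmetric] intro!: nn_integral_cong split: split_indicator)
    also have "\<dots> = (\<integral>\<^sup>+v. (\<integral>\<^sup>+b. ennreal (\<rho> (add (v, b))) * indicator A (add (v, b)) \<partial>PB) \<partial>N)"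
      using PB.nn_integral_fst[of _ N, OF meas[unfolded T_def]] by (simp add: T_def)
    also have "\<dots> = (\<integral>\<^sup>+v. (\<integral>\<^sup>+u. ennreal (\<rho> (u + v)) * indicator A (u + v) \<partial>subspace_lebesgue F) \<partial>N)"
    proof (rule nn_integral_cong)
      fix v :: L2J
      have cont: "(\<lambda>u. u + v) \<in> borel_measurable borel"
        by (intro borel_measurable_continuous_onI continuous_intros)
      have "(\<lambda>u. ennreal (\<rho> (u + v)) * indicator A (u + v)) \<in> borel_measurable borel"
        using measurable_compose[OF cont \<rho>m] measurable_compose[OF cont, of "indicator A :: L2J \<Rightarrow> ennreal"] A
        by measurable
      then show "(\<integral>\<^sup>+b. ennreal (\<rho> (add (v, b))) * indicator A (add (v, b)) \<partial>PB) =
          (\<integral>\<^sup>+u. ennreal (\<rho> (u + v)) * indicator A (u + v) \<partial>subspace_lebesgue F)"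
        unfolding B(3) PB_def[symmetric] by (subst nn_integral_distr[OF sm]) (auto simp: add_def add.commute)
    qed
    also have "\<dots> = emeasure Q0 A" using dis[OF A] by (simp add: N_def)
    finally show "emeasure Q0 A = emeasure (distr (density T (\<lambda>w. ennreal (\<rho> (add w)))) borel add) A" ..
  qed (simp add: Q0)
  have int_eq: "(\<integral>\<^sup>+y. H y \<partial>Q0) = (\<integral>\<^sup>+w. ennreal (\<rho> (add w)) * H (add w) \<partial>T)"
    if H: "H \<in> borel_measurable borel" for H
  proof -
    have addm': "add \<in> density T (\<lambda>w. ennreal (\<rho> (add w))) \<rightarrow>\<^sub>M borel" using addm by simp
    show ?thesis
      by (subst Q0_eq, subst nn_integral_distr[OF addm'])
         (use H \<rho>am Hm[OF H] in \<open>auto simp: nn_integral_density\<close>)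
  qed
  have shift: "(\<integral>\<^sup>+w. H (add w + l a) \<partial>T) = (\<integral>\<^sup>+w. H (add w) \<partial>T)"
    if H: "H \<in> borel_measurable borel" for H :: "L2J \<Rightarrow> ennreal" and a
  proof -
    obtain k where k: "l a = (\<Sum>b\<in>B. k b *\<^sub>R b)"
      using span_finite_combination[OF B(1), of "l a"] l(2) B(2) by blast
    have Hs: "(\<lambda>w. H (add w + l a)) \<in> borel_measurable T"
    proof -
      have "(\<lambda>y. y + l a) \<in> borel_measurable borel"
        by (intro borel_measurable_continuous_onI continuous_intros)
      from measurable_compose[OF addm measurable_compose[OF this H]] show ?thesis .
    qed
    define sh where "sh = (\<lambda>a. \<lambda>b\<in>B. a b + k b)"
    have shm: "sh \<in> PB \<rightarrow>\<^sub>M PB" unfolding sh_def PB_def by (intro measurable_restrict) measurable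
    have "(\<integral>\<^sup>+w. H (add w + l a) \<partial>T) = (\<integral>\<^sup>+v. (\<integral>\<^sup>+b. H (add (v, b) + l a) \<partial>PB) \<partial>N)"
      using PB.nn_integral_fst[of _ N, OF Hs[unfolded T_def]] by (simp add: T_def)
    also have "\<dots> = (\<integral>\<^sup>+v. (\<integral>\<^sup>+b. H (add (v, b)) \<partial>PB) \<partial>N)"
    proof (rule nn_integral_cong)
      fix v assume "v \<in> space N"
      then have Hv: "(\<lambda>b. H (add (v, b))) \<in> borel_measurable PB"
        using measurable_compose_Pair1[OF _ Hm[OF H, unfolded T_def]] by simp
      have "(\<integral>\<^sup>+b. H (add (v, b) + l a) \<partial>PB) = (\<integral>\<^sup>+b. H (add (v, sh b)) \<partial>PB)"
        by (intro nn_integral_cong arg_cong[where f = H])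
           (simp add: add_def sh_def k scaleR_add_left sum.distrib)
      also have "\<dots> = (\<integral>\<^sup>+b. H (add (v, b)) \<partial>distr PB PB sh)"
        using nn_integral_distr[OF shm, of "\<lambda>b. H (add (v, b))"] Hv by simp
      also have "distr PB PB sh = PB" unfolding PB_def sh_def by (rule PiM_lborel_translation[OF B(1)])
      finally show "(\<integral>\<^sup>+b. H (add (v, b) + l a) \<partial>PB) = (\<integral>\<^sup>+b. H (add (v, b)) \<partial>PB)" .
    qed
    also have "\<dots> = (\<integral>\<^sup>+w. H (add w) \<partial>T)"
      using PB.nn_integral_fst[of _ N, OF Hm[OF H, unfolded T_def]] by (simp add: T_def)
    finally show ?thesis .
  qed
  have lcont: "continuous_on UNIV l" using l(1) by (simp add: linear_continuous_on linear_conv_bounded_linear)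
  have plus_l: "(\<lambda>w :: L2J \<times> 's. fst w + l (snd w)) \<in> borel_measurable (borel \<Otimes>\<^sub>M borel)"
    by (intro borel_measurable_pair_continuous' continuous_intros continuous_on_compose2[OF lcont]) auto
  \<comment> \<open>Truncation to the doubled ball, which contains every shift
    \<open>y + l a\<close> of a point of \<open>ball y1 R'\<close>; there the lower bound
    \<open>c0\<close> of the density is available.\<close>
  define H where "H = (\<lambda>y. indicator (ball y1 (2 * R)) y * G y)"
  have H: "H \<in> borel_measurable borel" unfolding H_def by (intro borel_measurable_times_ennreal borel_measurable_indicator G) auto
  define J where "J = (\<lambda>y. (\<integral>\<^sup>+a\<in>cball 0 r. G (y + l a) \<partial>(lborel :: 's measure)))"
  have J: "J \<in> borel_measurable borel"
  proof -
    have "(\<lambda>w. G (fst w + l (snd w))) \<in> borel_measurable (borel \<Otimes>\<^sub>M lborel)"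
      using measurable_compose[OF plus_l G]
      unfolding measurable_cong_sets[OF sets_pair_measure_cong[OF refl sets_lborel] refl] .
    then have "(\<lambda>w. G (fst w + l (snd w)) * indicator (cball 0 r) (snd w)) \<in> borel_measurable (borel \<Otimes>\<^sub>M lborel)"
      by (rule borel_measurable_times_ennreal) (rule measurable_compose[OF measurable_snd borel_measurable_indicator], simp)
    from lborel.borel_measurable_nn_integral_fst[OF this] show ?thesis by (simp add: J_def)
  qed
  have joint: "(\<lambda>w. indicator (cball 0 r) (snd w) * H (add (fst w) + l (snd w))) \<in> borel_measurable (T \<Otimes>\<^sub>M lborel)"
  proof -
    have "snd \<in> T \<Otimes>\<^sub>M (lborel :: 's measure) \<rightarrow>\<^sub>M borel"
      using measurable_snd[of T "lborel :: 's measure"] unfolding measurable_cong_sets[OF refl sets_lborel] .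
    from measurable_Pair[OF measurable_compose[OF measurable_fst addm] this]
    have "(\<lambda>w. (add (fst w), snd w)) \<in> T \<Otimes>\<^sub>M (lborel :: 's measure) \<rightarrow>\<^sub>M borel \<Otimes>\<^sub>M borel" .
    from measurable_compose[OF this measurable_compose[OF plus_l H]]
    have "(\<lambda>w. H (add (fst w) + l (snd w))) \<in> borel_measurable (T \<Otimes>\<^sub>M lborel)" by simp
    then show ?thesis
      by (rule borel_measurable_times_ennreal[rotated])
         (rule measurable_compose[OF measurable_snd borel_measurable_indicator], simp)
  qed
  have "(\<integral>\<^sup>+y\<in>ball y1 R'. J y \<partial>Q0) = (\<integral>\<^sup>+w. ennreal (\<rho> (add w)) * (J (add w) * indicator (ball y1 R') (add w)) \<partial>T)"
    by (intro int_eq borel_measurable_times_ennreal J borel_measurable_indicator) auto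
  also have "\<dots> \<le> (\<integral>\<^sup>+w. ennreal c1 * (\<integral>\<^sup>+a. indicator (cball 0 r) a * H (add w + l a) \<partial>lborel) \<partial>T)"
  proof (rule nn_integral_mono)
    fix w
    show "ennreal (\<rho> (add w)) * (J (add w) * indicator (ball y1 R') (add w))
      \<le> ennreal c1 * (\<integral>\<^sup>+a. indicator (cball 0 r) a * H (add w + l a) \<partial>lborel)"
    proof (cases "add w \<in> ball y1 R'")
      case True
      then have d: "dist y1 (add w) < R'" by simp
      have "J (add w) = (\<integral>\<^sup>+a. indicator (cball 0 r) a * H (add w + l a) \<partial>lborel)"
        unfolding J_def
      proof (rule nn_integral_cong)
        fix a :: 's
        have "dist y1 (add w + l a) < 2 * R" if "a \<in> cball 0 r"
        proof -
          have "dist y1 (add w + l a) \<le> dist y1 (add w) + dist (add w) (add w + l a)" by (rule dist_triangle)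
          also have "dist (add w) (add w + l a) = norm (l a)" by (simp add: dist_norm)
          finally show ?thesis using R(1)[OF that] R(2) d by linarith
        qed
        then show "G (add w + l a) * indicator (cball 0 r) a = indicator (cball 0 r) a * H (add w + l a)"
          by (auto simp: H_def indicator_def)
      qed
      moreover have "\<rho> (add w) \<le> c1"
      proof -
        have "R' > 0" using d zero_le_dist[of y1 "add w"] by linarith
        then show ?thesis using c(1)[of "add w"] d R(2) by simp
      qed
      ultimately show ?thesis using True by (auto intro!: mult_right_mono ennreal_leI)
    qed simp
  qed
  also have "\<dots> = ennreal c1 * (\<integral>\<^sup>+w. (\<integral>\<^sup>+a. indicator (cball 0 r) a * H (add w + l a) \<partial>lborel) \<partial>T)"
    using lborel.borel_measurable_nn_integral_fst[OF joint] by (intro nn_integral_cmult) simp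
  also have "(\<integral>\<^sup>+w. (\<integral>\<^sup>+a. indicator (cball 0 r) a * H (add w + l a) \<partial>lborel) \<partial>T)
      = (\<integral>\<^sup>+a. (\<integral>\<^sup>+w. indicator (cball 0 r) a * H (add w + l a) \<partial>T) \<partial>lborel)"
    using TL.Fubini'[of "\<lambda>w a. indicator (cball 0 r) a * H (add w + l a)"] joint by (simp add: case_prod_unfold)
  also have "\<dots> = (\<integral>\<^sup>+a. indicator (cball (0::'s) r) a * (\<integral>\<^sup>+w. H (add w) \<partial>T) \<partial>lborel)"
  proof (rule nn_integral_cong)
    fix a :: 's
    have "(\<lambda>y. y + l a) \<in> borel_measurable borel"
      by (intro borel_measurable_continuous_onI continuous_intros)
    from measurable_compose[OF addm measurable_compose[OF this H]]
    have "(\<integral>\<^sup>+w. indicator (cball 0 r) a * H (add w + l a) \<partial>T) = indicator (cball 0 r) a * (\<integral>\<^sup>+w. H (add w + l a) \<partial>T)"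
      by (intro nn_integral_cmult)
    then show "(\<integral>\<^sup>+w. indicator (cball 0 r) a * H (add w + l a) \<partial>T) = indicator (cball 0 r) a * (\<integral>\<^sup>+w. H (add w) \<partial>T)"
      by (simp add: shift[OF H])
  qed
  also have "\<dots> = emeasure lborel (cball (0::'s) r) * (\<integral>\<^sup>+w. H (add w) \<partial>T)"
    by (subst nn_integral_multc) (auto intro!: borel_measurable_indicator)
  finally have "ennreal c0 * (\<integral>\<^sup>+y\<in>ball y1 R'. J y \<partial>Q0) \<le>
      ennreal c0 * (ennreal c1 * (emeasure lborel (cball (0::'s) r) * (\<integral>\<^sup>+w. H (add w) \<partial>T)))"
    by (intro mult_left_mono) auto
  also have "\<dots> = ennreal c1 * emeasure lborel (cball (0::'s) r) * (\<integral>\<^sup>+w. ennreal c0 * H (add w) \<partial>T)"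
    using Hm[OF H] by (subst nn_integral_cmult) (auto simp: mult_ac)
  also have "\<dots> \<le> ennreal c1 * emeasure lborel (cball (0::'s) r) * (\<integral>\<^sup>+w. ennreal (\<rho> (add w)) * G (add w) \<partial>T)"
  proof (intro mult_left_mono nn_integral_mono)
    fix w
    show "ennreal c0 * H (add w) \<le> ennreal (\<rho> (add w)) * G (add w)"
      using c(1)[of "add w"] by (auto simp: H_def indicator_def intro!: mult_right_mono ennreal_leI)
  qed auto
  also have "(\<integral>\<^sup>+w. ennreal (\<rho> (add w)) * G (add w) \<partial>T) = (\<integral>\<^sup>+y. G y \<partial>Q0)"
    by (rule int_eq[OF G, symmetric])
  finally show ?thesis by (simp add: J_def)
qed

text \<open>Finds a point of the support without a countable base: if each point of \<open>K\<close>
  had a null ball around it, finitely many of these would cover \<open>K\<close>.\<close>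

lemma compact_positive_point:
  fixes K :: "'a::metric_space set"
  assumes K: "compact K" and pos: "emeasure M K > 0" and M: "sets M = sets borel"
  shows "\<exists>y\<in>K. \<forall>r>0. emeasure M (ball y r) > 0"
proof (rule ccontr)
  assume "\<not> ?thesis"
  then obtain r where r: "\<And>y. y \<in> K \<Longrightarrow> r y > 0 \<and> emeasure M (ball y (r y)) = 0"
    by (metis not_gr_zero)
  have "K \<subseteq> (\<Union>y\<in>K. ball y (r y))" using r by force
  then obtain D where D: "D \<subseteq> K" "finite D" "K \<subseteq> (\<Union>y\<in>D. ball y (r y))"
    using compactE_image[OF K, of K "\<lambda>y. ball y (r y)"] by auto
  have "emeasure M K \<le> emeasure M (\<Union>y\<in>D. ball y (r y))"
    using D by (intro emeasure_mono) (auto simp: M)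
  also have "\<dots> \<le> (\<Sum>y\<in>D. emeasure M (ball y (r y)))"
    using D by (intro emeasure_subadditive_finite) (auto simp: M)
  also have "\<dots> = 0" using r D by (intro sum.neutral) auto
  finally show False using pos by simp
qed

subsection \<open>Overlap near a controllable point\<close>

lemma ennreal_divide_leI:
  assumes le: "ennreal a \<le> ennreal b * I" and "b > 0" "a \<ge> 0"
  shows "ennreal (a / b) \<le> I"
proof -
  have "ennreal (a / b) = ennreal (1 / b) * ennreal a"
    using assms by (subst ennreal_mult[symmetric]) auto
  also have "\<dots> \<le> ennreal (1 / b) * (ennreal b * I)" by (intro mult_left_mono le) auto
  also have "\<dots> = ennreal (1 / b * b) * I"
    using assms by (subst ennreal_mult) (auto simp: mult.assoc)
  finally show ?thesis using assms by simp
qed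

context oscillators begin

lemma solves_linearised_add:
  assumes "solves_linearised V \<gamma>1 \<gamma>n q (L2J_fun \<xi>) w" "solves_linearised V \<gamma>1 \<gamma>n q (L2J_fun \<xi>') w'"
  shows "solves_linearised V \<gamma>1 \<gamma>n q (L2J_fun (\<xi> + \<xi>')) (\<lambda>s. w s + w' s)"
  unfolding solves_linearised_def
proof (intro conjI ballI)
  show "continuous_on {0..1} (\<lambda>s. w s + w' s)"
    using assms by (intro continuous_intros) (auto simp: solves_linearised_def)
  fix s :: real assume s: "s \<in> {0..1}"
  obtain N where N: "negligible N" "\<And>s. s \<in> {0..1} - N \<Longrightarrow> L2J_fun (\<xi> + \<xi>') s = L2J_fun \<xi> s + L2J_fun \<xi>' s"
    by (rule AE_unit_interval_negligible[OF L2J_fun_add[of \<xi> \<xi>']]) blast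
  let ?f = "\<lambda>\<xi> w \<tau>. (snd (w \<tau>), - (hessian V (q \<tau>) *v fst (w \<tau>)) + boundary_force \<gamma>1 \<gamma>n (snd (w \<tau>)) (L2J_fun \<xi> \<tau>))"
  have "((\<lambda>\<tau>. ?f \<xi> w \<tau> + ?f \<xi>' w' \<tau>) has_integral w s + w' s) {0..s}"
    using assms s by (intro has_integral_add) (auto simp: solves_linearised_def)
  then show "(?f (\<xi> + \<xi>') (\<lambda>s. w s + w' s) has_integral w s + w' s) {0..s}"
  proof (rule has_integral_spike[OF N(1), rotated])
    fix \<tau> assume "\<tau> \<in> {0..s} - N"
    then show "?f (\<xi> + \<xi>') (\<lambda>s. w s + w' s) \<tau> = ?f \<xi> w \<tau> + ?f \<xi>' w' \<tau>"
      using N(2)[of \<tau>] s by (simp add: boundary_force_def matrix_vector_right_distrib algebra_simps)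
  qed
qed

lemma solves_linearised_scaleR:
  assumes "solves_linearised V \<gamma>1 \<gamma>n q (L2J_fun \<xi>) w"
  shows "solves_linearised V \<gamma>1 \<gamma>n q (L2J_fun (c *\<^sub>R \<xi>)) (\<lambda>s. c *\<^sub>R w s)"
  unfolding solves_linearised_def
proof (intro conjI ballI)
  show "continuous_on {0..1} (\<lambda>s. c *\<^sub>R w s)"
    using assms by (intro continuous_intros) (auto simp: solves_linearised_def)
  fix s :: real assume s: "s \<in> {0..1}"
  obtain N where N: "negligible N" "\<And>s. s \<in> {0..1} - N \<Longrightarrow> L2J_fun (c *\<^sub>R \<xi>) s = c *\<^sub>R L2J_fun \<xi> s"
    by (rule AE_unit_interval_negligible[OF L2J_fun_scaleR[of c \<xi>]]) blast
  let ?f = "\<lambda>\<xi> w \<tau>. (snd (w \<tau>), - (hessian V (q \<tau>) *v fst (w \<tau>)) + boundary_force \<gamma>1 \<gamma>n (snd (w \<tau>)) (L2J_fun \<xi> \<tau>))"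
  have "((\<lambda>\<tau>. c *\<^sub>R ?f \<xi> w \<tau>) has_integral c *\<^sub>R w s) {0..s}"
    using assms s by (intro has_integral_cmul) (auto simp: solves_linearised_def)
  then show "(?f (c *\<^sub>R \<xi>) (\<lambda>s. c *\<^sub>R w s) has_integral c *\<^sub>R w s) {0..s}"
  proof (rule has_integral_spike[OF N(1), rotated])
    fix \<tau> assume "\<tau> \<in> {0..s} - N"
    then show "?f (c *\<^sub>R \<xi>) (\<lambda>s. c *\<^sub>R w s) \<tau> = c *\<^sub>R ?f \<xi> w \<tau>"
      using N(2)[of \<tau>] s by (simp add: boundary_force_def matrix_vector_mult_scaleR algebra_simps)
  qed
qed

lemma solves_linearised_sum:
  assumes "finite I" "I \<noteq> {}" "\<And>i. i \<in> I \<Longrightarrow> solves_linearised V \<gamma>1 \<gamma>n q (L2J_fun (\<xi> i)) (w i)"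
  shows "solves_linearised V \<gamma>1 \<gamma>n q (L2J_fun (\<Sum>i\<in>I. c i *\<^sub>R \<xi> i)) (\<lambda>s. \<Sum>i\<in>I. c i *\<^sub>R w i s)"
  using assms
proof (induction I rule: finite_ne_induct)
  case (singleton i)
  then show ?case by (simp add: solves_linearised_scaleR)
next
  case (insert i I)
  then show ?case by (simp add: solves_linearised_add solves_linearised_scaleR)
qed

text \<open>Controls steering the linearised system to a basis are replaced by nearby elements of one of
  the spaces \<open>F n\<close>; the resulting finite-dimensional family of perturbations of the noise moves the
  endpoint almost like the identity.\<close>

lemma near_identity_chart:
  assumes LC: "\<And>v. \<exists>\<xi> w. solves_linearised V \<gamma>1 \<gamma>n (\<lambda>t. snd (path x0 y0 t)) (L2J_fun \<xi>) w \<and> w 1 = v"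
    and F: "incseq F" "closure (\<Union>n. F n) = UNIV" "\<And>n. \<exists>B. finite B \<and> F n = span B"
  shows "\<exists>n (l :: 'n state \<Rightarrow> L2J) \<delta>. linear l \<and> range l \<subseteq> F n \<and> \<delta> > 0 \<and>
    (\<forall>x y a b. norm (x - x0) < \<delta> \<longrightarrow> norm (y + l a - y0) < \<delta> \<longrightarrow> norm (y + l b - y0) < \<delta> \<longrightarrow>
      norm (step x (y + l a) - step x (y + l b) - (a - b)) \<le> norm (a - b) / 2)"
proof -
  obtain C where C: "C \<ge> 0" "\<And>e. e > 0 \<Longrightarrow> \<exists>\<delta>>0. \<forall>x y y' \<xi> w. norm (x - x0) < \<delta> \<longrightarrow> norm (y - y0) < \<delta> \<longrightarrow> norm (y' - y0) < \<delta> \<longrightarrow>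
     solves_linearised V \<gamma>1 \<gamma>n (\<lambda>t. snd (path x0 y0 t)) (L2J_fun \<xi>) w \<longrightarrow>
     norm (step x y - step x y' - (snd (w 1), fst (w 1))) \<le> e * norm (y - y') + C * norm (y - y' - \<xi>)"
    using step_strict_derivative[of x0 y0] by blast
  define d where "d = real (DIM('n state))"
  have d: "d > 0" by (simp add: d_def)
  \<comment> \<open>Makes the error of replacing the controls at most \<open>norm a / 4\<close>
    after summing over the \<open>d\<close> basis directions; the choice \<open>1 / (4 * L)\<close>
    below contributes the other quarter. The summand 1 keeps the denominator positive when
    \<open>C = 0\<close>.\<close>
  define \<eta> where "\<eta> = 1 / (4 * (C + 1) * d)"
  have \<eta>: "\<eta> > 0" using C d by (simp add: \<eta>_def)
  have "\<exists>\<xi> w. solves_linearised V \<gamma>1 \<gamma>n (\<lambda>t. snd (path x0 y0 t)) (L2J_fun \<xi>) w \<and> w 1 = (snd e, fst e)"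
    for e :: "'n state" by (rule LC)
  then obtain \<xi> w where \<xi>: "\<And>e. solves_linearised V \<gamma>1 \<gamma>n (\<lambda>t. snd (path x0 y0 t)) (L2J_fun (\<xi> e)) (w e)"
      "\<And>e :: 'n state. w e 1 = (snd e, fst e)" by metis
  have "\<exists>n h. h \<in> F n \<and> norm (h - \<xi> e) < \<eta>" for e
  proof -
    have "\<xi> e \<in> closure (\<Union>n. F n)" using F(2) by simp
    then obtain h where "h \<in> (\<Union>n. F n)" "dist h (\<xi> e) < \<eta>" using \<eta> closure_approachable by blast
    then show ?thesis by (auto simp: dist_norm)
  qed
  then obtain m h where h: "\<And>e. h e \<in> F (m e)" "\<And>e. norm (h e - \<xi> e) < \<eta>" by metis
  define n where "n = Max (m ` (Basis :: 'n state set))"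
  have hn: "h e \<in> F n" if "e \<in> Basis" for e
    using h(1)[of e] incseqD[OF F(1), of "m e" n] that by (auto simp: n_def)
  define l where "l = (\<lambda>a. \<Sum>e\<in>Basis. (a \<bullet> e) *\<^sub>R h e)"
  have lin: "linear l"
    by (rule linearI) (simp_all add: l_def inner_add_left scaleR_add_left sum.distrib scaleR_sum_right)
  have range: "range l \<subseteq> F n"
  proof -
    obtain B where "F n = span B" using F(3) by blast
    then show ?thesis using hn by (auto simp: l_def intro!: span_sum span_scale)
  qed
  obtain L where L: "L > 0" "\<And>a. norm (l a) \<le> L * norm a" using linear_bounded_pos[OF lin] by blast
  define \<Xi> where "\<Xi> = (\<lambda>a. \<Sum>e\<in>Basis. (a \<bullet> e) *\<^sub>R \<xi> e)"
  have err: "C * norm (l a - \<Xi> a) \<le> norm a / 4" for a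
  proof -
    have "norm (l a - \<Xi> a) = norm (\<Sum>e\<in>Basis. (a \<bullet> e) *\<^sub>R (h e - \<xi> e))"
      by (simp add: l_def \<Xi>_def scaleR_diff_right sum_subtractf)
    also have "\<dots> \<le> (\<Sum>e\<in>Basis. \<bar>a \<bullet> e\<bar> * norm (h e - \<xi> e))"
      by (rule order_trans[OF norm_sum]) simp
    also have "\<dots> \<le> (\<Sum>e\<in>(Basis :: 'n state set). norm a * \<eta>)"
      using h(2) by (intro sum_mono mult_mono Basis_le_norm) (auto intro: less_imp_le)
    also have "\<dots> = norm a * (d * \<eta>)" by (simp add: d_def)
    finally have "C * norm (l a - \<Xi> a) \<le> (C + 1) * (norm a * (d * \<eta>))"
      using C(1) by (intro mult_mono) auto
    also have "\<dots> = norm a * (((C + 1) * d) * \<eta>)" by simp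
    also have "((C + 1) * d) * \<eta> = 1 / 4"
    proof -
      have "(C + 1) * d \<noteq> 0" using C(1) d by simp
      then show ?thesis unfolding \<eta>_def mult.assoc by (metis (no_types) mult.commute nonzero_divide_mult_cancel_left times_divide_eq_right mult.right_neutral)
    qed
    also have "norm a * (1 / 4) = norm a / 4" by simp
    finally show ?thesis .
  qed
  have sol: "solves_linearised V \<gamma>1 \<gamma>n (\<lambda>t. snd (path x0 y0 t)) (L2J_fun (\<Xi> a)) (\<lambda>s. \<Sum>e\<in>Basis. (a \<bullet> e) *\<^sub>R w e s)" for a
    unfolding \<Xi>_def using \<xi>(1) by (intro solves_linearised_sum) auto
  have endpoint: "(snd (\<Sum>e\<in>Basis. (a \<bullet> e) *\<^sub>R w e 1), fst (\<Sum>e\<in>Basis. (a \<bullet> e) *\<^sub>R w e 1)) = a" for a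
  proof -
    have "(snd (\<Sum>e\<in>Basis. (a \<bullet> e) *\<^sub>R w e 1), fst (\<Sum>e\<in>Basis. (a \<bullet> e) *\<^sub>R w e 1)) = (\<Sum>e\<in>Basis. (a \<bullet> e) *\<^sub>R e)"
      by (intro prod_eqI) (simp_all add: \<xi>(2) fst_sum snd_sum)
    then show ?thesis by (simp add: euclidean_representation)
  qed
  obtain \<delta> where \<delta>: "\<delta> > 0" "\<And>x y y' \<xi> w. norm (x - x0) < \<delta> \<Longrightarrow> norm (y - y0) < \<delta> \<Longrightarrow> norm (y' - y0) < \<delta> \<Longrightarrow>
     solves_linearised V \<gamma>1 \<gamma>n (\<lambda>t. snd (path x0 y0 t)) (L2J_fun \<xi>) w \<Longrightarrow>
     norm (step x y - step x y' - (snd (w 1), fst (w 1))) \<le> 1 / (4 * L) * norm (y - y') + C * norm (y - y' - \<xi>)"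
    using C(2)[of "1 / (4 * L)"] L(1) by auto
  have "norm (step x (y + l a) - step x (y + l b) - (a - b)) \<le> norm (a - b) / 2"
    if "norm (x - x0) < \<delta>" "norm (y + l a - y0) < \<delta>" "norm (y + l b - y0) < \<delta>" for x y a b
  proof -
    have diff: "y + l a - (y + l b) = l (a - b)" by (simp add: linear_diff[OF lin])
    have "norm (step x (y + l a) - step x (y + l b) - (a - b))
        \<le> 1 / (4 * L) * norm (l (a - b)) + C * norm (l (a - b) - \<Xi> (a - b))"
      using \<delta>(2)[OF that sol[of "a - b"]] unfolding endpoint diff .
    also have "\<dots> \<le> 1 / (4 * L) * (L * norm (a - b)) + norm (a - b) / 4"
      using L by (intro add_mono mult_left_mono err) auto
    also have "\<dots> = norm (a - b) / 2" using L(1) by simp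
    finally show ?thesis .
  qed
  then show ?thesis using lin range \<delta>(1) by blast
qed

lemma continuous_step_comp:
  assumes "continuous_on A f" "continuous_on A g"
  shows "continuous_on A (\<lambda>w. step (f w) (g w))"
  using continuous_on_compose2[OF continuous_step continuous_on_Pair[OF assms]] by simp

text \<open>The conclusion bounds the difference of the two integrals of \<open>h\<close> by
  \<open>1 - \<epsilon>\<close>, written with nonnegative integrals: no test function separates the
  two laws completely. Around a point \<open>y1\<close> of positive density all of whose balls have
  positive mass, the noise is averaged over the shifts \<open>l a\<close>. On each family of shifts
  both endpoint maps are near the identity, so \<open>near_identity_overlap\<close> applies, and
  \<open>quasi_invariance\<close> removes the averaging.\<close>

lemma overlap:
  assumes Q0: "prob_space Q0" "sets Q0 = sets borel" and K: "compact K" "emeasure Q0 K = 1"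
    and LC: "\<And>y v. y \<in> K \<Longrightarrow> \<exists>\<xi> w. solves_linearised V \<gamma>1 \<gamma>n (\<lambda>t. snd (path x0 y t)) (L2J_fun \<xi>) w \<and> w 1 = v"
    and F: "incseq F" "closure (\<Union>n. F n) = UNIV" "\<And>n. \<exists>B. finite B \<and> F n = span B"
    and p: "\<And>n. continuous_on UNIV (p n)"
    and \<rho>: "\<And>n. continuous_on UNIV (\<rho> n)" "\<And>n y. \<rho> n y \<ge> 0"
    and dis: "\<And>n A. A \<in> sets borel \<Longrightarrow> emeasure Q0 A =
      (\<integral>\<^sup>+v. (\<integral>\<^sup>+u. ennreal (\<rho> n (u + v)) * indicator A (u + v) \<partial>subspace_lebesgue (F n)) \<partial>distr Q0 borel (p n))"
    and B: "B \<ge> 0"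
  shows "\<exists>\<epsilon>>0. \<exists>\<delta>>0. \<forall>x x' h. norm (x - x0) < \<delta> \<longrightarrow> norm (x' - x0) < \<delta> \<longrightarrow>
    (\<lambda>(s, y). h s y) \<in> borel_measurable (borel \<Otimes>\<^sub>M borel) \<longrightarrow> (\<forall>s y. 0 \<le> h s y \<and> h s y \<le> 1) \<longrightarrow>
    (\<forall>s y y'. \<bar>h s y - h s y'\<bar> \<le> B * norm (y - y')) \<longrightarrow>
    ennreal \<epsilon> \<le> (\<integral>\<^sup>+y. ennreal (1 - h (step x y) y) \<partial>Q0) + (\<integral>\<^sup>+y. ennreal (h (step x' y) y) \<partial>Q0)"
proof -
  interpret Q0: prob_space Q0 by fact
  have "emeasure Q0 K > 0" using K(2) by simp
  from compact_positive_point[OF K(1) this Q0(2)]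
  obtain y0 where y0: "y0 \<in> K" "\<And>r. r > 0 \<Longrightarrow> emeasure Q0 (ball y0 r) > 0" by blast
  obtain n l \<delta>0 where chart: "linear l" "range l \<subseteq> F n" "\<delta>0 > 0"
    "\<And>x y a b. norm (x - x0) < \<delta>0 \<Longrightarrow> norm (y + l a - y0) < \<delta>0 \<Longrightarrow> norm (y + l b - y0) < \<delta>0 \<Longrightarrow>
      norm (step x (y + l a) - step x (y + l b) - (a - b)) \<le> norm (a - b) / 2"
    using near_identity_chart[OF LC[OF y0(1)] F] by blast
  obtain L where L: "L > 0" "\<And>a. norm (l a) \<le> L * norm a" using linear_bounded_pos[OF chart(1)] by blast
  have \<rho>m: "\<rho> n \<in> borel_measurable borel" using \<rho>(1) by (rule borel_measurable_continuous_onI)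
  \<comment> \<open>The density vanishes only on a \<open>Q0\<close>-null set, so some level set
    \<open>1 / real (Suc k) \<le> \<rho> n y\<close> carries mass near \<open>y0\<close>. Level set
    and ball are closed, hence compact within \<open>K\<close>, and
    \<open>compact_positive_point\<close> applies a second time to give \<open>y1\<close>.\<close>
  have "\<exists>k::nat. emeasure Q0 (K \<inter> cball y0 (\<delta>0 / 2) \<inter> {y. 1 / real (Suc k) \<le> \<rho> n y}) > 0"
  proof (rule ccontr)
    assume "\<not> ?thesis"
    then have "K \<inter> cball y0 (\<delta>0 / 2) \<inter> {y. 1 / real (Suc k) \<le> \<rho> n y} \<in> null_sets Q0" for k :: nat
      using K(1) \<rho>m by (auto simp: null_sets_def Q0(2) compact_imp_closed)
    then have "(\<Union>k::nat. K \<inter> cball y0 (\<delta>0 / 2) \<inter> {y. 1 / real (Suc k) \<le> \<rho> n y}) \<in> null_sets Q0" by blast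
    moreover have "{y. \<rho> n y = 0} \<in> null_sets Q0"
    proof -
      have Z: "{y. \<rho> n y = 0} \<in> sets borel" using \<rho>m by simp
      have "emeasure Q0 {y. \<rho> n y = 0} = (\<integral>\<^sup>+v. (\<integral>\<^sup>+u. 0 \<partial>subspace_lebesgue (F n)) \<partial>distr Q0 borel (p n))"
        unfolding dis[OF Z, of n] by (intro nn_integral_cong) (auto simp: indicator_def)
      then show ?thesis using Z by (auto simp: null_sets_def Q0(2))
    qed
    moreover have "- K \<in> null_sets Q0"
    proof -
      have "K \<in> sets Q0" using K(1) by (simp add: Q0(2) compact_imp_closed)
      then have "emeasure Q0 (space Q0 - K) = 0" using K(2) by (subst emeasure_compl) (auto simp: Q0.emeasure_space_1)
      moreover have "space Q0 = UNIV" using sets_eq_imp_space_eq[OF Q0(2)] by simp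
      ultimately show ?thesis using K(1) by (auto simp: null_sets_def Q0(2) compact_imp_closed Compl_eq_Diff_UNIV)
    qed
    ultimately have "(\<Union>k::nat. K \<inter> cball y0 (\<delta>0 / 2) \<inter> {y. 1 / real (Suc k) \<le> \<rho> n y}) \<union> {y. \<rho> n y = 0} \<union> - K \<in> null_sets Q0"
      by (intro null_sets.Un)
    moreover have "ball y0 (\<delta>0 / 2) \<subseteq> (\<Union>k::nat. K \<inter> cball y0 (\<delta>0 / 2) \<inter> {y. 1 / real (Suc k) \<le> \<rho> n y}) \<union> {y. \<rho> n y = 0} \<union> - K"
    proof
      fix y assume y: "y \<in> ball y0 (\<delta>0 / 2)"
      show "y \<in> (\<Union>k::nat. K \<inter> cball y0 (\<delta>0 / 2) \<inter> {y. 1 / real (Suc k) \<le> \<rho> n y}) \<union> {y. \<rho> n y = 0} \<union> - K"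
      proof (cases "\<rho> n y = 0")
        case False
        then have "\<rho> n y > 0" using \<rho>(2)[of n y] by linarith
        then obtain k :: nat where "inverse (real (Suc k)) < \<rho> n y" using reals_Archimedean by blast
        then show ?thesis using y by (auto simp: inverse_eq_divide intro: less_imp_le)
      qed simp
    qed
    ultimately have "ball y0 (\<delta>0 / 2) \<in> null_sets Q0"
      by (intro null_sets_subset[OF _ _ \<open>ball y0 (\<delta>0 / 2) \<subseteq> _\<close>]) (simp_all add: Q0(2))
    then show False using y0(2)[of "\<delta>0 / 2"] chart(3) by (auto simp: null_sets_def)
  qed
  then obtain k :: nat where k: "emeasure Q0 (K \<inter> cball y0 (\<delta>0 / 2) \<inter> {y. 1 / real (Suc k) \<le> \<rho> n y}) > 0" by blast
  have "compact (K \<inter> cball y0 (\<delta>0 / 2) \<inter> {y. 1 / real (Suc k) \<le> \<rho> n y})"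
    using K(1) by (intro compact_Int_closed closed_Collect_le continuous_intros \<rho>(1)) auto
  from compact_positive_point[OF this k Q0(2)]
  obtain y1 where y1: "dist y0 y1 \<le> \<delta>0 / 2" "1 / real (Suc k) \<le> \<rho> n y1" "\<And>r. r > 0 \<Longrightarrow> emeasure Q0 (ball y1 r) > 0"
    by auto
  have \<rho>1: "\<rho> n y1 > 0" using y1(2) by (rule order_less_le_trans[rotated]) simp
  have "isCont (\<rho> n) y1" using \<rho>(1)[of n] by (simp add: continuous_on_eq_continuous_at)
  then obtain R0 where R0: "R0 > 0" "\<And>y. dist y y1 < R0 \<Longrightarrow> dist (\<rho> n y) (\<rho> n y1) < \<rho> n y1 / 2"
    using \<rho>1 unfolding continuous_at_eps_delta by (meson half_gt_zero)
  \<comment> \<open>\<open>2 * R \<le> R0\<close> keeps the density between half and twice its value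
    at \<open>y1\<close>; \<open>R \<le> \<delta>0 / 8\<close> keeps \<open>y + l a\<close> in the
    domain of the chart, as \<open>\<delta>0 / 2 + R' + R < \<delta>0\<close>.\<close>
  define R where "R = min (R0 / 2) (\<delta>0 / 8)"
  have R: "R > 0" "2 * R \<le> R0" "R \<le> \<delta>0 / 8" using R0(1) chart(3) by (auto simp: R_def)
  have \<rho>b: "\<rho> n y1 / 2 \<le> \<rho> n y \<and> \<rho> n y \<le> 2 * \<rho> n y1" if "y \<in> ball y1 (2 * R)" for y
  proof -
    have "dist y y1 < R0" using that R(2) by (simp add: dist_commute)
    then have "\<bar>\<rho> n y - \<rho> n y1\<bar> < \<rho> n y1 / 2" using R0(2) by (simp only: dist_real_def)
    then show ?thesis using \<rho>1 by linarith
  qed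
  define r where "r = R / L"
  have r: "r > 0" using R(1) L(1) by (simp add: r_def)
  have lR: "norm (l a) \<le> R" if "a \<in> cball 0 r" for a
  proof -
    have "norm (l a) \<le> L * r" using L that by (intro order_trans[OF L(2)] mult_left_mono) auto
    then show ?thesis using L(1) by (simp add: r_def)
  qed
  have "isCont (\<lambda>(x, y). step x y) (x0, y1)"
    using continuous_step continuous_on_eq_continuous_at[OF open_UNIV] by blast
  moreover have "r / 4 > 0" using r by simp
  ultimately obtain \<delta>1 where \<delta>1: "\<delta>1 > 0" "\<And>w. dist w (x0, y1) < \<delta>1 \<Longrightarrow>
      dist (case w of (x, y) \<Rightarrow> step x y) (case (x0, y1) of (x, y) \<Rightarrow> step x y) < r / 4"
    unfolding continuous_at_eps_delta by metis
  define R' where "R' = min R (\<delta>1 / 2)"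
  have R': "R' > 0" "R' \<le> R" "R' \<le> \<delta>1 / 2" using R(1) \<delta>1(1) by (auto simp: R'_def)
  define b where "b = max (norm x0) (norm y0) + \<delta>0 + 1"
  obtain Ls where Ls: "Ls > 0" "\<And>x x' y y'. norm x \<le> b \<Longrightarrow> norm x' \<le> b \<Longrightarrow> norm y \<le> b \<Longrightarrow> norm y' \<le> b \<Longrightarrow>
      norm (step x y - step x' y') \<le> Ls * (norm (x - x') + norm (y - y'))"
    using step_lipschitz[of b] by blast
  \<comment> \<open>The admissible distance of the two endpoints. As a function of the parameter
    \<open>a\<close> the test function has Lipschitz constant \<open>B * L\<close>, and
    \<open>(B * L) * (2 * \<eta>) \<le> 1 / 2\<close> is required.\<close>
  define \<eta> where "\<eta> = 1 / (4 * (B * L + 1))"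
  have \<eta>: "\<eta> > 0" using B L(1) by (simp add: \<eta>_def add_nonneg_pos)
  have B\<eta>: "(B * L) * (2 * \<eta>) \<le> 1 / 2"
  proof -
    have "B * L \<ge> 0" using B L(1) by simp
    then have "2 * (B * L) / (4 * (B * L + 1)) \<le> 1 / 2" by (subst pos_divide_le_eq) auto
    moreover have "B * L * (2 * \<eta>) = 2 * (B * L) / (4 * (B * L + 1))" unfolding \<eta>_def by simp
    ultimately show ?thesis by (simp only:)
  qed
  define \<delta> where "\<delta> = min (min \<delta>0 (\<delta>1 / 2)) (min 1 (\<eta> / (2 * Ls)))"
  have \<delta>: "\<delta> > 0" "\<delta> \<le> \<delta>0" "\<delta> \<le> \<delta>1 / 2" "\<delta> \<le> 1" "\<delta> \<le> \<eta> / (2 * Ls)"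
    using chart(3) \<delta>1(1) \<eta> Ls(1) by (auto simp: \<delta>_def)
  define \<kappa> where "\<kappa> = (2 * 15 ^ DIM('n state) :: real)"
  define m0 where "m0 = measure lborel (cball (0 :: 'n state) (r / 4))"
  define m1 where "m1 = measure lborel (cball (0 :: 'n state) r)"
  define q where "q = measure Q0 (ball y1 R')"
  have fin: "emeasure lborel (cball (0 :: 'n state) s) \<noteq> \<top>" for s
    using emeasure_lborel_cball_finite[of "0 :: 'n state" s] by (metis infinity_ennreal_def less_irrefl)
  have em: "emeasure lborel (cball (0 :: 'n state) (r / 4)) = ennreal m0" "emeasure lborel (cball (0 :: 'n state) r) = ennreal m1"
    unfolding m0_def m1_def by (intro emeasure_eq_ennreal_measure fin)+
  have m0: "m0 > 0" "m1 > 0" using r by (simp_all add: m0_def m1_def content_cball_pos)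
  have q: "emeasure Q0 (ball y1 R') = ennreal q" "q > 0"
    using y1(3)[OF R'(1)] by (auto simp: q_def Q0.emeasure_eq_measure)
  \<comment> \<open>The volume \<open>m0\<close> of the covered ball times the mass \<open>q\<close>
    of the centres \<open>y\<close>, divided by the covering constant \<kappa>, the volume
    \<open>m1\<close> of the parameters and the ratio of the two density bounds.\<close>
  define \<epsilon> where "\<epsilon> = (\<rho> n y1 / 2 * (m0 * q)) / (\<kappa> * (2 * \<rho> n y1 * m1))"
  have \<kappa>: "\<kappa> > 0" by (simp add: \<kappa>_def)
  have \<epsilon>: "\<epsilon> > 0" using m0 q \<rho>1 \<kappa> by (simp add: \<epsilon>_def)
  have "ennreal \<epsilon> \<le> (\<integral>\<^sup>+y. ennreal (1 - h (step x y) y) \<partial>Q0) + (\<integral>\<^sup>+y. ennreal (h (step x' y) y) \<partial>Q0)"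
    if x: "norm (x - x0) < \<delta>" and x': "norm (x' - x0) < \<delta>"
      and hm: "(\<lambda>(s, y). h s y) \<in> borel_measurable (borel \<Otimes>\<^sub>M borel)" and h01: "\<And>s y. 0 \<le> h s y \<and> h s y \<le> 1"
      and hB: "\<And>s y y'. \<bar>h s y - h s y'\<bar> \<le> B * norm (y - y')" for x x' h
  proof -
    define G1 where "G1 = (\<lambda>y. ennreal (1 - h (step x y) y))"
    define G2 where "G2 = (\<lambda>y. ennreal (h (step x' y) y))"
    have hsm: "(\<lambda>y. h (step z y) y) \<in> borel_measurable borel" for z
    proof -
      have "(\<lambda>y. step z y) \<in> borel_measurable borel"
        by (intro borel_measurable_continuous_onI continuous_step_comp continuous_intros)
      then have "(\<lambda>y. (step z y, y)) \<in> borel \<rightarrow>\<^sub>M borel \<Otimes>\<^sub>M borel" by (intro measurable_Pair) auto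
      from measurable_compose[OF this hm] show ?thesis by simp
    qed
    have G: "G1 \<in> borel_measurable borel" "G2 \<in> borel_measurable borel"
      unfolding G1_def G2_def using hsm by measurable
    define I where "I = (\<lambda>G y. (\<integral>\<^sup>+a\<in>cball 0 r. G (y + l a) \<partial>(lborel :: 'n state measure)))"
    have Im: "I G \<in> borel_measurable borel" if G: "G \<in> borel_measurable borel" for G :: "L2J \<Rightarrow> ennreal"
    proof -
      have lcont: "continuous_on UNIV l" using chart(1) by (simp add: linear_continuous_on linear_conv_bounded_linear)
      have "(\<lambda>w :: L2J \<times> 'n state. fst w + l (snd w)) \<in> borel_measurable (borel \<Otimes>\<^sub>M borel)"
        by (intro borel_measurable_pair_continuous' continuous_intros continuous_on_compose2[OF lcont]) auto
      from measurable_compose[OF this G]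
      have "(\<lambda>w. G (fst w + l (snd w))) \<in> borel_measurable (borel \<Otimes>\<^sub>M lborel)"
        unfolding measurable_cong_sets[OF sets_pair_measure_cong[OF refl sets_lborel] refl] .
      then have "(\<lambda>w. G (fst w + l (snd w)) * indicator (cball 0 r) (snd w)) \<in> borel_measurable (borel \<Otimes>\<^sub>M lborel)"
        by (rule borel_measurable_times_ennreal) (rule measurable_compose[OF measurable_snd borel_measurable_indicator], simp)
      from lborel.borel_measurable_nn_integral_fst[OF this] show ?thesis by (simp add: I_def)
    qed
    have pointwise: "ennreal m0 \<le> ennreal \<kappa> * (I G1 y + I G2 y)" if y: "y \<in> ball y1 R'" for y
    proof -
      have near_y0: "norm (y + l a - y0) < \<delta>0" if "a \<in> cball 0 r" for a
      proof -
        have "norm (y + l a - y0) \<le> norm (y - y1) + norm (y1 - y0) + norm (l a)"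
          using norm_triangle_ineq[of "y - y1 + (y1 - y0)" "l a"] norm_triangle_ineq[of "y - y1" "y1 - y0"] by (simp add: algebra_simps)
        also have "\<dots> < \<delta>0"
        proof -
          have "norm (y - y1) < R'" "norm (y1 - y0) \<le> \<delta>0 / 2" "norm (l a) \<le> R"
            using y y1(1) lR[OF that] by (auto simp: dist_norm norm_minus_commute)
          then show ?thesis using R R' chart(3) by linarith
        qed
        finally show ?thesis .
      qed
      have "emeasure lborel (cball (0::'n state) (r / 4)) \<le> ennreal (2 * 15 ^ DIM('n state)) *
        ((\<integral>\<^sup>+a\<in>cball 0 r. ennreal (1 - h (step x (y + l a)) (y + l a)) \<partial>lborel) +
         (\<integral>\<^sup>+a\<in>cball 0 r. ennreal (h (step x' (y + l a)) (y + l a)) \<partial>lborel))"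
      proof (rule near_identity_overlap[OF r, where \<sigma> = "\<lambda>a. step x (y + l a)" and \<sigma>' = "\<lambda>a. step x' (y + l a)"
            and k = "\<lambda>s a. h s (y + l a)" and c = "step x0 y1" and \<eta> = \<eta> and B = "B * L"])
        have lcont: "continuous_on UNIV l" using chart(1) by (simp add: linear_continuous_on linear_conv_bounded_linear)
        show "continuous_on UNIV (\<lambda>a. step x (y + l a))" "continuous_on UNIV (\<lambda>a. step x' (y + l a))"
          by (intro continuous_step_comp continuous_intros lcont)+
        show "norm (step x (y + l a) - step x (y + l b) - (a - b)) \<le> norm (a - b) / 2"
          "norm (step x' (y + l a) - step x' (y + l b) - (a - b)) \<le> norm (a - b) / 2"
          if "a \<in> cball 0 r" "b \<in> cball 0 r" for a b
          by (rule chart(4)[OF order_less_le_trans[OF x \<delta>(2)] near_y0[OF that(1)] near_y0[OF that(2)]],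
              rule chart(4)[OF order_less_le_trans[OF x' \<delta>(2)] near_y0[OF that(1)] near_y0[OF that(2)]])
        have "norm (step z (y + l 0) - step x0 y1) \<le> r / 4" if "norm (z - x0) < \<delta>" for z
        proof -
          have "dist (z, y) (x0, y1) \<le> dist z x0 + dist y y1"
            using norm_Pair_le[of "z - x0" "y - y1"] by (simp add: dist_norm)
          also have "\<dots> < \<delta>1" using that y \<delta>(3) R'(3) by (simp add: dist_norm norm_minus_commute)
          finally show ?thesis using \<delta>1(2)[of "(z, y)"] by (simp add: dist_norm linear_0[OF chart(1)])
        qed
        then show "norm (step x (y + l 0) - step x0 y1) \<le> r / 4" "norm (step x' (y + l 0) - step x0 y1) \<le> r / 4"
          using x x' by auto
        show "norm (step x (y + l a) - step x' (y + l a)) \<le> \<eta>" if a: "a \<in> cball 0 r" for a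
        proof -
          have "norm x \<le> b" "norm x' \<le> b" "norm (y + l a) \<le> b"
            using x x' \<delta>(4) near_y0[OF a] norm_triangle_ineq2[of x x0] norm_triangle_ineq2[of x' x0]
              norm_triangle_ineq2[of "y + l a" y0] chart(3) by (auto simp: b_def)
          then have "norm (step x (y + l a) - step x' (y + l a)) \<le> Ls * (norm (x - x') + norm (y + l a - (y + l a)))"
            by (intro Ls(2))
          also have "\<dots> \<le> Ls * (2 * \<delta>)"
            using Ls(1) x x' norm_triangle_ineq4[of "x - x0" "x' - x0"] by (intro mult_left_mono) auto
          also have "\<dots> \<le> \<eta>" using Ls(1) \<delta>(5) by (simp add: field_simps)
          finally show ?thesis .
        qed
        have "(\<lambda>w :: 'n state \<times> 'n state. (fst w, y + l (snd w))) \<in> borel \<rightarrow>\<^sub>M borel \<Otimes>\<^sub>M borel"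
          by (intro measurable_Pair borel_measurable_continuous_onI continuous_intros continuous_on_compose2[OF lcont]) auto
        from measurable_compose[OF this hm]
        show "(\<lambda>(s, a). h s (y + l a)) \<in> borel_measurable borel" by (simp add: case_prod_unfold)
        show "0 \<le> h s (y + l a) \<and> h s (y + l a) \<le> 1" for s a by (rule h01)
        show "\<bar>h s (y + l a) - h s (y + l b)\<bar> \<le> B * L * norm (a - b)" for s a b
        proof -
          have "\<bar>h s (y + l a) - h s (y + l b)\<bar> \<le> B * norm (l (a - b))"
            using hB[of s "y + l a" "y + l b"] by (simp add: linear_diff[OF chart(1)])
          also have "\<dots> \<le> B * (L * norm (a - b))" using B L(2) by (intro mult_left_mono)
          finally show ?thesis by (simp add: mult.assoc)
        qed
        show "B * L * (2 * \<eta>) \<le> 1 / 2" by (rule B\<eta>)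
        show "B * L \<ge> 0" using B L(1) by simp
      qed
      then show ?thesis by (simp add: em \<kappa>_def I_def G1_def G2_def)
    qed
    have "ennreal m0 * ennreal q = (\<integral>\<^sup>+y\<in>ball y1 R'. ennreal m0 \<partial>Q0)"
      by (subst nn_integral_cmult_indicator) (auto simp: Q0(2) q(1))
    also have "\<dots> \<le> (\<integral>\<^sup>+y. ennreal \<kappa> * (I G1 y * indicator (ball y1 R') y + I G2 y * indicator (ball y1 R') y) \<partial>Q0)"
    proof (rule nn_integral_mono)
      fix y
      show "ennreal m0 * indicator (ball y1 R') y \<le> ennreal \<kappa> * (I G1 y * indicator (ball y1 R') y + I G2 y * indicator (ball y1 R') y)"
        using pointwise[of y] by (auto simp: indicator_def)
    qed
    also have "\<dots> = ennreal \<kappa> * ((\<integral>\<^sup>+y\<in>ball y1 R'. I G1 y \<partial>Q0) + (\<integral>\<^sup>+y\<in>ball y1 R'. I G2 y \<partial>Q0))"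
    proof -
      have mm: "(\<lambda>y. I G y * indicator (ball y1 R') y) \<in> borel_measurable Q0" if "G \<in> borel_measurable borel" for G
        unfolding measurable_cong_sets[OF Q0(2) refl]
        by (intro borel_measurable_times_ennreal Im[OF that] borel_measurable_indicator) auto
      show ?thesis using mm[OF G(1)] mm[OF G(2)] by (simp add: nn_integral_cmult nn_integral_add)
    qed
    finally have A: "ennreal m0 * ennreal q \<le> ennreal \<kappa> * ((\<integral>\<^sup>+y\<in>ball y1 R'. I G1 y \<partial>Q0) + (\<integral>\<^sup>+y\<in>ball y1 R'. I G2 y \<partial>Q0))" .
    have QI: "ennreal (\<rho> n y1 / 2) * (\<integral>\<^sup>+y\<in>ball y1 R'. I G y \<partial>Q0) \<le> ennreal (2 * \<rho> n y1) * ennreal m1 * (\<integral>\<^sup>+y. G y \<partial>Q0)"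
      if "G \<in> borel_measurable borel" for G
      unfolding I_def em(2)[symmetric]
      by (rule quasi_invariance[OF Q0 F(3)[of n] p[of n] \<rho>(1)[of n] \<rho>(2)[of n] dis chart(1,2) lR R'(2) \<rho>b _ that])
        (use \<rho>1 in auto)
    have "ennreal (\<rho> n y1 / 2 * (m0 * q)) = ennreal (\<rho> n y1 / 2) * (ennreal m0 * ennreal q)"
      using \<rho>1 m0 q by (subst ennreal_mult, simp, simp, subst ennreal_mult) auto
    also have "\<dots> \<le> ennreal (\<rho> n y1 / 2) * (ennreal \<kappa> * ((\<integral>\<^sup>+y\<in>ball y1 R'. I G1 y \<partial>Q0) + (\<integral>\<^sup>+y\<in>ball y1 R'. I G2 y \<partial>Q0)))"
      by (intro mult_left_mono A) auto
    also have "\<dots> = ennreal \<kappa> * (ennreal (\<rho> n y1 / 2) * (\<integral>\<^sup>+y\<in>ball y1 R'. I G1 y \<partial>Q0) +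
        ennreal (\<rho> n y1 / 2) * (\<integral>\<^sup>+y\<in>ball y1 R'. I G2 y \<partial>Q0))"
      by (simp add: distrib_left mult_ac)
    also have "\<dots> \<le> ennreal \<kappa> * (ennreal (2 * \<rho> n y1) * ennreal m1 * (\<integral>\<^sup>+y. G1 y \<partial>Q0) +
        ennreal (2 * \<rho> n y1) * ennreal m1 * (\<integral>\<^sup>+y. G2 y \<partial>Q0))"
      by (intro mult_left_mono add_mono QI G) auto
    also have "\<dots> = ennreal (\<kappa> * (2 * \<rho> n y1 * m1)) * ((\<integral>\<^sup>+y. G1 y \<partial>Q0) + (\<integral>\<^sup>+y. G2 y \<partial>Q0))"
    proof -
      have "ennreal (\<kappa> * (2 * \<rho> n y1 * m1)) = ennreal \<kappa> * (ennreal (2 * \<rho> n y1) * ennreal m1)"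
        using \<kappa> \<rho>1 m0 by (subst ennreal_mult, simp, simp, subst ennreal_mult) auto
      then show ?thesis by (simp only: distrib_left mult.assoc)
    qed
    finally have main: "ennreal (\<rho> n y1 / 2 * (m0 * q)) \<le> ennreal (\<kappa> * (2 * \<rho> n y1 * m1)) * ((\<integral>\<^sup>+y. G1 y \<partial>Q0) + (\<integral>\<^sup>+y. G2 y \<partial>Q0))" .
    have t: "\<kappa> * (2 * \<rho> n y1 * m1) > 0" using \<kappa> \<rho>1 m0 by simp
    have "0 \<le> \<rho> n y1 / 2 * (m0 * q)" using \<rho>1 m0 q by simp
    from ennreal_divide_leI[OF main t this] show ?thesis by (simp add: G1_def G2_def \<epsilon>_def)
  qed
  then show ?thesis using \<epsilon> \<delta>(1) by blast
qed

end

subsection \<open>The law of the past\<close>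

lemma past_dist_summable:
  assumes "\<iota> > 1" "\<And>j. norm (\<xi> j) \<le> b" "\<And>j. norm (\<xi>' j) \<le> b"
  shows "summable (\<lambda>j. (1 / \<iota>) ^ j * norm (\<xi> j - \<xi>' j))"
proof (rule summable_comparison_test')
  show "summable (\<lambda>j. (1 / \<iota>) ^ j * (2 * b))"
    using assms(1) by (intro summable_mult2 summable_geometric) simp
  show "norm ((1 / \<iota>) ^ j * norm (\<xi> j - \<xi>' j)) \<le> (1 / \<iota>) ^ j * (2 * b)" for j
    using assms(1) norm_triangle_ineq4[of "\<xi> j" "\<xi>' j"] assms(2,3)[of j]
    by (simp add: abs_mult mult_left_mono)
qed

lemma past_dist_suminf:
  assumes "\<iota> > 1" "\<And>j. norm (\<xi> j) \<le> b" "\<And>j. norm (\<xi>' j) \<le> b"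
  shows "past_dist \<iota> \<xi> \<xi>' = (\<Sum>j. (1 / \<iota>) ^ j * norm (\<xi> j - \<xi>' j))"
proof -
  have "((\<lambda>j. (1 / \<iota>) ^ j * norm (\<xi> j - \<xi>' j)) has_sum (\<Sum>j. (1 / \<iota>) ^ j * norm (\<xi> j - \<xi>' j))) UNIV"
    using past_dist_summable[OF assms] assms(1)
    by (intro norm_summable_imp_has_sum) (auto intro: summable_sums simp: abs_mult)
  moreover have "\<iota> powi (- int j) = (1 / \<iota>) ^ j" for j
    by (simp add: power_int_minus power_one_over inverse_eq_divide)
  ultimately show ?thesis
    unfolding past_dist_def by (simp add: infsumI)
qed

text \<open>All old segments move one place back and lose a factor \<iota>: this is where the chain
  contracts in the noise variable.\<close>

lemma past_dist_append:
  assumes "\<iota> > 1" "\<And>j. norm (\<xi> j) \<le> b" "\<And>j. norm (\<xi>' j) \<le> b" "norm y \<le> b" "norm y' \<le> b"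
  shows "past_dist \<iota> (append_past \<xi> y) (append_past \<xi>' y') = norm (y - y') + (1 / \<iota>) * past_dist \<iota> \<xi> \<xi>'"
proof -
  have b: "norm (append_past \<xi> y j) \<le> b" "norm (append_past \<xi>' y' j) \<le> b" for j
    using assms by (auto simp: append_past_def split: nat.split)
  have sm: "summable (\<lambda>j. (1 / \<iota>) ^ j * norm (append_past \<xi> y j - append_past \<xi>' y' j))"
    by (rule past_dist_summable[OF assms(1) b])
  have "past_dist \<iota> (append_past \<xi> y) (append_past \<xi>' y')
      = (\<Sum>j. (1 / \<iota>) ^ j * norm (append_past \<xi> y j - append_past \<xi>' y' j))"
    by (rule past_dist_suminf[OF assms(1) b])
  also have "\<dots> = (\<Sum>j. (1 / \<iota>) ^ Suc j * norm (append_past \<xi> y (Suc j) - append_past \<xi>' y' (Suc j))) + norm (y - y')"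
    using suminf_split_head[OF sm] by (simp add: append_past_def)
  also have "(\<Sum>j. (1 / \<iota>) ^ Suc j * norm (append_past \<xi> y (Suc j) - append_past \<xi>' y' (Suc j)))
      = (1 / \<iota>) * (\<Sum>j. (1 / \<iota>) ^ j * norm (\<xi> j - \<xi>' j))"
    using past_dist_summable[OF assms(1-3)] by (subst suminf_mult[symmetric]) (auto simp: append_past_def mult.assoc)
  also have "(\<Sum>j. (1 / \<iota>) ^ j * norm (\<xi> j - \<xi>' j)) = past_dist \<iota> \<xi> \<xi>'"
    by (rule past_dist_suminf[OF assms(1-3), symmetric])
  finally show ?thesis by simp
qed

lemma past_dist_component:
  assumes "\<iota> > 1" "\<And>j. norm (\<xi> j) \<le> b" "\<And>j. norm (\<xi>' j) \<le> b"
  shows "(1 / \<iota>) ^ j * norm (\<xi> j - \<xi>' j) \<le> past_dist \<iota> \<xi> \<xi>'"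
  unfolding past_dist_suminf[OF assms]
  using sum_le_suminf[OF past_dist_summable[OF assms], of "{j}"] assms(1) by simp

lemma past_dist_initial:
  assumes "\<iota> > 1" "\<And>j. norm (\<xi> j) \<le> b" "\<And>j. norm (\<xi>' j) \<le> b"
    and "\<And>j. j < m \<Longrightarrow> norm (\<xi> j - \<xi>' j) \<le> e" "e \<ge> 0"
  shows "past_dist \<iota> \<xi> \<xi>' \<le> e * (\<iota> / (\<iota> - 1)) + (1 / \<iota>) ^ m * (2 * b * (\<iota> / (\<iota> - 1)))"
proof -
  have b: "b \<ge> 0" using assms(2)[of 0] norm_ge_zero order_trans by blast
  have geo: "summable (\<lambda>j. (1 / \<iota>) ^ j)" "(\<Sum>j. (1 / \<iota>) ^ j) = \<iota> / (\<iota> - 1)"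
  proof -
    have n: "norm (1 / \<iota>) < 1" using assms(1) by simp
    show "summable (\<lambda>j. (1 / \<iota>) ^ j)" by (rule summable_geometric[OF n])
    show "(\<Sum>j. (1 / \<iota>) ^ j) = \<iota> / (\<iota> - 1)"
      unfolding suminf_geometric[OF n] using assms(1) by (simp add: field_simps)
  qed
  have geo': "summable (\<lambda>j. if j < m then 0 else (1 / \<iota>) ^ j)"
    "(\<Sum>j. if j < m then 0 else (1 / \<iota>) ^ j) = (1 / \<iota>) ^ m * (\<iota> / (\<iota> - 1))"
  proof -
    have "(\<lambda>j. (1 / \<iota>) ^ m * (1 / \<iota>) ^ j) sums ((1 / \<iota>) ^ m * (\<iota> / (\<iota> - 1)))"
      using geo by (intro sums_mult) (simp add: sums_iff)
    then have "(\<lambda>j. if j + m < m then 0 else (1 / \<iota>) ^ (j + m)) sums ((1 / \<iota>) ^ m * (\<iota> / (\<iota> - 1)))"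
      by (simp add: power_add mult.commute)
    then have "(\<lambda>j. if j < m then 0 else (1 / \<iota>) ^ j) sums ((1 / \<iota>) ^ m * (\<iota> / (\<iota> - 1)))"
      by (subst (asm) sums_iff_shift) simp
    then show "summable (\<lambda>j. if j < m then 0 else (1 / \<iota>) ^ j)"
      "(\<Sum>j. if j < m then 0 else (1 / \<iota>) ^ j) = (1 / \<iota>) ^ m * (\<iota> / (\<iota> - 1))"
      by (auto simp: sums_iff)
  qed
  have "past_dist \<iota> \<xi> \<xi>' \<le> (\<Sum>j. e * (1 / \<iota>) ^ j + (2 * b) * (if j < m then 0 else (1 / \<iota>) ^ j))"
    unfolding past_dist_suminf[OF assms(1-3)]
  proof (rule suminf_le[OF _ past_dist_summable[OF assms(1-3)]])
    fix j
    show "(1 / \<iota>) ^ j * norm (\<xi> j - \<xi>' j) \<le> e * (1 / \<iota>) ^ j + (2 * b) * (if j < m then 0 else (1 / \<iota>) ^ j)"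
    proof (cases "j < m")
      case True
      then show ?thesis using assms(1) assms(4)[of j] by (simp add: mult.commute divide_right_mono power_one_over)
    next
      case False
      have "norm (\<xi> j - \<xi>' j) \<le> 2 * b" using norm_triangle_ineq4[of "\<xi> j" "\<xi>' j"] assms(2,3)[of j] by simp
      then have "(1 / \<iota>) ^ j * norm (\<xi> j - \<xi>' j) \<le> (1 / \<iota>) ^ j * (2 * b)" using assms(1) by (intro mult_left_mono) auto
      moreover have "0 \<le> e * (1 / \<iota>) ^ j" using assms(1,5) by simp
      ultimately show ?thesis using False by (simp add: mult.commute)
    qed
  next
    show "summable (\<lambda>j. e * (1 / \<iota>) ^ j + (2 * b) * (if j < m then 0 else (1 / \<iota>) ^ j))"
      by (intro summable_add summable_mult geo geo')
  qed
  also have "\<dots> = (\<Sum>j. e * (1 / \<iota>) ^ j) + (\<Sum>j. (2 * b) * (if j < m then 0 else (1 / \<iota>) ^ j))"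
    by (rule suminf_add[symmetric]) (intro summable_mult geo geo')+
  also have "\<dots> = e * (\<Sum>j. (1 / \<iota>) ^ j) + (2 * b) * (\<Sum>j. if j < m then 0 else (1 / \<iota>) ^ j)"
    by (simp only: suminf_mult[OF geo(1)] suminf_mult[OF geo'(1)])
  finally show ?thesis by (simp add: geo geo' mult_ac)
qed

text \<open>After \<open>m\<close> terms only a geometric tail remains. On bounded pasts the metric
  is thus governed by finitely many segments, and these are what (SRZ) and cylinder sets
  control.\<close>

lemma past_dist_small:
  assumes "\<iota> > 1" "e > 0"
  obtains m \<delta> where "\<delta> > 0"
    "\<And>\<xi> \<xi>'. (\<And>j. norm (\<xi> j) \<le> b) \<Longrightarrow> (\<And>j. norm (\<xi>' j) \<le> b) \<Longrightarrow>
      (\<And>j. j < m \<Longrightarrow> norm (\<xi> j - \<xi>' j) \<le> \<delta>) \<Longrightarrow> past_dist \<iota> \<xi> \<xi>' < e"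
proof -
  define g where "g = \<iota> / (\<iota> - 1)"
  have g: "g > 0" using assms(1) by (simp add: g_def)
  have "(\<lambda>m. (1 / \<iota>) ^ m * (2 * b * g)) \<longlonglongrightarrow> 0 * (2 * b * g)"
    using assms(1) by (intro tendsto_mult LIMSEQ_realpow_zero tendsto_const) auto
  then have "eventually (\<lambda>m. (1 / \<iota>) ^ m * (2 * b * g) < e / 2) sequentially"
    using assms(2) by (intro order_tendstoD(2)) auto
  then obtain m where m: "(1 / \<iota>) ^ m * (2 * b * g) < e / 2" by (auto simp: eventually_sequentially)
  show ?thesis
  proof (rule that[of "e / (2 * g)"])
    show pos: "e / (2 * g) > 0" using assms(2) g by simp
    fix \<xi> \<xi>' :: past assume *: "\<And>j. norm (\<xi> j) \<le> b" "\<And>j. norm (\<xi>' j) \<le> b"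
      "\<And>j. j < m \<Longrightarrow> norm (\<xi> j - \<xi>' j) \<le> e / (2 * g)"
    have "past_dist \<iota> \<xi> \<xi>' \<le> e / (2 * g) * g + (1 / \<iota>) ^ m * (2 * b * g)"
      unfolding g_def by (rule past_dist_initial[OF assms(1) *[unfolded g_def]]) (use pos in \<open>simp_all add: g_def\<close>)
    then show "past_dist \<iota> \<xi> \<xi>' < e" using m g by simp
  qed
qed

lemma measurable_append_past:
  "(\<lambda>(\<xi>, y). append_past \<xi> y) \<in> past_algebra \<Otimes>\<^sub>M borel \<rightarrow>\<^sub>M past_algebra"
proof (rule measurable_PiM_single')
  fix j :: nat
  show "(\<lambda>w. (case w of (\<xi>, y) \<Rightarrow> append_past \<xi> y) j) \<in> past_algebra \<Otimes>\<^sub>M borel \<rightarrow>\<^sub>M borel"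
  proof (cases j)
    case 0
    then show ?thesis by (simp add: append_past_def case_prod_unfold)
  next
    case (Suc i)
    have "(\<lambda>w. fst w i) \<in> past_algebra \<Otimes>\<^sub>M (borel :: L2J measure) \<rightarrow>\<^sub>M borel"
      by (rule measurable_compose[OF measurable_fst measurable_component_singleton]) simp
    then show ?thesis using Suc by (simp add: append_past_def case_prod_unfold)
  qed
qed simp

lemma measurable_segment: "segment k \<in> trajectories \<rightarrow>\<^sub>M borel"
proof -
  have "(\<lambda>z k. segment k z) \<in> trajectories \<rightarrow>\<^sub>M Pi\<^sub>M UNIV (\<lambda>_::int. borel)"
    unfolding trajectories_def by (rule measurable_vimage_algebra1) (simp add: space_PiM)
  from measurable_compose[OF this measurable_component_singleton[of k UNIV]] show ?thesis by simp
qed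

lemma space_trajectories [simp]: "space trajectories = UNIV"
  by (simp add: trajectories_def)

lemma measurable_past_of: "past_of \<in> trajectories \<rightarrow>\<^sub>M past_algebra"
  by (rule measurable_PiM_single') (auto simp: past_of_def measurable_segment)

lemma segment_shift: "segment k (\<lambda>t. z (t + 1)) = segment (k + 1) z"
  by (simp add: segment_def algebra_simps)

lemma measurable_shift: "(\<lambda>z t. z (t + 1)) \<in> trajectories \<rightarrow>\<^sub>M trajectories"
proof -
  have "(\<lambda>z k. segment k (\<lambda>t. z (t + 1))) \<in> trajectories \<rightarrow>\<^sub>M Pi\<^sub>M UNIV (\<lambda>_::int. borel)"
    by (rule measurable_PiM_single') (auto simp: segment_shift measurable_segment)
  then show ?thesis
    unfolding trajectories_def[of] by (intro measurable_vimage_algebra2) (auto simp: trajectories_def[symmetric])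
qed

lemma past_of_shift: "past_of (\<lambda>t. z (t + 1)) = append_past (past_of z) (segment 1 z)"
  by (rule ext) (auto simp: past_of_def append_past_def segment_shift split: nat.split)

text \<open>The union of finite nets of mesh \<open>1 / Suc n\<close> is dense. Compactness of
  \<open>K\<close> in this way supplies the countability needed for the support of the law of the
  past and for measurable infima.\<close>

lemma finite_ball_cover:
  fixes K :: "'a::metric_space set"
  assumes "compact K"
  obtains D where "countable D" "D \<subseteq> K" "\<And>x e. x \<in> K \<Longrightarrow> e > 0 \<Longrightarrow> \<exists>d\<in>D. dist x d < e"
proof -
  have "\<exists>F. finite F \<and> F \<subseteq> K \<and> K \<subseteq> (\<Union>x\<in>F. ball x (1 / real (Suc n)))" for n
    using seq_compact_imp_totally_bounded[OF compact_imp_seq_compact[OF assms]] by simp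
  then obtain F where F: "\<And>n. finite (F n)" "\<And>n. F n \<subseteq> K" "\<And>n. K \<subseteq> (\<Union>x\<in>F n. ball x (1 / real (Suc n)))"
    by metis
  show ?thesis
  proof (rule that[of "\<Union>n. F n"])
    show "countable (\<Union>n. F n)" using F(1) by (auto intro: countable_finite)
    show "(\<Union>n. F n) \<subseteq> K" using F(2) by auto
    fix x and e :: real assume x: "x \<in> K" and "e > 0"
    then obtain n :: nat where n: "inverse (real (Suc n)) < e" using reals_Archimedean by blast
    obtain d where d: "d \<in> F n" "x \<in> ball d (1 / real (Suc n))" using F(3)[of n] x by blast
    then have "dist x d < e" using n by (simp add: dist_commute inverse_eq_divide)
    then show "\<exists>d\<in>\<Union>n. F n. dist x d < e" using d(1) by blast
  qed
qed

section \<open>The stationary noise, its support and the kernel of the next segment\<close>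

locale stationary_noise =
  fixes \<Lambda> :: "(real \<Rightarrow> real \<times> real) measure" and K :: "L2J set" and \<iota> :: real
    and Q :: "past \<Rightarrow> L2J measure" and S :: "past set"
  assumes prob: "prob_space \<Lambda>" and sets_law: "sets \<Lambda> = sets trajectories"
    and CP: "CP \<Lambda> K" and iota: "\<iota> > 1" and S_def: "S = past_support \<iota> K \<Lambda>"
    and cond: "conditional_law \<Lambda> S Q" and SF: "SF \<iota> K S Q"
begin

sublocale \<Lambda>: prob_space \<Lambda> by (rule prob)

definition pasts :: "past measure" where "pasts = past_law \<Lambda>"

abbreviation D :: "past \<Rightarrow> past \<Rightarrow> real" where "D \<equiv> past_dist \<iota>"

lemma space_law [simp]: "space \<Lambda> = UNIV"
  using sets_eq_imp_space_eq[OF sets_law] by simp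

lemma measurable_law: "f \<in> \<Lambda> \<rightarrow>\<^sub>M N \<longleftrightarrow> f \<in> trajectories \<rightarrow>\<^sub>M N"
  using measurable_cong_sets[OF sets_law refl] by blast

lemma past_of_law: "past_of \<in> \<Lambda> \<rightarrow>\<^sub>M past_algebra"
  using measurable_past_of by (simp add: measurable_law)

lemma segment_law: "segment k \<in> \<Lambda> \<rightarrow>\<^sub>M borel"
  using measurable_segment by (simp add: measurable_law)

lemma sets_pasts [simp]: "sets pasts = sets past_algebra" "space pasts = UNIV"
  by (simp_all add: pasts_def past_law_def space_PiM)

sublocale pasts: prob_space pasts
  unfolding pasts_def past_law_def by (rule \<Lambda>.prob_space_distr[OF past_of_law])

lemma stationary: "distr \<Lambda> trajectories (\<lambda>z t. z (t + 1)) = \<Lambda>"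
  using CP unfolding CP_def by blast

lemma compact_K: "compact K"
  using CP unfolding CP_def by blast

lemma K_bounded: "\<exists>b>0. \<forall>y\<in>K. norm y \<le> b"
  using compact_imp_bounded[OF compact_K] by (simp add: bounded_pos)

lemma nn_integral_shift:
  assumes "f \<in> borel_measurable trajectories"
  shows "(\<integral>\<^sup>+z. f (\<lambda>t. z (t + 1)) \<partial>\<Lambda>) = (\<integral>\<^sup>+z. f z \<partial>\<Lambda>)"
proof -
  have "(\<integral>\<^sup>+z. f z \<partial>\<Lambda>) = (\<integral>\<^sup>+z. f z \<partial>distr \<Lambda> trajectories (\<lambda>z t. z (t + 1)))" by (simp add: stationary)
  also have "\<dots> = (\<integral>\<^sup>+z. f (\<lambda>t. z (t + 1)) \<partial>\<Lambda>)"
    using assms measurable_shift by (intro nn_integral_distr) (auto simp: measurable_law)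
  finally show ?thesis ..
qed

lemma cond_rect:
  "A \<in> sets past_algebra \<Longrightarrow> B \<in> sets borel \<Longrightarrow>
    emeasure \<Lambda> {z. past_of z \<in> A \<and> segment 1 z \<in> B} = (\<integral>\<^sup>+\<xi>\<in>A \<inter> S. emeasure (Q \<xi>) B \<partial>pasts)"
  using cond by (simp add: conditional_law_def pasts_def)

lemma S_subset: "S \<subseteq> UNIV \<rightarrow> K"
  using Metric_space.topspace_mtopology[OF Metric_space_past_dist[OF iota compact_imp_bounded[OF compact_K]]]
  by (auto simp: S_def past_support_def support_def past_topology_def)

lemma Q_prob:
  assumes "\<xi> \<in> S" shows "prob_space (Q \<xi>)" "sets (Q \<xi>) = sets borel" "space (Q \<xi>) = UNIV"
proof -
  have "Q \<in> restrict_space past_algebra S \<rightarrow>\<^sub>M prob_algebra borel"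
    using cond by (simp add: conditional_law_def)
  from measurable_space[OF this, of \<xi>] assms
  show "prob_space (Q \<xi>)" "sets (Q \<xi>) = sets borel" by (auto simp: space_restrict_space space_PiM space_prob_algebra)
  then show "space (Q \<xi>) = UNIV" using sets_eq_imp_space_eq by fastforce
qed

lemma Q_K:
  assumes "\<xi> \<in> S" shows "emeasure (Q \<xi>) K = 1" "AE y in Q \<xi>. y \<in> K"
proof -
  show 1: "emeasure (Q \<xi>) K = 1" using SF assms by (simp add: SF_def)
  interpret prob_space "Q \<xi>" using Q_prob(1)[OF assms] .
  have "K \<in> sets (Q \<xi>)" using Q_prob(2)[OF assms] compact_K by (simp add: compact_imp_closed)
  then show "AE y in Q \<xi>. y \<in> K" using 1 by (intro AE_prob_1) (simp add: measure_def)
qed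

lemma K_borel: "K \<in> sets borel"
  using compact_K by (simp add: compact_imp_closed)

text \<open>(SF) gives \<open>K\<close> full mass under \<open>Q \<xi>\<close> for every \<xi> in
  \<open>S\<close>; integrating over the past by the conditional law transfers this to the noise
  itself.\<close>

lemma segment_in_K: "AE z in \<Lambda>. segment 1 z \<in> K"
proof -
  have eq: "(\<integral>\<^sup>+\<xi>\<in>S. emeasure (Q \<xi>) K \<partial>pasts) = (\<integral>\<^sup>+\<xi>\<in>S. emeasure (Q \<xi>) UNIV \<partial>pasts)"
  proof (rule nn_integral_cong)
    fix \<xi>
    show "emeasure (Q \<xi>) K * indicator S \<xi> = emeasure (Q \<xi>) UNIV * indicator S \<xi>"
      using Q_K(1) prob_space.emeasure_space_1[OF Q_prob(1)] Q_prob(3) by (auto simp: indicator_def)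
  qed
  have "emeasure \<Lambda> {z. segment 1 z \<in> K} = emeasure \<Lambda> UNIV"
  proof -
    have "(UNIV :: past set) \<in> sets past_algebra" using sets_PiM_I_countable[of "UNIV :: nat set" "\<lambda>_. UNIV" "\<lambda>_. borel :: L2J measure"] by simp
    then show ?thesis using eq cond_rect[where A = UNIV and B = K] cond_rect[where A = UNIV and B = UNIV] K_borel by simp
  qed
  then have "emeasure \<Lambda> {z. segment 1 z \<in> K} = 1" using \<Lambda>.emeasure_space_1 by simp
  then show ?thesis
    using \<Lambda>.AE_prob_1[where A = "{z. segment 1 z \<in> K}"] by (simp add: measure_def)
qed

lemma segment_nonpos_in_K: "AE z in \<Lambda>. segment (1 - int j) z \<in> K"
proof (induction j)
  case 0
  then show ?case using segment_in_K by simp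
next
  case (Suc j)
  define N where "N = {z. segment (- int j) z \<notin> K}"
  have Nm: "N \<in> sets trajectories"
    using measurable_sets[OF measurable_segment[of "- int j"], of "- K"] K_borel by (simp add: N_def vimage_def)
  have "emeasure \<Lambda> N = (\<integral>\<^sup>+z. indicator N z \<partial>\<Lambda>)" using Nm sets_law by simp
  also have "\<dots> = (\<integral>\<^sup>+z. indicator N (\<lambda>t. z (t + 1)) \<partial>\<Lambda>)"
    using Nm by (intro nn_integral_shift[symmetric]) simp
  also have "\<dots> = (\<integral>\<^sup>+z. 0 \<partial>\<Lambda>)"
    using Suc.IH by (intro nn_integral_cong_AE) (auto simp: N_def segment_shift add.commute elim!: eventually_mono)
  finally have "N \<in> null_sets \<Lambda>" using Nm sets_law by (auto simp: null_sets_def)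
  from AE_not_in[OF this] show ?case by (simp add: N_def)
qed

lemma PiK_sets: "UNIV \<rightarrow> K \<in> sets past_algebra"
  using sets_PiM_I_countable[of UNIV "\<lambda>_. K" "\<lambda>_::nat. borel"] K_borel by (simp add: PiE_UNIV_domain)

lemma AE_pasts_K: "AE \<xi> in pasts. \<xi> \<in> UNIV \<rightarrow> K"
proof -
  have "AE z in \<Lambda>. \<forall>j. segment (- int j) z \<in> K"
    using segment_nonpos_in_K[of "Suc _"] by (simp add: AE_all_countable)
  then have "AE z in \<Lambda>. past_of z \<in> UNIV \<rightarrow> K" by (simp add: past_of_def Pi_iff)
  then show ?thesis
    unfolding pasts_def past_law_def using PiK_sets by (subst AE_distr_iff[OF past_of_law]) (simp_all add: space_PiM)
qed

lemma metric: "Metric_space (UNIV \<rightarrow> K) D"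
  by (rule Metric_space_past_dist[OF iota compact_imp_bounded[OF compact_K]])

lemma D_nonneg: "0 \<le> D \<xi> \<xi>'"
  by (rule Metric_space.nonneg[OF metric])

lemma openin_iff:
  "openin (past_topology \<iota> K) U \<longleftrightarrow> U \<subseteq> UNIV \<rightarrow> K \<and>
    (\<forall>\<xi>\<in>U. \<exists>r>0. \<forall>\<xi>'\<in>UNIV \<rightarrow> K. D \<xi> \<xi>' < r \<longrightarrow> \<xi>' \<in> U)"
proof -
  have "Metric_space.mball (UNIV \<rightarrow> K) D \<xi> r \<subseteq> U \<longleftrightarrow> (\<forall>\<xi>'\<in>UNIV \<rightarrow> K. D \<xi> \<xi>' < r \<longrightarrow> \<xi>' \<in> U)"
    if "\<xi> \<in> UNIV \<rightarrow> K" for \<xi> r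
    unfolding Metric_space.mball_def[OF metric] using that by blast
  then show ?thesis
    unfolding past_topology_def Metric_space.openin_mtopology[OF metric]
    by (intro conj_cong refl) (meson subsetD)
qed

text \<open>Cylinders over a countable dense subset of \<^term>\<open>K\<close> form a countable base of the topology of
  pasts; this makes the support measurable and of full measure.\<close>

lemma S_measurable_full: "S \<in> sets past_algebra" "AE \<xi> in pasts. \<xi> \<in> S"
proof -
  obtain b where b: "b > 0" "\<And>y. y \<in> K \<Longrightarrow> norm y \<le> b" using K_bounded by blast
  obtain E where E: "countable E" "E \<subseteq> K" "\<And>x e. x \<in> K \<Longrightarrow> e > 0 \<Longrightarrow> \<exists>d\<in>E. dist x d < e"
    using finite_ball_cover[OF compact_K] by blast
  define cyl where "cyl = (\<lambda>(k::nat, ds). (UNIV \<rightarrow> K) \<inter> {\<xi>. \<forall>j<length ds. dist (\<xi> j) (ds ! j) < 1 / real (Suc k)})"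
  define I where "I = (UNIV :: nat set) \<times> lists E"
  have I: "countable I" unfolding I_def using E(1) by (intro countable_SIGMA) auto
  have cyl_sets: "cyl i \<in> sets past_algebra" for i
  proof -
    obtain k ds where [simp]: "i = (k, ds)" by (cases i)
    have "cyl i = (UNIV \<rightarrow> K) \<inter> (\<Inter>j\<in>{..<length ds}. (\<lambda>\<xi>. \<xi> j) -` ball (ds ! j) (1 / real (Suc k)))"
      by (auto simp: cyl_def dist_commute)
    also have "\<dots> \<in> sets past_algebra"
    proof -
      have "(\<lambda>\<xi>. \<xi> j) -` ball (ds ! j) (1 / real (Suc k)) \<in> sets past_algebra" for j
        using measurable_sets[OF measurable_component_singleton[of j UNIV "\<lambda>_. borel"], of "ball (ds ! j) (1 / real (Suc k))"]
        by (simp add: space_PiM)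
      then show ?thesis
        by (cases "length ds = 0") (auto intro!: sets.Int PiK_sets sets.finite_INT simp: lessThan_empty_iff)
    qed
    finally show ?thesis .
  qed
  have cyl_open: "openin (past_topology \<iota> K) (cyl i)" for i
  proof -
    obtain k ds where [simp]: "i = (k, ds)" by (cases i)
    show ?thesis unfolding openin_iff
    proof (intro conjI ballI)
      show "cyl i \<subseteq> UNIV \<rightarrow> K" by (auto simp: cyl_def)
      fix \<xi> assume \<xi>: "\<xi> \<in> cyl i"
      define r where "r = (\<lambda>j. (1 / \<iota>) ^ j * (1 / real (Suc k) - dist (\<xi> j) (ds ! j)))"
      define R where "R = Min (insert 1 (r ` {..<length ds}))"
      have rpos: "r j > 0" if "j < length ds" for j
        using \<xi> that iota by (auto simp: r_def cyl_def)
      have "R > 0" using rpos by (auto simp: R_def)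
      moreover have "\<xi>' \<in> cyl i" if \<xi>': "\<xi>' \<in> UNIV \<rightarrow> K" "D \<xi> \<xi>' < R" for \<xi>'
      proof -
        have "dist (\<xi>' j) (ds ! j) < 1 / real (Suc k)" if j: "j < length ds" for j
        proof -
          have bb: "norm (\<xi> j) \<le> b" "norm (\<xi>' j) \<le> b" for j using \<xi> \<xi>' b(2) by (auto simp: cyl_def)
          have "(1 / \<iota>) ^ j * norm (\<xi> j - \<xi>' j) \<le> D \<xi> \<xi>'" by (rule past_dist_component[OF iota bb])
          also have "\<dots> < R" by fact
          also have "R \<le> r j" using j by (auto simp: R_def)
          finally have "norm (\<xi> j - \<xi>' j) < 1 / real (Suc k) - dist (\<xi> j) (ds ! j)"
            unfolding r_def using iota by (subst (asm) mult_less_cancel_left_pos) auto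
          then show ?thesis using dist_triangle[of "\<xi>' j" "ds ! j" "\<xi> j"] by (simp add: dist_norm norm_minus_commute)
        qed
        then show ?thesis using \<xi>' by (simp add: cyl_def)
      qed
      ultimately show "\<exists>r>0. \<forall>\<xi>'\<in>UNIV \<rightarrow> K. D \<xi> \<xi>' < r \<longrightarrow> \<xi>' \<in> cyl i" by blast
    qed
  qed
  have base: "\<exists>i\<in>I. \<xi> \<in> cyl i \<and> cyl i \<subseteq> U" if U: "openin (past_topology \<iota> K) U" and \<xi>: "\<xi> \<in> U" for U \<xi>
  proof -
    obtain r where r: "r > 0" "\<And>\<xi>'. \<xi>' \<in> UNIV \<rightarrow> K \<Longrightarrow> D \<xi> \<xi>' < r \<Longrightarrow> \<xi>' \<in> U"
      using U \<xi> unfolding openin_iff by blast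
    have \<xi>K: "\<xi> \<in> UNIV \<rightarrow> K" using U \<xi> unfolding openin_iff by blast
    obtain m \<delta> where \<delta>: "\<delta> > 0"
      "\<And>\<eta> \<eta>'. (\<And>j. norm (\<eta> j) \<le> b) \<Longrightarrow> (\<And>j. norm (\<eta>' j) \<le> b) \<Longrightarrow>
        (\<And>j. j < m \<Longrightarrow> norm (\<eta> j - \<eta>' j) \<le> \<delta>) \<Longrightarrow> D \<eta> \<eta>' < r"
      by (rule past_dist_small[OF iota r(1), of b]) blast
    obtain k :: nat where k: "inverse (real (Suc k)) < \<delta> / 2"
      using reals_Archimedean[of "\<delta> / 2"] \<delta>(1) by auto
    have "\<exists>d\<in>E. dist (\<xi> j) d < 1 / real (Suc k)" for j
      using E(3)[of "\<xi> j" "1 / real (Suc k)"] \<xi>K by (simp add: Pi_iff)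
    then obtain d where d: "\<And>j. d j \<in> E" "\<And>j. dist (\<xi> j) (d j) < 1 / real (Suc k)" by metis
    define i where "i = (k, map d [0..<m])"
    have "i \<in> I" using d(1) by (auto simp: i_def I_def)
    moreover have "\<xi> \<in> cyl i" using \<xi>K d(2) by (auto simp: i_def cyl_def)
    moreover have "cyl i \<subseteq> U"
    proof
      fix \<xi>' assume \<xi>': "\<xi>' \<in> cyl i"
      then have \<xi>'K: "\<xi>' \<in> UNIV \<rightarrow> K" by (simp add: cyl_def i_def)
      have bb: "norm (\<xi> j) \<le> b" "norm (\<xi>' j) \<le> b" for j using \<xi>K \<xi>'K b(2) by auto
      have "D \<xi> \<xi>' < r"
      proof (rule \<delta>(2)[OF bb])
        fix j assume j: "j < m"
        then have "dist (\<xi>' j) (d j) < 1 / real (Suc k)" using \<xi>' by (auto simp: cyl_def i_def)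
        then show "norm (\<xi> j - \<xi>' j) \<le> \<delta>"
          using dist_triangle3[of "\<xi> j" "\<xi>' j" "d j"] d(2)[of j] k
          by (simp add: dist_norm norm_minus_commute inverse_eq_divide)
      qed
      then show "\<xi>' \<in> U" using r(2)[OF \<xi>'K] by simp
    qed
    ultimately show ?thesis by blast
  qed
  have open_sets: "U \<in> sets past_algebra" if U: "openin (past_topology \<iota> K) U" for U
  proof -
    have "U = (\<Union>i\<in>{i\<in>I. cyl i \<subseteq> U}. cyl i)" using base[OF U] by blast
    also have "\<dots> \<in> sets past_algebra"
      using I cyl_sets by (intro sets.countable_UN'') (auto intro: countable_subset)
    finally show ?thesis .
  qed
  \<comment> \<open>There are countably many cylinders, so the null ones together are null. A past
    with a null neighbourhood lies in one of them, hence the support is the complement of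
    \<open>Z\<close> among the pasts with values in \<open>K\<close>.\<close>
  define Z where "Z = (\<Union>i\<in>{i\<in>I. emeasure pasts (cyl i) = 0}. cyl i)"
  have Z: "Z \<in> null_sets pasts"
    unfolding Z_def using I cyl_sets
    by (intro null_sets_UN') (auto simp: null_sets_def intro: countable_subset)
  have S_eq: "S = (UNIV \<rightarrow> K) - Z"
  proof (intro equalityI subsetI)
    fix \<xi> assume \<xi>: "\<xi> \<in> S"
    have "\<xi> \<notin> Z"
    proof
      assume "\<xi> \<in> Z"
      then obtain i where i: "emeasure pasts (cyl i) = 0" "\<xi> \<in> cyl i" by (auto simp: Z_def)
      then show False using \<xi> cyl_open[of i] by (auto simp: S_def past_support_def support_def pasts_def)
    qed
    then show "\<xi> \<in> (UNIV \<rightarrow> K) - Z" using S_subset \<xi> by blast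
  next
    fix \<xi> assume \<xi>: "\<xi> \<in> (UNIV \<rightarrow> K) - Z"
    have "emeasure pasts U > 0" if U: "openin (past_topology \<iota> K) U" "\<xi> \<in> U" for U
    proof (rule ccontr)
      assume "\<not> emeasure pasts U > 0"
      then have U0: "emeasure pasts U = 0" by simp
      obtain i where i: "i \<in> I" "\<xi> \<in> cyl i" "cyl i \<subseteq> U" using base[OF U] by blast
      have "emeasure pasts (cyl i) \<le> emeasure pasts U"
        using i open_sets[OF U(1)] by (intro emeasure_mono) auto
      then have "\<xi> \<in> Z" unfolding Z_def using i U0 by (intro UN_I[of i]) auto
      then show False using \<xi> by simp
    qed
    then show "\<xi> \<in> S"
      using \<xi> Metric_space.topspace_mtopology[OF metric]
      by (auto simp: S_def past_support_def support_def past_topology_def pasts_def)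
  qed
  show "S \<in> sets past_algebra" unfolding S_eq using Z PiK_sets by auto
  show "AE \<xi> in pasts. \<xi> \<in> S"
    using AE_pasts_K AE_not_in[OF Z] unfolding S_eq by eventually_elim simp
qed

lemma S_closed:
  assumes \<xi>: "\<xi> \<in> UNIV \<rightarrow> K" and lim: "\<And>e. e > 0 \<Longrightarrow> \<exists>\<xi>'\<in>S. D \<xi> \<xi>' < e"
  shows "\<xi> \<in> S"
proof -
  have "emeasure (past_law \<Lambda>) U > 0" if U: "openin (past_topology \<iota> K) U" "\<xi> \<in> U" for U
  proof -
    obtain r where r: "r > 0" "\<And>\<xi>'. \<xi>' \<in> UNIV \<rightarrow> K \<Longrightarrow> D \<xi> \<xi>' < r \<Longrightarrow> \<xi>' \<in> U"
      using U unfolding openin_iff by blast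
    obtain \<xi>' where \<xi>': "\<xi>' \<in> S" "D \<xi> \<xi>' < r" using lim[OF r(1)] by blast
    then have "\<xi>' \<in> U" using r(2) S_subset by blast
    then show ?thesis using \<xi>'(1) U(1) by (simp add: S_def past_support_def support_def)
  qed
  then show ?thesis
    using \<xi> Metric_space.topspace_mtopology[OF metric]
    by (simp add: S_def past_support_def support_def past_topology_def)
qed

text \<open>Extends \<open>Q\<close> to a probability kernel on all pasts, so that transfers are
  measurable without restriction to \<open>S\<close>; the value off \<open>S\<close> is an arbitrary
  probability measure.\<close>

definition kernel :: "past \<Rightarrow> L2J measure" where
  "kernel \<xi> = (if \<xi> \<in> S then Q \<xi> else return borel 0)"

lemma kernel_eq [simp]: "\<xi> \<in> S \<Longrightarrow> kernel \<xi> = Q \<xi>"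
  by (simp add: kernel_def)

lemma measurable_kernel: "kernel \<in> past_algebra \<rightarrow>\<^sub>M prob_algebra borel"
proof -
  have S: "{\<xi> \<in> space past_algebra. \<xi> \<in> S} \<in> sets past_algebra"
    using S_measurable_full(1) by (simp add: space_PiM)
  have "Q \<in> restrict_space past_algebra {\<xi>. \<xi> \<in> S} \<rightarrow>\<^sub>M prob_algebra borel"
    using cond by (simp add: conditional_law_def)
  moreover have "(\<lambda>\<xi>. return borel (0 :: L2J)) \<in> restrict_space past_algebra {\<xi>. \<xi> \<notin> S} \<rightarrow>\<^sub>M prob_algebra borel"
    by (intro measurable_const) (simp add: space_prob_algebra prob_space_return)
  ultimately show ?thesis
    unfolding kernel_def measurable_If_restrict_space_iff[OF S] by blast
qed

lemma kernel_prob: "prob_space (kernel \<xi>)" "sets (kernel \<xi>) = sets borel" "space (kernel \<xi>) = UNIV"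
proof -
  show "prob_space (kernel \<xi>)" "sets (kernel \<xi>) = sets borel"
    using measurable_space[OF measurable_kernel, of \<xi>] by (auto simp: space_PiM space_prob_algebra)
  then show "space (kernel \<xi>) = UNIV" using sets_eq_imp_space_eq by fastforce
qed

lemma measurable_kernel_iff: "f \<in> kernel \<xi> \<rightarrow>\<^sub>M N \<longleftrightarrow> f \<in> borel \<rightarrow>\<^sub>M N"
  using measurable_cong_sets[OF kernel_prob(2) refl] by blast

lemma joint_law:
  "distr \<Lambda> (past_algebra \<Otimes>\<^sub>M borel) (\<lambda>z. (past_of z, segment 1 z))
    = pasts \<bind> (\<lambda>\<xi>. distr (kernel \<xi>) (past_algebra \<Otimes>\<^sub>M borel) (\<lambda>y. (\<xi>, y)))" (is "?L = ?R")
proof -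
  have k: "(\<lambda>\<xi>. distr (kernel \<xi>) (past_algebra \<Otimes>\<^sub>M borel) (\<lambda>y. (\<xi>, y))) \<in> past_algebra \<rightarrow>\<^sub>M prob_algebra (past_algebra \<Otimes>\<^sub>M borel)"
    by (rule measurable_distr_prob_space2[OF measurable_kernel]) simp
  then have k': "(\<lambda>\<xi>. distr (kernel \<xi>) (past_algebra \<Otimes>\<^sub>M borel) (\<lambda>y. (\<xi>, y))) \<in> pasts \<rightarrow>\<^sub>M subprob_algebra (past_algebra \<Otimes>\<^sub>M borel)"
    unfolding measurable_cong_sets[OF sets_pasts(1) refl] by (rule measurable_prob_algebraD)
  have pm: "(\<lambda>z. (past_of z, segment 1 z)) \<in> \<Lambda> \<rightarrow>\<^sub>M past_algebra \<Otimes>\<^sub>M borel"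
    by (intro measurable_Pair past_of_law segment_law)
  have setsR: "sets ?R = sets (past_algebra \<Otimes>\<^sub>M borel)"
    by (rule sets_bind[OF _ _]) auto
  let ?E = "{A \<times> B | A B. A \<in> sets (past_algebra :: past measure) \<and> B \<in> sets (borel :: L2J measure)}"
  show ?thesis
  proof (rule measure_eqI_generator_eq[where E = ?E and \<Omega> = UNIV and A = "\<lambda>_. UNIV"])
    show "Int_stable ?E" by (rule Int_stable_pair_measure_generator)
    have U: "(UNIV :: past set) \<in> sets past_algebra" using sets.top[of "past_algebra"] by (simp add: space_PiM)
    show "range (\<lambda>_. UNIV) \<subseteq> ?E" using U by (auto intro!: exI[of _ UNIV])
    show "sets ?L = sigma_sets UNIV ?E" by (simp add: sets_pair_measure space_PiM)
    show "sets ?R = sigma_sets UNIV ?E" unfolding setsR by (simp add: sets_pair_measure space_PiM)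
    interpret L: prob_space ?L by (rule \<Lambda>.prob_space_distr[OF pm])
    show "emeasure ?L UNIV \<noteq> \<infinity>" by simp
    fix X assume "X \<in> ?E"
    then obtain A B where X: "X = A \<times> B" "A \<in> sets past_algebra" "B \<in> sets borel" by auto
    have "emeasure ?L X = emeasure \<Lambda> {z. past_of z \<in> A \<and> segment 1 z \<in> B}"
      using X by (subst emeasure_distr[OF pm]) (auto intro!: arg_cong[where f = "emeasure \<Lambda>"])
    also have "\<dots> = (\<integral>\<^sup>+\<xi>\<in>A \<inter> S. emeasure (Q \<xi>) B \<partial>pasts)" by (rule cond_rect[OF X(2,3)])
    also have "\<dots> = (\<integral>\<^sup>+\<xi>. emeasure (distr (kernel \<xi>) (past_algebra \<Otimes>\<^sub>M borel) (\<lambda>y. (\<xi>, y))) X \<partial>pasts)"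
    proof (rule nn_integral_cong_AE)
      show "AE \<xi> in pasts. emeasure (Q \<xi>) B * indicator (A \<inter> S) \<xi>
          = emeasure (distr (kernel \<xi>) (past_algebra \<Otimes>\<^sub>M borel) (\<lambda>y. (\<xi>, y))) X"
        using S_measurable_full(2)
      proof eventually_elim
        case (elim \<xi>)
        have "emeasure (distr (kernel \<xi>) (past_algebra \<Otimes>\<^sub>M borel) (\<lambda>y. (\<xi>, y))) X = emeasure (Q \<xi>) {y. \<xi> \<in> A \<and> y \<in> B}"
        proof -
          have pair: "Pair \<xi> \<in> kernel \<xi> \<rightarrow>\<^sub>M past_algebra \<Otimes>\<^sub>M (borel :: L2J measure)"
            unfolding measurable_kernel_iff by (rule measurable_Pair1') (simp add: space_PiM)
          have "emeasure (distr (kernel \<xi>) (past_algebra \<Otimes>\<^sub>M borel) (Pair \<xi>)) X = emeasure (kernel \<xi>) (Pair \<xi> -` X \<inter> space (kernel \<xi>))"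
            using X by (intro emeasure_distr pair) auto
          also have "Pair \<xi> -` X \<inter> space (kernel \<xi>) = {y. \<xi> \<in> A \<and> y \<in> B}" using X by (auto simp: kernel_prob)
          finally show ?thesis using elim by simp
        qed
        then show ?case using elim by (auto simp: indicator_def)
      qed
    qed
    also have "\<dots> = emeasure ?R X"
      by (rule emeasure_bind[symmetric, OF _ k']) (use X in auto)
    finally show "emeasure ?L X = emeasure ?R X" .
  qed auto
qed

text \<open>Stationarity read on pasts: shifting time by one unit appends the segment number 1, so
  the law of the past is invariant for the chain.\<close>

lemma nn_integral_pasts_append:
  assumes G: "G \<in> borel_measurable past_algebra"
  shows "(\<integral>\<^sup>+\<xi>. G \<xi> \<partial>pasts) = (\<integral>\<^sup>+\<xi>. (\<integral>\<^sup>+y. G (append_past \<xi> y) \<partial>kernel \<xi>) \<partial>pasts)"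
proof -
  have k: "(\<lambda>\<xi>. distr (kernel \<xi>) (past_algebra \<Otimes>\<^sub>M borel) (\<lambda>y. (\<xi>, y))) \<in> past_algebra \<rightarrow>\<^sub>M prob_algebra (past_algebra \<Otimes>\<^sub>M borel)"
    by (rule measurable_distr_prob_space2[OF measurable_kernel]) simp
  then have k': "(\<lambda>\<xi>. distr (kernel \<xi>) (past_algebra \<Otimes>\<^sub>M borel) (\<lambda>y. (\<xi>, y))) \<in> pasts \<rightarrow>\<^sub>M subprob_algebra (past_algebra \<Otimes>\<^sub>M borel)"
    unfolding measurable_cong_sets[OF sets_pasts(1) refl] by (rule measurable_prob_algebraD)
  have pm: "(\<lambda>z. (past_of z, segment 1 z)) \<in> \<Lambda> \<rightarrow>\<^sub>M past_algebra \<Otimes>\<^sub>M borel"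
    by (intro measurable_Pair past_of_law segment_law)
  have Ga: "(\<lambda>(\<xi>, y). G (append_past \<xi> y)) \<in> borel_measurable (past_algebra \<Otimes>\<^sub>M borel)"
    using measurable_compose[OF measurable_append_past G] by (simp add: case_prod_unfold)
  have Gp: "(\<lambda>z. G (past_of z)) \<in> borel_measurable trajectories"
    by (rule measurable_compose[OF measurable_past_of G])
  have "(\<integral>\<^sup>+\<xi>. G \<xi> \<partial>pasts) = (\<integral>\<^sup>+z. G (past_of z) \<partial>\<Lambda>)"
    unfolding pasts_def past_law_def using G by (subst nn_integral_distr[OF past_of_law]) auto
  also have "\<dots> = (\<integral>\<^sup>+z. G (append_past (past_of z) (segment 1 z)) \<partial>\<Lambda>)"
    using nn_integral_shift[OF Gp] by (simp add: past_of_shift)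
  also have "\<dots> = (\<integral>\<^sup>+w. (case w of (\<xi>, y) \<Rightarrow> G (append_past \<xi> y)) \<partial>distr \<Lambda> (past_algebra \<Otimes>\<^sub>M borel) (\<lambda>z. (past_of z, segment 1 z)))"
    using Ga by (subst nn_integral_distr[OF pm]) auto
  also have "\<dots> = (\<integral>\<^sup>+\<xi>. (\<integral>\<^sup>+w. (case w of (\<xi>, y) \<Rightarrow> G (append_past \<xi> y)) \<partial>distr (kernel \<xi>) (past_algebra \<Otimes>\<^sub>M borel) (\<lambda>y. (\<xi>, y))) \<partial>pasts)"
    unfolding joint_law by (rule nn_integral_bind[OF Ga k'])
  also have "\<dots> = (\<integral>\<^sup>+\<xi>. (\<integral>\<^sup>+y. G (append_past \<xi> y) \<partial>kernel \<xi>) \<partial>pasts)"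
  proof (rule nn_integral_cong)
    fix \<xi>
    have "(\<lambda>y. (\<xi>, y)) \<in> kernel \<xi> \<rightarrow>\<^sub>M past_algebra \<Otimes>\<^sub>M borel"
      unfolding measurable_kernel_iff by (rule measurable_Pair1') (simp add: space_PiM)
    then show "(\<integral>\<^sup>+w. (case w of (\<xi>, y) \<Rightarrow> G (append_past \<xi> y)) \<partial>distr (kernel \<xi>) (past_algebra \<Otimes>\<^sub>M borel) (\<lambda>y. (\<xi>, y)))
        = (\<integral>\<^sup>+y. G (append_past \<xi> y) \<partial>kernel \<xi>)"
      using Ga by (subst nn_integral_distr) auto
  qed
  finally show ?thesis .
qed

lemma Q_lipschitz:
  "\<exists>C>0. \<forall>\<xi>\<in>S. \<forall>\<xi>'\<in>S. \<forall>\<Gamma>\<in>sets borel. \<bar>measure (Q \<xi>) \<Gamma> - measure (Q \<xi>') \<Gamma>\<bar> \<le> C * D \<xi> \<xi>'"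
proof -
  obtain C where C: "C > 0" "\<And>\<xi> \<xi>'. \<xi> \<in> S \<Longrightarrow> \<xi>' \<in> S \<Longrightarrow> var_dist (Q \<xi>) (Q \<xi>') \<le> C * D \<xi> \<xi>'"
    using SF unfolding SF_def by blast
  have "\<bar>measure (Q \<xi>) \<Gamma> - measure (Q \<xi>') \<Gamma>\<bar> \<le> C * D \<xi> \<xi>'" if "\<xi> \<in> S" "\<xi>' \<in> S" "\<Gamma> \<in> sets borel" for \<xi> \<xi>' \<Gamma>
  proof -
    interpret q: prob_space "Q \<xi>" using Q_prob(1) that by blast
    interpret q': prob_space "Q \<xi>'" using Q_prob(1) that by blast
    have "\<bar>measure (Q \<xi>) \<Gamma> - measure (Q \<xi>') \<Gamma>\<bar> \<le> 1" for \<Gamma>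
      using q.prob_le_1[of \<Gamma>] q'.prob_le_1[of \<Gamma>] measure_nonneg[of "Q \<xi>" \<Gamma>] measure_nonneg[of "Q \<xi>'" \<Gamma>] by linarith
    then have "bdd_above ((\<lambda>\<Gamma>. \<bar>measure (Q \<xi>) \<Gamma> - measure (Q \<xi>') \<Gamma>\<bar>) ` sets (Q \<xi>))" by (auto intro!: bdd_aboveI)
    then have "\<bar>measure (Q \<xi>) \<Gamma> - measure (Q \<xi>') \<Gamma>\<bar> \<le> var_dist (Q \<xi>) (Q \<xi>')"
      unfolding var_dist_def using that Q_prob(2)[OF that(1)] by (intro cSUP_upper) auto
    then show ?thesis using C(2)[OF that(1,2)] by linarith
  qed
  then show ?thesis using C(1) by blast
qed

lemma append_sets:
  "{y. append_past \<xi> y \<in> S} \<in> sets borel"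
proof -
  have "(\<lambda>y. append_past \<xi> y) \<in> borel \<rightarrow>\<^sub>M past_algebra"
    using measurable_compose[OF measurable_Pair1' measurable_append_past, of \<xi>] by (simp add: space_PiM)
  from measurable_sets[OF this S_measurable_full(1)] show ?thesis by (simp add: vimage_def)
qed

lemma AE_append_generic: "AE \<xi> in pasts. AE y in kernel \<xi>. append_past \<xi> y \<in> S"
proof -
  have Sm: "- S \<in> sets past_algebra" using S_measurable_full(1) sets.compl_sets[of S past_algebra] by (simp add: space_PiM Compl_eq_Diff_UNIV)
  then have G: "(indicator (- S) :: past \<Rightarrow> ennreal) \<in> borel_measurable past_algebra" by (rule borel_measurable_indicator)
  have "(\<integral>\<^sup>+\<xi>. indicator (- S) \<xi> \<partial>pasts) = (\<integral>\<^sup>+\<xi>. 0 \<partial>pasts)"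
    using S_measurable_full(2) by (intro nn_integral_cong_AE) (auto elim!: eventually_mono)
  then have zero: "(\<integral>\<^sup>+\<xi>. (\<integral>\<^sup>+y. indicator (- S) (append_past \<xi> y) \<partial>kernel \<xi>) \<partial>pasts) = 0"
    unfolding nn_integral_pasts_append[OF G] by simp
  have Ga: "(\<lambda>(\<xi>, y). indicator (- S) (append_past \<xi> y) :: ennreal) \<in> borel_measurable (past_algebra \<Otimes>\<^sub>M borel)"
    using measurable_compose[OF measurable_append_past G] by (simp add: case_prod_unfold)
  have "(\<lambda>\<xi>. \<integral>\<^sup>+y. indicator (- S) (append_past \<xi> y) \<partial>kernel \<xi>) \<in> borel_measurable past_algebra"
    by (rule nn_integral_measurable_subprob_algebra2[OF Ga measurable_prob_algebraD[OF measurable_kernel]])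
  then have "(\<lambda>\<xi>. \<integral>\<^sup>+y. indicator (- S) (append_past \<xi> y) \<partial>kernel \<xi>) \<in> borel_measurable pasts"
    using measurable_cong_sets[OF sets_pasts(1) refl] by blast
  from iffD1[OF nn_integral_0_iff_AE[OF this] zero]
  show ?thesis
  proof eventually_elim
    case (elim \<xi>)
    have "(\<lambda>y. indicator (- S) (append_past \<xi> y) :: ennreal) \<in> borel_measurable (kernel \<xi>)"
      unfolding measurable_kernel_iff using measurable_compose[OF measurable_Pair1' Ga, of \<xi>] by (simp add: space_PiM)
    from iffD1[OF nn_integral_0_iff_AE[OF this] elim] show ?case
      by eventually_elim (auto simp: indicator_def split: if_splits)
  qed
qed

text \<open>The support is invariant for every past in it, not just for almost every one, since the kernel
  is continuous in total variation and the support is closed.\<close>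

lemma AE_append_S:
  assumes \<xi>: "\<xi> \<in> S"
  shows "AE y in Q \<xi>. append_past \<xi> y \<in> S"
proof -
  obtain b where b: "b > 0" "\<And>y. y \<in> K \<Longrightarrow> norm y \<le> b" using K_bounded by blast
  obtain C where C: "C > 0" "\<And>\<xi> \<xi>' \<Gamma>. \<xi> \<in> S \<Longrightarrow> \<xi>' \<in> S \<Longrightarrow> \<Gamma> \<in> sets borel \<Longrightarrow>
      \<bar>measure (Q \<xi>) \<Gamma> - measure (Q \<xi>') \<Gamma>\<bar> \<le> C * D \<xi> \<xi>'"
    using Q_lipschitz by blast
  interpret Q: prob_space "Q \<xi>" using Q_prob(1)[OF \<xi>] .
  \<comment> \<open>Almost every past has the property, and every neighbourhood of a point of the
    support has positive measure; so good pasts exist arbitrarily close to \<xi>.\<close>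
  have "\<exists>\<xi>'. \<xi>' \<in> S \<and> D \<xi> \<xi>' < e \<and> (AE y in Q \<xi>'. append_past \<xi>' y \<in> S)" if e: "e > 0" for e
  proof -
    define U where "U = {\<xi>' \<in> UNIV \<rightarrow> K. D \<xi> \<xi>' < e}"
    have "openin (past_topology \<iota> K) U"
      using Metric_space.openin_mball[OF metric, of \<xi> e] \<xi> S_subset
      by (auto simp: past_topology_def U_def Metric_space.mball_def[OF metric] subset_iff elim!: back_subst[where P = "openin _"])
    moreover have "\<xi> \<in> U" using \<xi> S_subset Metric_space.mdist_zero[OF metric] e by (auto simp: U_def subset_iff)
    ultimately have pos: "emeasure pasts U > 0"
      using \<xi> by (auto simp: S_def past_support_def support_def pasts_def)
    show ?thesis
    proof (rule ccontr)
      assume none: "\<not> ?thesis"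
      have "AE \<xi>' in pasts. \<xi>' \<in> S \<and> (AE y in kernel \<xi>'. append_past \<xi>' y \<in> S)"
        using S_measurable_full(2) AE_append_generic by eventually_elim (rule conjI)
      then have "AE \<xi>' in pasts. \<xi>' \<notin> U"
      proof eventually_elim
        case (elim \<xi>')
        then have "AE y in Q \<xi>'. append_past \<xi>' y \<in> S" using kernel_eq[of \<xi>'] by metis
        then show ?case using none elim unfolding U_def by blast
      qed
      then obtain N where N: "N \<in> null_sets pasts" "\<And>\<xi>'. \<xi>' \<in> space pasts - N \<Longrightarrow> \<xi>' \<notin> U" by (rule AE_E3) blast
      have "emeasure pasts U \<le> emeasure pasts N" using N by (intro emeasure_mono) auto
      then show False using N(1) pos by (auto simp: null_sets_def)
    qed
  qed
  then have "\<exists>\<xi>'. \<xi>' \<in> S \<and> D \<xi> \<xi>' < 1 / real (Suc k) \<and> (AE y in Q \<xi>'. append_past \<xi>' y \<in> S)" for k :: nat by simp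
  then obtain s where s: "\<And>k. s k \<in> S" "\<And>k. D \<xi> (s k) < 1 / real (Suc k)" "\<And>k. AE y in Q (s k). append_past (s k) y \<in> S"
    by metis
  define G where "G = (\<lambda>k. {y. append_past (s k) y \<in> S})"
  have Gm: "G k \<in> sets borel" for k by (simp add: G_def append_sets)
  have small: "measure (Q \<xi>) (- G k) \<le> C / real (Suc k)" for k
  proof -
    interpret q: prob_space "Q (s k)" using Q_prob(1)[OF s(1)] .
    have "measure (Q (s k)) (- G k) = 0"
    proof -
      have "AE y in Q (s k). y \<notin> - G k" using s(3)[of k] by (simp add: G_def)
      then have "- G k \<in> null_sets (Q (s k))"
        using Gm[of k] by (subst AE_iff_null_sets) (auto simp: Q_prob(2)[OF s(1)])
      then show ?thesis by (simp add: measure_def null_sets_def)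
    qed
    then have "measure (Q \<xi>) (- G k) \<le> C * D \<xi> (s k)"
      using C(2)[OF \<xi> s(1), of "- G k" k] Gm[of k] measure_nonneg[of "Q \<xi>" "- G k"] by auto
    also have "\<dots> \<le> C * (1 / real (Suc k))" using C(1) s(2)[of k] by (intro mult_left_mono) auto
    finally show ?thesis by simp
  qed
  \<comment> \<open>The bad sets have mass at most \<open>C / real (Suc k)\<close> under
    \<open>Q \<xi>\<close>, so almost every \<open>y\<close> is good for infinitely many
    \<open>k\<close>; along these \<open>k\<close> the pasts \<open>append_past (s k) y\<close> lie
    in \<open>S\<close> and approach \<open>append_past \<xi> y\<close>.\<close>
  have null: "(\<Inter>k\<in>{n..}. - G k) \<in> null_sets (Q \<xi>)" for n
  proof -
    have m: "(\<Inter>k\<in>{n..}. - G k) \<in> sets borel" using Gm by (intro sets.countable_INT'') auto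
    have "measure (Q \<xi>) (\<Inter>k\<in>{n..}. - G k) \<le> 0"
    proof (rule field_le_epsilon)
      fix e :: real assume e: "e > 0"
      obtain k0 :: nat where "C / e < real k0" using reals_Archimedean2 by blast
      define k where "k = max n k0"
      have "C / e < real (Suc k)" using \<open>C / e < real k0\<close> by (simp add: k_def)
      then have "C / real (Suc k) < e" using e by (simp add: field_simps)
      moreover have "measure (Q \<xi>) (\<Inter>k\<in>{n..}. - G k) \<le> measure (Q \<xi>) (- G k)"
        using Gm[of k] Q_prob(2)[OF \<xi>] by (intro Q.finite_measure_mono) (auto simp: k_def)
      ultimately show "measure (Q \<xi>) (\<Inter>k\<in>{n..}. - G k) \<le> 0 + e" using small[of k] by linarith
    qed
    then have "measure (Q \<xi>) (\<Inter>k\<in>{n..}. - G k) = 0" using measure_nonneg antisym by blast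
    then show ?thesis using m Q_prob(2)[OF \<xi>] by (auto simp: null_sets_def Q.emeasure_eq_measure)
  qed
  have "AE y in Q \<xi>. \<forall>n. y \<notin> (\<Inter>k\<in>{n..}. - G k)"
    using AE_not_in[OF null] by (simp add: AE_all_countable)
  with Q_K(2)[OF \<xi>] show ?thesis
  proof eventually_elim
    case (elim y)
    have \<xi>b: "norm (\<xi> j) \<le> b" "norm (s k j) \<le> b" for j k
      using \<xi> s(1) S_subset b(2) by (auto simp: subset_iff Pi_iff)
    show "append_past \<xi> y \<in> S"
    proof (rule S_closed)
      show "append_past \<xi> y \<in> UNIV \<rightarrow> K"
        using elim(1) \<xi> S_subset by (auto simp: append_past_def subset_iff Pi_iff split: nat.split)
      fix e :: real assume e: "e > 0"
      obtain n :: nat where n: "inverse (real (Suc n)) < e" using reals_Archimedean[OF e] by blast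
      obtain k where k: "k \<ge> n" "append_past (s k) y \<in> S" using elim(2)[rule_format, of n] by (auto simp: G_def)
      have "D (append_past \<xi> y) (append_past (s k) y) = (1 / \<iota>) * D \<xi> (s k)"
        using past_dist_append[OF iota \<xi>b(1) \<xi>b(2)[of k], of y y] b(2)[OF elim(1)] by simp
      also have "\<dots> \<le> 1 * D \<xi> (s k)" using iota D_nonneg by (intro mult_right_mono) auto
      also have "\<dots> < 1 / real (Suc k)" using s(2)[of k] by simp
      also have "\<dots> \<le> inverse (real (Suc n))" using k(1) by (simp add: inverse_eq_divide frac_le)
      also have "\<dots> < e" by (rule n)
      finally show "\<exists>\<xi>'\<in>S. D (append_past \<xi> y) \<xi>' < e" using k(2) by blast
    qed
  qed
qed

end

subsection \<open>Contraction of the transfer operator\<close>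

text \<open>The contraction argument sees the dynamics only through a jointly measurable map and a
  set invariant under segments from \<open>K\<close>; continuity and controllability enter later
  through the overlap and recurrence hypotheses.\<close>

locale driven_noise = stationary_noise \<Lambda> K \<iota> Q S
  for \<Lambda> :: "(real \<Rightarrow> real \<times> real) measure" and K :: "L2J set" and \<iota> :: real
    and Q :: "past \<Rightarrow> L2J measure" and S :: "past set" +
  fixes move :: "'s::euclidean_space \<Rightarrow> L2J \<Rightarrow> 's" and X :: "'s set"
  assumes measurable_move: "(\<lambda>(x, y). move x y) \<in> borel \<Otimes>\<^sub>M borel \<rightarrow>\<^sub>M borel"
    and move_X: "x \<in> X \<Longrightarrow> y \<in> K \<Longrightarrow> move x y \<in> X"
begin

abbreviation phase_algebra :: "('s \<times> past) measure" where
  "phase_algebra \<equiv> borel \<Otimes>\<^sub>M past_algebra"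

definition observable :: "('s \<times> past \<Rightarrow> real) \<Rightarrow> bool" where
  "observable f \<longleftrightarrow> f \<in> borel_measurable phase_algebra \<and> bounded (range f)"

definition transfer :: "('s \<times> past \<Rightarrow> real) \<Rightarrow> 's \<times> past \<Rightarrow> real" where
  "transfer f = (\<lambda>(x, \<xi>). \<integral>y. f (move x y, append_past \<xi> y) \<partial>kernel \<xi>)"

lemma observable_bounded: "observable f \<Longrightarrow> \<exists>b. \<forall>z. \<bar>f z\<bar> \<le> b"
  by (auto simp: observable_def bounded_iff)

lemma measurable_next:
  "(\<lambda>((x, \<xi>), y). (move x y, append_past \<xi> y)) \<in> phase_algebra \<Otimes>\<^sub>M borel \<rightarrow>\<^sub>M phase_algebra"
proof -
  have 1: "(\<lambda>w :: ('s \<times> past) \<times> L2J. (fst (fst w), snd w)) \<in> phase_algebra \<Otimes>\<^sub>M borel \<rightarrow>\<^sub>M borel \<Otimes>\<^sub>M borel"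
    by (intro measurable_Pair measurable_compose[OF measurable_fst measurable_fst] measurable_snd)
  have 2: "(\<lambda>w :: ('s \<times> past) \<times> L2J. (snd (fst w), snd w)) \<in> phase_algebra \<Otimes>\<^sub>M borel \<rightarrow>\<^sub>M past_algebra \<Otimes>\<^sub>M borel"
    by (intro measurable_Pair measurable_compose[OF measurable_fst measurable_snd] measurable_snd)
  show ?thesis
    using measurable_Pair[OF measurable_compose[OF 1 measurable_move] measurable_compose[OF 2 measurable_append_past]]
    by (simp add: case_prod_unfold)
qed

lemma measurable_next_section:
  "f \<in> phase_algebra \<rightarrow>\<^sub>M N \<Longrightarrow> (\<lambda>y. f (move x y, append_past \<xi> y)) \<in> borel \<rightarrow>\<^sub>M N"
  using measurable_compose[OF measurable_compose[OF measurable_Pair1' measurable_next], of "(x, \<xi>)" f N]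
  by (simp add: space_pair_measure space_PiM)

lemma integrable_next:
  assumes "observable f"
  shows "integrable (kernel \<xi>) (\<lambda>y. f (move x y, append_past \<xi> y))"
proof -
  interpret k: prob_space "kernel \<xi>" by (rule kernel_prob)
  obtain b where "\<And>z. \<bar>f z\<bar> \<le> b" using observable_bounded[OF assms] by blast
  then show ?thesis
    using assms measurable_next_section[of f borel x \<xi>]
    by (intro k.integrable_const_bound[where B = b]) (auto simp: observable_def measurable_kernel_iff)
qed

lemma observable_transfer:
  assumes f: "observable f" shows "observable (transfer f)"
proof -
  have "(\<lambda>z. distr (kernel (snd z)) phase_algebra (\<lambda>y. (move (fst z) y, append_past (snd z) y))) \<in> phase_algebra \<rightarrow>\<^sub>M subprob_algebra phase_algebra"
    using measurable_next measurable_prob_algebraD[OF measurable_compose[OF measurable_snd measurable_kernel]]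
    by (intro measurable_distr2[where M = borel]) (auto simp: case_prod_unfold)
  from measurable_compose[OF this integral_measurable_subprob_algebra[of f phase_algebra]] f
  have "(\<lambda>z. integral\<^sup>L (distr (kernel (snd z)) phase_algebra (\<lambda>y. (move (fst z) y, append_past (snd z) y))) f) \<in> borel_measurable phase_algebra"
    by (simp add: observable_def)
  moreover have "integral\<^sup>L (distr (kernel (snd z)) phase_algebra (\<lambda>y. (move (fst z) y, append_past (snd z) y))) f = transfer f z" for z
    using f measurable_next_section[of "\<lambda>w. w" phase_algebra "fst z" "snd z"]
    by (subst integral_distr) (auto simp: observable_def measurable_kernel_iff transfer_def case_prod_unfold)
  ultimately have "transfer f \<in> borel_measurable phase_algebra" by simp
  moreover have "bounded (range (transfer f))"
  proof -
    obtain b where b: "\<And>z. \<bar>f z\<bar> \<le> b" using observable_bounded[OF f] by blast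
    have "\<bar>transfer f (x, \<xi>)\<bar> \<le> b" for x \<xi>
    proof -
      interpret k: prob_space "kernel \<xi>" by (rule kernel_prob)
      have "\<And>y. f (move x y, append_past \<xi> y) \<le> b" "\<And>y. - b \<le> f (move x y, append_past \<xi> y)"
        using b by (simp_all add: abs_le_iff minus_le_iff)
      then show ?thesis
        using k.integral_le_const[OF integrable_next[OF f, of \<xi> x], of b] k.integral_ge_const[OF integrable_next[OF f, of \<xi> x], of "- b"]
        by (simp add: transfer_def)
    qed
    then show ?thesis by (auto simp: bounded_iff)
  qed
  ultimately show ?thesis by (simp add: observable_def)
qed

lemma observable_affine:
  assumes "observable f" shows "observable (\<lambda>z. a + c * f z)"
proof -
  obtain b where b: "\<And>z. \<bar>f z\<bar> \<le> b" using observable_bounded[OF assms] by blast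
  have "\<bar>a + c * f z\<bar> \<le> \<bar>a\<bar> + \<bar>c\<bar> * b" for z
    using abs_triangle_ineq[of a "c * f z"] mult_left_mono[OF b[of z] abs_ge_zero[of c]] by (simp add: abs_mult)
  then show ?thesis using assms by (auto simp: observable_def bounded_iff)
qed

lemma transfer_affine:
  assumes f: "observable f"
  shows "transfer (\<lambda>z. a + c * f z) z = a + c * transfer f z"
proof -
  obtain x \<xi> where [simp]: "z = (x, \<xi>)" by (cases z)
  interpret k: prob_space "kernel \<xi>" by (rule kernel_prob)
  show ?thesis
    using integrable_next[OF f, of \<xi> x] k.prob_space by (simp add: transfer_def)
qed

lemma AE_next:
  assumes "x \<in> X" "\<xi> \<in> S"
  shows "AE y in Q \<xi>. y \<in> K \<and> move x y \<in> X \<and> append_past \<xi> y \<in> S"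
  using Q_K(2)[OF assms(2)] AE_append_S[OF assms(2)]
  by eventually_elim (use assms move_X in auto)

lemma transfer_mono:
  assumes f: "observable f" and g: "observable g" and le: "\<And>z. z \<in> X \<times> S \<Longrightarrow> f z \<le> g z" and z: "z \<in> X \<times> S"
  shows "transfer f z \<le> transfer g z"
proof -
  obtain x \<xi> where [simp]: "z = (x, \<xi>)" and x: "x \<in> X" "\<xi> \<in> S" using z by auto
  have "AE y in kernel \<xi>. f (move x y, append_past \<xi> y) \<le> g (move x y, append_past \<xi> y)"
    unfolding kernel_eq[OF x(2)] using AE_next[OF x] by eventually_elim (use le in auto)
  then show ?thesis
    using integral_mono_AE[OF integrable_next[OF f] integrable_next[OF g]] by (simp add: transfer_def)
qed

lemma observable_iterate: "observable f \<Longrightarrow> observable ((transfer ^^ m) f)"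
  by (induction m) (auto intro: observable_transfer)

lemma iterate_affine:
  assumes "observable f"
  shows "(transfer ^^ m) (\<lambda>z. a + c * f z) = (\<lambda>z. a + c * (transfer ^^ m) f z)"
  by (induction m) (auto simp: transfer_affine[OF observable_iterate[OF assms]])

lemma iterate_mono:
  assumes "observable f" "observable g" "\<And>z. z \<in> X \<times> S \<Longrightarrow> f z \<le> g z" "z \<in> X \<times> S"
  shows "(transfer ^^ m) f z \<le> (transfer ^^ m) g z"
  using assms(4)
proof (induction m arbitrary: z)
  case (Suc m)
  then show ?case
    using transfer_mono[OF observable_iterate[OF assms(1)] observable_iterate[OF assms(2)]] by simp
qed (use assms in auto)

lemma observable_const: "observable (\<lambda>_. c)" by (simp add: observable_def)

lemma iterate_const: "(transfer ^^ m) (\<lambda>_. c) = (\<lambda>_. c)"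
  using iterate_affine[OF observable_const, of m c 0 0] by simp

definition test_functions :: "real \<Rightarrow> ('s \<Rightarrow> L2J \<Rightarrow> real) set" where
  "test_functions B = {h. (\<lambda>(s, y). h s y) \<in> borel_measurable (borel \<Otimes>\<^sub>M borel) \<and>
    (\<forall>s y. 0 \<le> h s y \<and> h s y \<le> 1) \<and> (\<forall>s y y'. \<bar>h s y - h s y'\<bar> \<le> B * norm (y - y'))}"

text \<open>Over functions of the state alone the supremum would be the total variation distance of
  the laws of the next states. No absolute value is taken since test functions are closed under
  passing from \<open>h\<close> to \<open>1 - h\<close>.\<close>

definition gap :: "real \<Rightarrow> 's \<Rightarrow> 's \<Rightarrow> past \<Rightarrow> real" where
  "gap B x x' \<xi> = (SUP h\<in>test_functions B. (\<integral>y. h (move x y) y \<partial>Q \<xi>) - (\<integral>y. h (move x' y) y \<partial>Q \<xi>))"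

lemma measurable_test:
  assumes "(\<lambda>(s, y). h s y) \<in> borel_measurable (borel \<Otimes>\<^sub>M borel)"
  shows "(\<lambda>y. h (move x y) y) \<in> borel_measurable borel"
proof -
  have "(\<lambda>y. (x, y)) \<in> borel \<rightarrow>\<^sub>M borel \<Otimes>\<^sub>M (borel :: L2J measure)" by (rule measurable_Pair1') simp
  from measurable_compose[OF this measurable_move]
  have "(\<lambda>y. (move x y, y)) \<in> borel \<rightarrow>\<^sub>M borel \<Otimes>\<^sub>M borel" by (intro measurable_Pair) auto
  from measurable_compose[OF this assms] show ?thesis by simp
qed

lemma integrable_test:
  assumes \<xi>: "\<xi> \<in> S" and h: "h \<in> test_functions B"
  shows "integrable (Q \<xi>) (\<lambda>y. h (move x y) y)" "0 \<le> (\<integral>y. h (move x y) y \<partial>Q \<xi>)" "(\<integral>y. h (move x y) y \<partial>Q \<xi>) \<le> 1"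
proof -
  interpret Q: prob_space "Q \<xi>" using Q_prob(1)[OF \<xi>] .
  show i: "integrable (Q \<xi>) (\<lambda>y. h (move x y) y)"
    using h measurable_test[of h x] measurable_cong_sets[OF Q_prob(2)[OF \<xi>] refl]
    by (intro Q.integrable_const_bound[where B = 1]) (auto simp: test_functions_def)
  show "0 \<le> (\<integral>y. h (move x y) y \<partial>Q \<xi>)" "(\<integral>y. h (move x y) y \<partial>Q \<xi>) \<le> 1"
    using h by (auto intro!: Q.integral_le_const[OF i] Q.integral_ge_const[OF i] simp: test_functions_def)
qed

lemma gap_upper:
  assumes \<xi>: "\<xi> \<in> S" and h: "h \<in> test_functions B"
  shows "(\<integral>y. h (move x y) y \<partial>Q \<xi>) - (\<integral>y. h (move x' y) y \<partial>Q \<xi>) \<le> gap B x x' \<xi>"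
  unfolding gap_def
proof (rule cSUP_upper[OF h])
  show "bdd_above ((\<lambda>h. (\<integral>y. h (move x y) y \<partial>Q \<xi>) - (\<integral>y. h (move x' y) y \<partial>Q \<xi>)) ` test_functions B)"
  proof (rule bdd_aboveI2[where M = 1])
    fix h assume "h \<in> test_functions B"
    then show "(\<integral>y. h (move x y) y \<partial>Q \<xi>) - (\<integral>y. h (move x' y) y \<partial>Q \<xi>) \<le> 1"
      using integrable_test(2)[OF \<xi>, of h B x'] integrable_test(3)[OF \<xi>, of h B x] by linarith
  qed
qed

lemma zero_test: "B \<ge> 0 \<Longrightarrow> (\<lambda>_ _. 0) \<in> test_functions B"
  by (simp add: test_functions_def)

lemma gap_least:
  assumes "B \<ge> 0"
    and "\<And>h. h \<in> test_functions B \<Longrightarrow> (\<integral>y. h (move x y) y \<partial>Q \<xi>) - (\<integral>y. h (move x' y) y \<partial>Q \<xi>) \<le> c"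
  shows "gap B x x' \<xi> \<le> c"
  unfolding gap_def using zero_test[OF assms(1)] assms(2) by (intro cSUP_least) auto

lemma gap_nonneg: "B \<ge> 0 \<Longrightarrow> \<xi> \<in> S \<Longrightarrow> 0 \<le> gap B x x' \<xi>"
  using gap_upper[of \<xi> "\<lambda>_ _. 0" B x x'] zero_test by simp

lemma gap_refl: "B \<ge> 0 \<Longrightarrow> \<xi> \<in> S \<Longrightarrow> gap B x x \<xi> = 0"
  using gap_nonneg[of B \<xi> x x] gap_least[where B = B and x = x and \<xi> = \<xi> and x' = x and c = 0] by simp

text \<open>Truncation at 1 loses nothing for observables with values in [0, 1] and separates the
  two regimes of the contraction. The gap is taken at the past of the first argument, so the cost
  need not be symmetric.\<close>

definition cost :: "real \<Rightarrow> real \<Rightarrow> 's \<times> past \<Rightarrow> 's \<times> past \<Rightarrow> real" where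
  "cost \<theta> B z z' = min 1 (\<theta> * gap B (fst z) (fst z') (snd z) + B * D (snd z) (snd z'))"

lemma cost_le_past: "B \<ge> 0 \<Longrightarrow> \<xi> \<in> S \<Longrightarrow> cost \<theta> B (s, \<xi>) (s, \<xi>') \<le> B * D \<xi> \<xi>'"
  by (simp add: cost_def gap_refl)

lemma D_append:
  assumes "\<xi> \<in> S" "\<xi>' \<in> S" "y \<in> K" "y' \<in> K"
  shows "D (append_past \<xi> y) (append_past \<xi>' y') = norm (y - y') + (1 / \<iota>) * D \<xi> \<xi>'"
proof -
  obtain b where b: "b > 0" "\<And>y. y \<in> K \<Longrightarrow> norm y \<le> b" using K_bounded by blast
  show ?thesis
    by (rule past_dist_append[OF iota, of \<xi> b]) (use assms S_subset b(2) in \<open>auto simp: Pi_iff subset_iff\<close>)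
qed

lemma D_self: "\<xi> \<in> S \<Longrightarrow> D \<xi> \<xi> = 0"
  using Metric_space.mdist_zero[OF metric] S_subset by blast

lemma append_in_S_compact:
  assumes \<xi>: "\<xi> \<in> S"
  shows "compact {y \<in> K. append_past \<xi> y \<in> S}"
proof -
  have "closed {y \<in> K. append_past \<xi> y \<in> S}"
    unfolding closed_sequential_limits
  proof (intro allI impI, elim conjE)
    fix u l assume u: "\<forall>n. u n \<in> {y \<in> K. append_past \<xi> y \<in> S}" and lim: "u \<longlonglongrightarrow> l"
    have l: "l \<in> K" using u lim closed_sequentially[OF compact_imp_closed[OF compact_K]] by blast
    have "append_past \<xi> l \<in> S"
    proof (rule S_closed)
      show "append_past \<xi> l \<in> UNIV \<rightarrow> K"
        using subsetD[OF S_subset \<xi>] l by (auto simp: append_past_def Pi_iff split: nat.split)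
      fix e :: real assume "e > 0"
      then obtain n where "norm (l - u n) < e"
        using lim by (metis LIMSEQ_def dist_norm norm_minus_commute order_refl)
      moreover have "D (append_past \<xi> l) (append_past \<xi> (u n)) = norm (l - u n)"
        using D_append[OF \<xi> \<xi> l, of "u n"] u D_self[OF \<xi>] by simp
      ultimately show "\<exists>\<xi>'\<in>S. D (append_past \<xi> l) \<xi>' < e"
        using u by (intro bexI[of _ "append_past \<xi> (u n)"]) auto
    qed
    then show "l \<in> {y \<in> K. append_past \<xi> y \<in> S}" using l by simp
  qed
  then have "compact (K \<inter> {y \<in> K. append_past \<xi> y \<in> S})" by (rule compact_Int_closed[OF compact_K])
  moreover have "K \<inter> {y \<in> K. append_past \<xi> y \<in> S} = {y \<in> K. append_past \<xi> y \<in> S}" by blast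
  ultimately show ?thesis by simp
qed

lemma append_in_S_nonempty:
  assumes \<xi>: "\<xi> \<in> S"
  shows "{y \<in> K. append_past \<xi> y \<in> S} \<noteq> {}"
proof -
  interpret Q: prob_space "Q \<xi>" using Q_prob(1)[OF \<xi>] .
  have "AE y in Q \<xi>. y \<in> K \<and> append_past \<xi> y \<in> S"
    using Q_K(2)[OF \<xi>] AE_append_S[OF \<xi>] by eventually_elim simp
  then show ?thesis using Q.AE_contr by fastforce
qed

text \<open>The segments \<open>y\<close> in \<open>K\<close> with
  \<open>append_past \<xi> y\<close> in \<open>S\<close> form a compact set. The infimum of
  McShane's extension is taken over a countable dense part of it, which makes the result jointly
  measurable in state and segment; test functions must be defined on all of
  \<open>L2J\<close>.\<close>

lemma mcshane:
  assumes f: "f \<in> borel_measurable phase_algebra" "\<And>z. 0 \<le> f z \<and> f z \<le> 1" and B: "B \<ge> 0" and \<xi>: "\<xi> \<in> S"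
    and lip: "\<And>s y y'. s \<in> X \<Longrightarrow> y \<in> K \<Longrightarrow> y' \<in> K \<Longrightarrow> append_past \<xi> y \<in> S \<Longrightarrow> append_past \<xi> y' \<in> S \<Longrightarrow>
      f (s, append_past \<xi> y) - f (s, append_past \<xi> y') \<le> B * norm (y - y')"
  shows "\<exists>h\<in>test_functions B. \<forall>s\<in>X. \<forall>y\<in>K. append_past \<xi> y \<in> S \<longrightarrow> h s y = f (s, append_past \<xi> y)"
proof -
  obtain E where E: "countable E" "E \<subseteq> {y \<in> K. append_past \<xi> y \<in> S}"
    "\<And>x e. x \<in> {y \<in> K. append_past \<xi> y \<in> S} \<Longrightarrow> e > 0 \<Longrightarrow> \<exists>d\<in>E. dist x d < e"
    using finite_ball_cover[OF append_in_S_compact[OF \<xi>]] by blast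
  have ne: "E \<noteq> {}" using append_in_S_nonempty[OF \<xi>] E(3)[OF _ zero_less_one] by blast
  define g where "g = (\<lambda>s y. INF d\<in>E. f (s, append_past \<xi> d) + B * norm (y - d))"
  have bdd: "bdd_below ((\<lambda>d. f (s, append_past \<xi> d) + B * norm (y - d)) ` E)" for s y
    using f(2) B by (intro bdd_belowI2[where m = 0]) simp
  have g_le: "g s y \<le> f (s, append_past \<xi> d) + B * norm (y - d)" if "d \<in> E" for s y d
    unfolding g_def by (rule cINF_lower[OF bdd that])
  have g_ge: "c \<le> g s y" if "\<And>d. d \<in> E \<Longrightarrow> c \<le> f (s, append_past \<xi> d) + B * norm (y - d)" for s y c
    unfolding g_def by (rule cINF_greatest[OF ne that])
  have g0: "0 \<le> g s y" for s y using f(2) B by (intro g_ge) simp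
  have glip: "g s y \<le> g s y' + B * norm (y - y')" for s y y'
  proof -
    have "g s y - B * norm (y - y') \<le> g s y'"
    proof (rule g_ge)
      fix d assume d: "d \<in> E"
      have "B * norm (y - d) \<le> B * (norm (y - y') + norm (y' - d))"
        using norm_triangle_ineq[of "y - y'" "y' - d"] B by (intro mult_left_mono) auto
      then show "g s y - B * norm (y - y') \<le> f (s, append_past \<xi> d) + B * norm (y' - d)"
        using g_le[OF d, of s y] by (simp add: algebra_simps)
    qed
    then show ?thesis by simp
  qed
  define h where "h = (\<lambda>s y. min 1 (g s y))"
  have gm: "(\<lambda>w. g (fst w) (snd w)) \<in> borel_measurable (borel \<Otimes>\<^sub>M borel)"
    unfolding g_def
  proof (rule borel_measurable_cINF[OF E(1)])
    fix d assume "d \<in> E"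
    have "(\<lambda>s. (s, append_past \<xi> d)) \<in> borel \<rightarrow>\<^sub>M phase_algebra" by (intro measurable_Pair2') (simp add: space_PiM)
    from measurable_compose[OF measurable_compose[OF measurable_fst this] f(1)]
    have 1: "(\<lambda>w :: 's \<times> L2J. f (fst w, append_past \<xi> d)) \<in> borel_measurable (borel \<Otimes>\<^sub>M borel)" .
    have "(\<lambda>y. norm (y - d)) \<in> borel_measurable borel" by (intro borel_measurable_continuous_onI continuous_intros)
    from measurable_compose[OF measurable_snd this]
    have 2: "(\<lambda>w :: 's \<times> L2J. norm (snd w - d)) \<in> borel_measurable (borel \<Otimes>\<^sub>M borel)" .
    show "(\<lambda>w :: 's \<times> L2J. f (fst w, append_past \<xi> d) + B * norm (snd w - d)) \<in> borel_measurable (borel \<Otimes>\<^sub>M borel)"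
      by (intro borel_measurable_add borel_measurable_times borel_measurable_const 1 2)
  qed (rule bdd)
  have "h \<in> test_functions B"
    unfolding test_functions_def mem_Collect_eq
  proof (intro conjI allI)
    show "(\<lambda>(s, y). h s y) \<in> borel_measurable (borel \<Otimes>\<^sub>M borel)"
      using gm unfolding h_def case_prod_unfold by (intro borel_measurable_min borel_measurable_const)
    fix s y y'
    show "0 \<le> h s y" "h s y \<le> 1" using g0[of s y] by (auto simp: h_def)
    show "\<bar>h s y - h s y'\<bar> \<le> B * norm (y - y')"
      using glip[of s y y'] glip[of s y' y] by (auto simp: h_def norm_minus_commute min_def abs_if)
  qed
  moreover have "h s y = f (s, append_past \<xi> y)" if s: "s \<in> X" and y: "y \<in> K" "append_past \<xi> y \<in> S" for s y
  proof -
    have "f (s, append_past \<xi> y) \<le> g s y"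
    proof (rule g_ge)
      fix d assume "d \<in> E"
      then show "f (s, append_past \<xi> y) \<le> f (s, append_past \<xi> d) + B * norm (y - d)"
        using lip[OF s y(1) _ y(2), of d] E(2) by auto
    qed
    moreover have "g s y \<le> f (s, append_past \<xi> y)"
    proof (rule field_le_epsilon)
      fix e :: real assume e: "e > 0"
      have "e / (2 * B + 1) > 0" using e B by simp
      then obtain d where d: "d \<in> E" "norm (y - d) < e / (2 * B + 1)"
        using E(3)[of y] y by (auto simp: dist_norm)
      then have "(2 * B + 1) * norm (y - d) < e" using B by (simp add: field_simps)
      moreover have "g s y \<le> f (s, append_past \<xi> y) + 2 * (B * norm (y - d))"
        using g_le[OF d(1), of s y] lip[OF s _ y(1) _ y(2), of d] E(2) d(1) by (auto simp: norm_minus_commute)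
      ultimately show "g s y \<le> f (s, append_past \<xi> y) + e"
        using norm_ge_zero[of "y - d"] unfolding distrib_right mult.assoc mult_1 by linarith
    qed
    ultimately show ?thesis using f(2)[of "(s, append_past \<xi> y)"] by (simp add: h_def)
  qed
  ultimately show ?thesis by blast
qed

definition cost_lipschitz :: "real \<Rightarrow> real \<Rightarrow> ('s \<times> past \<Rightarrow> real) \<Rightarrow> bool" where
  "cost_lipschitz \<theta> B f \<longleftrightarrow> (\<forall>z\<in>X \<times> S. \<forall>z'\<in>X \<times> S. f z - f z' \<le> cost \<theta> B z z')"

lemma transfer_unit:
  assumes "observable f" "\<And>z. 0 \<le> f z \<and> f z \<le> 1"
  shows "0 \<le> transfer f z \<and> transfer f z \<le> 1"
proof -
  obtain x \<xi> where [simp]: "z = (x, \<xi>)" by (cases z)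
  interpret k: prob_space "kernel \<xi>" by (rule kernel_prob)
  show ?thesis
    using assms(2) k.integral_le_const[OF integrable_next[OF assms(1), of \<xi> x], of 1]
      k.integral_ge_const[OF integrable_next[OF assms(1), of \<xi> x], of 0]
    by (simp add: transfer_def)
qed

lemma Q_lipschitz_integral:
  assumes C: "\<And>\<xi> \<xi>' \<Gamma>. \<xi> \<in> S \<Longrightarrow> \<xi>' \<in> S \<Longrightarrow> \<Gamma> \<in> sets borel \<Longrightarrow> \<bar>measure (Q \<xi>) \<Gamma> - measure (Q \<xi>') \<Gamma>\<bar> \<le> C * D \<xi> \<xi>'"
    and \<xi>: "\<xi> \<in> S" "\<xi>' \<in> S" and g: "g \<in> borel_measurable borel" "\<And>y. 0 \<le> g y \<and> g y \<le> 1"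
  shows "\<bar>(\<integral>y. g y \<partial>Q \<xi>) - (\<integral>y. g y \<partial>Q \<xi>')\<bar> \<le> C * D \<xi> \<xi>'"
proof (rule integral_diff_le_setwise)
  show "g \<in> borel_measurable (Q \<xi>)" using g(1) measurable_cong_sets[OF Q_prob(2)[OF \<xi>(1)] refl] by blast
qed (use assms Q_prob in auto)

text \<open>Both kernels are compared with \<^term>\<open>Q \<xi>\<close>: the first bracket is the definition of the gap (the
  test function being a McShane extension of \<^term>\<open>f\<close> in the last noise component), and the
  rest is controlled by the total variation distance of \<^term>\<open>Q \<xi>\<close> and \<^term>\<open>Q \<xi>'\<close>.\<close>

lemma transfer_step:
  assumes C: "\<And>\<xi> \<xi>' \<Gamma>. \<xi> \<in> S \<Longrightarrow> \<xi>' \<in> S \<Longrightarrow> \<Gamma> \<in> sets borel \<Longrightarrow> \<bar>measure (Q \<xi>) \<Gamma> - measure (Q \<xi>') \<Gamma>\<bar> \<le> C * D \<xi> \<xi>'"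
    and B: "B \<ge> 0" and f: "observable f" "\<And>z. 0 \<le> f z \<and> f z \<le> 1" "cost_lipschitz \<theta> B f"
    and x: "x \<in> X" "x' \<in> X" and \<xi>: "\<xi> \<in> S" "\<xi>' \<in> S"
  shows "transfer f (x, \<xi>) - transfer f (x', \<xi>') \<le> gap B x x' \<xi> + (B / \<iota> + 2 * C) * D \<xi> \<xi>'"
proof -
  have past_lip: "f (s, \<eta>) - f (s, \<eta>') \<le> B * D \<eta> \<eta>'" if "s \<in> X" "\<eta> \<in> S" "\<eta>' \<in> S" for s \<eta> \<eta>'
  proof -
    have "f (s, \<eta>) - f (s, \<eta>') \<le> cost \<theta> B (s, \<eta>) (s, \<eta>')" using f(3) that by (simp add: cost_lipschitz_def)
    then show ?thesis using cost_le_past[OF B that(2), of \<theta> s \<eta>'] by linarith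
  qed
  have "\<exists>h\<in>test_functions B. \<forall>s\<in>X. \<forall>y\<in>K. append_past \<xi> y \<in> S \<longrightarrow> h s y = f (s, append_past \<xi> y)"
  proof (rule mcshane[OF _ f(2) B \<xi>(1)])
    show "f \<in> borel_measurable phase_algebra" using f(1) by (simp add: observable_def)
    fix s y y' assume *: "s \<in> X" "y \<in> K" "y' \<in> K" "append_past \<xi> y \<in> S" "append_past \<xi> y' \<in> S"
    show "f (s, append_past \<xi> y) - f (s, append_past \<xi> y') \<le> B * norm (y - y')"
      using past_lip[OF *(1,4,5)] D_append[OF \<xi>(1) \<xi>(1) *(2,3)] D_self[OF \<xi>(1)] by simp
  qed
  then obtain h where h: "h \<in> test_functions B"
    "\<And>s y. s \<in> X \<Longrightarrow> y \<in> K \<Longrightarrow> append_past \<xi> y \<in> S \<Longrightarrow> h s y = f (s, append_past \<xi> y)" by blast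
  have m: "(\<lambda>y. f (move w y, append_past \<eta> y)) \<in> borel_measurable \<nu>" if "sets \<nu> = sets borel" for w \<eta> \<nu>
    unfolding measurable_cong_sets[OF that refl]
    using f(1) by (intro measurable_next_section) (simp add: observable_def)
  have hint: "(\<integral>y. h (move w y) y \<partial>Q \<xi>) = transfer f (w, \<xi>)" if w: "w \<in> X" for w
  proof -
    have "(\<integral>y. h (move w y) y \<partial>Q \<xi>) = (\<integral>y. f (move w y, append_past \<xi> y) \<partial>Q \<xi>)"
    proof (rule integral_cong_AE)
      show "(\<lambda>y. h (move w y) y) \<in> borel_measurable (Q \<xi>)" using integrable_test(1)[OF \<xi>(1) h(1)] by blast
      show "(\<lambda>y. f (move w y, append_past \<xi> y)) \<in> borel_measurable (Q \<xi>)"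
        using m Q_prob(2)[OF \<xi>(1)] by blast
      show "AE y in Q \<xi>. h (move w y) y = f (move w y, append_past \<xi> y)"
        using AE_next[OF w \<xi>(1)] by eventually_elim (use h(2) in auto)
    qed
    then show ?thesis using \<xi>(1) by (simp add: transfer_def)
  qed
  define a where "a = (\<lambda>y. f (move x' y, append_past \<xi> y))"
  define b where "b = (\<lambda>y. f (move x' y, append_past \<xi>' y))"
  define G where "G = {y. append_past \<xi> y \<in> S}"
  interpret q: prob_space "Q \<xi>" using Q_prob(1)[OF \<xi>(1)] .
  interpret q': prob_space "Q \<xi>'" using Q_prob(1)[OF \<xi>(2)] .
  have Gm: "G \<in> sets borel" by (simp add: G_def append_sets)
  \<comment> \<open>Where a segment drawn after \<xi>' cannot follow \<xi> within \<open>S\<close>,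
    the observable is not controlled; such segments are null for \<open>Q \<xi>\<close>, hence of
    mass at most \<open>C * D \<xi> \<xi>'\<close> for \<open>Q \<xi>'\<close>. Together with the
    change of kernel in \<open>T2\<close> this accounts for the constant
    \<open>2 * C\<close>.\<close>
  have Gnull: "measure (Q \<xi>') (- G) \<le> C * D \<xi> \<xi>'"
  proof -
    have "AE y in Q \<xi>. y \<notin> - G" using AE_append_S[OF \<xi>(1)] by (simp add: G_def)
    then have "- G \<in> null_sets (Q \<xi>)"
      using Gm by (subst AE_iff_null_sets) (auto simp: Q_prob(2)[OF \<xi>(1)])
    then have "measure (Q \<xi>) (- G) = 0" by (simp add: measure_def null_sets_def)
    then show ?thesis using C[OF \<xi>, of "- G"] Gm by auto
  qed
  have T1: "transfer f (x, \<xi>) - transfer f (x', \<xi>) \<le> gap B x x' \<xi>"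
    using gap_upper[OF \<xi>(1) h(1), of x x'] hint x by simp
  have T2: "(\<integral>y. a y \<partial>Q \<xi>) - (\<integral>y. a y \<partial>Q \<xi>') \<le> C * D \<xi> \<xi>'"
    using Q_lipschitz_integral[OF C \<xi>, of a] m[OF refl] f(2) unfolding a_def by fastforce
  have T3: "(\<integral>y. a y \<partial>Q \<xi>') - (\<integral>y. b y \<partial>Q \<xi>') \<le> (B / \<iota>) * D \<xi> \<xi>' + C * D \<xi> \<xi>'"
  proof -
    have int: "integrable (Q \<xi>') a" "integrable (Q \<xi>') b"
      using m[OF Q_prob(2)[OF \<xi>(2)]] f(2) unfolding a_def b_def
      by (auto intro!: q'.integrable_const_bound[where B = 1])
    have ind: "integrable (Q \<xi>') (indicator (- G) :: L2J \<Rightarrow> real)"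
      using Gm Q_prob(2)[OF \<xi>(2)] by (intro integrable_real_indicator) (auto simp: q'.emeasure_eq_measure)
    have "(\<integral>y. a y \<partial>Q \<xi>') - (\<integral>y. b y \<partial>Q \<xi>') = (\<integral>y. a y - b y \<partial>Q \<xi>')" using int by simp
    also have "\<dots> \<le> (\<integral>y. (B / \<iota>) * D \<xi> \<xi>' + indicator (- G) y \<partial>Q \<xi>')"
    proof (rule integral_mono_AE)
      show "integrable (Q \<xi>') (\<lambda>y. a y - b y)" using int by simp
      show "integrable (Q \<xi>') (\<lambda>y. (B / \<iota>) * D \<xi> \<xi>' + indicator (- G) y)" using ind by simp
      show "AE y in Q \<xi>'. a y - b y \<le> (B / \<iota>) * D \<xi> \<xi>' + indicator (- G) y"
        using AE_next[OF x(2) \<xi>(2)]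
      proof eventually_elim
        case (elim y)
        have BD: "0 \<le> (B / \<iota>) * D \<xi> \<xi>'" using B iota D_nonneg by simp
        show ?case
        proof (cases "y \<in> G")
          case True
          then show ?thesis
            using past_lip[of "move x' y" "append_past \<xi> y" "append_past \<xi>' y"] elim D_append[OF \<xi>, of y y]
            by (simp add: a_def b_def G_def)
        next
          case False
          have "a y - b y \<le> 1"
            using f(2)[of "(move x' y, append_past \<xi> y)"] f(2)[of "(move x' y, append_past \<xi>' y)"] by (simp add: a_def b_def)
          then show ?thesis using False BD by simp
        qed
      qed
    qed
    also have "\<dots> = (B / \<iota>) * D \<xi> \<xi>' + measure (Q \<xi>') (- G)"
      using ind q'.prob_space Q_prob(3)[OF \<xi>(2)] by simp
    finally show ?thesis using Gnull by linarith
  qed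
  have "transfer f (x', \<xi>) = (\<integral>y. a y \<partial>Q \<xi>)" "transfer f (x', \<xi>') = (\<integral>y. b y \<partial>Q \<xi>')"
    using \<xi> by (simp_all add: transfer_def a_def b_def)
  moreover have "(B / \<iota> + 2 * C) * D \<xi> \<xi>' = (B / \<iota>) * D \<xi> \<xi>' + C * D \<xi> \<xi>' + C * D \<xi> \<xi>'"
    by (simp only: distrib_right mult_2)
  ultimately show ?thesis using T1 T2 T3 by linarith
qed

text \<open>The weight \<theta> on the gap turns its coefficient 1 into \<open>1 / \<theta>\<close>
  relative to the cost. The condition on \<open>B\<close> leaves at least half of the gain due to
  \<iota>, whence the mean of 1 and \<open>1 / \<iota>\<close>.\<close>

lemma step_le_cost:
  assumes C: "C \<ge> 0" "2 * C \<le> B * (1 - 1 / \<iota>) / 2" and B: "B \<ge> 0" and \<theta>: "\<theta> > 1" and \<xi>: "\<xi> \<in> S"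
  defines "\<alpha> \<equiv> max (1 / \<theta>) ((1 + 1 / \<iota>) / 2)"
  shows "gap B x x' \<xi> + (B / \<iota> + 2 * C) * D \<xi> \<xi>' \<le> \<alpha> * (\<theta> * gap B x x' \<xi> + B * D \<xi> \<xi>')"
proof -
  have "gap B x x' \<xi> = (1 / \<theta>) * (\<theta> * gap B x x' \<xi>)" using \<theta> by simp
  also have "\<dots> \<le> \<alpha> * (\<theta> * gap B x x' \<xi>)"
    using gap_nonneg[OF B \<xi>, of x x'] \<theta> by (intro mult_right_mono) (auto simp: \<alpha>_def)
  finally have 1: "gap B x x' \<xi> \<le> \<alpha> * (\<theta> * gap B x x' \<xi>)" .
  have "B / \<iota> + 2 * C \<le> B / \<iota> + B * (1 - 1 / \<iota>) / 2" using C(2) by simp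
  also have "\<dots> = ((1 + 1 / \<iota>) / 2) * B" using iota by (simp add: field_simps)
  also have "\<dots> \<le> \<alpha> * B" using B by (intro mult_right_mono) (auto simp: \<alpha>_def)
  finally have "(B / \<iota> + 2 * C) * D \<xi> \<xi>' \<le> \<alpha> * B * D \<xi> \<xi>'" by (intro mult_right_mono D_nonneg)
  then show ?thesis using 1 by (simp add: distrib_left mult.assoc)
qed

text \<open>The truncation at 1 is not multiplied by \<alpha>, so strict contraction is claimed only
  below cost 1; at cost 1 the Lipschitz property survives because values stay in [0, 1].\<close>

lemma cost_lipschitz_transfer:
  assumes C: "C \<ge> 0" "2 * C \<le> B * (1 - 1 / \<iota>) / 2"
    "\<And>\<xi> \<xi>' \<Gamma>. \<xi> \<in> S \<Longrightarrow> \<xi>' \<in> S \<Longrightarrow> \<Gamma> \<in> sets borel \<Longrightarrow> \<bar>measure (Q \<xi>) \<Gamma> - measure (Q \<xi>') \<Gamma>\<bar> \<le> C * D \<xi> \<xi>'"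
    and B: "B \<ge> 0" and \<theta>: "\<theta> > 1" and f: "observable f" "\<And>z. 0 \<le> f z \<and> f z \<le> 1" "cost_lipschitz \<theta> B f"
    and z: "z \<in> X \<times> S" "z' \<in> X \<times> S"
  defines "\<alpha> \<equiv> max (1 / \<theta>) ((1 + 1 / \<iota>) / 2)"
  shows "cost \<theta> B z z' < 1 \<Longrightarrow> transfer f z - transfer f z' \<le> \<alpha> * cost \<theta> B z z'" "cost_lipschitz \<theta> B (transfer f)"
proof -
  have "0 < 1 / \<theta>" using \<theta> by simp
  then have \<alpha>: "0 < \<alpha>" "\<alpha> < 1" using \<theta> iota by (simp_all add: \<alpha>_def less_max_iff_disj)
  have main: "transfer f z - transfer f z' \<le> \<alpha> * (\<theta> * gap B (fst z) (fst z') (snd z) + B * D (snd z) (snd z'))"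
    if "z \<in> X \<times> S" "z' \<in> X \<times> S" for z z'
  proof -
    obtain x \<xi> x' \<xi>' where zz: "z = (x, \<xi>)" "z' = (x', \<xi>')" by (metis surj_pair)
    have x: "x \<in> X" "x' \<in> X" and \<xi>: "\<xi> \<in> S" "\<xi>' \<in> S" using that by (simp_all add: zz)
    show ?thesis
      unfolding zz \<alpha>_def fst_conv snd_conv
      using transfer_step[OF C(3) B f x \<xi>] step_le_cost[OF C(1,2) B \<theta> \<xi>(1), of x x' \<xi>'] by (rule order_trans)
  qed
  show "transfer f z - transfer f z' \<le> \<alpha> * cost \<theta> B z z'" if "cost \<theta> B z z' < 1"
    using main[OF z] that by (simp add: cost_def min_def split: if_splits)
  show "cost_lipschitz \<theta> B (transfer f)"
    unfolding cost_lipschitz_def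
  proof (intro ballI)
    fix z z' assume zz: "z \<in> X \<times> S" "z' \<in> X \<times> S"
    have "0 \<le> \<theta> * gap B (fst z) (fst z') (snd z) + B * D (snd z) (snd z')"
      using zz gap_nonneg[OF B] B \<theta> D_nonneg by auto
    then have "\<alpha> * (\<theta> * gap B (fst z) (fst z') (snd z) + B * D (snd z) (snd z'))
        \<le> 1 * (\<theta> * gap B (fst z) (fst z') (snd z) + B * D (snd z) (snd z'))"
      using \<alpha> by (intro mult_right_mono) auto
    then show "transfer f z - transfer f z' \<le> cost \<theta> B z z'"
      using main[OF zz] transfer_unit[OF f(1,2), of z] transfer_unit[OF f(1,2), of z'] by (simp add: cost_def)
  qed
qed

text \<open>Functions of the state alone are test functions whether continuous or not, so the gap
  bounds their transfer by definition: one step smooths every measurable observable with values in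
  [0, 1]. This is the source of convergence in total variation.\<close>

lemma cost_lipschitz_observable_of_state:
  assumes C: "C \<ge> 0" "2 * C \<le> B * (1 - 1 / \<iota>) / 2"
    "\<And>\<xi> \<xi>' \<Gamma>. \<xi> \<in> S \<Longrightarrow> \<xi>' \<in> S \<Longrightarrow> \<Gamma> \<in> sets borel \<Longrightarrow> \<bar>measure (Q \<xi>) \<Gamma> - measure (Q \<xi>') \<Gamma>\<bar> \<le> C * D \<xi> \<xi>'"
    and B: "B \<ge> 0" and \<theta>: "\<theta> > 1" and g: "g \<in> borel_measurable borel" "\<And>x. 0 \<le> g x \<and> g x \<le> 1"
  shows "observable (\<lambda>z. g (fst z))" "cost_lipschitz \<theta> B (transfer (\<lambda>z. g (fst z)))"
proof -
  show obs: "observable (\<lambda>z. g (fst z))"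
    using g measurable_compose[OF measurable_fst g(1)] by (auto simp: observable_def bounded_iff intro!: exI[of _ 1])
  have "C \<le> B" 
  proof -
    have "B * (1 - 1 / \<iota>) \<le> B * 1" using B iota by (intro mult_left_mono) auto
    then show ?thesis using C(1,2) B by simp
  qed
  have h': "(\<lambda>(s, y :: L2J). g s) \<in> borel_measurable (borel \<Otimes>\<^sub>M borel)"
    using measurable_compose[OF measurable_fst g(1)] by (simp add: case_prod_unfold)
  then have h: "(\<lambda>s y. g s) \<in> test_functions B" using g(2) B by (simp add: test_functions_def)
  show "cost_lipschitz \<theta> B (transfer (\<lambda>z. g (fst z)))"
    unfolding cost_lipschitz_def
  proof (intro ballI)
    fix z z' assume zz: "z \<in> X \<times> S" "z' \<in> X \<times> S"
    obtain x \<xi> x' \<xi>' where [simp]: "z = (x, \<xi>)" "z' = (x', \<xi>')" by (metis surj_pair)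
    have \<xi>: "\<xi> \<in> S" "\<xi>' \<in> S" using zz by auto
    have gm: "(\<lambda>y. g (move x' y)) \<in> borel_measurable borel"
      using measurable_test[OF h'] by simp
    have "\<bar>(\<integral>y. g (move x' y) \<partial>Q \<xi>) - (\<integral>y. g (move x' y) \<partial>Q \<xi>')\<bar> \<le> C * D \<xi> \<xi>'"
      by (rule Q_lipschitz_integral[OF _ \<xi> gm g(2)]) (rule C(3))
    then have "(\<integral>y. g (move x' y) \<partial>Q \<xi>) - (\<integral>y. g (move x' y) \<partial>Q \<xi>') \<le> C * D \<xi> \<xi>'"
      by (rule order_trans[OF abs_ge_self])
    also have "\<dots> \<le> B * D \<xi> \<xi>'" using \<open>C \<le> B\<close> by (intro mult_right_mono D_nonneg)
    finally have "transfer (\<lambda>z. g (fst z)) z - transfer (\<lambda>z. g (fst z)) z' \<le> gap B x x' \<xi> + B * D \<xi> \<xi>'"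
      using gap_upper[OF \<xi>(1) h, of x x'] \<xi> by (simp add: transfer_def)
    moreover have "gap B x x' \<xi> \<le> \<theta> * gap B x x' \<xi>"
      using mult_right_mono[of 1 \<theta> "gap B x x' \<xi>"] gap_nonneg[OF B \<xi>(1)] \<theta> by simp
    ultimately show "transfer (\<lambda>z. g (fst z)) z - transfer (\<lambda>z. g (fst z)) z' \<le> cost \<theta> B z z'"
      using transfer_unit[OF obs, of z] transfer_unit[OF obs, of z'] g(2) by (simp add: cost_def)
  qed
qed

text \<open>Only finitely many segments are constrained: within \<open>S\<close> this bounds the
  distance to the zero past when \<open>m\<close> is large and \<delta> small, and (SRZ) can enforce
  it.\<close>

definition small_set :: "'s \<Rightarrow> real \<Rightarrow> nat \<Rightarrow> ('s \<times> past) set" where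
  "small_set a \<delta> m = {(x, \<xi>). norm (x - a) < \<delta> \<and> (\<forall>j<m. norm (\<xi> j) < \<delta>)}"

lemma observable_small_set: "observable (indicator (small_set a \<delta> m))"
proof -
  have "small_set a \<delta> m = ball a \<delta> \<times> {\<xi>. \<forall>j<m. norm (\<xi> j) < \<delta>}"
    by (auto simp: small_set_def dist_norm norm_minus_commute)
  moreover have "{\<xi>. \<forall>j<m. norm (\<xi> j) < \<delta>} \<in> sets past_algebra"
  proof -
    have "(\<lambda>\<xi>. \<xi> j) -` ball 0 \<delta> \<in> sets past_algebra" for j
      using measurable_sets[OF measurable_component_singleton[of j UNIV "\<lambda>_. borel"], of "ball 0 \<delta>"]
      by (simp add: space_PiM)
    moreover have U: "(UNIV :: past set) \<in> sets past_algebra" using sets.top[of "past_algebra"] by (simp add: space_PiM)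
    moreover have "{\<xi> :: past. \<forall>j<m. norm (\<xi> j) < \<delta>} = (\<Inter>j\<in>{..<m}. (\<lambda>\<xi>. \<xi> j) -` ball 0 \<delta>)" by auto
    moreover have "(\<Inter>j\<in>{..<m}. (\<lambda>\<xi> :: past. \<xi> j) -` ball 0 \<delta>) \<in> sets past_algebra" if "m \<noteq> 0"
      using that calculation(1) by (intro sets.finite_INT) (auto simp: lessThan_empty_iff)
    ultimately show ?thesis by (cases "m = 0") simp_all
  qed
  ultimately have "small_set a \<delta> m \<in> sets phase_algebra" by (simp add: pair_measureI)
  then show ?thesis by (auto simp: observable_def bounded_iff indicator_def intro!: exI[of _ 1] borel_measurable_indicator)
qed

text \<open>The gap at a past close to zero differs from the gap at the zero past by a total
  variation error only, so an overlap known at the zero past alone persists for all pasts with small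
  recent segments.\<close>

lemma small_set_coupling:
  assumes C: "C \<ge> 0"
    "\<And>\<xi> \<xi>' \<Gamma>. \<xi> \<in> S \<Longrightarrow> \<xi>' \<in> S \<Longrightarrow> \<Gamma> \<in> sets borel \<Longrightarrow> \<bar>measure (Q \<xi>) \<Gamma> - measure (Q \<xi>') \<Gamma>\<bar> \<le> C * D \<xi> \<xi>'"
    and B: "B \<ge> 0" and zero: "(\<lambda>_. 0) \<in> S"
    and overlap: "\<epsilon> > 0" "\<delta>0 > 0" "\<And>x x' h. norm (x - a) < \<delta>0 \<Longrightarrow> norm (x' - a) < \<delta>0 \<Longrightarrow> h \<in> test_functions B \<Longrightarrow>
      (\<integral>y. h (move x y) y \<partial>Q (\<lambda>_. 0)) - (\<integral>y. h (move x' y) y \<partial>Q (\<lambda>_. 0)) \<le> 1 - \<epsilon>"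
  shows "\<exists>\<delta>>0. \<exists>m. \<forall>f. observable f \<longrightarrow> (\<forall>z. 0 \<le> f z \<and> f z \<le> 1) \<longrightarrow> cost_lipschitz \<theta> B f \<longrightarrow>
    (\<forall>z\<in>X \<times> S \<inter> small_set a \<delta> m. \<forall>z'\<in>X \<times> S \<inter> small_set a \<delta> m. transfer f z - transfer f z' \<le> 1 - \<epsilon> / 2)"
proof -
  let ?o = "\<lambda>_. 0 :: L2J"
  obtain b where b: "b > 0" "\<And>y. y \<in> K \<Longrightarrow> norm y \<le> b" using K_bounded by blast
  have Sb: "norm (\<xi> j) \<le> b" if "\<xi> \<in> S" for \<xi> j using subsetD[OF S_subset that] b(2) by (auto simp: Pi_iff)
  \<comment> \<open>Collects the errors: \<open>2 * C * e\<close> from moving two integrals to the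
    zero past, and the coefficient of \<open>D \<xi> \<xi>'\<close> times \<open>2 * e\<close>. With
    \<open>e = \<epsilon> / (2 * A)\<close> they use up at most half of \<epsilon>; the summand 1
    makes \<open>A\<close> positive.\<close>
  define A where "A = 2 * C + 2 * (B / \<iota> + 2 * C) + 1"
  have "B / \<iota> \<ge> 0" using B iota by simp
  then have A: "A > 0" using C(1) by (simp add: A_def)
  define e where "e = \<epsilon> / (2 * A)"
  have e: "e > 0" using overlap(1) A by (simp add: e_def)
  obtain m \<delta>1 where \<delta>1: "\<delta>1 > 0"
    "\<And>\<eta> \<eta>'. (\<And>j. norm (\<eta> j) \<le> b) \<Longrightarrow> (\<And>j. norm (\<eta>' j) \<le> b) \<Longrightarrow>
      (\<And>j. j < m \<Longrightarrow> norm (\<eta> j - \<eta>' j) \<le> \<delta>1) \<Longrightarrow> D \<eta> \<eta>' < e"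
    by (rule past_dist_small[OF iota e, of b]) blast
  define \<delta> where "\<delta> = min \<delta>0 \<delta>1"
  have \<delta>: "\<delta> > 0" using overlap(2) \<delta>1(1) by (simp add: \<delta>_def)
  have near: "D \<xi> ?o \<le> e" if "\<xi> \<in> S" "\<And>j. j < m \<Longrightarrow> norm (\<xi> j) < \<delta>" for \<xi>
    by (intro less_imp_le \<delta>1(2) Sb[OF that(1)] Sb[OF zero]) (use that(2) in \<open>force simp: \<delta>_def\<close>)
  have "transfer f (x, \<xi>) - transfer f (x', \<xi>') \<le> 1 - \<epsilon> / 2"
    if f: "observable f" "\<And>z. 0 \<le> f z \<and> f z \<le> 1" "cost_lipschitz \<theta> B f"
      and x: "x \<in> X" "x' \<in> X" and \<xi>: "\<xi> \<in> S" "\<xi>' \<in> S"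
      and sm: "(x, \<xi>) \<in> small_set a \<delta> m" "(x', \<xi>') \<in> small_set a \<delta> m" for f x x' \<xi> \<xi>'
  proof -
    have n: "D \<xi> ?o \<le> e" "D \<xi>' ?o \<le> e" using near \<xi> sm by (auto simp: small_set_def)
    have sym: "D ?o \<xi>' = D \<xi>' ?o" by (simp add: past_dist_def norm_minus_commute)
    have tri: "D \<xi> \<xi>' \<le> 2 * e"
      using Metric_space.triangle[OF metric, of \<xi> ?o \<xi>'] \<xi> zero S_subset n sym by (auto simp: subset_iff)
    have "gap B x x' \<xi> \<le> 1 - \<epsilon> + 2 * C * e"
    proof (rule gap_least[OF B])
      fix h assume h: "h \<in> test_functions B"
      have hQ: "\<bar>(\<integral>y. h (move w y) y \<partial>Q \<xi>) - (\<integral>y. h (move w y) y \<partial>Q ?o)\<bar> \<le> C * e" for w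
      proof -
        have "\<bar>(\<integral>y. h (move w y) y \<partial>Q \<xi>) - (\<integral>y. h (move w y) y \<partial>Q ?o)\<bar> \<le> C * D \<xi> ?o"
          using h by (intro Q_lipschitz_integral[OF C(2) \<xi>(1) zero] measurable_test) (auto simp: test_functions_def)
        also have "\<dots> \<le> C * e" using n C(1) by (intro mult_left_mono)
        finally show ?thesis .
      qed
      have "(\<integral>y. h (move x y) y \<partial>Q ?o) - (\<integral>y. h (move x' y) y \<partial>Q ?o) \<le> 1 - \<epsilon>"
        using sm by (intro overlap(3) h) (auto simp: small_set_def \<delta>_def)
      then show "(\<integral>y. h (move x y) y \<partial>Q \<xi>) - (\<integral>y. h (move x' y) y \<partial>Q \<xi>) \<le> 1 - \<epsilon> + 2 * C * e"
        using hQ[of x] hQ[of x'] unfolding abs_le_iff by linarith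
    qed
    moreover have "(B / \<iota> + 2 * C) * D \<xi> \<xi>' \<le> (B / \<iota> + 2 * C) * (2 * e)"
      using tri C(1) \<open>B / \<iota> \<ge> 0\<close> by (intro mult_left_mono) auto
    moreover have "2 * C * e + (B / \<iota> + 2 * C) * (2 * e) \<le> A * e" using e by (simp add: A_def algebra_simps)
    moreover have "A * e = \<epsilon> / 2" using A by (simp add: e_def)
    ultimately show ?thesis using transfer_step[OF C(2) B f x \<xi>] by linarith
  qed
  then show ?thesis using \<delta> by (intro exI[of _ \<delta>] conjI exI[of _ m]) auto
qed

lemma iterate_unit_cost_lipschitz:
  assumes C: "C \<ge> 0" "2 * C \<le> B * (1 - 1 / \<iota>) / 2"
    "\<And>\<xi> \<xi>' \<Gamma>. \<xi> \<in> S \<Longrightarrow> \<xi>' \<in> S \<Longrightarrow> \<Gamma> \<in> sets borel \<Longrightarrow> \<bar>measure (Q \<xi>) \<Gamma> - measure (Q \<xi>') \<Gamma>\<bar> \<le> C * D \<xi> \<xi>'"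
    and B: "B \<ge> 0" and \<theta>: "\<theta> > 1" and f: "observable f" "\<And>z. 0 \<le> f z \<and> f z \<le> 1" "cost_lipschitz \<theta> B f"
  shows "(\<forall>z. 0 \<le> (transfer ^^ m) f z \<and> (transfer ^^ m) f z \<le> 1) \<and> cost_lipschitz \<theta> B ((transfer ^^ m) f)"
proof (induction m)
  case 0
  show ?case using f by simp
next
  case (Suc m)
  let ?g = "(transfer ^^ m) f"
  have g: "observable ?g" "\<And>z. 0 \<le> ?g z \<and> ?g z \<le> 1" "cost_lipschitz \<theta> B ?g"
    using Suc observable_iterate[OF f(1)] by auto
  have "cost_lipschitz \<theta> B (transfer ?g)"
  proof (cases "X \<times> S = {}")
    case False
    then obtain z where "z \<in> X \<times> S" by blast
    then show ?thesis using cost_lipschitz_transfer(2)[OF C B \<theta> g] by blast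
  qed (auto simp: cost_lipschitz_def)
  then show ?case using transfer_unit[OF g(1,2)] by simp
qed

lemma cost_nonneg: "B \<ge> 0 \<Longrightarrow> \<theta> \<ge> 0 \<Longrightarrow> snd z \<in> S \<Longrightarrow> 0 \<le> cost \<theta> B z z'"
  by (simp add: cost_def gap_nonneg D_nonneg)

text \<open>With \<open>s\<close> the supremum of \<open>g\<close> on the part of \<open>A\<close>
  in \<open>X \<times> S\<close>, one has there both \<open>g \<le> s\<close> and
  \<open>g \<ge> s - (1 - e)\<close>. Visiting \<open>A\<close> with probability at least
  \<open>p\<close> thus lowers the upper bound 1 by \<open>p * (1 - s)\<close> and raises the lower
  bound 0 by \<open>p * (s - (1 - e))\<close>, in total by \<open>p * e\<close>. The two chains
  never have to move jointly.\<close>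

lemma recurrent_contraction:
  assumes g: "observable g" "\<And>z. 0 \<le> g z \<and> g z \<le> 1"
    and A: "observable (indicator A)" and p: "\<And>z. z \<in> X \<times> S \<Longrightarrow> p \<le> (transfer ^^ k) (indicator A) z" "p > 0"
    and close: "\<And>z z'. z \<in> X \<times> S \<inter> A \<Longrightarrow> z' \<in> X \<times> S \<inter> A \<Longrightarrow> g z - g z' \<le> 1 - e"
    and z: "z \<in> X \<times> S" "z' \<in> X \<times> S"
  shows "(transfer ^^ k) g z - (transfer ^^ k) g z' \<le> 1 - p * e"
proof -
  let ?A = "X \<times> S \<inter> A"
  have ne: "?A \<noteq> {}"
  proof
    assume empty: "?A = {}"
    have "(transfer ^^ k) (indicator A) z \<le> (transfer ^^ k) (\<lambda>_. 0) z"
      by (rule iterate_mono[OF A observable_const _ z(1)]) (use empty in \<open>auto simp: indicator_def\<close>)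
    then show False using p(1)[OF z(1)] p(2) by (simp add: iterate_const)
  qed
  define s where "s = (SUP w\<in>?A. g w)"
  have bdd: "bdd_above (g ` ?A)" using g(2) by (intro bdd_aboveI2[where M = 1]) auto
  have s_upper: "g w \<le> s" if "w \<in> ?A" for w unfolding s_def by (rule cSUP_upper[OF that bdd])
  have s1: "s \<le> 1" unfolding s_def using g(2) by (intro cSUP_least[OF ne]) auto
  have s_le: "s \<le> g w + (1 - e)" if "w \<in> ?A" for w
    unfolding s_def using close[OF _ that] by (intro cSUP_least[OF ne]) (auto simp: algebra_simps)
  have "(transfer ^^ k) g z \<le> (transfer ^^ k) (\<lambda>w. 1 + (s - 1) * indicator A w) z"
    by (rule iterate_mono[OF g(1) observable_affine[OF A] _ z(1)]) (use g(2) s_upper in \<open>auto simp: indicator_def\<close>)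
  also have "\<dots> = 1 + (s - 1) * (transfer ^^ k) (indicator A) z" by (simp add: iterate_affine[OF A])
  also have "(s - 1) * (transfer ^^ k) (indicator A) z \<le> (s - 1) * p"
    using p(1)[OF z(1)] s1 by (intro mult_left_mono_neg) auto
  finally have up: "(transfer ^^ k) g z \<le> 1 + (s - 1) * p" by simp
  \<comment> \<open>The lower bound \<open>p\<close> can be used only with a nonnegative
    coefficient; replacing a negative one by 0 keeps the comparison because \<open>g\<close> is
    nonnegative.\<close>
  define c where "c = max 0 (s - (1 - e))"
  have "c * p \<le> c * (transfer ^^ k) (indicator A) z'"
    using p(1)[OF z(2)] by (intro mult_left_mono) (auto simp: c_def)
  also have "\<dots> = (transfer ^^ k) (\<lambda>w. 0 + c * indicator A w) z'" by (subst iterate_affine[OF A]) simp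
  also have "\<dots> \<le> (transfer ^^ k) g z'"
    by (rule iterate_mono[OF observable_affine[OF A] g(1) _ z(2)])
      (use g(2) s_le in \<open>auto simp: indicator_def c_def algebra_simps\<close>)
  finally have low: "c * p \<le> (transfer ^^ k) g z'" .
  have "(s - (1 - e)) * p \<le> c * p" using p(2) by (intro mult_right_mono) (auto simp: c_def)
  then show ?thesis using up low by (simp add: algebra_simps)
qed

lemma iterate_cong:
  assumes "observable f" "observable g" "\<And>z. z \<in> X \<times> S \<Longrightarrow> f z = g z" "z \<in> X \<times> S"
  shows "(transfer ^^ m) f z = (transfer ^^ m) g z"
  by (rule antisym; rule iterate_mono) (use assms in auto)

text \<open>One block makes the oscillation at most \<kappa>. Dividing by \<kappa> restores an
  observable with values in [0, 1] that is Lipschitz for the same cost, so the block can be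
  repeated.\<close>

lemma geometric_oscillation:
  assumes \<kappa>: "0 < \<kappa>"
    and contr: "\<And>f z z'. observable f \<Longrightarrow> (\<forall>z. 0 \<le> f z \<and> f z \<le> 1) \<Longrightarrow> cost_lipschitz \<theta> B f \<Longrightarrow>
      z \<in> X \<times> S \<Longrightarrow> z' \<in> X \<times> S \<Longrightarrow> (transfer ^^ N) f z - (transfer ^^ N) f z' \<le> \<kappa> * cost \<theta> B z z'"
    and f: "observable f" "\<And>z. 0 \<le> f z \<and> f z \<le> 1" "cost_lipschitz \<theta> B f"
    and z: "z \<in> X \<times> S" "z' \<in> X \<times> S"
  shows "(transfer ^^ (N * j)) f z - (transfer ^^ (N * j)) f z' \<le> \<kappa> ^ j"
  using f
proof (induction j arbitrary: f)
  case 0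
  then have "f z \<le> 1" "0 \<le> f z'" by blast+
  then show ?case by simp
next
  case (Suc j)
  define F where "F = (transfer ^^ N) f"
  have F: "observable F" unfolding F_def by (rule observable_iterate[OF Suc.prems(1)])
  have diff: "F w - F w' \<le> \<kappa> * cost \<theta> B w w'" if "w \<in> X \<times> S" "w' \<in> X \<times> S" for w w'
    unfolding F_def using contr[OF Suc.prems(1) _ Suc.prems(3) that] Suc.prems(2) by blast
  have cost1: "cost \<theta> B w w' \<le> 1" for w w' by (simp add: cost_def)
  have diff1: "F w - F w' \<le> \<kappa>" if "w \<in> X \<times> S" "w' \<in> X \<times> S" for w w'
    using order_trans[OF diff[OF that] mult_left_mono[OF cost1, of \<kappa> w w']] \<kappa> by simp
  define i where "i = (INF w\<in>X \<times> S. F w)"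
  obtain b where b: "\<And>w. \<bar>F w\<bar> \<le> b" using observable_bounded[OF F] by blast
  have "bdd_below (F ` (X \<times> S))" using b by (intro bdd_belowI2[where m = "- b"]) (simp add: abs_le_iff minus_le_iff)
  then have i_le: "i \<le> F w" if "w \<in> X \<times> S" for w unfolding i_def using that by (intro cINF_lower)
  have i_ge: "F w - \<kappa> \<le> i" if "w \<in> X \<times> S" for w
    unfolding i_def using z diff1[OF that] by (intro cINF_greatest) (auto simp: algebra_simps)
  \<comment> \<open>The clipping is invisible on \<open>X \<times> S\<close>; it gives values in
    [0, 1] everywhere, as observables are defined on the whole product.\<close>
  define h where "h = (\<lambda>w. min 1 (max 0 ((F w - i) / \<kappa>)))"
  have Fh: "F w = i + \<kappa> * h w" "h w = (F w - i) / \<kappa>" if "w \<in> X \<times> S" for w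
    using i_le[OF that] i_ge[OF that] \<kappa> by (auto simp: h_def field_simps min_def max_def)
  have h: "observable h" "\<And>w. 0 \<le> h w \<and> h w \<le> 1" "cost_lipschitz \<theta> B h"
  proof -
    show "0 \<le> h w \<and> h w \<le> 1" for w by (simp add: h_def)
    then have "bounded (range h)" by (auto simp: bounded_iff intro!: exI[of _ 1])
    moreover have "h \<in> borel_measurable phase_algebra"
      using F unfolding h_def observable_def by (auto intro!: borel_measurable_min borel_measurable_max borel_measurable_divide borel_measurable_diff)
    ultimately show "observable h" by (simp add: observable_def)
    show "cost_lipschitz \<theta> B h"
      unfolding cost_lipschitz_def
    proof (intro ballI)
      fix w w' assume w: "w \<in> X \<times> S" "w' \<in> X \<times> S"
      have "h w - h w' = (F w - F w') / \<kappa>" by (simp add: Fh(2) w flip: diff_divide_distrib)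
      also have "\<dots> \<le> cost \<theta> B w w'" using diff[OF w] \<kappa> by (simp add: pos_divide_le_eq mult.commute)
      finally show "h w - h w' \<le> cost \<theta> B w w'" .
    qed
  qed
  have "(transfer ^^ (N * Suc j)) f w = i + \<kappa> * (transfer ^^ (N * j)) h w" if w: "w \<in> X \<times> S" for w
  proof -
    have "(transfer ^^ (N * Suc j)) f w = (transfer ^^ (N * j)) F w"
      by (simp add: F_def add.commute[of N] funpow_add)
    also have "\<dots> = (transfer ^^ (N * j)) (\<lambda>w. i + \<kappa> * h w) w"
      by (rule iterate_cong[OF F observable_affine[OF h(1)] Fh(1) w])
    finally show ?thesis by (simp add: iterate_affine[OF h(1)])
  qed
  then have "(transfer ^^ (N * Suc j)) f z - (transfer ^^ (N * Suc j)) f z'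
      = \<kappa> * ((transfer ^^ (N * j)) h z - (transfer ^^ (N * j)) h z')" using z by (simp add: algebra_simps)
  also have "\<dots> \<le> \<kappa> * \<kappa> ^ j" using Suc.IH[OF h] \<kappa> by (intro mult_left_mono) auto
  finally show ?case by simp
qed

lemma exponential_mixing:
  assumes zero: "(\<lambda>_. 0) \<in> S"
    and overlap: "\<And>B. B \<ge> 0 \<Longrightarrow> \<exists>\<epsilon>>0. \<exists>\<delta>>0. \<forall>x x' h. norm (x - a) < \<delta> \<longrightarrow> norm (x' - a) < \<delta> \<longrightarrow> h \<in> test_functions B \<longrightarrow>
      (\<integral>y. h (move x y) y \<partial>Q (\<lambda>_. 0)) - (\<integral>y. h (move x' y) y \<partial>Q (\<lambda>_. 0)) \<le> 1 - \<epsilon>"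
    and recurrence: "\<And>\<delta> m. \<delta> > 0 \<Longrightarrow> \<exists>k p. p > 0 \<and> (\<forall>z\<in>X \<times> S. p \<le> (transfer ^^ k) (indicator (small_set a \<delta> m)) z)"
  shows "\<exists>\<gamma>>0. \<exists>C>0. \<forall>t g. g \<in> borel_measurable borel \<longrightarrow> (\<forall>x. 0 \<le> g x \<and> g x \<le> 1) \<longrightarrow>
    (\<forall>z\<in>X \<times> S. \<forall>z'\<in>X \<times> S. (transfer ^^ t) (\<lambda>z. g (fst z)) z - (transfer ^^ t) (\<lambda>z. g (fst z)) z' \<le> C * exp (- \<gamma> * real t))"
proof -
  obtain C where C: "C > 0" "\<And>\<xi> \<xi>' \<Gamma>. \<xi> \<in> S \<Longrightarrow> \<xi>' \<in> S \<Longrightarrow> \<Gamma> \<in> sets borel \<Longrightarrow>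
      \<bar>measure (Q \<xi>) \<Gamma> - measure (Q \<xi>') \<Gamma>\<bar> \<le> C * D \<xi> \<xi>'"
    using Q_lipschitz by blast
  \<comment> \<open>The equality case of the condition
    \<open>2 * C \<le> B * (1 - 1 / \<iota>) / 2\<close>.\<close>
  define B where "B = 4 * C / (1 - 1 / \<iota>)"
  have i: "1 - 1 / \<iota> > 0" using iota by simp
  have B: "B \<ge> 0" "2 * C \<le> B * (1 - 1 / \<iota>) / 2" using i iota C(1) by (simp_all add: B_def)
  have C0: "C \<ge> 0" using C(1) by simp
  define \<theta> :: real where "\<theta> = 2"
  have \<theta>: "\<theta> > 1" by (simp add: \<theta>_def)
  define \<alpha> where "\<alpha> = max (1 / \<theta>) ((1 + 1 / \<iota>) / 2)"
  have \<alpha>: "0 < \<alpha>" "\<alpha> < 1" using i by (simp_all add: \<alpha>_def \<theta>_def less_max_iff_disj)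
  obtain \<epsilon> \<delta>0 where \<epsilon>: "\<epsilon> > 0" "\<delta>0 > 0" "\<And>x x' h. norm (x - a) < \<delta>0 \<Longrightarrow> norm (x' - a) < \<delta>0 \<Longrightarrow> h \<in> test_functions B \<Longrightarrow>
      (\<integral>y. h (move x y) y \<partial>Q (\<lambda>_. 0)) - (\<integral>y. h (move x' y) y \<partial>Q (\<lambda>_. 0)) \<le> 1 - \<epsilon>"
    using overlap[OF B(1)] by blast
  have "\<exists>\<delta>>0. \<exists>m. \<forall>f. observable f \<longrightarrow> (\<forall>z. 0 \<le> f z \<and> f z \<le> 1) \<longrightarrow> cost_lipschitz \<theta> B f \<longrightarrow>
      (\<forall>z\<in>X \<times> S \<inter> small_set a \<delta> m. \<forall>z'\<in>X \<times> S \<inter> small_set a \<delta> m. transfer f z - transfer f z' \<le> 1 - \<epsilon> / 2)"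
    by (rule small_set_coupling[OF C0 C(2) B(1) zero \<epsilon>])
  then obtain \<delta> m where \<delta>: "\<delta> > 0" and small': "\<forall>f. observable f \<longrightarrow> (\<forall>z. 0 \<le> f z \<and> f z \<le> 1) \<longrightarrow> cost_lipschitz \<theta> B f \<longrightarrow>
      (\<forall>z\<in>X \<times> S \<inter> small_set a \<delta> m. \<forall>z'\<in>X \<times> S \<inter> small_set a \<delta> m. transfer f z - transfer f z' \<le> 1 - \<epsilon> / 2)"
    by (elim exE conjE)
  note small = \<delta> small'[rule_format]
  let ?A = "small_set a \<delta> m"
  obtain k p where p: "p > 0" "\<And>z. z \<in> X \<times> S \<Longrightarrow> p \<le> (transfer ^^ k) (indicator ?A) z"
    using recurrence[OF small(1), of m] by blast
  define \<kappa> where "\<kappa> = max \<alpha> (1 - p * (\<epsilon> / 2))"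
  have \<kappa>: "0 < \<kappa>" "\<kappa> < 1" using \<alpha> p(1) \<epsilon>(1) by (simp_all add: \<kappa>_def less_max_iff_disj)
  have unit: "(\<forall>z. 0 \<le> (transfer ^^ r) f z \<and> (transfer ^^ r) f z \<le> 1) \<and> cost_lipschitz \<theta> B ((transfer ^^ r) f)"
    if "observable f" "\<forall>z. 0 \<le> f z \<and> f z \<le> 1" "cost_lipschitz \<theta> B f" for f r
    by (rule iterate_unit_cost_lipschitz[OF C0 B(2) C(2) B(1) \<theta>]) (use that in auto)
  \<comment> \<open>The same \<open>k + 1\<close> steps serve both regimes. Below cost 1 the first
    step of the chain contracts, applied to the \<open>k\<close>-fold transfer, which keeps the
    Lipschitz class; at cost 1 the first \<open>k\<close> steps reach the small set with probability
    at least \<open>p\<close> and the last one uses the overlap there.\<close>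
  have contr: "(transfer ^^ Suc k) f z - (transfer ^^ Suc k) f z' \<le> \<kappa> * cost \<theta> B z z'"
    if f: "observable f" "\<forall>z. 0 \<le> f z \<and> f z \<le> 1" "cost_lipschitz \<theta> B f" and z: "z \<in> X \<times> S" "z' \<in> X \<times> S" for f z z'
  proof (cases "cost \<theta> B z z' < 1")
    case True
    let ?g = "(transfer ^^ k) f"
    have g: "observable ?g" "\<And>z. 0 \<le> ?g z \<and> ?g z \<le> 1" "cost_lipschitz \<theta> B ?g"
      using unit[OF f] observable_iterate[OF f(1)] by blast+
    have "transfer ?g z - transfer ?g z' \<le> \<alpha> * cost \<theta> B z z'"
      unfolding \<alpha>_def by (rule cost_lipschitz_transfer(1)[OF C0 B(2) C(2) B(1) \<theta> g z True])
    also have "\<dots> \<le> \<kappa> * cost \<theta> B z z'"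
      using cost_nonneg[OF B(1), where \<theta> = \<theta> and z = z and z' = z'] \<theta> z by (intro mult_right_mono) (auto simp: \<kappa>_def)
    finally show ?thesis by simp
  next
    case False
    then have c1: "cost \<theta> B z z' = 1" by (simp add: cost_def)
    have "(transfer ^^ k) (transfer f) z - (transfer ^^ k) (transfer f) z' \<le> 1 - p * (\<epsilon> / 2)"
    proof (rule recurrent_contraction[OF observable_transfer[OF f(1)] _ observable_small_set p(2) p(1) _ z])
      show "0 \<le> transfer f z \<and> transfer f z \<le> 1" for z using transfer_unit[OF f(1)] f(2) by blast
    next
      fix w w' assume w: "w \<in> X \<times> S \<inter> ?A" "w' \<in> X \<times> S \<inter> ?A"
      show "transfer f w - transfer f w' \<le> 1 - \<epsilon> / 2"
        by (rule small(2)[OF f(1) _ f(3) w]) (use f(2) in blast)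
    qed
    then show ?thesis by (simp add: c1 funpow_swap1 \<kappa>_def)
  qed
  define N where "N = Suc k"
  have "N > 0" by (simp add: N_def)
  define \<gamma> where "\<gamma> = - ln \<kappa> / real N"
  have \<gamma>: "\<gamma> > 0" using \<kappa> by (simp add: \<gamma>_def N_def divide_neg_pos)
  have pow: "\<kappa> ^ j = exp (- \<gamma> * real (N * j))" for j
  proof -
    have "\<kappa> ^ j = exp (real j * ln \<kappa>)" using \<kappa> by (simp add: exp_of_nat_mult)
    also have "real j * ln \<kappa> = - \<gamma> * real (N * j)" using \<open>N > 0\<close> by (simp add: \<gamma>_def)
    finally show ?thesis .
  qed
  have "(transfer ^^ t) (\<lambda>z. g (fst z)) z - (transfer ^^ t) (\<lambda>z. g (fst z)) z' \<le> exp (\<gamma> * real N) * exp (- \<gamma> * real t)"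
    if g: "g \<in> borel_measurable borel" "\<forall>x. 0 \<le> g x \<and> g x \<le> 1" and z: "z \<in> X \<times> S" "z' \<in> X \<times> S" for t g z z'
  proof (cases t)
    case 0
    have "g (fst z) - g (fst z') \<le> 1" using g(2)[rule_format, of "fst z"] g(2)[rule_format, of "fst z'"] by linarith
    moreover have "1 \<le> exp (\<gamma> * real N)" using \<gamma> by simp
    ultimately have "g (fst z) - g (fst z') \<le> exp (\<gamma> * real N)" by (rule order_trans)
    then show ?thesis using 0 by simp
  next
    case (Suc u)
    let ?f0 = "\<lambda>z. g (fst z)"
    note f0 = cost_lipschitz_observable_of_state[OF C0 B(2) C(2) B(1) \<theta> g(1)]
    have obs0: "observable ?f0" by (rule f0(1)) (use g(2) in auto)
    have "cost_lipschitz \<theta> B (transfer ?f0)" by (rule f0(2)) (use g(2) in auto)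
    moreover have "0 \<le> transfer ?f0 z \<and> transfer ?f0 z \<le> 1" for z by (rule transfer_unit[OF obs0]) (use g(2) in auto)
    ultimately have f1: "(\<forall>z. 0 \<le> (transfer ^^ r) (transfer ?f0) z \<and> (transfer ^^ r) (transfer ?f0) z \<le> 1)
        \<and> cost_lipschitz \<theta> B ((transfer ^^ r) (transfer ?f0))" for r
      using obs0 by (intro unit observable_transfer) auto
    \<comment> \<open>One transfer is spent on smoothing the observable and \<open>r\<close> more
      are applied before the \<open>j\<close> blocks of length \<open>N\<close>; the incomplete
      block is paid for by the factor \<open>exp (\<gamma> * real N)\<close>.\<close>
    define j where "j = u div N"
    define r where "r = u mod N"
    have u: "u = N * j + r" by (simp add: j_def r_def)
    have "r < N" by (simp add: r_def N_def)
    have "(transfer ^^ t) ?f0 = (transfer ^^ (N * j)) ((transfer ^^ r) (transfer ?f0))"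
    proof -
      have "(transfer ^^ Suc u) ?f0 = (transfer ^^ u) (transfer ?f0)" by (simp add: funpow_swap1)
      then show ?thesis by (simp add: Suc u funpow_add)
    qed
    moreover have "(transfer ^^ (N * j)) ((transfer ^^ r) (transfer ?f0)) z - (transfer ^^ (N * j)) ((transfer ^^ r) (transfer ?f0)) z' \<le> \<kappa> ^ j"
    proof (rule geometric_oscillation[OF \<kappa>(1) _ _ _ _ z])
      show "observable ((transfer ^^ r) (transfer ?f0))" by (intro observable_iterate observable_transfer obs0)
      show "0 \<le> (transfer ^^ r) (transfer ?f0) w \<and> (transfer ^^ r) (transfer ?f0) w \<le> 1" for w using f1 by blast
      show "cost_lipschitz \<theta> B ((transfer ^^ r) (transfer ?f0))" using f1 by blast
    qed (use contr N_def in simp)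
    moreover have "\<kappa> ^ j \<le> exp (\<gamma> * real N) * exp (- \<gamma> * real t)"
    proof -
      have "real t \<le> real (N * j) + real N" using \<open>r < N\<close> u Suc by linarith
      then have "- \<gamma> * real (N * j) \<le> \<gamma> * real N + - \<gamma> * real t"
        using mult_left_mono[of "real t" "real (N * j) + real N" \<gamma>] \<gamma> by (simp add: distrib_left)
      then show ?thesis unfolding pow by (simp flip: exp_add)
    qed
    ultimately show ?thesis by simp
  qed
  then show ?thesis using \<gamma> by (intro exI[of _ \<gamma>] conjI exI[of _ "exp (\<gamma> * real N)"]) auto
qed

end

section \<open>Iterated kernels and the zero past\<close>

context stationary_noise begin

text \<open>The integrands have to be compared only along lists from \<open>K\<close> that keep the
  past in \<open>S\<close>. Monotonicity of \<open>nn_integral\<close> holds for arbitrary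
  functions, so the events of (SRZ) call for no measurability argument.\<close>

lemma iterated_integral_mono:
  assumes "\<xi> \<in> S"
    and "\<And>ys. length ys = m \<Longrightarrow> set ys \<subseteq> K \<Longrightarrow> foldl append_past \<xi> ys \<in> S \<Longrightarrow> g ys \<le> g' ys"
  shows "iterated_integral Q m g \<xi> \<le> iterated_integral Q m g' \<xi>"
  using assms
proof (induction m arbitrary: \<xi> g g')
  case (Suc m)
  have "(\<integral>\<^sup>+y. iterated_integral Q m (\<lambda>ys. g (y # ys)) (append_past \<xi> y) \<partial>Q \<xi>)
      \<le> (\<integral>\<^sup>+y. iterated_integral Q m (\<lambda>ys. g' (y # ys)) (append_past \<xi> y) \<partial>Q \<xi>)"
  proof (rule nn_integral_mono_AE)
    show "AE y in Q \<xi>. iterated_integral Q m (\<lambda>ys. g (y # ys)) (append_past \<xi> y)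
        \<le> iterated_integral Q m (\<lambda>ys. g' (y # ys)) (append_past \<xi> y)"
      using Q_K(2)[OF Suc.prems(1)] AE_append_S[OF Suc.prems(1)]
    proof eventually_elim
      case (elim y)
      show ?case by (rule Suc.IH[OF elim(2)]) (use Suc.prems(2) elim in auto)
    qed
  qed
  then show ?case by simp
qed simp

lemma iterated_integral_const_0: "\<xi> \<in> S \<Longrightarrow> iterated_integral Q m (\<lambda>_. 0) \<xi> = 0"
proof (induction m arbitrary: \<xi>)
  case (Suc m)
  have "(\<integral>\<^sup>+y. iterated_integral Q m (\<lambda>_. 0) (append_past \<xi> y) \<partial>Q \<xi>) = (\<integral>\<^sup>+y. 0 \<partial>Q \<xi>)"
    using AE_append_S[OF Suc.prems] by (intro nn_integral_cong_AE) (auto elim!: eventually_mono intro: Suc.IH)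
  then show ?case by simp
qed simp

lemma S_nonempty: "S \<noteq> {}"
  using S_measurable_full(2) pasts.AE_contr by fastforce

lemma foldl_append_past:
  "j < length ys \<Longrightarrow> foldl append_past \<xi> ys j = ys ! (length ys - 1 - j)"
proof (induction ys arbitrary: j rule: rev_induct)
  case (snoc y ys)
  then show ?case by (cases j) (auto simp: append_past_def nth_append)
qed simp

text \<open>If no past in \<open>S\<close> had small recent segments, the indicator in (SRZ) would
  vanish along all lists that matter and the probability would be 0. So \<open>S\<close> contains
  pasts arbitrarily close to the zero past, and \<open>S\<close> is closed.\<close>

lemma zero_past:
  assumes "SRZ S Q" shows "(\<lambda>_. 0) \<in> S"
proof (rule S_closed)
  obtain \<xi> where \<xi>: "\<xi> \<in> S" using S_nonempty by blast
  have reach: "\<exists>\<eta>\<in>S. \<forall>j<n. norm (\<eta> j) < \<delta>" if n: "n \<ge> 1" "\<delta> > 0" for n \<delta>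
  proof (rule ccontr)
    assume none: "\<not> ?thesis"
    obtain s where "(INF \<xi>\<in>S. delayed_prob Q s n \<xi> {ys. length ys = n \<and> set ys \<subseteq> ball 0 \<delta>}) > 0"
      using assms n unfolding SRZ_def by blast
    then have "delayed_prob Q s n \<xi> {ys. length ys = n \<and> set ys \<subseteq> ball 0 \<delta>} > 0"
      using \<xi> by (meson INF_lower less_le_trans)
    moreover have "delayed_prob Q s n \<xi> {ys. length ys = n \<and> set ys \<subseteq> ball 0 \<delta>} \<le> iterated_integral Q (s + n) (\<lambda>_. 0) \<xi>"
      unfolding delayed_prob_def
    proof (rule iterated_integral_mono[OF \<xi>])
      fix ys assume ys: "length ys = s + n" "foldl append_past \<xi> ys \<in> S"
      have "drop s ys \<notin> {ys. length ys = n \<and> set ys \<subseteq> ball 0 \<delta>}"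
      proof
        assume *: "drop s ys \<in> {ys. length ys = n \<and> set ys \<subseteq> ball 0 \<delta>}"
        have "norm (foldl append_past \<xi> ys j) < \<delta>" if j: "j < n" for j
        proof -
          have "foldl append_past \<xi> ys j = drop s ys ! (n - 1 - j)"
            using j ys(1) by (subst foldl_append_past) auto
          moreover have "drop s ys ! (n - 1 - j) \<in> set (drop s ys)" using j ys(1) by (intro nth_mem) simp
          ultimately show ?thesis using * by auto
        qed
        then show False using none ys(2) by blast
      qed
      then show "indicator {ys. length ys = n \<and> set ys \<subseteq> ball 0 \<delta>} (drop s ys) \<le> (0 :: ennreal)" by simp
    qed
    ultimately show False by (simp add: iterated_integral_const_0[OF \<xi>])
  qed
  have zK: "0 \<in> K"
  proof -
    have "\<exists>y\<in>K. dist y 0 < e" if "e > 0" for e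
      using reach[of 1 e] that S_subset by (auto simp: Pi_iff)
    then have "0 \<in> closure K" by (simp add: closure_approachable)
    then show ?thesis using compact_imp_closed[OF compact_K] by simp
  qed
  then show "(\<lambda>_. 0) \<in> UNIV \<rightarrow> K" by simp
  obtain b where b: "b > 0" "\<And>y. y \<in> K \<Longrightarrow> norm y \<le> b" using K_bounded by blast
  fix e :: real assume e: "e > 0"
  obtain m \<delta> where \<delta>: "\<delta> > 0"
    "\<And>\<eta> \<eta>'. (\<And>j. norm (\<eta> j) \<le> b) \<Longrightarrow> (\<And>j. norm (\<eta>' j) \<le> b) \<Longrightarrow>
      (\<And>j. j < m \<Longrightarrow> norm (\<eta> j - \<eta>' j) \<le> \<delta>) \<Longrightarrow> D \<eta> \<eta>' < e"
    by (rule past_dist_small[OF iota e, of b]) blast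
  \<comment> \<open>\<open>Suc m\<close> in place of \<open>m\<close>, because (SRZ) concerns at
    least one segment.\<close>
  obtain \<eta> where \<eta>: "\<eta> \<in> S" "\<And>j. j < Suc m \<Longrightarrow> norm (\<eta> j) < \<delta>"
    using reach[of "Suc m" \<delta>] \<delta>(1) by auto
  have "D (\<lambda>_. 0) \<eta> < e"
  proof (rule \<delta>(2))
    show "norm (\<eta> j) \<le> b" for j using b(2) subsetD[OF S_subset \<eta>(1)] by (auto simp: Pi_iff)
    show "norm (0 - \<eta> j) \<le> \<delta>" if "j < m" for j using \<eta>(2)[of j] that by simp
  qed (use b(1) in simp)
  then show "\<exists>\<xi>'\<in>S. D (\<lambda>_. 0) \<xi>' < e" using \<eta>(1) by blast
qed

end

text \<open>Setwise limits are finitely additive. Since \<open>e n\<close> is uniform over sets, the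
  limit inherits continuity at the empty set from a single \<open>\<nu> n\<close>, hence countable
  additivity.\<close>

lemma uniform_Cauchy_limit_measure:
  assumes \<nu>: "\<And>n. prob_space (\<nu> n)" "\<And>n. sets (\<nu> n) = sets M"
    and cauchy: "\<And>n m \<Gamma>. n \<le> m \<Longrightarrow> \<Gamma> \<in> sets M \<Longrightarrow> \<bar>measure (\<nu> n) \<Gamma> - measure (\<nu> m) \<Gamma>\<bar> \<le> e n"
    and e: "e \<longlonglongrightarrow> (0::real)"
  shows "\<exists>\<mu>. prob_space \<mu> \<and> sets \<mu> = sets M \<and> (\<forall>n. \<forall>\<Gamma>\<in>sets M. \<bar>measure (\<nu> n) \<Gamma> - measure \<mu> \<Gamma>\<bar> \<le> e n)"
proof -
  have space: "space (\<nu> n) = space M" for n by (rule sets_eq_imp_space_eq[OF \<nu>(2)])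
  interpret \<nu>: prob_space "\<nu> n" for n by (rule \<nu>(1))
  define m where "m = (\<lambda>\<Gamma>. lim (\<lambda>n. measure (\<nu> n) \<Gamma>))"
  have lim: "(\<lambda>n. measure (\<nu> n) \<Gamma>) \<longlonglongrightarrow> m \<Gamma>" if \<Gamma>: "\<Gamma> \<in> sets M" for \<Gamma>
  proof -
    have "Cauchy (\<lambda>n. measure (\<nu> n) \<Gamma>)"
    proof (rule CauchyI')
      fix \<epsilon> :: real assume "\<epsilon> > 0"
      then have "eventually (\<lambda>n. e n < \<epsilon>) sequentially" by (rule order_tendstoD(2)[OF e])
      then obtain N where N: "\<And>n. n \<ge> N \<Longrightarrow> e n < \<epsilon>" by (auto simp: eventually_sequentially)
      have "dist (measure (\<nu> n) \<Gamma>) (measure (\<nu> k) \<Gamma>) < \<epsilon>" if "n \<ge> N" "k > n" for n k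
        using cauchy[OF less_imp_le[OF that(2)] \<Gamma>] N[OF that(1)] by (simp add: dist_real_def)
      then show "\<exists>N. \<forall>n\<ge>N. \<forall>k>n. dist (measure (\<nu> n) \<Gamma>) (measure (\<nu> k) \<Gamma>) < \<epsilon>" by blast
    qed
    then show ?thesis unfolding m_def by (simp add: Cauchy_convergent_iff convergent_LIMSEQ_iff)
  qed
  have close: "\<bar>measure (\<nu> n) \<Gamma> - m \<Gamma>\<bar> \<le> e n" if \<Gamma>: "\<Gamma> \<in> sets M" for n \<Gamma>
  proof (rule LIMSEQ_le_const2)
    show "(\<lambda>k. \<bar>measure (\<nu> n) \<Gamma> - measure (\<nu> k) \<Gamma>\<bar>) \<longlonglongrightarrow> \<bar>measure (\<nu> n) \<Gamma> - m \<Gamma>\<bar>"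
      by (intro tendsto_intros lim \<Gamma>)
    show "\<exists>N. \<forall>k\<ge>N. \<bar>measure (\<nu> n) \<Gamma> - measure (\<nu> k) \<Gamma>\<bar> \<le> e n" using cauchy[OF _ \<Gamma>] by blast
  qed
  have m0: "0 \<le> m \<Gamma>" if "\<Gamma> \<in> sets M" for \<Gamma>
    by (rule LIMSEQ_le_const[OF lim[OF that]]) auto
  define \<mu> where "\<mu> = measure_of (space M) (sets M) (\<lambda>\<Gamma>. ennreal (m \<Gamma>))"
  have add: "m (A \<union> B) = m A + m B" if "A \<in> sets M" "B \<in> sets M" "A \<inter> B = {}" for A B
  proof (rule LIMSEQ_unique[OF lim])
    have "(\<lambda>n. measure (\<nu> n) A + measure (\<nu> n) B) \<longlonglongrightarrow> m A + m B" by (intro tendsto_add lim that)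
    moreover have "measure (\<nu> n) (A \<union> B) = measure (\<nu> n) A + measure (\<nu> n) B" for n
      using that \<nu>(2) by (intro \<nu>.finite_measure_Union) auto
    ultimately show "(\<lambda>n. measure (\<nu> n) (A \<union> B)) \<longlonglongrightarrow> m A + m B" by simp
  qed (use that in auto)
  have em: "emeasure \<mu> \<Gamma> = ennreal (m \<Gamma>)" if \<Gamma>: "\<Gamma> \<in> sets M" for \<Gamma>
  proof -
    have empty: "m {} = 0" unfolding m_def by simp
    have pos: "positive (sets M) (\<lambda>\<Gamma>. ennreal (m \<Gamma>))" by (simp add: positive_def empty)
    have "additive (sets M) (\<lambda>\<Gamma>. ennreal (m \<Gamma>))"
      unfolding additive_def by (intro ballI impI) (simp add: add m0 ennreal_plus)
    then have "countably_additive (sets M) (\<lambda>\<Gamma>. ennreal (m \<Gamma>))"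
    proof (rule sets.empty_continuous_imp_countably_additive[OF pos])
      show "\<forall>A\<in>sets M. ennreal (m A) \<noteq> \<infinity>" by simp
      fix A :: "nat \<Rightarrow> _" assume A: "range A \<subseteq> sets M" "decseq A" "(\<Inter>i. A i) = {}"
      have Ai: "A i \<in> sets M" for i using A(1) by blast
      have "(\<lambda>i. m (A i)) \<longlonglongrightarrow> 0"
      proof (rule LIMSEQ_I)
        fix r :: real assume r: "r > 0"
        obtain n where n: "e n < r / 2"
          using order_tendstoD(2)[OF e, of "r / 2"] r by (auto simp: eventually_sequentially)
        have "(\<lambda>i. measure (\<nu> n) (A i)) \<longlonglongrightarrow> measure (\<nu> n) (\<Inter>i. A i)"
          using A \<nu>(2) by (intro \<nu>.finite_Lim_measure_decseq) auto
        then have "eventually (\<lambda>i. measure (\<nu> n) (A i) < r / 2) sequentially"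
          using A(3) r by (intro order_tendstoD(2)) auto
        then obtain N where "\<And>i. i \<ge> N \<Longrightarrow> measure (\<nu> n) (A i) < r / 2" by (auto simp: eventually_sequentially)
        moreover have "m (A i) \<le> measure (\<nu> n) (A i) + e n" for i using close[OF Ai, of n i] by (simp add: abs_le_iff)
        ultimately have "norm (m (A i) - 0) < r" if "i \<ge> N" for i
          using that n m0[OF Ai, of i] by (smt (verit) real_norm_def field_sum_of_halves)
        then show "\<exists>N. \<forall>i\<ge>N. norm (m (A i) - 0) < r" by blast
      qed
      then show "(\<lambda>i. ennreal (m (A i))) \<longlonglongrightarrow> 0" using tendsto_ennrealI[of "\<lambda>i. m (A i)" 0] by simp
    qed
    then show ?thesis
      using pos \<Gamma> sets.sigma_algebra_axioms unfolding \<mu>_def by (intro emeasure_measure_of_sigma) auto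
  qed
  have sets: "sets \<mu> = sets M" unfolding \<mu>_def by simp
  have "prob_space \<mu>"
  proof
    have "(\<lambda>n. measure (\<nu> n) (space M)) \<longlonglongrightarrow> m (space M)" by (rule lim) simp
    moreover have "measure (\<nu> n) (space M) = 1" for n using \<nu>.prob_space[of n] space[of n] by simp
    ultimately have "m (space M) = 1" using LIMSEQ_unique[OF tendsto_const, of 1] by simp
    then show "emeasure \<mu> (space \<mu>) = 1" using em[of "space M"] sets_eq_imp_space_eq[OF sets] by simp
  qed
  moreover have "measure \<mu> \<Gamma> = m \<Gamma>" if "\<Gamma> \<in> sets M" for \<Gamma>
    using em[OF that] m0[OF that] by (simp add: measure_def)
  ultimately show ?thesis using sets close by (intro exI[of _ \<mu>]) auto
qed

section \<open>Iterated transfers and the state as a function of the past\<close>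

context driven_noise begin

lemma transfer_nonneg: "(\<And>z. 0 \<le> f z) \<Longrightarrow> 0 \<le> transfer f z"
  by (cases z) (simp add: transfer_def)

text \<open>Connects the transfer operator with the iterated integrals in which (SRZ) is
  formulated.\<close>

lemma iterated_transfer:
  assumes f: "observable f" "\<And>z. 0 \<le> f z" and \<xi>: "\<xi> \<in> S"
  shows "ennreal ((transfer ^^ m) f (x, \<xi>)) = iterated_integral Q m (\<lambda>ys. ennreal (f (foldl move x ys, foldl append_past \<xi> ys))) \<xi>"
    and "0 \<le> (transfer ^^ m) f (x, \<xi>)"
proof -
  have "(\<forall>w. 0 \<le> (transfer ^^ m) f w) \<and> (\<forall>x. \<forall>\<xi>\<in>S. ennreal ((transfer ^^ m) f (x, \<xi>))
    = iterated_integral Q m (\<lambda>ys. ennreal (f (foldl move x ys, foldl append_past \<xi> ys))) \<xi>)"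
  proof (induction m)
    case 0
    show ?case using f(2) by simp
  next
    case (Suc m)
    let ?g = "(transfer ^^ m) f"
    have g: "observable ?g" by (rule observable_iterate[OF f(1)])
    have "0 \<le> transfer ?g w" for w
      using Suc.IH by (intro transfer_nonneg) blast
    moreover have "ennreal (transfer ?g (x, \<xi>)) = iterated_integral Q (Suc m) (\<lambda>ys. ennreal (f (foldl move x ys, foldl append_past \<xi> ys))) \<xi>"
      if \<xi>: "\<xi> \<in> S" for x \<xi>
    proof -
      have "(\<integral>\<^sup>+y. ennreal (?g (move x y, append_past \<xi> y)) \<partial>kernel \<xi>) = ennreal (\<integral>y. ?g (move x y, append_past \<xi> y) \<partial>kernel \<xi>)"
        by (rule nn_integral_eq_integral[OF integrable_next[OF g]]) (use Suc.IH in blast)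
      then have "ennreal (transfer ?g (x, \<xi>)) = (\<integral>\<^sup>+y. ennreal (?g (move x y, append_past \<xi> y)) \<partial>Q \<xi>)"
        using \<xi> by (simp add: transfer_def[of ?g])
      also have "\<dots> = (\<integral>\<^sup>+y. iterated_integral Q m (\<lambda>ys. ennreal (f (foldl move (move x y) ys, foldl append_past (append_past \<xi> y) ys))) (append_past \<xi> y) \<partial>Q \<xi>)"
        using AE_append_S[OF \<xi>] Suc.IH by (intro nn_integral_cong_AE) (auto elim!: eventually_mono)
      finally show ?thesis by simp
    qed
    ultimately show ?case by simp
  qed
  then show "ennreal ((transfer ^^ m) f (x, \<xi>)) = iterated_integral Q m (\<lambda>ys. ennreal (f (foldl move x ys, foldl append_past \<xi> ys))) \<xi>"
    and "0 \<le> (transfer ^^ m) f (x, \<xi>)" using \<xi> by blast+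
qed

text \<open>In contrast to \<open>iterate_mono\<close> the initial state may lie outside
  \<open>X\<close>: only the states reached after \<open>m\<close> steps are compared, and those are
  what absorption controls.\<close>

lemma iterate_mono_reach:
  assumes f: "observable f" "\<And>z. 0 \<le> f z" and g: "observable g" "\<And>z. 0 \<le> g z" and \<xi>: "\<xi> \<in> S"
    and le: "\<And>ys \<eta>. length ys = m \<Longrightarrow> set ys \<subseteq> K \<Longrightarrow> \<eta> \<in> S \<Longrightarrow> f (foldl move x ys, \<eta>) \<le> g (foldl move x ys, \<eta>)"
  shows "(transfer ^^ m) f (x, \<xi>) \<le> (transfer ^^ m) g (x, \<xi>)"
proof -
  have "ennreal ((transfer ^^ m) f (x, \<xi>)) \<le> ennreal ((transfer ^^ m) g (x, \<xi>))"
    unfolding iterated_transfer(1)[OF f \<xi>] iterated_transfer(1)[OF g \<xi>]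
    using le by (intro iterated_integral_mono[OF \<xi>] ennreal_leI) auto
  then show ?thesis using iterated_transfer(2)[OF g \<xi>] by (simp add: ennreal_le_iff)
qed

text \<open>Consumes the \<open>k\<close> most recent segments of \<xi>, the oldest first; the
  latest has index 0, so the recursion peels it off.\<close>

primrec run :: "nat \<Rightarrow> 's \<Rightarrow> past \<Rightarrow> 's" where
  "run 0 x \<xi> = x"
| "run (Suc k) x \<xi> = move (run k x (\<lambda>j. \<xi> (Suc j))) (\<xi> 0)"

lemma run_append: "run (Suc k) x (append_past \<xi> y) = move (run k x \<xi>) y"
  by (simp add: append_past_def)

lemma run_foldl: "run k x \<xi> = foldl move x (map (\<lambda>j. \<xi> (k - 1 - j)) [0..<k])"
proof (induction k arbitrary: \<xi>)
  case (Suc k)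
  have "map (\<lambda>j. \<xi> (Suc (k - Suc j))) [0..<k] = map (\<lambda>j. \<xi> (k - j)) [0..<k]"
    by (auto simp: Suc_diff_Suc)
  note eq = this
  show ?case by (simp add: Suc.IH eq del: map_eq_conv)
qed simp

lemma measurable_run: "run k x \<in> past_algebra \<rightarrow>\<^sub>M borel"
proof (induction k)
  case (Suc k)
  have "(\<lambda>\<xi> j. \<xi> (Suc j)) \<in> past_algebra \<rightarrow>\<^sub>M (past_algebra :: past measure)"
    by (rule measurable_PiM_single') (auto intro: measurable_component_singleton)
  from measurable_compose[OF this Suc] have 1: "(\<lambda>\<xi>. run k x (\<lambda>j. \<xi> (Suc j))) \<in> past_algebra \<rightarrow>\<^sub>M borel" .
  have 2: "(\<lambda>\<xi> :: past. \<xi> 0) \<in> past_algebra \<rightarrow>\<^sub>M borel" by (rule measurable_component_singleton) simp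
  show ?case using measurable_compose[OF measurable_Pair[OF 1 2] measurable_move] by simp
qed simp

text \<open>The left side reads the past at the final time, the right side \<open>k\<close> steps
  earlier, where the transfers start; invariance of the law of the past under appending identifies
  the two, one step at a time.\<close>

lemma run_law:
  assumes f: "observable f" "\<And>z. 0 \<le> f z"
  shows "(\<integral>\<^sup>+\<xi>. ennreal (f (run k x \<xi>, \<xi>)) \<partial>pasts) = (\<integral>\<^sup>+\<xi>. ennreal ((transfer ^^ k) f (x, \<xi>)) \<partial>pasts)"
  using f
proof (induction k arbitrary: f)
  case (Suc k)
  have "(\<lambda>\<xi>. (run (Suc k) x \<xi>, \<xi>)) \<in> past_algebra \<rightarrow>\<^sub>M phase_algebra" by (intro measurable_Pair measurable_run measurable_ident_sets refl)
  from measurable_compose[OF this, of f borel] Suc.prems(1)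
  have "(\<lambda>\<xi>. ennreal (f (run (Suc k) x \<xi>, \<xi>))) \<in> borel_measurable past_algebra"
    by (intro measurable_compose[OF _ measurable_ennreal]) (simp add: observable_def)
  then have "(\<integral>\<^sup>+\<xi>. ennreal (f (run (Suc k) x \<xi>, \<xi>)) \<partial>pasts)
      = (\<integral>\<^sup>+\<xi>. (\<integral>\<^sup>+y. ennreal (f (run (Suc k) x (append_past \<xi> y), append_past \<xi> y)) \<partial>kernel \<xi>) \<partial>pasts)"
    by (rule nn_integral_pasts_append)
  also have "\<dots> = (\<integral>\<^sup>+\<xi>. ennreal (transfer f (run k x \<xi>, \<xi>)) \<partial>pasts)"
  proof (rule nn_integral_cong)
    fix \<xi>
    show "(\<integral>\<^sup>+y. ennreal (f (run (Suc k) x (append_past \<xi> y), append_past \<xi> y)) \<partial>kernel \<xi>) = ennreal (transfer f (run k x \<xi>, \<xi>))"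
      unfolding run_append using integrable_next[OF Suc.prems(1), of \<xi> "run k x \<xi>"] Suc.prems(2)
      by (subst nn_integral_eq_integral) (auto simp: transfer_def)
  qed
  also have "\<dots> = (\<integral>\<^sup>+\<xi>. ennreal ((transfer ^^ k) (transfer f) (x, \<xi>)) \<partial>pasts)"
    using Suc.prems by (intro Suc.IH observable_transfer) (auto intro: transfer_nonneg)
  finally show ?case by (simp add: funpow_swap1)
qed simp

subsection \<open>Convergence of the marginals\<close>

definition marginal :: "nat \<Rightarrow> 's \<Rightarrow> 's measure" where
  "marginal t x = distr pasts borel (run t x)"

definition reaches :: "nat \<Rightarrow> 's \<Rightarrow> bool" where
  "reaches T x \<longleftrightarrow> (\<forall>ys. length ys = T \<longrightarrow> set ys \<subseteq> K \<longrightarrow> foldl move x ys \<in> X)"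

lemma run_pasts: "run t x \<in> pasts \<rightarrow>\<^sub>M borel"
  using measurable_run measurable_cong_sets[OF sets_pasts(1) refl] by blast

lemma marginal_prob: "prob_space (marginal t x)" "sets (marginal t x) = sets borel"
  unfolding marginal_def by (auto intro: pasts.prob_space_distr run_pasts)

lemma reaches_invariant: "x \<in> X \<Longrightarrow> reaches T x"
  unfolding reaches_def
proof (intro allI impI)
  fix ys assume "x \<in> X" "set ys \<subseteq> K"
  then show "foldl move x ys \<in> X" by (induction ys arbitrary: x) (auto intro: move_X)
qed

lemma iterate_nonneg: "(\<And>z. 0 \<le> f z) \<Longrightarrow> 0 \<le> (transfer ^^ m) f z"
  by (induction m arbitrary: z) (auto intro: transfer_nonneg)

lemma iterate_near_const:
  assumes f: "observable f" "\<And>z. 0 \<le> f z" and near: "\<And>z. z \<in> X \<times> S \<Longrightarrow> \<bar>f z - c\<bar> \<le> e"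
    and x: "reaches T x" "\<xi> \<in> S"
  shows "\<bar>(transfer ^^ T) f (x, \<xi>) - c\<bar> \<le> e"
proof -
  have near': "f (foldl move x ys, \<eta>) \<le> c + e" "c - e \<le> f (foldl move x ys, \<eta>)"
    if "length ys = T" "set ys \<subseteq> K" "\<eta> \<in> S" for ys \<eta>
    using near[of "(foldl move x ys, \<eta>)"] that x(1) by (auto simp: reaches_def abs_le_iff)
  \<comment> \<open>\<open>iterate_mono_reach\<close> compares nonnegative functions, hence the
    constants clipped at 0; the clipping is harmless because \<open>c + e\<close> turns out
    nonnegative.\<close>
  have "(transfer ^^ T) f (x, \<xi>) \<le> (transfer ^^ T) (\<lambda>_. max 0 (c + e)) (x, \<xi>)"
    using near' by (intro iterate_mono_reach[OF f observable_const _ x(2)]) (auto simp: le_max_iff_disj)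
  moreover have "c + e \<ge> 0"
  proof -
    obtain ys where "length ys = T" "set ys \<subseteq> K"
    proof -
      obtain y where "y \<in> K" using subsetD[OF S_subset x(2)] by (auto simp: Pi_iff)
      then show ?thesis using that[of "replicate T y"] by (auto simp: set_replicate_conv_if)
    qed
    from near'(1)[OF this x(2)] f(2) show ?thesis by (meson order_trans)
  qed
  moreover have "(transfer ^^ T) (\<lambda>_. max 0 (c - e)) (x, \<xi>) \<le> (transfer ^^ T) f (x, \<xi>)"
    using near' f(2) by (intro iterate_mono_reach[OF observable_const _ f x(2)]) auto
  ultimately show ?thesis unfolding iterate_const abs_le_iff by auto
qed

lemma marginal_near_const:
  assumes \<Gamma>: "\<Gamma> \<in> sets borel" and x: "reaches T x"
    and near: "\<And>z. z \<in> X \<times> S \<Longrightarrow> \<bar>(transfer ^^ t) (\<lambda>z. indicator \<Gamma> (fst z)) z - c\<bar> \<le> e"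
  shows "\<bar>measure (marginal (T + t) x) \<Gamma> - c\<bar> \<le> e"
proof -
  let ?f = "\<lambda>z. indicator \<Gamma> (fst z) :: real"
  have "indicator \<Gamma> \<in> borel_measurable (borel :: 's measure)" using \<Gamma> by simp
  from measurable_compose[OF measurable_fst this]
  have f: "observable ?f" by (auto simp: observable_def bounded_iff indicator_def intro!: exI[of _ 1])
  have f0: "0 \<le> ?f z" for z by simp
  define h where "h = (transfer ^^ (T + t)) ?f"
  have h: "\<bar>h (x, \<xi>) - c\<bar> \<le> e" if "\<xi> \<in> S" for \<xi>
    unfolding h_def funpow_add comp_def
    by (rule iterate_near_const[OF observable_iterate[OF f] iterate_nonneg near x that]) simp
  have h': "h (x, \<xi>) \<le> c + e" "c - e \<le> h (x, \<xi>)" if "\<xi> \<in> S" for \<xi>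
    using h[OF that] by linarith+
  interpret m: prob_space "marginal (T + t) x" by (rule marginal_prob)
  have "emeasure (marginal (T + t) x) \<Gamma> = (\<integral>\<^sup>+w. indicator \<Gamma> w \<partial>marginal (T + t) x)"
    using \<Gamma> marginal_prob(2) by simp
  also have "\<dots> = (\<integral>\<^sup>+\<xi>. indicator \<Gamma> (run (T + t) x \<xi>) \<partial>pasts)"
    unfolding marginal_def using \<Gamma> by (intro nn_integral_distr run_pasts) simp
  also have "\<dots> = (\<integral>\<^sup>+\<xi>. ennreal (?f (run (T + t) x \<xi>, \<xi>)) \<partial>pasts)"
    by (intro nn_integral_cong) (simp split: split_indicator)
  also have "\<dots> = (\<integral>\<^sup>+\<xi>. ennreal (h (x, \<xi>)) \<partial>pasts)" unfolding h_def by (rule run_law[OF f f0])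
  finally have em: "ennreal (measure (marginal (T + t) x) \<Gamma>) = (\<integral>\<^sup>+\<xi>. ennreal (h (x, \<xi>)) \<partial>pasts)"
    by (simp add: m.emeasure_eq_measure)
  obtain \<xi>0 where \<xi>0: "\<xi>0 \<in> S" using S_nonempty by blast
  have hn: "0 \<le> h w" for w unfolding h_def by (rule iterate_nonneg) simp
  have ce: "0 \<le> c + e" using h[OF \<xi>0] hn[of "(x, \<xi>0)"] by (simp add: abs_le_iff)
  have "(\<integral>\<^sup>+\<xi>. ennreal (h (x, \<xi>)) \<partial>pasts) \<le> (\<integral>\<^sup>+\<xi>. ennreal (c + e) \<partial>pasts)"
    using S_measurable_full(2) h' by (intro nn_integral_mono_AE) (auto intro!: ennreal_leI elim!: eventually_mono)
  then have "ennreal (measure (marginal (T + t) x) \<Gamma>) \<le> ennreal (c + e)" by (simp add: em pasts.emeasure_space_1[simplified])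
  then have 1: "measure (marginal (T + t) x) \<Gamma> \<le> c + e" using ce by (simp add: ennreal_le_iff)
  have "(\<integral>\<^sup>+\<xi>. ennreal (c - e) \<partial>pasts) \<le> (\<integral>\<^sup>+\<xi>. ennreal (h (x, \<xi>)) \<partial>pasts)"
    using S_measurable_full(2) h' by (intro nn_integral_mono_AE) (auto intro!: ennreal_leI elim!: eventually_mono)
  then have "ennreal (c - e) \<le> ennreal (measure (marginal (T + t) x) \<Gamma>)" by (simp add: em pasts.emeasure_space_1[simplified])
  then have "c - e \<le> measure (marginal (T + t) x) \<Gamma>" by (simp add: ennreal_le_iff)
  then show ?thesis using 1 by (simp add: abs_le_iff)
qed

text \<open>Chains that have run for \<open>t\<close> steps after entering \<open>X\<close> have
  nearly the same law, whatever their entry times. One initial state at two times gives a Cauchy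
  sequence. The constant \<open>4 * C\<close> is made of the distance to the law started at
  \<open>a\<close> and the distance of that law to the limit, \<open>2 * C\<close> each.\<close>

lemma limit_marginal:
  assumes \<gamma>: "\<gamma> > 0" "C > 0"
    and mix: "\<And>t g z z'. g \<in> borel_measurable borel \<Longrightarrow> (\<forall>x. 0 \<le> g x \<and> g x \<le> 1) \<Longrightarrow> z \<in> X \<times> S \<Longrightarrow> z' \<in> X \<times> S \<Longrightarrow>
      (transfer ^^ t) (\<lambda>z. g (fst z)) z - (transfer ^^ t) (\<lambda>z. g (fst z)) z' \<le> C * exp (- \<gamma> * real t)"
    and a: "a \<in> X"
  shows "\<exists>\<mu>. prob_space \<mu> \<and> sets \<mu> = sets borel \<and> (\<forall>t T x. reaches T x \<longrightarrow>
    (\<forall>\<Gamma>\<in>sets borel. \<bar>measure (marginal (T + t) x) \<Gamma> - measure \<mu> \<Gamma>\<bar> \<le> 4 * C * exp (- \<gamma> * real t)))"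
proof -
  obtain \<xi>0 where \<xi>0: "\<xi>0 \<in> S" using S_nonempty by blast
  have near: "\<bar>measure (marginal (T + t) x) \<Gamma> - measure (marginal (T' + t) x') \<Gamma>\<bar> \<le> 2 * C * exp (- \<gamma> * real t)"
    if \<Gamma>: "\<Gamma> \<in> sets borel" and x: "reaches T x" "reaches T' x'" for t T T' x x' \<Gamma>
  proof -
    let ?f = "\<lambda>z. indicator \<Gamma> (fst z) :: real"
    define c where "c = (transfer ^^ t) ?f (a, \<xi>0)"
    have c: "\<bar>(transfer ^^ t) ?f z - c\<bar> \<le> C * exp (- \<gamma> * real t)" if z: "z \<in> X \<times> S" for z
    proof -
      have z0: "(a, \<xi>0) \<in> X \<times> S" using a \<xi>0 by simp
      have m: "indicator \<Gamma> \<in> borel_measurable (borel :: 's measure)" using \<Gamma> by simp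
      have "(transfer ^^ t) ?f z - c \<le> C * exp (- \<gamma> * real t)" "c - (transfer ^^ t) ?f z \<le> C * exp (- \<gamma> * real t)"
        unfolding c_def by (rule mix[OF m _ z z0], simp) (rule mix[OF m _ z0 z], simp)
      then show ?thesis by (simp add: abs_le_iff)
    qed
    show ?thesis
      using marginal_near_const[OF \<Gamma> x(1) c] marginal_near_const[OF \<Gamma> x(2) c] by linarith
  qed
  have "\<exists>\<mu>. prob_space \<mu> \<and> sets \<mu> = sets (borel :: 's measure) \<and>
      (\<forall>n. \<forall>\<Gamma>\<in>sets borel. \<bar>measure (marginal n a) \<Gamma> - measure \<mu> \<Gamma>\<bar> \<le> 2 * C * exp (- \<gamma> * real n))"
  proof (rule uniform_Cauchy_limit_measure[OF marginal_prob])
    fix n m :: nat and \<Gamma> :: "'s set" assume nm: "n \<le> m" and \<Gamma>: "\<Gamma> \<in> sets borel"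
    show "\<bar>measure (marginal n a) \<Gamma> - measure (marginal m a) \<Gamma>\<bar> \<le> 2 * C * exp (- \<gamma> * real n)"
      using near[OF \<Gamma> reaches_invariant[OF a, of 0] reaches_invariant[OF a, of "m - n"], of n] nm by simp
  next
    show "(\<lambda>n. 2 * C * exp (- \<gamma> * real n)) \<longlonglongrightarrow> 0" using \<gamma>(1) by real_asymp
  qed
  then obtain \<mu> where \<mu>: "prob_space \<mu>" "sets \<mu> = sets (borel :: 's measure)"
    "\<And>n \<Gamma>. \<Gamma> \<in> sets borel \<Longrightarrow> \<bar>measure (marginal n a) \<Gamma> - measure \<mu> \<Gamma>\<bar> \<le> 2 * C * exp (- \<gamma> * real n)"
    by blast
  have "\<bar>measure (marginal (T + t) x) \<Gamma> - measure \<mu> \<Gamma>\<bar> \<le> 4 * C * exp (- \<gamma> * real t)"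
    if \<Gamma>: "\<Gamma> \<in> sets borel" and x: "reaches T x" for t T x \<Gamma>
    using near[OF \<Gamma> x reaches_invariant[OF a, of 0], of t] \<mu>(3)[OF \<Gamma>, of t] by simp
  then show ?thesis using \<mu>(1,2) by (intro exI[of _ \<mu>]) auto
qed

lemma marginal_full:
  assumes A: "A \<in> sets borel" and hit: "\<And>ys. length ys = t \<Longrightarrow> set ys \<subseteq> K \<Longrightarrow> foldl move x ys \<in> A"
  shows "measure (marginal t x) A = 1"
proof -
  have "AE \<xi> in pasts. run t x \<xi> \<in> A"
    using S_measurable_full(2)
  proof eventually_elim
    case (elim \<xi>)
    then show ?case using subsetD[OF S_subset elim] unfolding run_foldl by (intro hit) (auto simp: Pi_iff)
  qed
  then have "AE w in marginal t x. w \<in> A"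
    unfolding marginal_def using A by (subst AE_distr_iff[OF run_pasts]) auto
  then show ?thesis
    using prob_space.prob_eq_1[OF marginal_prob(1)] marginal_prob(2) A by simp
qed

lemma shifted_past_law:
  "distr \<Lambda> past_algebra (\<lambda>z j. segment (int t - int j) z) = pasts"
proof (induction t)
  case 0
  show ?case by (simp add: pasts_def past_law_def past_of_def[abs_def])
next
  case (Suc t)
  have m: "(\<lambda>z j. segment (int t - int j) z) \<in> trajectories \<rightarrow>\<^sub>M past_algebra" for t
    by (rule measurable_PiM_single') (auto intro: measurable_segment)
  have m': "(\<lambda>z j. segment (int t - int j) z) \<in> \<Lambda> \<rightarrow>\<^sub>M past_algebra" for t
    using m by (simp add: measurable_law)
  have "distr \<Lambda> past_algebra (\<lambda>z j. segment (int (Suc t) - int j) z)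
      = distr (distr \<Lambda> trajectories (\<lambda>z t. z (t + 1))) past_algebra (\<lambda>z j. segment (int t - int j) z)"
    using measurable_shift by (subst distr_distr[OF m]) (auto simp: measurable_law comp_def segment_shift algebra_simps)
  also have "\<dots> = pasts" by (simp add: stationary Suc.IH)
  finally show ?case .
qed

end

subsection \<open>Absorption and recurrence\<close>

lemma square_integrable_on_unit_intervals:
  assumes "\<And>k. square_integrable_on z {real k..real k + 1}"
  shows "square_integrable_on z {0..t}"
proof -
  have "square_integrable_on z {0..real n}" for n
  proof (induction n)
    case 0
    show ?case
      using integrable_on_refl[of z "0::real"] integrable_on_refl[of "\<lambda>s. (norm (z s))\<^sup>2" "0::real"]
      unfolding square_integrable_on_Icc_iff by simp
  next
    case (Suc n)
    then show ?case
      using assms[of n] unfolding square_integrable_on_Icc_iff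
      by (auto simp: add.commute intro!: Henstock_Kurzweil_Integration.integrable_combine[where c = "real n"])
  qed
  from this[of "nat \<lceil>t\<rceil>"] show ?thesis
    by (rule square_integrable_on_subset) (auto intro: order_trans[OF _ real_nat_ceiling_ge])
qed

lemma energy_eq_nn_integral:
  "energy z t = (\<integral>\<^sup>+s. ennreal ((norm (z s))\<^sup>2) * indicator {t..t + 1} s \<partial>lebesgue)"
  unfolding energy_def by (simp add: norm_prod_def)

lemma borel_measurable_energy_density:
  fixes z :: "real \<Rightarrow> real \<times> real"
  assumes "z \<in> borel_measurable (lebesgue_on {a..b})"
  shows "(\<lambda>s. ennreal ((norm (z s))\<^sup>2) * indicator {a..b} s) \<in> borel_measurable lebesgue"
proof -
  have "(\<lambda>s. if s \<in> {a..b} then z s else 0) \<in> borel_measurable lebesgue"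
    using assms by (subst borel_measurable_if) auto
  then have "(\<lambda>s. ennreal ((norm (if s \<in> {a..b} then z s else 0))\<^sup>2)) \<in> borel_measurable lebesgue"
    by measurable
  then show ?thesis by (rule back_subst[where P = "\<lambda>f. f \<in> borel_measurable lebesgue"]) (auto simp: indicator_def)
qed

text \<open>Realises a list of segments as one forcing, so that hypotheses on the flow apply to
  iterates of \<open>step\<close>. It vanishes after the last segment and is thus a bounded forcing
  for all times.\<close>

definition concat_forcing :: "L2J list \<Rightarrow> real \<Rightarrow> real \<times> real" where
  "concat_forcing ys t = (if 0 \<le> t \<and> t < real (length ys) then L2J_fun (ys ! nat \<lfloor>t\<rfloor>) (t - of_int \<lfloor>t\<rfloor>) else 0)"

definition piece :: "L2J list \<Rightarrow> nat \<Rightarrow> L2J" where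
  "piece ys k = (if k < length ys then ys ! k else 0)"

lemma L2J_fun_zero: "AE s in lebesgue_on {0..<1}. L2J_fun 0 s = 0"
  using L2J_fun_abs[OF square_integrable_on_zero] by (simp add: zero_L2J_def)

lemma concat_forcing_piece:
  obtains N where "negligible N" "\<And>s. s \<in> {0..1} - N \<Longrightarrow> concat_forcing ys (s + real k) = L2J_fun (piece ys k) s"
proof -
  obtain N where N: "negligible N" "\<And>s. s \<in> {0..1} - N \<Longrightarrow> L2J_fun 0 s = 0"
    by (rule AE_unit_interval_negligible[OF L2J_fun_zero]) blast
  show ?thesis
  proof (rule that[of "insert 1 N"])
    show "negligible (insert 1 N)" using N(1) by simp
    fix s assume s: "s \<in> {0..1} - insert 1 N"
    then have "0 \<le> s" "s < 1" by auto
    then have "\<lfloor>s + real k\<rfloor> = int k" by (intro floor_unique) auto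
    moreover have "s + real k < real (length ys) \<longleftrightarrow> k < length ys"
    proof
      assume "s + real k < real (length ys)"
      then have "real k < real (length ys)" using \<open>0 \<le> s\<close> by linarith
      then show "k < length ys" by simp
    next
      assume "k < length ys"
      then have "real k + 1 \<le> real (length ys)" by (simp add: Suc_leI flip: of_nat_Suc)
      then show "s + real k < real (length ys)" using \<open>s < 1\<close> by linarith
    qed
    ultimately show "concat_forcing ys (s + real k) = L2J_fun (piece ys k) s"
      using s N(2)[of s] by (auto simp: concat_forcing_def piece_def)
  qed
qed

lemma concat_forcing_integrable:
  "square_integrable_on (\<lambda>s. concat_forcing ys (s + real k)) {0..1}"
  "((\<lambda>s. (norm (concat_forcing ys s))\<^sup>2) has_integral (norm (piece ys k))\<^sup>2) {real k..real k + 1}"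
proof -
  obtain N where N: "negligible N" "\<And>s. s \<in> {0..1} - N \<Longrightarrow> concat_forcing ys (s + real k) = L2J_fun (piece ys k) s"
    using concat_forcing_piece[of ys k] by blast
  have y: "square_integrable_on (L2J_fun (piece ys k)) {0..1}" by (rule square_integrable_L2J_fun)
  have i: "(L2J_fun (piece ys k)) integrable_on {0..1}" "(\<lambda>s. (norm (L2J_fun (piece ys k) s))\<^sup>2) integrable_on {0..1}"
    using y by (simp_all add: square_integrable_on_Icc_iff)
  have 1: "(\<lambda>s. concat_forcing ys (s + real k)) integrable_on {0..1}"
    by (rule integrable_spike[OF i(1) N(1)]) (use N(2) in auto)
  have "((\<lambda>s. (norm (L2J_fun (piece ys k) s))\<^sup>2) has_integral (norm (piece ys k))\<^sup>2) {0..1}"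
    unfolding power2_norm_L2J by (rule integrable_integral[OF i(2)])
  then have 2: "((\<lambda>s. (norm (concat_forcing ys (s + real k)))\<^sup>2) has_integral (norm (piece ys k))\<^sup>2) {0..1}"
    by (rule has_integral_spike[OF N(1), rotated]) (use N(2) in auto)
  show "square_integrable_on (\<lambda>s. concat_forcing ys (s + real k)) {0..1}"
    unfolding square_integrable_on_Icc_iff using 1 2 by blast
  show "((\<lambda>s. (norm (concat_forcing ys s))\<^sup>2) has_integral (norm (piece ys k))\<^sup>2) {real k..real k + 1}"
    using 2 has_integral_shift_Icc_real[of "\<lambda>s. (norm (concat_forcing ys s))\<^sup>2" "real k" _ 0 1] by (simp add: o_def add.commute)
qed

lemma concat_forcing_square_integrable: "square_integrable_on (concat_forcing ys) {0..t}"
proof (rule square_integrable_on_unit_intervals)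
  fix k
  show "square_integrable_on (concat_forcing ys) {real k..real k + 1}"
    using square_integrable_on_shift[where z = "\<lambda>s. concat_forcing ys (s + real k)" and a = "real k" and c = "- real k" and b = "real k + 1"]
      concat_forcing_integrable(1)[of ys k] by simp
qed

lemma measurable_concat_forcing: "concat_forcing ys \<in> borel_measurable (lebesgue_on {0..})"
proof -
  let ?n = "real (length ys)"
  have "concat_forcing ys \<in> borel_measurable (lebesgue_on {0..?n})"
    using concat_forcing_square_integrable[of ys ?n] by (simp add: square_integrable_on_def)
  then have "(\<lambda>s. if s \<in> {0..?n} then concat_forcing ys s else 0) \<in> borel_measurable lebesgue"
    by (subst borel_measurable_if) auto
  moreover have "(\<lambda>s. if s \<in> {0..?n} then concat_forcing ys s else 0) = concat_forcing ys"
    by (auto simp: concat_forcing_def)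
  ultimately show ?thesis by (auto intro: measurable_restrict_space1)
qed

text \<open>A window \<open>{t..t + 1}\<close> is covered by two consecutive unit intervals, hence
  the factor 2.\<close>

lemma bounded_concat_forcing:
  assumes b: "b \<ge> 0" "\<And>y. y \<in> set ys \<Longrightarrow> norm y \<le> b"
  shows "bounded_forcing (2 * b\<^sup>2) (concat_forcing ys)"
  unfolding bounded_forcing_def
proof (intro conjI measurable_concat_forcing SUP_least)
  fix t :: real assume t: "t \<in> {0..}"
  let ?z = "concat_forcing ys"
  define m where "m = nat \<lfloor>t\<rfloor>"
  have m: "real m \<le> t" "t < real m + 1" using t by (auto simp: m_def floor_less_iff)
  have unit: "(\<integral>\<^sup>+s. ennreal ((norm (?z s))\<^sup>2) * indicator {real k..real k + 1} s \<partial>lebesgue) \<le> ennreal (b\<^sup>2)" for k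
  proof -
    have "(\<integral>\<^sup>+s. ennreal ((norm (?z s))\<^sup>2) * indicator {real k..real k + 1} s \<partial>lebesgue) = ennreal ((norm (piece ys k))\<^sup>2)"
      unfolding nn_integral_completion by (rule nn_integral_has_integral_lebesgue'[OF _ concat_forcing_integrable(2)]) simp
    moreover have "norm (piece ys k) \<le> b" using b by (auto simp: piece_def)
    ultimately show ?thesis by (simp add: ennreal_leI power_mono)
  qed
  have "energy ?z t = (\<integral>\<^sup>+s. ennreal ((norm (?z s))\<^sup>2) * indicator {t..t + 1} s \<partial>lebesgue)"
    by (rule energy_eq_nn_integral)
  also have "\<dots> \<le> (\<integral>\<^sup>+s. ennreal ((norm (?z s))\<^sup>2) * indicator {real m..real m + 1} s
      + ennreal ((norm (?z s))\<^sup>2) * indicator {real (Suc m)..real (Suc m) + 1} s \<partial>lebesgue)"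
    using m by (intro nn_integral_mono) (auto simp: indicator_def)
  also have "\<dots> = (\<integral>\<^sup>+s. ennreal ((norm (?z s))\<^sup>2) * indicator {real m..real m + 1} s \<partial>lebesgue)
      + (\<integral>\<^sup>+s. ennreal ((norm (?z s))\<^sup>2) * indicator {real (Suc m)..real (Suc m) + 1} s \<partial>lebesgue)"
  proof (rule nn_integral_add)
    have meas: "(\<lambda>s. ennreal ((norm (?z s))\<^sup>2) * indicator {real k..real k + 1} s) \<in> borel_measurable lebesgue" for k
      by (intro borel_measurable_energy_density measurable_restrict_mono[OF measurable_concat_forcing]) auto
    show "(\<lambda>s. ennreal ((norm (?z s))\<^sup>2) * indicator {real m..real m + 1} s) \<in> borel_measurable lebesgue"
      "(\<lambda>s. ennreal ((norm (?z s))\<^sup>2) * indicator {real (Suc m)..real (Suc m) + 1} s) \<in> borel_measurable lebesgue"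
      by (rule meas)+
  qed
  also have "\<dots> \<le> ennreal (b\<^sup>2) + ennreal (b\<^sup>2)" by (intro add_mono unit)
  also have "\<dots> = ennreal (2 * b\<^sup>2)" by (simp flip: ennreal_plus)
  finally show "energy ?z t \<le> ennreal (2 * b\<^sup>2)" .
qed

lemma segment_concat_forcing:
  assumes "k < length ys" shows "segment (int (Suc k)) (concat_forcing ys) = ys ! k"
proof -
  let ?f = "\<lambda>s. concat_forcing ys (s + real k)"
  have f: "square_integrable_on ?f {0..<1}"
    using concat_forcing_integrable(1)[of ys k] by (simp add: square_integrable_on_closed_unit_iff)
  obtain N where N: "negligible N" "\<And>s. s \<in> {0..1} - N \<Longrightarrow> ?f s = L2J_fun (piece ys k) s"
    using concat_forcing_piece[of ys k] by blast
  have "AE s in lebesgue. s \<notin> N" using N(1) by (intro AE_not_in) (simp add: negligible_iff_null_sets)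
  then have "AE s in lebesgue_on {0..<1}. ?f s = L2J_fun (ys ! k) s"
    using N(2) assms by (subst AE_restrict_space_iff) (auto simp: piece_def elim!: eventually_mono)
  then have "abs_L2J ?f = abs_L2J (L2J_fun (ys ! k))"
    using f square_integrable_L2J_fun[of "ys ! k"]
    by (intro Quotient3_rel_abs[OF Quotient3_L2J]) (simp add: square_integrable_on_closed_unit_iff)
  then show ?thesis using f by (simp add: segment_def)
qed

context oscillators begin

lemma foldl_step_flow:
  "k \<le> length ys \<Longrightarrow> foldl step x (take k ys) = flow V \<gamma>1 \<gamma>n (real k) x (concat_forcing ys)"
proof (induction k)
  case (Suc k)
  then have k: "k < length ys" by simp
  have "flow V \<gamma>1 \<gamma>n (real (Suc k)) x (concat_forcing ys)
      = step (flow V \<gamma>1 \<gamma>n (real k) x (concat_forcing ys)) (ys ! k)"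
    unfolding flow_Suc_segment[OF concat_forcing_square_integrable] segment_concat_forcing[OF k] ..
  then show ?case using Suc k by (simp add: take_Suc_conv_app_nth)
qed simp

lemma foldl_step_absorbed:
  assumes "\<And>z x t. bounded_forcing (2 * b\<^sup>2) z \<Longrightarrow> x \<in> cball 0 r \<Longrightarrow> t \<ge> T \<Longrightarrow> flow V \<gamma>1 \<gamma>n t x z \<in> cball 0 R"
    and "b \<ge> 0" "\<And>y. y \<in> set ys \<Longrightarrow> norm y \<le> b" "x \<in> cball 0 r" "real (length ys) \<ge> T"
  shows "foldl step x ys \<in> cball 0 R"
  using assms(1)[OF bounded_concat_forcing[OF assms(2,3)] assms(4,5)] foldl_step_flow[of "length ys" ys x] by simp

lemma foldl_step_zero: "foldl step x (replicate n 0) = flow V \<gamma>1 \<gamma>n (real n) x (\<lambda>_. 0)"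
proof -
  have "foldl step x (replicate n 0) = flow V \<gamma>1 \<gamma>n (real n) x (concat_forcing (replicate n 0))"
    using foldl_step_flow[of n "replicate n 0" x] by simp
  also have "\<dots> = flow V \<gamma>1 \<gamma>n (real n) x (\<lambda>_. 0)"
  proof -
    obtain N where N: "negligible N" "\<And>s. s \<in> {0..1} - N \<Longrightarrow> L2J_fun 0 s = 0"
      by (rule AE_unit_interval_negligible[OF L2J_fun_zero]) blast
    \<comment> \<open>The representative of the class 0 vanishes only almost everywhere; its
      exceptional set is translated to every unit interval.\<close>
    define N' where "N' = (\<Union>k. (\<lambda>s. real k + s) ` N)"
    have "negligible N'" unfolding N'_def using N(1) by (intro negligible_Union_nat negligible_translation)
    moreover have "concat_forcing (replicate n 0) s = 0" if s: "s \<notin> N'" for s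
    proof (cases "0 \<le> s \<and> s < real n")
      case True
      have "s - of_int \<lfloor>s\<rfloor> \<notin> N"
      proof
        assume "s - of_int \<lfloor>s\<rfloor> \<in> N"
        then have "real (nat \<lfloor>s\<rfloor>) + (s - of_int \<lfloor>s\<rfloor>) \<in> N'" unfolding N'_def by blast
        then show False using s True by simp
      qed
      moreover have "nat \<lfloor>s\<rfloor> < n" using True by (simp add: nat_less_iff floor_less_iff)
      moreover have "s - of_int \<lfloor>s\<rfloor> \<in> {0..1}"        using of_int_floor_le[of s] real_of_int_floor_add_one_gt[of s] unfolding atLeastAtMost_iff by linarith
      ultimately show ?thesis using N(2) True by (simp add: concat_forcing_def)
    qed (auto simp: concat_forcing_def)
    ultimately show ?thesis
      by (intro flow_cong[OF concat_forcing_square_integrable square_integrable_on_zero, where N = N']) auto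
  qed
  finally show ?thesis .
qed

end

lemma bounded_forcing_square_integrable:
  assumes "bounded_forcing M z" shows "square_integrable_on z {0..t}"
proof (rule square_integrable_on_unit_intervals)
  fix k :: nat
  have "z \<in> borel_measurable (lebesgue_on {0..})" using assms by (simp add: bounded_forcing_def)
  then have m: "z \<in> borel_measurable (lebesgue_on {real k..real k + 1})" by (rule measurable_restrict_mono) auto
  have "energy z (real k) \<le> (SUP t\<in>{0..}. energy z t)" by (rule SUP_upper) simp
  also have "\<dots> \<le> ennreal M" using assms by (simp add: bounded_forcing_def)
  finally have "(\<integral>\<^sup>+s. ennreal ((norm (z s))\<^sup>2) \<partial>lebesgue_on {real k..real k + 1}) < \<infinity>"
    unfolding energy_eq_nn_integral by (subst nn_integral_restrict_space) (auto simp: top.not_eq_extremum[symmetric] top_unique)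
  then show "square_integrable_on z {real k..real k + 1}"
    unfolding square_integrable_on_def using m by (auto intro!: integrableI_bounded)
qed

lemma bounded_forcing_zero: "M \<ge> 0 \<Longrightarrow> bounded_forcing M (\<lambda>_. 0)"
  by (simp add: bounded_forcing_def energy_def)

lemma forcing_set_integral_le:
  assumes z: "z \<in> forcing_set M T" and T: "T \<ge> 1" and M: "M \<ge> 0"
  shows "integral {0..T} (\<lambda>s. (norm (z s))\<^sup>2) \<le> real (Suc (nat \<lceil>T\<rceil>)) * M"
proof -
  let ?n = "nat \<lceil>T\<rceil>"
  \<comment> \<open>Windows starting at the integers cover \<open>{0..T}\<close>; the last ones are
    moved back to start at \<open>T - 1\<close>, since \<open>forcing_set\<close> bounds the energy
    only up to that time.\<close>
  define u where "u = (\<lambda>k. min (real k) (T - 1))"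
  have sq: "square_integrable_on z {0..T}" using z by (simp add: forcing_set_def)
  then have i: "(\<lambda>s. (norm (z s))\<^sup>2) integrable_on {0..T}" by (simp add: square_integrable_on_Icc_iff)
  have meas: "(\<lambda>s. ennreal ((norm (z s))\<^sup>2) * indicator {u k..u k + 1} s) \<in> borel_measurable lebesgue" for k
  proof -
    have sub: "{u k..u k + 1} \<subseteq> {0..T}" using T by (auto simp: u_def)
    have "z \<in> borel_measurable (lebesgue_on {0..T})" using sq by (simp add: square_integrable_on_def)
    then show ?thesis by (intro borel_measurable_energy_density measurable_restrict_mono[OF _ sub])
  qed
  have "ennreal (integral {0..T} (\<lambda>s. (norm (z s))\<^sup>2)) = (\<integral>\<^sup>+s. ennreal ((norm (z s))\<^sup>2) * indicator {0..T} s \<partial>lebesgue)"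
    unfolding nn_integral_completion
    by (rule nn_integral_has_integral_lebesgue'[symmetric, OF _ integrable_integral[OF i]]) simp
  also have "\<dots> \<le> (\<integral>\<^sup>+s. (\<Sum>k\<le>?n. ennreal ((norm (z s))\<^sup>2) * indicator {u k..u k + 1} s) \<partial>lebesgue)"
  proof (rule nn_integral_mono)
    fix s
    show "ennreal ((norm (z s))\<^sup>2) * indicator {0..T} s \<le> (\<Sum>k\<le>?n. ennreal ((norm (z s))\<^sup>2) * indicator {u k..u k + 1} s)"
    proof (cases "s \<in> {0..T}")
      case True
      define k where "k = nat \<lfloor>s\<rfloor>"
      have k: "real k \<le> s" "s < real k + 1" using True of_int_floor_le[of s] real_of_int_floor_add_one_gt[of s] by (auto simp: k_def)
      have "s \<in> {u k..u k + 1}" using True k by (auto simp: u_def min_def)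
      moreover have "k \<le> ?n"
      proof -
        have "real k \<le> T" using k True by auto
        then have "real k \<le> real ?n" using real_nat_ceiling_ge[of T] by linarith
        then show ?thesis by simp
      qed
      ultimately show ?thesis
        using member_le_sum[of k "{..?n}" "\<lambda>k. ennreal ((norm (z s))\<^sup>2) * indicator {u k..u k + 1} s"] True by simp
    qed simp
  qed
  also have "\<dots> = (\<Sum>k\<le>?n. energy z (u k))"
    unfolding energy_eq_nn_integral by (rule nn_integral_sum) (rule meas)
  also have "\<dots> \<le> (\<Sum>k\<le>?n. ennreal M)"
  proof (rule sum_mono)
    fix k
    have "energy z (u k) \<le> (SUP t\<in>{0..T - 1}. energy z t)" using T by (intro SUP_upper) (auto simp: u_def)
    also have "\<dots> \<le> ennreal M" using z by (simp add: forcing_set_def)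
    finally show "energy z (u k) \<le> ennreal M" .
  qed
  also have "\<dots> = ennreal (real (Suc ?n) * M)" using M by (simp add: ennreal_mult ennreal_of_nat_eq_real_of_nat)
  finally show ?thesis using M by (subst (asm) ennreal_le_iff) auto
qed

context oscillators begin

text \<open>\<open>LEAST\<close> over the reals says something only if the minimum is attained. At
  the infimum of the admissible times the property holds by continuity of the flow in time and
  closedness of the ball.\<close>

lemma absorbing_time_ge_1:
  assumes "absorbing_radius V \<gamma>1 \<gamma>n M \<rho>"
  shows "absorbing_time V \<gamma>1 \<gamma>n M \<rho> \<ge> 1"
proof -
  define absorbs where "absorbs = (\<lambda>T. T \<ge> 1 \<and> (\<forall>t\<ge>T. \<forall>x0\<in>cball 0 \<rho>. \<forall>z. bounded_forcing M z \<longrightarrow> flow V \<gamma>1 \<gamma>n t x0 z \<in> cball 0 \<rho>))"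
  define A where "A = Collect absorbs"
  obtain T where T: "\<forall>z. bounded_forcing M z \<longrightarrow> (\<forall>x0\<in>cball 0 \<rho>. \<forall>t\<ge>T. flow V \<gamma>1 \<gamma>n t x0 z \<in> cball 0 \<rho>)"
    using assms unfolding absorbing_radius_def by blast
  have "max 1 T \<in> A" using T by (simp add: A_def absorbs_def)
  then have ne: "A \<noteq> {}" by blast
  have bdd: "bdd_below A" by (rule bdd_belowI[of _ 1]) (simp add: A_def absorbs_def)
  have Inf: "absorbs (Inf A)"
    unfolding absorbs_def
  proof (intro conjI allI ballI impI)
    show ge1: "1 \<le> Inf A" by (rule cInf_greatest[OF ne]) (simp add: A_def absorbs_def)
    fix t x0 z assume t: "Inf A \<le> t" and x0: "x0 \<in> cball (0 :: 'n state) \<rho>" and z: "bounded_forcing M z"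
    have later: "flow V \<gamma>1 \<gamma>n s x0 z \<in> cball 0 \<rho>" if s: "s > t" for s
    proof -
      obtain T' where "T' \<in> A" "T' < s" using cInf_lessD[OF ne, of s] t s by auto
      then show ?thesis using x0 z by (auto simp: A_def absorbs_def)
    qed
    have "continuous_on {0..t + 1} (\<lambda>s. flow V \<gamma>1 \<gamma>n s x0 z)"
      using t ge1 by (intro continuous_on_flow bounded_forcing_square_integrable[OF z]) simp
    moreover have s: "t + 1 / real (Suc k) \<in> {0..t + 1}" for k using t ge1 by auto
    moreover have "(\<lambda>k. t + 1 / real (Suc k)) \<longlonglongrightarrow> t" by real_asymp
    ultimately have "(\<lambda>k. flow V \<gamma>1 \<gamma>n (t + 1 / real (Suc k)) x0 z) \<longlonglongrightarrow> flow V \<gamma>1 \<gamma>n t x0 z"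
      using t ge1 by (intro continuous_on_tendsto_compose[where s = "{0..t + 1}" and f = "\<lambda>s. flow V \<gamma>1 \<gamma>n s x0 z"]) auto
    moreover have "flow V \<gamma>1 \<gamma>n (t + 1 / real (Suc k)) x0 z \<in> cball 0 \<rho>" for k by (rule later) simp
    ultimately show "flow V \<gamma>1 \<gamma>n t x0 z \<in> cball 0 \<rho>" by (rule closed_sequentially[OF closed_cball, rotated])
  qed
  have "absorbing_time V \<gamma>1 \<gamma>n M \<rho> = (LEAST T. absorbs T)"
    by (simp add: absorbing_time_def absorbs_def)
  also have "\<dots> = Inf A"
    using Inf by (rule Least_equality) (rule cInf_lower[OF _ bdd], simp add: A_def)
  finally show ?thesis using Inf by (simp add: absorbs_def)
qed

lemma ball_subset_phase_set:
  assumes "absorbing_radius V \<gamma>1 \<gamma>n M \<rho>" "M > 0"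
  shows "cball 0 \<rho> \<subseteq> phase_set V \<gamma>1 \<gamma>n M \<rho>"
proof
  fix x :: "'n state" assume x: "x \<in> cball 0 \<rho>"
  let ?T = "absorbing_time V \<gamma>1 \<gamma>n M \<rho>"
  have "0 \<in> {0..?T}" using absorbing_time_ge_1[OF assms(1)] by simp
  moreover have "(\<lambda>_. 0) \<in> forcing_set M ?T"
    by (auto simp: forcing_set_def square_integrable_on_zero energy_def intro!: SUP_least)
  moreover have "x \<in> (\<lambda>x0. flow V \<gamma>1 \<gamma>n 0 x0 (\<lambda>_. 0)) ` cball 0 \<rho>" using x by simp
  ultimately show "x \<in> phase_set V \<gamma>1 \<gamma>n M \<rho>"
    unfolding phase_set_def Let_def by blast
qed

lemma phase_set_bounded:
  assumes "absorbing_radius V \<gamma>1 \<gamma>n M \<rho>" "M > 0"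
  shows "\<exists>R. \<forall>x\<in>phase_set V \<gamma>1 \<gamma>n M \<rho>. norm x \<le> R"
proof -
  let ?T = "absorbing_time V \<gamma>1 \<gamma>n M \<rho>"
  have T: "?T \<ge> 1" by (rule absorbing_time_ge_1[OF assms(1)])
  obtain R where R: "\<And>t z x0. t \<ge> 0 \<Longrightarrow> square_integrable_on z {0..t} \<Longrightarrow> norm x0 \<le> \<rho> \<Longrightarrow>
      integral {0..t} (\<lambda>s. (norm (z s))\<^sup>2) \<le> real (Suc (nat \<lceil>?T\<rceil>)) * M \<Longrightarrow> norm (flow V \<gamma>1 \<gamma>n t x0 z) < R"
    using flow_bounded[of \<rho> "real (Suc (nat \<lceil>?T\<rceil>)) * M"] by blast
  have "norm (flow V \<gamma>1 \<gamma>n t x0 z) \<le> R" if t: "t \<in> {0..?T}" and z: "z \<in> forcing_set M ?T" and x0: "x0 \<in> cball 0 \<rho>" for t z x0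
  proof (rule less_imp_le[OF R])
    have sq: "square_integrable_on z {0..?T}" using z by (simp add: forcing_set_def)
    show sqt: "square_integrable_on z {0..t}" by (rule square_integrable_on_subset[OF sq]) (use t in auto)
    have "integral {0..t} (\<lambda>s. (norm (z s))\<^sup>2) \<le> integral {0..?T} (\<lambda>s. (norm (z s))\<^sup>2)"
      using sq sqt t by (intro integral_subset_le) (auto simp: square_integrable_on_Icc_iff)
    then show "integral {0..t} (\<lambda>s. (norm (z s))\<^sup>2) \<le> real (Suc (nat \<lceil>?T\<rceil>)) * M"
      using forcing_set_integral_le[OF z T] assms(2) by linarith
  qed (use t x0 in auto)
  then show ?thesis unfolding phase_set_def Let_def by (intro exI[of _ R]) blast
qed

text \<open>The unforced orbit of 0 ends up in the absorbing ball, as zero forcing obeys the bound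
  \<open>M\<close>; the ball is closed, so the limit lies in it and therefore in the set on which
  (LC) is assumed.\<close>

lemma equilibrium:
  assumes rho: "absorbing_radius V \<gamma>1 \<gamma>n M \<rho>" "M > 0" and SE: "SE V \<gamma>1 \<gamma>n (phase_set V \<gamma>1 \<gamma>n M \<rho>)"
  obtains a where "a \<in> phase_set V \<gamma>1 \<gamma>n M \<rho>"
    "\<And>e. e > 0 \<Longrightarrow> \<exists>T\<ge>0. \<forall>t\<ge>T. \<forall>x\<in>phase_set V \<gamma>1 \<gamma>n M \<rho>. norm (flow V \<gamma>1 \<gamma>n t x (\<lambda>_. 0) - a) < e"
proof -
  let ?X = "phase_set V \<gamma>1 \<gamma>n M \<rho>"
  obtain c where c: "((\<lambda>t. SUP x\<in>?X. norm (flow V \<gamma>1 \<gamma>n t x (\<lambda>_. 0) - (0, c))) \<longlongrightarrow> 0) at_top"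
    using SE unfolding SE_def by blast
  obtain R where R: "\<And>x. x \<in> ?X \<Longrightarrow> norm x \<le> R" using phase_set_bounded[OF rho] by blast
  obtain R' where R': "\<And>t x. t \<ge> 0 \<Longrightarrow> norm x \<le> R \<Longrightarrow> norm (flow V \<gamma>1 \<gamma>n t x (\<lambda>_. 0)) < R'"
    using flow_bounded[of R 0] square_integrable_on_zero by fastforce
  \<comment> \<open>The supremum in (SE) is a real one and controls its members only for a bounded
    family.\<close>
  have bdd: "bdd_above ((\<lambda>x. norm (flow V \<gamma>1 \<gamma>n t x (\<lambda>_. 0) - (0, c))) ` ?X)" if "t \<ge> 0" for t
  proof (rule bdd_aboveI2)
    fix x assume "x \<in> ?X"
    then show "norm (flow V \<gamma>1 \<gamma>n t x (\<lambda>_. 0) - (0, c)) \<le> R' + norm ((0, c) :: 'n state)"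
      using R'[OF that R] norm_triangle_ineq4[of "flow V \<gamma>1 \<gamma>n t x (\<lambda>_. 0)" "(0, c)"] by fastforce
  qed
  have conv: "\<exists>T\<ge>0. \<forall>t\<ge>T. \<forall>x\<in>?X. norm (flow V \<gamma>1 \<gamma>n t x (\<lambda>_. 0) - (0, c)) < e" if "e > 0" for e
  proof -
    have "eventually (\<lambda>t. (SUP x\<in>?X. norm (flow V \<gamma>1 \<gamma>n t x (\<lambda>_. 0) - (0, c))) < e) at_top"
      using order_tendstoD(2)[OF c that] .
    then obtain T where T: "\<And>t. t \<ge> T \<Longrightarrow> (SUP x\<in>?X. norm (flow V \<gamma>1 \<gamma>n t x (\<lambda>_. 0) - (0, c))) < e"
      by (auto simp: eventually_at_top_linorder)
    have "norm (flow V \<gamma>1 \<gamma>n t x (\<lambda>_. 0) - (0, c)) < e" if "t \<ge> max 0 T" "x \<in> ?X" for t x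
      using cSUP_upper[OF that(2) bdd[of t]] T[of t] that(1) by simp
    then show ?thesis by (intro exI[of _ "max 0 T"]) auto
  qed
  have \<rho>: "\<rho> > 0" using rho by (simp add: absorbing_radius_def)
  have sub: "cball 0 \<rho> \<subseteq> ?X" by (rule ball_subset_phase_set[OF rho])
  obtain T where T: "\<And>t. t \<ge> T \<Longrightarrow> flow V \<gamma>1 \<gamma>n t 0 (\<lambda>_. 0) \<in> cball 0 \<rho>"
  proof -
    obtain T where "\<forall>z. bounded_forcing M z \<longrightarrow> (\<forall>x0\<in>cball 0 \<rho>. \<forall>t\<ge>T. flow V \<gamma>1 \<gamma>n t x0 z \<in> cball 0 \<rho>)"
      using rho(1) unfolding absorbing_radius_def by blast
    then have "flow V \<gamma>1 \<gamma>n t 0 (\<lambda>_. 0) \<in> cball 0 \<rho>" if "t \<ge> T" for t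
      using bounded_forcing_zero[of M] rho(2) \<rho> that by simp
    then show ?thesis using that by blast
  qed
  have "((0, c) :: 'n state) \<in> cball 0 \<rho>"
  proof (rule ccontr)
    assume "\<not> ?thesis"
    then have pos: "norm ((0, c) :: 'n state) - \<rho> > 0" unfolding mem_cball dist_0_norm by linarith
    then obtain T' where T': "\<forall>t\<ge>T'. \<forall>x\<in>?X. norm (flow V \<gamma>1 \<gamma>n t x (\<lambda>_. 0) - (0, c)) < norm ((0, c) :: 'n state) - \<rho>"
      using conv[OF pos] by blast
    let ?w = "flow V \<gamma>1 \<gamma>n (max T T') 0 (\<lambda>_. 0)"
    have "0 \<in> ?X" using sub \<rho> by auto
    then have "norm (?w - (0, c)) < norm ((0, c) :: 'n state) - \<rho>"
      using T' by (metis max.cobounded2)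
    moreover have "norm ?w \<le> \<rho>" using T[of "max T T'"] by simp
    ultimately show False using norm_triangle_ineq3[of "(0, c)" ?w] by (simp add: norm_minus_commute)
  qed
  then show ?thesis using that[of "(0, c)"] conv sub by blast
qed

end

lemma closed_support: "closed (support euclidean \<mu>)"
proof -
  have "- support euclidean \<mu> = \<Union>{U. open U \<and> emeasure \<mu> U = 0}"
    by (auto simp: support_def not_less)
  then show ?thesis unfolding closed_def by auto
qed

lemma support_subset:
  assumes \<mu>: "prob_space \<mu>" "sets \<mu> = sets borel" and A: "closed A" "measure \<mu> A = 1"
  shows "support euclidean \<mu> \<subseteq> A"
proof
  fix x assume x: "x \<in> support euclidean \<mu>"
  interpret prob_space \<mu> by (rule \<mu>(1))
  show "x \<in> A"
  proof (rule ccontr)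
    assume "x \<notin> A"
    then have pos: "emeasure \<mu> (- A) > 0" using x A(1) by (auto simp: support_def open_Compl)
    have "space \<mu> = UNIV" using sets_eq_imp_space_eq[OF \<mu>(2)] by simp
    then have "measure \<mu> (- A) = 0"
      using prob_compl[of A] A \<mu>(2) by (simp add: Compl_eq_Diff_UNIV)
    then show False using pos by (simp add: emeasure_eq_measure)
  qed
qed

context oscillators begin

text \<open>Continuity of the \<open>N\<close>-step map at zero noise, uniform over bounded initial
  states. The segments range over a ball of infinite dimension, so this rests on the Lipschitz bound
  for \<open>step\<close> and not on compactness.\<close>

lemma foldl_step_stable:
  "e > 0 \<Longrightarrow> \<exists>\<delta>>0. \<forall>x ys. norm x \<le> R \<longrightarrow> length ys = N \<longrightarrow> set ys \<subseteq> ball 0 \<delta> \<longrightarrow>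
    norm (foldl step x ys - foldl step x (replicate N 0)) < e"
proof (induction N arbitrary: e)
  case 0
  then show ?case by (intro exI[of _ 1]) auto
next
  case (Suc N)
  obtain R1 where R1: "\<And>x. norm x \<le> R \<Longrightarrow> norm (foldl step x (replicate N 0)) < R1"
  proof -
    obtain R1 where "\<forall>t z x0. t \<ge> 0 \<longrightarrow> square_integrable_on z {0..t} \<longrightarrow> norm x0 \<le> R \<longrightarrow>
        integral {0..t} (\<lambda>s. (norm (z s))\<^sup>2) \<le> 0 \<longrightarrow> norm (flow V \<gamma>1 \<gamma>n t x0 z) < R1"
      using flow_bounded[of R 0] by blast
    from this[rule_format, of "real N" "\<lambda>_. 0"] show ?thesis
      using that[of R1] square_integrable_on_zero by (simp add: foldl_step_zero)
  qed
  define r where "r = max 0 R1 + 1"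
  obtain L where L: "L > 0" "\<And>x x' y y'. norm x \<le> r \<Longrightarrow> norm x' \<le> r \<Longrightarrow> norm y \<le> r \<Longrightarrow> norm y' \<le> r \<Longrightarrow>
      norm (step x y - step x' y') \<le> L * (norm (x - x') + norm (y - y'))"
    using step_lipschitz[of r] by blast
  define e' where "e' = min 1 (e / (2 * L))"
  have e': "e' > 0" "e' \<le> 1" "e' \<le> e / (2 * L)" using Suc.prems L(1) by (auto simp: e'_def)
  obtain \<delta> where \<delta>: "\<delta> > 0" "\<And>x ys. norm x \<le> R \<Longrightarrow> length ys = N \<Longrightarrow> set ys \<subseteq> ball 0 \<delta> \<Longrightarrow>
      norm (foldl step x ys - foldl step x (replicate N 0)) < e'"
    using Suc.IH[OF e'(1)] by blast
  define \<delta>' where "\<delta>' = min \<delta> e'"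
  have "norm (foldl step x ys - foldl step x (replicate (Suc N) 0)) < e"
    if x: "norm x \<le> R" and ys: "length ys = Suc N" "set ys \<subseteq> ball 0 \<delta>'" for x ys
  proof -
    obtain zs y where zs: "ys = zs @ [y]" using ys(1) by (cases ys rule: rev_cases) auto
    let ?u = "foldl step x zs" and ?v = "foldl step x (replicate N 0)"
    have uv: "norm (?u - ?v) < e'" using ys by (intro \<delta>(2)[OF x]) (auto simp: zs \<delta>'_def)
    have v: "norm ?v \<le> r" using R1[OF x] by (simp add: r_def)
    have u: "norm ?u \<le> r" using norm_triangle_sub[of ?u ?v] uv e'(2) R1[OF x] by (simp add: r_def)
    have y: "norm y < e'" using ys(2) by (simp add: zs \<delta>'_def)
    then have "norm y \<le> r" "norm (0 :: L2J) \<le> r" using e'(2) by (simp_all add: r_def)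
    from L(2)[OF u v this] have "norm (step ?u y - step ?v 0) \<le> L * (norm (?u - ?v) + norm y)" by simp
    also have "\<dots> < L * (e' + e')" using uv y L(1) by (intro mult_strict_left_mono add_strict_mono)
    also have "\<dots> \<le> L * (e / (2 * L) + e / (2 * L))" using e'(3) L(1) by (intro mult_left_mono add_mono) auto
    also have "\<dots> = e" using L(1) by simp
    finally show ?thesis by (simp add: zs flip: replicate_append_same)
  qed
  moreover have "\<delta>' > 0" using \<delta>(1) e'(1) by (simp add: \<delta>'_def)
  ultimately show ?case by blast
qed

end

locale forced_oscillators = oscillators V \<gamma>1 \<gamma>n + stationary_noise \<Lambda> K \<iota> Q S
  for V :: "('n::{finite,linorder}) config \<Rightarrow> real" and \<gamma>1 \<gamma>n :: real
    and \<Lambda> :: "(real \<Rightarrow> real \<times> real) measure" and K :: "L2J set" and \<iota> :: real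
    and Q :: "past \<Rightarrow> L2J measure" and S :: "past set" +
  fixes M \<rho> :: real
  assumes BAS: "BAS V \<gamma>1 \<gamma>n" and M: "M > 0" and rho: "absorbing_radius V \<gamma>1 \<gamma>n M \<rho>"
    and SE: "SE V \<gamma>1 \<gamma>n (phase_set V \<gamma>1 \<gamma>n M \<rho>)" and LC: "LC V \<gamma>1 \<gamma>n (phase_set V \<gamma>1 \<gamma>n M \<rho>) K"
    and DLP: "DLP \<iota> S Q" and SRZ: "SRZ S Q"
begin

definition reach_set :: "real \<Rightarrow> 'n state set" where
  "reach_set R = {foldl step x ys | x ys. norm x \<le> R \<and> set ys \<subseteq> K}"

lemma driven: "driven_noise \<Lambda> K \<iota> Q S step (reach_set R)"
proof
  have "(\<lambda>w. step (fst w) (snd w)) \<in> borel_measurable (borel \<Otimes>\<^sub>M borel)"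
    using continuous_step by (intro borel_measurable_pair_continuous) (simp add: case_prod_unfold)
  then show "(\<lambda>(x, y). step x y) \<in> borel \<Otimes>\<^sub>M borel \<rightarrow>\<^sub>M borel" by (simp add: case_prod_unfold)
  fix x y assume "x \<in> reach_set R" "y \<in> K"
  then obtain x0 ys where *: "x = foldl step x0 ys" "norm x0 \<le> R" "set ys \<subseteq> K" by (auto simp: reach_set_def)
  then have "step x y = foldl step x0 (ys @ [y])" "set (ys @ [y]) \<subseteq> K" using \<open>y \<in> K\<close> by auto
  then show "step x y \<in> reach_set R" using *(2) unfolding reach_set_def by blast
qed

lemma ball_subset_reach_set: "norm x \<le> R \<Longrightarrow> x \<in> reach_set R"
  unfolding reach_set_def mem_Collect_eq by (intro exI[of _ x] exI[of _ "[]"]) simp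

text \<open>(BAS) is applied with the bound \<open>2 * b\<^sup>2\<close>, valid for every
  concatenation of segments from \<open>K\<close>; the bound \<open>M\<close> is known only for
  trajectories of the noise.\<close>

lemma absorption:
  obtains R where "R > 0"
    "\<And>r. r > 0 \<Longrightarrow> \<exists>T. \<forall>x ys. norm x \<le> r \<longrightarrow> set ys \<subseteq> K \<longrightarrow> T \<le> length ys \<longrightarrow> norm (foldl step x ys) \<le> R"
proof -
  obtain b where b: "b > 0" "\<And>y. y \<in> K \<Longrightarrow> norm y \<le> b" using K_bounded by blast
  have "2 * b\<^sup>2 > 0" using b(1) by simp
  from BAS[unfolded BAS_def, rule_format, OF this]
  obtain R where R: "absorbing_radius V \<gamma>1 \<gamma>n (2 * b\<^sup>2) R" ..
  have "\<exists>T. \<forall>x ys. norm x \<le> r \<longrightarrow> set ys \<subseteq> K \<longrightarrow> T \<le> length ys \<longrightarrow> norm (foldl step x ys) \<le> R" if "r > 0" for r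
  proof -
    from conjunct2[OF R[unfolded absorbing_radius_def], rule_format, OF that]
    obtain T where T: "\<forall>z. bounded_forcing (2 * b\<^sup>2) z \<longrightarrow> (\<forall>x\<in>cball 0 r. \<forall>t\<ge>T. flow V \<gamma>1 \<gamma>n t x z \<in> cball 0 R)"
      by (elim exE conjE)
    have "norm (foldl step x ys) \<le> R" if "norm x \<le> r" "set ys \<subseteq> K" "nat \<lceil>T\<rceil> \<le> length ys" for x ys
    proof -
      have "foldl step x ys \<in> cball 0 R"
      proof (rule foldl_step_absorbed[where r = r and b = b and T = T])
        show "flow V \<gamma>1 \<gamma>n t x z \<in> cball 0 R" if "bounded_forcing (2 * b\<^sup>2) z" "x \<in> cball 0 r" "T \<le> t" for z x t
          using T[rule_format, OF that] .
        show "T \<le> real (length ys)" using that(3) by linarith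
        show "norm y \<le> b" if "y \<in> set ys" for y using b(2) that \<open>set ys \<subseteq> K\<close> by blast
        show "b \<ge> 0" using b(1) by simp
        show "x \<in> cball 0 r" using \<open>norm x \<le> r\<close> by simp
      qed
      then show ?thesis by simp
    qed
    then show ?thesis by blast
  qed
  moreover have "R > 0" using R by (simp add: absorbing_radius_def)
  ultimately show ?thesis by (rule that[rotated])
qed

text \<open>The overlap is established at the zero past only; \<open>small_set_coupling\<close>
  carries it to nearby pasts.\<close>

lemma equilibrium_overlap:
  assumes a: "a \<in> phase_set V \<gamma>1 \<gamma>n M \<rho>" and B: "B \<ge> 0"
  shows "\<exists>\<epsilon>>0. \<exists>\<delta>>0. \<forall>x x' h. norm (x - a) < \<delta> \<longrightarrow> norm (x' - a) < \<delta> \<longrightarrow>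
    h \<in> driven_noise.test_functions B \<longrightarrow>
    (\<integral>y. h (step x y) y \<partial>Q (\<lambda>_. 0)) - (\<integral>y. h (step x' y) y \<partial>Q (\<lambda>_. 0)) \<le> 1 - \<epsilon>"
proof -
  interpret d: driven_noise \<Lambda> K \<iota> Q S step "reach_set R" for R by (rule driven)
  let ?o = "\<lambda>_ :: nat. 0 :: L2J"
  have zero: "?o \<in> S" by (rule zero_past[OF SRZ])
  interpret q: prob_space "Q ?o" by (rule Q_prob[OF zero])
  have LCa: "\<exists>\<xi> w. solves_linearised V \<gamma>1 \<gamma>n (\<lambda>t. snd (path a y t)) (L2J_fun \<xi>) w \<and> w 1 = v" if "y \<in> K" for y v
    using LC that a unfolding LC_def by blast
  from DLP[unfolded DLP_def] show ?thesis
  proof (elim exE conjE)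
    fix F F' :: "nat \<Rightarrow> L2J set" and P :: "nat \<Rightarrow> L2J \<Rightarrow> L2J" and \<rho>' :: "nat \<Rightarrow> past \<Rightarrow> L2J \<Rightarrow> real"
    assume F: "incseq F" "closure (\<Union>n. F n) = UNIV"
      and F': "\<forall>n. (\<exists>B. finite B \<and> F n = span B) \<and> subspace (F' n) \<and> F n \<inter> F' n = {0} \<and>
          bounded_linear (P n) \<and> (\<forall>y. P n y \<in> F n \<and> y - P n y \<in> F' n)"
      and dens: "\<forall>n. (\<forall>\<xi>\<in>S. \<forall>y. \<rho>' n \<xi> y \<ge> 0) \<and>
          (\<exists>L. \<forall>\<xi>\<in>S. \<forall>\<xi>'\<in>S. \<forall>y y'. \<bar>\<rho>' n \<xi> y - \<rho>' n \<xi>' y'\<bar> \<le> L * (D \<xi> \<xi>' + norm (y - y'))) \<and>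
          (\<forall>\<xi>\<in>S. \<forall>A\<in>sets borel. emeasure (Q \<xi>) A =
             (\<integral>\<^sup>+v. (\<integral>\<^sup>+u. ennreal (\<rho>' n \<xi> (u + v)) * indicator A (u + v) \<partial>subspace_lebesgue (F n))
                \<partial>distr (Q \<xi>) borel (\<lambda>y. y - P n y)))"
    have cont: "continuous_on UNIV (\<rho>' n ?o)" for n
    proof -
      have "\<exists>L. \<forall>\<xi>\<in>S. \<forall>\<xi>'\<in>S. \<forall>y y'. \<bar>\<rho>' n \<xi> y - \<rho>' n \<xi>' y'\<bar> \<le> L * (D \<xi> \<xi>' + norm (y - y'))"
        using dens by blast
      then obtain L where "\<forall>\<xi>\<in>S. \<forall>\<xi>'\<in>S. \<forall>y y'. \<bar>\<rho>' n \<xi> y - \<rho>' n \<xi>' y'\<bar> \<le> L * (D \<xi> \<xi>' + norm (y - y'))" ..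
      from this[rule_format, OF zero zero] have L: "\<bar>\<rho>' n ?o y - \<rho>' n ?o y'\<bar> \<le> L * norm (y - y')" for y y'
        by (simp add: d.D_self[OF zero])
      have "\<bar>L\<bar>-lipschitz_on UNIV (\<rho>' n ?o)"
      proof (rule lipschitz_onI)
        fix y y' :: L2J
        have "L * norm (y - y') \<le> \<bar>L\<bar> * norm (y - y')" by (intro mult_right_mono) auto
        then show "dist (\<rho>' n ?o y) (\<rho>' n ?o y') \<le> \<bar>L\<bar> * dist y y'"
          using L[of y y'] by (simp add: dist_norm)
      qed simp
      then show ?thesis by (rule lipschitz_on_continuous_on)
    qed
    have "\<exists>\<epsilon>>0. \<exists>\<delta>>0. \<forall>x x' h. norm (x - a) < \<delta> \<longrightarrow> norm (x' - a) < \<delta> \<longrightarrow>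
      (\<lambda>(s, y). h s y) \<in> borel_measurable (borel \<Otimes>\<^sub>M borel) \<longrightarrow> (\<forall>s y. 0 \<le> h s y \<and> h s y \<le> 1) \<longrightarrow>
      (\<forall>s y y'. \<bar>h s y - h s y'\<bar> \<le> B * norm (y - y')) \<longrightarrow>
      ennreal \<epsilon> \<le> (\<integral>\<^sup>+y. ennreal (1 - h (step x y) y) \<partial>Q ?o) + (\<integral>\<^sup>+y. ennreal (h (step x' y) y) \<partial>Q ?o)"
    proof (rule overlap[OF q.prob_space_axioms Q_prob(2)[OF zero] compact_K Q_K(1)[OF zero] LCa F])
      show "\<exists>B. finite B \<and> F n = span B" for n using F' by blast
      show "continuous_on UNIV (\<lambda>y. y - P n y)" for n
        using F' by (intro continuous_on_diff continuous_on_id linear_continuous_on) blast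
      show "continuous_on UNIV (\<rho>' n ?o)" for n by (rule cont)
      show "0 \<le> \<rho>' n ?o y" for n y using dens zero by blast
      show "emeasure (Q ?o) A = (\<integral>\<^sup>+v. (\<integral>\<^sup>+u. ennreal (\<rho>' n ?o (u + v)) * indicator A (u + v) \<partial>subspace_lebesgue (F n))
          \<partial>distr (Q ?o) borel (\<lambda>y. y - P n y))" if "A \<in> sets borel" for n A
        using dens zero that by blast
    qed (use B in auto)
    then obtain \<epsilon> \<delta> where \<epsilon>: "\<epsilon> > 0" "\<delta> > 0" and ov: "\<forall>x x' h. norm (x - a) < \<delta> \<longrightarrow> norm (x' - a) < \<delta> \<longrightarrow>
      (\<lambda>(s, y). h s y) \<in> borel_measurable (borel \<Otimes>\<^sub>M borel) \<longrightarrow> (\<forall>s y. 0 \<le> h s y \<and> h s y \<le> 1) \<longrightarrow>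
      (\<forall>s y y'. \<bar>h s y - h s y'\<bar> \<le> B * norm (y - y')) \<longrightarrow>
      ennreal \<epsilon> \<le> (\<integral>\<^sup>+y. ennreal (1 - h (step x y) y) \<partial>Q ?o) + (\<integral>\<^sup>+y. ennreal (h (step x' y) y) \<partial>Q ?o)"
      by (elim exE conjE)
    have "(\<integral>y. h (step x y) y \<partial>Q ?o) - (\<integral>y. h (step x' y) y \<partial>Q ?o) \<le> 1 - \<epsilon>"
      if x: "norm (x - a) < \<delta>" "norm (x' - a) < \<delta>" and h: "h \<in> driven_noise.test_functions B" for x x' h
    proof -
      note I = d.integrable_test[OF zero h]
      have h': "(\<lambda>(s, y). h s y) \<in> borel_measurable (borel \<Otimes>\<^sub>M borel)" "\<forall>s y. 0 \<le> h s y \<and> h s y \<le> 1"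
        "\<forall>s y y'. \<bar>h s y - h s y'\<bar> \<le> B * norm (y - y')"
        using h by (simp_all add: d.test_functions_def)
      have b: "0 \<le> h w y" "h w y \<le> 1" for w y using h'(2) by blast+
      have "ennreal \<epsilon> \<le> (\<integral>\<^sup>+y. ennreal (1 - h (step x y) y) \<partial>Q ?o) + (\<integral>\<^sup>+y. ennreal (h (step x' y) y) \<partial>Q ?o)"
        by (rule ov[rule_format, OF x h'(1)]) (use h'(2,3) in auto)
      also have "(\<integral>\<^sup>+y. ennreal (1 - h (step x y) y) \<partial>Q ?o) = ennreal (1 - (\<integral>y. h (step x y) y \<partial>Q ?o))"
        using I(1)[of x] q.prob_space by (subst nn_integral_eq_integral) (simp_all add: b)
      also have "(\<integral>\<^sup>+y. ennreal (h (step x' y) y) \<partial>Q ?o) = ennreal (\<integral>y. h (step x' y) y \<partial>Q ?o)"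
        by (intro nn_integral_eq_integral I) (simp add: b)
      also have "ennreal (1 - (\<integral>y. h (step x y) y \<partial>Q ?o)) + ennreal (\<integral>y. h (step x' y) y \<partial>Q ?o)
          = ennreal (1 - (\<integral>y. h (step x y) y \<partial>Q ?o) + (\<integral>y. h (step x' y) y \<partial>Q ?o))"
        using I(2)[of x'] I(3)[of x] by (subst ennreal_plus) auto
      finally show ?thesis using I(2)[of x'] I(3)[of x] by (subst (asm) ennreal_le_iff) auto
    qed
    then show ?thesis using \<epsilon> by (intro exI[of _ \<epsilon>] exI[of _ \<delta>]) auto
  qed
qed

text \<open>By (SRZ) a delay of \<open>s\<close> segments is followed by \<open>n\<close> small ones
  with probability bounded below. The first of these only complete the absorption into the ball of
  radius \<open>R\<close>. Without noise, \<open>n1\<close> further steps would lead into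
  \<open>cball 0 \<rho>\<close> and \<open>n2\<close> more close to the equilibrium, and small noise
  changes the endpoint little.\<close>

lemma recurrence:
  assumes R: "R > 0" "\<And>r. r > 0 \<Longrightarrow> \<exists>T. \<forall>x ys. norm x \<le> r \<longrightarrow> set ys \<subseteq> K \<longrightarrow> T \<le> length ys \<longrightarrow> norm (foldl step x ys) \<le> R"
    and conv: "\<And>e. e > 0 \<Longrightarrow> \<exists>T\<ge>0. \<forall>t\<ge>T. \<forall>x\<in>phase_set V \<gamma>1 \<gamma>n M \<rho>. norm (flow V \<gamma>1 \<gamma>n t x (\<lambda>_. 0) - a) < e"
    and \<delta>: "\<delta> > 0"
  shows "\<exists>k p. p > 0 \<and> (\<forall>z\<in>reach_set R \<times> S. p \<le> (driven_noise.transfer Q S step ^^ k) (indicator (driven_noise.small_set a \<delta> m)) z)"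
proof -
  interpret d: driven_noise \<Lambda> K \<iota> Q S step "reach_set R" by (rule driven)
  obtain T0 where T0: "\<forall>t\<ge>T0. \<forall>x\<in>phase_set V \<gamma>1 \<gamma>n M \<rho>. norm (flow V \<gamma>1 \<gamma>n t x (\<lambda>_. 0) - a) < \<delta> / 2"
    using conv[of "\<delta> / 2"] \<delta> by auto
  have "\<forall>r>0. \<exists>T>0. \<forall>z. bounded_forcing M z \<longrightarrow> (\<forall>x0\<in>cball 0 r. \<forall>t\<ge>T. flow V \<gamma>1 \<gamma>n t x0 z \<in> cball 0 \<rho>)"
    using rho unfolding absorbing_radius_def by (rule conjunct2)
  from this[rule_format, OF R(1)]
  obtain T1 where T1: "\<forall>z. bounded_forcing M z \<longrightarrow> (\<forall>x0\<in>cball 0 R. \<forall>t\<ge>T1. flow V \<gamma>1 \<gamma>n t x0 z \<in> cball 0 \<rho>)"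
    by (elim exE conjE)
  obtain TR where TR: "\<forall>x ys. norm x \<le> R \<longrightarrow> set ys \<subseteq> K \<longrightarrow> TR \<le> length ys \<longrightarrow> norm (foldl step x ys) \<le> R"
    using R(2)[OF R(1)] ..
  define n1 where "n1 = nat \<lceil>T1\<rceil>"
  \<comment> \<open>At least \<open>m\<close>, so that the small segments include the last
    \<open>m\<close> of the past.\<close>
  define n2 where "n2 = max (nat \<lceil>T0\<rceil>) m"
  have zero_run: "norm (foldl step x (replicate (n1 + n2) 0) - a) < \<delta> / 2" if x: "norm x \<le> R" for x
  proof -
    let ?w = "flow V \<gamma>1 \<gamma>n (real n1) x (\<lambda>_. 0)"
    have "real n1 \<ge> T1" unfolding n1_def by linarith
    then have "?w \<in> cball 0 \<rho>" using T1[rule_format, OF bounded_forcing_zero] M x by simp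
    then have w: "?w \<in> phase_set V \<gamma>1 \<gamma>n M \<rho>" using ball_subset_phase_set[OF rho M] by blast
    have "real n2 \<ge> T0" unfolding n2_def by linarith
    from T0[rule_format, OF this w] show ?thesis
      by (simp add: replicate_add foldl_step_zero[symmetric])
  qed
  obtain \<delta>1 where \<delta>1: "\<delta>1 > 0" and stable: "\<forall>x ys. norm x \<le> R \<longrightarrow> length ys = n1 + n2 \<longrightarrow> set ys \<subseteq> ball 0 \<delta>1 \<longrightarrow>
      norm (foldl step x ys - foldl step x (replicate (n1 + n2) 0)) < \<delta> / 2"
    using foldl_step_stable[of "\<delta> / 2" R "n1 + n2"] \<delta> by auto
  define \<delta>' where "\<delta>' = min \<delta> \<delta>1"
  have \<delta>': "\<delta>' > 0" "\<delta>' \<le> \<delta>" "\<delta>' \<le> \<delta>1" using \<delta> \<delta>1 by (auto simp: \<delta>'_def)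
  \<comment> \<open>\<open>Suc TR\<close> steps for absorption; the successor ensures the condition
    \<open>n \<ge> 1\<close> of (SRZ).\<close>
  define n where "n = Suc TR + (n1 + n2)"
  define G where "G = {ys :: L2J list. length ys = n \<and> set ys \<subseteq> ball 0 \<delta>'}"
  have "n \<ge> 1" by (simp add: n_def)
  from SRZ[unfolded SRZ_def, rule_format, OF this \<delta>'(1)]
  obtain s where s: "(INF \<xi>\<in>S. delayed_prob Q s n \<xi> G) > 0" unfolding G_def ..
  have hit: "indicator G (drop s ys) \<le> ennreal (indicator (d.small_set a \<delta> m) (foldl step x ys, foldl append_past \<xi> ys))"
    if x: "x \<in> reach_set R" and ys: "length ys = s + n" "set ys \<subseteq> K" for x \<xi> ys
  proof (cases "drop s ys \<in> G")
    case True
    obtain x0 ys0 where x0: "x = foldl step x0 ys0" "norm x0 \<le> R" "set ys0 \<subseteq> K" using x by (auto simp: reach_set_def)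
    define us where "us = take (s + Suc TR) ys"
    define vs where "vs = drop (s + Suc TR) ys"
    have split: "ys = us @ vs" by (simp add: us_def vs_def)
    have us: "length us = s + Suc TR" "set us \<subseteq> K" using ys by (auto simp: us_def n_def dest: in_set_takeD)
    have vs: "length vs = n1 + n2" using ys by (simp add: vs_def n_def)
    have "vs = drop (Suc TR) (drop s ys)" by (simp add: vs_def add.commute)
    then have "set vs \<subseteq> set (drop s ys)" by (metis set_drop_subset)
    then have vs': "set vs \<subseteq> ball 0 \<delta>1" using True \<delta>'(3) by (auto simp: G_def)
    have "norm (foldl step x us) \<le> R"
      using TR[rule_format, of x0 "ys0 @ us"] x0 us by simp
    then have "norm (foldl step x ys - foldl step (foldl step x us) (replicate (n1 + n2) 0)) < \<delta> / 2"
      "norm (foldl step (foldl step x us) (replicate (n1 + n2) 0) - a) < \<delta> / 2"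
      using stable[rule_format, OF _ vs vs', of "foldl step x us"] zero_run by (simp_all add: split)
    then have "norm (foldl step x ys - a) < \<delta>"
      using norm_triangle_ineq[of "foldl step x ys - foldl step (foldl step x us) (replicate (n1 + n2) 0)"
          "foldl step (foldl step x us) (replicate (n1 + n2) 0) - a"] by simp
    moreover have "norm (foldl append_past \<xi> ys j) < \<delta>" if j: "j < m" for j
    proof -
      have jn: "j < n" using j by (simp add: n_def n2_def)
      have "foldl append_past \<xi> ys j = drop s ys ! (n - 1 - j)"
        using jn ys(1) by (subst foldl_append_past) auto
      moreover have "drop s ys ! (n - 1 - j) \<in> set (drop s ys)" using jn ys(1) by (intro nth_mem) simp
      ultimately show ?thesis using True \<delta>'(2) by (auto simp: G_def)
    qed
    ultimately show ?thesis by (simp add: d.small_set_def indicator_def)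
  qed simp
  define I where "I = (INF \<xi>\<in>S. delayed_prob Q s n \<xi> G)"
  have le: "I \<le> ennreal ((d.transfer ^^ (s + n)) (indicator (d.small_set a \<delta> m)) (x, \<xi>))"
    if x: "x \<in> reach_set R" and \<xi>: "\<xi> \<in> S" for x \<xi>
  proof -
    have "I \<le> delayed_prob Q s n \<xi> G" unfolding I_def by (rule INF_lower[OF \<xi>])
    also have "\<dots> \<le> iterated_integral Q (s + n) (\<lambda>ys. ennreal (indicator (d.small_set a \<delta> m) (foldl step x ys, foldl append_past \<xi> ys))) \<xi>"
      unfolding delayed_prob_def using hit[OF x] by (intro iterated_integral_mono[OF \<xi>])
    also have "\<dots> = ennreal ((d.transfer ^^ (s + n)) (indicator (d.small_set a \<delta> m)) (x, \<xi>))"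
      by (rule d.iterated_transfer(1)[OF d.observable_small_set _ \<xi>, symmetric]) simp
    finally show ?thesis .
  qed
  have nonneg: "0 \<le> (d.transfer ^^ (s + n)) (indicator (d.small_set a \<delta> m)) z" for z
    by (rule d.iterate_nonneg) simp
  \<comment> \<open>Needed because \<open>enn2real\<close> would send an infinite value to
    0.\<close>
  have "I < \<infinity>"
  proof -
    obtain \<xi> where "\<xi> \<in> S" using S_nonempty by blast
    from le[OF _ this, of 0] ball_subset_reach_set[of 0 R] R(1) show ?thesis
      using le_less_trans[OF _ ennreal_less_top] by fastforce
  qed
  then have "enn2real I > 0" using s by (simp add: I_def enn2real_positive_iff)
  moreover have "enn2real I \<le> (d.transfer ^^ (s + n)) (indicator (d.small_set a \<delta> m)) z" if "z \<in> reach_set R \<times> S" for z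
    using le[of "fst z" "snd z"] that nonneg by (intro enn2real_leI) auto
  ultimately show ?thesis by blast
qed

end

subsection \<open>Exponential mixing\<close>

text \<open>Here test functions have values in [-1, 1]; passing to \<open>(f + 1) / 2\<close>
  accounts for the factor 2.\<close>

lemma dual_lipschitz_dist_le:
  fixes \<mu> \<nu> :: "'a::metric_space measure"
  assumes \<mu>: "prob_space \<mu>" "sets \<mu> = sets borel" and \<nu>: "prob_space \<nu>" "sets \<nu> = sets borel"
    and le: "\<And>\<Gamma>. \<Gamma> \<in> sets borel \<Longrightarrow> \<bar>measure \<mu> \<Gamma> - measure \<nu> \<Gamma>\<bar> \<le> e"
  shows "dual_lipschitz_dist \<mu> \<nu> \<le> 2 * e"
  unfolding dual_lipschitz_dist_def
proof (rule cSUP_least)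
  show "{f :: 'a \<Rightarrow> real. (\<forall>x. \<bar>f x\<bar> \<le> 1) \<and> 1-lipschitz_on UNIV f} \<noteq> {}"
    by (auto intro!: exI[of _ "\<lambda>_. 0"] lipschitz_intros simp: lipschitz_on_def)
  fix f :: "'a \<Rightarrow> real" assume f: "f \<in> {f. (\<forall>x. \<bar>f x\<bar> \<le> 1) \<and> 1-lipschitz_on UNIV f}"
  interpret \<mu>: prob_space \<mu> by (rule \<mu>(1))
  interpret \<nu>: prob_space \<nu> by (rule \<nu>(1))
  have fm: "f \<in> borel_measurable borel"
    using f by (intro borel_measurable_continuous_onI) (auto intro: lipschitz_on_continuous_on)
  have m: "f \<in> borel_measurable \<mu>" "f \<in> borel_measurable \<nu>"
    using fm measurable_cong_sets[OF \<mu>(2) refl] measurable_cong_sets[OF \<nu>(2) refl] by blast+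
  have int: "integrable \<mu> f" "integrable \<nu> f"
    using f m by (auto intro!: \<mu>.integrable_const_bound[where B = 1] \<nu>.integrable_const_bound[where B = 1])
  have "\<bar>(\<integral>x. (f x + 1) / 2 \<partial>\<mu>) - (\<integral>x. (f x + 1) / 2 \<partial>\<nu>)\<bar> \<le> e"
  proof (rule integral_diff_le_setwise[OF \<mu>(1) \<nu>(1)])
    show "sets \<mu> = sets \<nu>" by (simp add: \<mu> \<nu>)
    show "(\<lambda>x. (f x + 1) / 2) \<in> borel_measurable \<mu>" using m(1) by simp
    fix x
    have "\<bar>f x\<bar> \<le> 1" using f by blast
    then show "0 \<le> (f x + 1) / 2 \<and> (f x + 1) / 2 \<le> 1" by (simp add: abs_le_iff)
  qed (use le \<mu>(2) in auto)
  moreover have "(\<integral>x. (f x + 1) / 2 \<partial>\<mu>) = ((\<integral>x. f x \<partial>\<mu>) + 1) / 2" "(\<integral>x. (f x + 1) / 2 \<partial>\<nu>) = ((\<integral>x. f x \<partial>\<nu>) + 1) / 2"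
    using int \<mu>.prob_space \<nu>.prob_space by simp_all
  ultimately show "\<bar>(\<integral>x. f x \<partial>\<mu>) - (\<integral>x. f x \<partial>\<nu>)\<bar> \<le> 2 * e" by (simp add: abs_le_iff field_simps)
qed

text \<open>Serves the flow along trajectories that are not locally square integrable, where nothing
  is known about it: on the completed space a change on a null set keeps a function
  measurable.\<close>

lemma measurable_completion_AE:
  assumes g: "g \<in> completion M \<rightarrow>\<^sub>M N" and eq: "AE x in M. f x = g x" and f: "f \<in> space M \<rightarrow> space N"
  shows "f \<in> completion M \<rightarrow>\<^sub>M N"
proof (rule measurableI)
  fix A assume A: "A \<in> sets N"
  have "{x \<in> space (completion M). f x \<noteq> g x} \<in> sets (completion M)"
    using sets_completion_AE[where M = M and P = "\<lambda>x. f x \<noteq> g x"] eq by (simp add: pred_def)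
  moreover have "{x \<in> space (completion M). f x \<noteq> g x \<and> f x \<in> A} \<in> sets (completion M)"
  proof -
    have "AE x in M. \<not> (f x \<noteq> g x \<and> f x \<in> A)" using eq by eventually_elim simp
    from sets_completion_AE[OF this] show ?thesis by (simp add: pred_def)
  qed
  moreover have "g -` A \<inter> space (completion M) \<in> sets (completion M)" by (rule measurable_sets[OF g A])
  ultimately have "(g -` A \<inter> space (completion M) - {x \<in> space (completion M). f x \<noteq> g x})
      \<union> {x \<in> space (completion M). f x \<noteq> g x \<and> f x \<in> A} \<in> sets (completion M)" by blast
  moreover have "(g -` A \<inter> space (completion M) - {x \<in> space (completion M). f x \<noteq> g x})
      \<union> {x \<in> space (completion M). f x \<noteq> g x \<and> f x \<in> A} = f -` A \<inter> space (completion M)" by auto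
  ultimately show "f -` A \<inter> space (completion M) \<in> sets (completion M)" by simp
qed (use f in auto)

context forced_oscillators begin

text \<open>The support is compact because the chain started at 0 lies in the closed ball of radius
  \<open>R\<close> almost surely after the absorption time, and limits in total variation preserve
  this.\<close>

lemma convergence:
  "\<exists>\<mu> \<gamma>. prob_space \<mu> \<and> sets \<mu> = sets borel \<and> compact (support euclidean \<mu>) \<and> \<gamma> > 0 \<and>
    (\<forall>r>0. \<exists>C>0. \<forall>t x \<Gamma>. norm x \<le> r \<longrightarrow> \<Gamma> \<in> sets borel \<longrightarrow>
      \<bar>measure (driven_noise.marginal \<Lambda> step t x) \<Gamma> - measure \<mu> \<Gamma>\<bar> \<le> C * exp (- \<gamma> * real t))"
proof -
  obtain R where R: "R > 0"
    "\<And>r. r > 0 \<Longrightarrow> \<exists>T. \<forall>x ys. norm x \<le> r \<longrightarrow> set ys \<subseteq> K \<longrightarrow> T \<le> length ys \<longrightarrow> norm (foldl step x ys) \<le> R"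
    using absorption by metis
  interpret d: driven_noise \<Lambda> K \<iota> Q S step "reach_set R" by (rule driven)
  obtain a where a: "a \<in> phase_set V \<gamma>1 \<gamma>n M \<rho>"
    "\<And>e. e > 0 \<Longrightarrow> \<exists>T\<ge>0. \<forall>t\<ge>T. \<forall>x\<in>phase_set V \<gamma>1 \<gamma>n M \<rho>. norm (flow V \<gamma>1 \<gamma>n t x (\<lambda>_. 0) - a) < e"
    by (rule equilibrium[OF rho M SE]) blast
  have "\<exists>\<gamma>>0. \<exists>C>0. \<forall>t g. g \<in> borel_measurable borel \<longrightarrow> (\<forall>x. 0 \<le> g x \<and> g x \<le> 1) \<longrightarrow>
    (\<forall>z\<in>reach_set R \<times> S. \<forall>z'\<in>reach_set R \<times> S. (d.transfer ^^ t) (\<lambda>z. g (fst z)) z - (d.transfer ^^ t) (\<lambda>z. g (fst z)) z' \<le> C * exp (- \<gamma> * real t))"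
    by (rule d.exponential_mixing[OF zero_past[OF SRZ] equilibrium_overlap[OF a(1)] recurrence[OF R a(2)]])
  then obtain \<gamma> C where \<gamma>: "\<gamma> > 0" "C > 0" and mix: "\<forall>t g. g \<in> borel_measurable borel \<longrightarrow> (\<forall>x. 0 \<le> g x \<and> g x \<le> 1) \<longrightarrow>
    (\<forall>z\<in>reach_set R \<times> S. \<forall>z'\<in>reach_set R \<times> S. (d.transfer ^^ t) (\<lambda>z. g (fst z)) z - (d.transfer ^^ t) (\<lambda>z. g (fst z)) z' \<le> C * exp (- \<gamma> * real t))"
    by (elim exE conjE)
  have zero: "0 \<in> reach_set R" using R(1) by (intro ball_subset_reach_set) simp
  have "\<exists>\<mu>. prob_space \<mu> \<and> sets \<mu> = sets borel \<and> (\<forall>t T x. d.reaches T x \<longrightarrow>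
    (\<forall>\<Gamma>\<in>sets borel. \<bar>measure (d.marginal (T + t) x) \<Gamma> - measure \<mu> \<Gamma>\<bar> \<le> 4 * C * exp (- \<gamma> * real t)))"
    by (rule d.limit_marginal[OF \<gamma> _ zero]) (rule mix[rule_format], blast+)
  then obtain \<mu> where \<mu>: "prob_space \<mu>" "sets \<mu> = sets borel"
    and lim: "\<forall>t T x. d.reaches T x \<longrightarrow>
      (\<forall>\<Gamma>\<in>sets borel. \<bar>measure (d.marginal (T + t) x) \<Gamma> - measure \<mu> \<Gamma>\<bar> \<le> 4 * C * exp (- \<gamma> * real t))"
    by (elim exE conjE)
  interpret \<mu>: prob_space \<mu> by (rule \<mu>(1))
  have full: "measure \<mu> (cball 0 R) = 1"
  proof -
    obtain T where T: "\<forall>x ys. norm x \<le> R \<longrightarrow> set ys \<subseteq> K \<longrightarrow> T \<le> length ys \<longrightarrow> norm (foldl step x ys) \<le> R"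
      using R(2)[OF R(1)] ..
    have "1 - measure \<mu> (cball 0 R) \<le> 4 * C * exp (- \<gamma> * real t)" if "t \<ge> T" for t
    proof -
      have "measure (d.marginal t 0) (cball 0 R) = 1"
      proof (rule d.marginal_full)
        fix ys assume "length ys = t" "set ys \<subseteq> K"
        then have "norm (foldl step 0 ys) \<le> R" using R(1) that by (intro T[rule_format]) auto
        then show "foldl step 0 ys \<in> cball 0 R" by simp
      qed simp
      moreover have "\<bar>measure (d.marginal (0 + t) 0) (cball 0 R) - measure \<mu> (cball 0 R)\<bar> \<le> 4 * C * exp (- \<gamma> * real t)"
        by (rule lim[rule_format, OF d.reaches_invariant[OF zero]]) simp
      ultimately show ?thesis by simp
    qed
    then have ev: "eventually (\<lambda>t. 1 - measure \<mu> (cball 0 R) \<le> 4 * C * exp (- \<gamma> * real t)) sequentially"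
      by (auto simp: eventually_sequentially)
    have "(\<lambda>t. 4 * C * exp (- \<gamma> * real t)) \<longlonglongrightarrow> 0" using \<gamma>(1) by real_asymp
    then have "1 - measure \<mu> (cball 0 R) \<le> 0" by (rule tendsto_lowerbound[OF _ ev]) simp
    then show ?thesis using \<mu>.prob_le_1[of "cball 0 R"] by linarith
  qed
  have "support euclidean \<mu> \<subseteq> cball 0 R" by (rule support_subset[OF \<mu> closed_cball full])
  then have comp: "compact (support euclidean \<mu>)"
    unfolding compact_eq_bounded_closed using closed_support bounded_subset[OF bounded_cball] by blast
  have "\<exists>C'>0. \<forall>t x \<Gamma>. norm x \<le> r \<longrightarrow> \<Gamma> \<in> sets borel \<longrightarrow>
      \<bar>measure (d.marginal t x) \<Gamma> - measure \<mu> \<Gamma>\<bar> \<le> C' * exp (- \<gamma> * real t)" if r: "r > 0" for r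
  proof -
    obtain T where T: "\<forall>x ys. norm x \<le> r \<longrightarrow> set ys \<subseteq> K \<longrightarrow> T \<le> length ys \<longrightarrow> norm (foldl step x ys) \<le> R"
      using R(2)[OF r] ..
    \<comment> \<open>Times before absorption are paid for by the factor
      \<open>exp (\<gamma> * real T)\<close>; the maximum with 1 covers them, since the distance of
      two probabilities is at most 1.\<close>
    define C' where "C' = max (4 * C) 1 * exp (\<gamma> * real T)"
    have "\<bar>measure (d.marginal t x) \<Gamma> - measure \<mu> \<Gamma>\<bar> \<le> C' * exp (- \<gamma> * real t)"
      if x: "norm x \<le> r" and \<Gamma>: "\<Gamma> \<in> sets borel" for t x \<Gamma>
    proof (cases "T \<le> t")
      case True
      have "d.reaches T x"
        unfolding d.reaches_def by (intro allI impI ball_subset_reach_set T[rule_format] x) auto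
      from lim[rule_format, OF this \<Gamma>, of "t - T"] True
      have "\<bar>measure (d.marginal t x) \<Gamma> - measure \<mu> \<Gamma>\<bar> \<le> 4 * C * exp (- \<gamma> * real (t - T))" by simp
      also have "\<dots> \<le> max (4 * C) 1 * exp (- \<gamma> * real (t - T))" by (intro mult_right_mono) auto
      also have "\<dots> = C' * exp (- \<gamma> * real t)"
        using True by (simp add: C'_def of_nat_diff algebra_simps flip: exp_add)
      finally show ?thesis .
    next
      case False
      interpret m: prob_space "d.marginal t x" by (rule d.marginal_prob)
      have "\<bar>measure (d.marginal t x) \<Gamma> - measure \<mu> \<Gamma>\<bar> \<le> 1"
        using m.prob_le_1[of \<Gamma>] \<mu>.prob_le_1[of \<Gamma>] measure_nonneg[of \<mu> \<Gamma>] measure_nonneg[of "d.marginal t x" \<Gamma>]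
        by linarith
      also have "1 \<le> max (4 * C) 1 * exp (\<gamma> * (real T - real t))"
        using mult_mono[of 1 "max (4 * C) 1" 1 "exp (\<gamma> * (real T - real t))"] False \<gamma>(1) by simp
      also have "\<dots> = C' * exp (- \<gamma> * real t)" by (simp add: C'_def algebra_simps flip: exp_add)
      finally show ?thesis by simp
    qed
    moreover have "C' > 0" by (simp add: C'_def less_max_iff_disj)
    ultimately show ?thesis by blast
  qed
  then show ?thesis using \<mu> comp \<gamma>(1) by (intro exI[of _ \<mu>] exI[of _ \<gamma>]) auto
qed

lemma run_flow:
  assumes "L2_loc z"
  shows "driven_noise.run step t x (\<lambda>j. segment (int t - int j) z) = flow V \<gamma>1 \<gamma>n (real t) x z"
proof (induction t)
  interpret d: driven_noise \<Lambda> K \<iota> Q S step "reach_set R" for R by (rule driven)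
  case 0
  show ?case by (simp add: d.run.simps)
next
  interpret d: driven_noise \<Lambda> K \<iota> Q S step "reach_set R" for R by (rule driven)
  case (Suc t)
  have "flow V \<gamma>1 \<gamma>n (real (Suc t)) x z = step (flow V \<gamma>1 \<gamma>n (real t) x z) (segment (int (Suc t)) z)"
    using assms by (intro flow_Suc_segment) (auto simp: L2_loc_def)
  then show ?case using Suc by (simp add: d.run.simps)
qed

text \<open>The state at time \<open>t\<close> depends on the segments 1 to \<open>t\<close>. By
  stationarity the past read at time \<open>t\<close> has the law of the past at time 0, of which
  \<open>marginal\<close> takes the image under \<open>run\<close>.\<close>

lemma trajectory_law:
  assumes \<zeta>: "\<zeta> \<in> completion P \<rightarrow>\<^sub>M trajectories" and L2: "AE \<omega> in P. L2_loc (\<zeta> \<omega>)" and \<Lambda>: "\<Lambda> = law P trajectories \<zeta>"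
  shows "law P borel (\<lambda>\<omega>. flow V \<gamma>1 \<gamma>n (real t) x (\<zeta> \<omega>)) = driven_noise.marginal \<Lambda> step t x"
proof -
  interpret d: driven_noise \<Lambda> K \<iota> Q S step "reach_set R" for R by (rule driven)
  define seg where "seg = (\<lambda>z j. segment (int t - int j) z)"
  have seg: "seg \<in> trajectories \<rightarrow>\<^sub>M past_algebra"
    unfolding seg_def by (rule measurable_PiM_single') (auto intro: measurable_segment)
  have g: "(\<lambda>\<omega>. d.run t x (seg (\<zeta> \<omega>))) \<in> completion P \<rightarrow>\<^sub>M borel"
    by (intro measurable_compose[OF measurable_compose[OF \<zeta> seg] d.measurable_run])
  have eq: "AE \<omega> in P. flow V \<gamma>1 \<gamma>n (real t) x (\<zeta> \<omega>) = d.run t x (seg (\<zeta> \<omega>))"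
    using L2 by eventually_elim (simp add: seg_def run_flow)
  have "law P borel (\<lambda>\<omega>. flow V \<gamma>1 \<gamma>n (real t) x (\<zeta> \<omega>)) = distr (completion P) borel (\<lambda>\<omega>. d.run t x (seg (\<zeta> \<omega>)))"
    unfolding law_def by (rule distr_cong_AE[OF refl refl AE_completion[OF eq] measurable_completion_AE[OF g eq] g]) simp
  also have "\<dots> = distr (distr (distr (completion P) trajectories \<zeta>) past_algebra seg) borel (d.run t x)"
    using \<zeta> seg d.measurable_run by (simp add: distr_distr comp_def)
  also have "distr (distr (completion P) trajectories \<zeta>) past_algebra seg = pasts"
    unfolding seg_def using d.shifted_past_law[of t] by (simp add: \<Lambda> law_def)
  finally show ?thesis by (simp add: d.marginal_def)
qed

end

theorem theorem5p2:
  fixes V :: "('n::{finite,linorder}) config \<Rightarrow> real"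
    and \<gamma>1 \<gamma>n M \<rho> \<iota> :: real
    and P :: "'w measure"
    and \<zeta> :: "'w \<Rightarrow> real \<Rightarrow> real \<times> real"
    and K :: "L2J set"
  assumes V_C2: "twice_continuously_differentiable V"
    and V_coercive: "filterlim V at_top at_infinity"
    and gamma_pos: "\<gamma>1 > 0" "\<gamma>n > 0"
    and P: "prob_space P"
    and process: "\<zeta> \<in> completion P \<rightarrow>\<^sub>M trajectories"
    and L2_loc: "AE \<omega> in P. L2_loc (\<zeta> \<omega>)"
    and BAS: "BAS V \<gamma>1 \<gamma>n"
    and CP: "CP (law P trajectories \<zeta>) K"
    and M: "M > 0" "AE \<omega> in P. bounded_forcing M (\<zeta> \<omega>)"
    and rho: "absorbing_radius V \<gamma>1 \<gamma>n M \<rho>"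
    and SE: "SE V \<gamma>1 \<gamma>n (phase_set V \<gamma>1 \<gamma>n M \<rho>)"
    and LC: "LC V \<gamma>1 \<gamma>n (phase_set V \<gamma>1 \<gamma>n M \<rho>) K"
    and iota: "\<iota> > 1"
    and DR: "DR (law P trajectories \<zeta>) K \<iota>"
  shows "\<exists>(\<mu> :: 'n state measure) \<gamma>.
    prob_space \<mu> \<and> sets \<mu> = sets borel \<and> compact (support euclidean \<mu>) \<and> \<gamma> > 0 \<and>
    (\<forall>r>0. \<exists>C>0. \<forall>t::nat.
       (SUP x0\<in>cball 0 r.
          dual_lipschitz_dist (law P borel (\<lambda>\<omega>. flow V \<gamma>1 \<gamma>n (real t) x0 (\<zeta> \<omega>))) \<mu>)
       \<le> C * exp (- \<gamma> * real t))"
proof -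
  define \<Lambda> where "\<Lambda> = law P trajectories \<zeta>"
  define S where "S = past_support \<iota> K \<Lambda>"
  obtain Q where Q: "conditional_law \<Lambda> S Q" "SF \<iota> K S Q" "DLP \<iota> S Q" "SRZ S Q"
    using DR unfolding DR_def Let_def \<Lambda>_def[symmetric] S_def[symmetric] by blast
  interpret P: prob_space P by (rule P)
  have prob: "prob_space \<Lambda>"
    unfolding \<Lambda>_def law_def by (rule prob_space.prob_space_distr[OF P.prob_space_completion process])
  have sets_law: "sets \<Lambda> = sets trajectories" by (simp add: \<Lambda>_def law_def)
  interpret forced_oscillators V \<gamma>1 \<gamma>n \<Lambda> K \<iota> Q S M \<rho>
    by (intro forced_oscillators.intro oscillators.intro stationary_noise.intro forced_oscillators_axioms.intro)
      (fact V_C2 V_coercive gamma_pos prob sets_law CP[folded \<Lambda>_def] iota S_def Q BAS M rho SE LC)+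
  interpret d: driven_noise \<Lambda> K \<iota> Q S step "reach_set R" for R by (rule driven)
  obtain \<mu> \<gamma> where \<mu>: "prob_space \<mu>" "sets \<mu> = sets (borel :: 'n state measure)" "compact (support euclidean \<mu>)" and \<gamma>: "\<gamma> > 0"
    and conv: "\<forall>r>0. \<exists>C>0. \<forall>t x \<Gamma>. norm x \<le> r \<longrightarrow> \<Gamma> \<in> sets borel \<longrightarrow>
      \<bar>measure (d.marginal t x) \<Gamma> - measure \<mu> \<Gamma>\<bar> \<le> C * exp (- \<gamma> * real t)"
    using convergence by (elim exE conjE)
  have "\<exists>C>0. \<forall>t::nat. (SUP x0\<in>cball 0 r.
      dual_lipschitz_dist (law P borel (\<lambda>\<omega>. flow V \<gamma>1 \<gamma>n (real t) x0 (\<zeta> \<omega>))) \<mu>) \<le> C * exp (- \<gamma> * real t)" if r: "r > 0" for r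
  proof -
    from conv[rule_format, OF r] obtain C where C: "C > 0" and le: "\<forall>t x \<Gamma>. norm x \<le> r \<longrightarrow> \<Gamma> \<in> sets borel \<longrightarrow>
        \<bar>measure (d.marginal t x) \<Gamma> - measure \<mu> \<Gamma>\<bar> \<le> C * exp (- \<gamma> * real t)"
      by (elim exE conjE)
    have "(SUP x0\<in>cball 0 r. dual_lipschitz_dist (law P borel (\<lambda>\<omega>. flow V \<gamma>1 \<gamma>n (real t) x0 (\<zeta> \<omega>))) \<mu>)
        \<le> 2 * C * exp (- \<gamma> * real t)" for t
    proof (rule cSUP_least)
      show "cball 0 r \<noteq> ({} :: 'n state set)" using r by simp
      fix x :: "'n state" assume "x \<in> cball 0 r"
      then have x: "norm x \<le> r" by simp
      have "dual_lipschitz_dist (d.marginal t x) \<mu> \<le> 2 * (C * exp (- \<gamma> * real t))"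
        by (rule dual_lipschitz_dist_le[OF d.marginal_prob \<mu>(1,2)]) (rule le[rule_format, OF x])
      then show "dual_lipschitz_dist (law P borel (\<lambda>\<omega>. flow V \<gamma>1 \<gamma>n (real t) x (\<zeta> \<omega>))) \<mu> \<le> 2 * C * exp (- \<gamma> * real t)"
        using trajectory_law[OF process L2_loc \<Lambda>_def] by simp
    qed
    then show ?thesis using C by (intro exI[of _ "2 * C"]) auto
  qed
  then show ?thesis using \<mu> \<gamma> by (intro exI[of _ \<mu>] exI[of _ \<gamma>]) auto
qed
end
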